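(* Work in the category $\mathbf{vect}_\Bbbk$ of finite-dimensional vector spaces over a field $\Bbbk$. 1. One has a fully faithful functor $\mathcal F$ from the groupoid ${}^*\mathbf{Bialg}$ of bialgebras and bialgebra isomorphisms to the groupoid ${}^*\mathbf{BrSyst}_2^{\updownarrow}$ of rank 2 bipointed braided systems and their isomorphisms, given by $$(H,\mu,\nu,\Delta,\varepsilon)\longmapsto\mathcal B(H):=(V_1:=H,\ V_2:=H^*;\ \sigma_{1,1}:=\sigma^r_{Ass}(H),\ \sigma_{2,2}:=\sigma_{Ass}(H^* ),\ \sigma_{1,2}:=\sigma_{bi};\ \nu,\varepsilon^*;\ \varepsilon,\nu^* ),$$ $$f\longmapsto(f,(f^{-1})^* ),$$ where $\sigma_{bi}(h\otimes l)=\langle l_{(1)},h_{(2)}\rangle\, l_{(2)}\otimes h_{(1)}$; the units of $\mathcal B(H)$ are $\nu,\varepsilon^*$ and the counits are $\varepsilon,\nu^*$. 2. For a bialgebra $H$, $\sigma_{bi}$ is invertible if and only if $H$ has an antipode. 3. Let $H\in\mathbf{vect}_\Bbbk$ be endowed with a unital associative algebra structure $(\mu,\nu)$ and a counital coassociative coalgebra structure $(\Delta,\varepsilon)$, with the pair $(\nu,\varepsilon)$ normalized (i.e. $\varepsilon\nu=\mathrm{Id}_\Bbbk$). Then the Yang--Baxter equation on $H\otimes H\otimes H^*$ (symmetrically, on $H\otimes H^*\otimes H^*$) for the data $\mathcal B(H)$, together with the naturality of $\sigma_{bi}$ with respect to the units $\nu$ and $\varepsilon^*$, is equivalent to the bialgebra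 compatibility conditions for $H$. 4. For a bialgebra $H$, one has category equivalences $$\mathbf{Mod}_H^H\overset{\sim}{\longrightarrow}\mathbf{Mod}_{\mathcal B(H)}\overset{\sim}{\longrightarrow}\mathbf{Mod}_{H^*\otimes_{\sigma_{bi}}H},\qquad (M,\rho,\delta)\mapsto(M;\rho,\delta^{co})\mapsto(M,\delta^{co}\otimes\rho),$$ where $\delta^{co}\otimes\rho$ denotes the action $\rho(\delta^{co}\otimes\mathrm{Id}_H)\colon M\otimes H^*\otimes H\to M$. If $H$ is a Hopf algebra, then moreover, with $\theta=\sigma_{bi}^{-1}$, $$\mathbf{Mod}_{H\otimes_\theta H^*}\simeq\mathbf{Mod}_{s_1\cdot\mathcal B(H)}\simeq\mathbf{Mod}_H^H.$$
   Context: Duality conventions ("rainbow"): for $H$ in $\mathbf{vect}_\Bbbk$, $\langle l,h\rangle=l(h)$ for $l\in H^*$, $h\in H$; Sweedler notation is used. The dual structures on $H^*$ are given by $\langle l_1l_2,h\rangle=\langle l_1,h_{(2)}\rangle\langle l_2,h_{(1)}\rangle$ (multiplication $\Delta^*$, unit $\varepsilon^*$) and $\langle l,h_1h_2\rangle=\langle l_{(1)},h_2\rangle\langle l_{(2)},h_1\rangle$ (comultiplication $\mu^*$, counit $\nu^*$). For a unital associative algebra $(V,\mu,\nu)$: $\sigma_{Ass}(V)=\nu\otimes\mu$ and $\sigma_{Ass}^r(V)=\mu\otimes\nu$, as maps $V\otimes V\to V\otimes V$. Bialgebra compatibility: $\Delta\mu=(\mu\otimes\mu)(\mathrm{Id}\otimes\tau\otimes\mathrm{Id})(\Delta\otimes\Delta)$,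 $\Delta\nu=\nu\otimes\nu$, $\varepsilon\mu=\varepsilon\otimes\varepsilon$, $\varepsilon\nu=\mathrm{Id}_\Bbbk$, with $\tau$ the flip. An antipode is $s\colon H\to H$ with $\mu(s\otimes\mathrm{Id})\Delta=\mu(\mathrm{Id}\otimes s)\Delta=\nu\varepsilon$; a Hopf algebra is a bialgebra with an antipode. A rank $r$ braided system is an ordered family $V_1,\dots,V_r$ with morphisms $\sigma_{i,j}\colon V_i\otimes V_j\to V_j\otimes V_i$, $i\le j$ (not necessarily invertible), satisfying the Yang--Baxter equation $(\sigma_{j,k}\otimes \mathrm{Id})(\mathrm{Id}\otimes\sigma_{i,k})(\sigma_{i,j}\otimes\mathrm{Id})=(\mathrm{Id}\otimes\sigma_{i,j})(\sigma_{i,k}\otimes\mathrm{Id})(\mathrm{Id}\otimes\sigma_{j,k})$ on $V_i\otimes V_j\otimes V_k$ for all $i\le j\le k$. It is bipointed if endowed with units $\nu_i\colon\Bbbk\to V_i$ and counits $\varepsilon_i\colon V_i\to\Bbbk$ with $\varepsilon_i\nu_i=\mathrm{Id}_\Bbbk$. An isomorphism of bipointed braided systems is a family of isomorphisms $f_i\colon V_i\to W_i$ with $(f_j\otimes f_i)\sigma_{i,j}=\xi_{i,j}(f_i\otimes f_j)$ for $i\le j$, preserving units and counits. Naturality of $\sigma_{bi}$ w.r.t. the units: $\sigma_{bi}(\nu\otimes\mathrm{Id}_{H^*})=\mathrm{Id}_{H^*}\otimes\nu$, $\sigma_{bi}(\mathrm{Id}_H\otimes\varepsilon^* )=\varepsilon^*\otimes\mathrm{Id}_H$.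 $\mathbf{Mod}_H^H$: right-right Hopf modules, i.e. $M$ with a right module structure $\rho$ and a right comodule structure $\delta$ over $H$ such that $\delta\rho=(\rho\otimes\mu)(\mathrm{Id}_M\otimes\tau\otimes\mathrm{Id}_H)(\delta\otimes\Delta)$. For a right $H$-comodule $(M,\delta)$, $\delta^{co}\colon M\otimes H^*\to M$, $m\otimes l\mapsto m_{(0)}\langle l,m_{(1)}\rangle$. For a braided system with units, $\mathbf{Mod}_{(\overline V,\overline\sigma)}$ denotes here the category of objects $M$ with $\rho_i\colon M\otimes V_i\to M$ such that $\rho_j(\rho_i\otimes\mathrm{Id})=\rho_i(\rho_j\otimes\mathrm{Id})(\mathrm{Id}_M\otimes\sigma_{i,j})$, $i\le j$, and $\rho_i(\mathrm{Id}_M\otimes\nu_i)=\mathrm{Id}_M$. $H^*\otimes_{\sigma_{bi}}H$ is the unital associative algebra $H^*\otimes H$ with multiplication $(\mu_{H^*}\otimes\mu_H)(\mathrm{Id}_{H^*}\otimes\sigma_{bi}\otimes\mathrm{Id}_H)$ and unit $\varepsilon^*\otimes\nu$; $H\otimes_\theta H^*$ is $H\otimes H^*$ with multiplication $(\mu_H\otimes\mu_{H^*})(\mathrm{Id}_H\otimes\theta\otimes\mathrm{Id}_{H^*})$ and unit $\nu\otimes\varepsilon^*$. $s_1\cdot\mathcal B(H)$ is the system $(H^*,H)$ with the same diagonal braiding components, units and counits as $\mathcal B(H)$, and with $\theta=\sigma_{bi}^{-1}$ on $H^*\otimes H$. Modules over algebras are right unital modules. *)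

theory Defs
  imports "Jordan_Normal_Form.VS_Connect"
begin

section \<open>Finite-dimensional vector spaces\<close>

text \<open>
  The ground field is the type \<open>'k\<close> (viewed as a ring by \<open>class_ring\<close>); a vector space is a
  \<open>module\<close> record over it, with an arbitrary carrier set. Linear maps are required to be
  \<open>undefined\<close> outside the carrier of their source, so that equality of morphisms is equality
  in HOL.
\<close>

definition fdvs :: "('k::field, 'v) module \<Rightarrow> bool" where
  "fdvs V \<longleftrightarrow> vectorspace class_ring V \<and> vectorspace.fin_dim class_ring V"

definition ground :: "('k::field, 'k) module" where
  "ground = \<lparr>carrier = UNIV, mult = (*), one = 1, zero = 0, add = (+), smult = (*)\<rparr>"

abbreviation "mhom \<equiv> LinearCombinations.module_hom class_ring"

definition Lin :: "('k::field, 'v) module \<Rightarrow> ('k, 'w) module \<Rightarrow> ('v \<Rightarrow> 'w) set" where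
  "Lin V W = mhom V W \<inter> extensional (carrier V)"

definition dual :: "('k::field, 'v) module \<Rightarrow> ('k, 'v \<Rightarrow> 'k) module" where
  "dual V = (ring.func_space class_ring (carrier V))\<lparr>carrier := Lin V ground\<rparr>"

definition transpose_map ::
  "('k::field, 'v) module \<Rightarrow> ('k, 'w) module \<Rightarrow> ('v \<Rightarrow> 'w) \<Rightarrow> ('w \<Rightarrow> 'k) \<Rightarrow> ('v \<Rightarrow> 'k)" where
  "transpose_map V W f = (\<lambda>l\<in>carrier (dual W). \<lambda>v\<in>carrier V. l (f v))"


section \<open>Tensor products\<close>

text \<open>
  For finite-dimensional spaces, \<open>V \<otimes> W\<close> is the dual of the space of bilinear forms on
  \<open>V \<times> W\<close> (Halmos), the pure tensor of \<open>v\<close> and \<open>w\<close> being the evaluation at \<open>(v, w)\<close>.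
  That this is a tensor product is \<open>tensor_universal\<close> below.
\<close>

definition bilinear_map ::
  "('k::field, 'v) module \<Rightarrow> ('k, 'w) module \<Rightarrow> ('k, 'u) module \<Rightarrow> ('v \<Rightarrow> 'w \<Rightarrow> 'u) \<Rightarrow> bool" where
  "bilinear_map V W U b \<longleftrightarrow>
     (\<forall>v\<in>carrier V. b v \<in> mhom W U) \<and>
     (\<forall>w\<in>carrier W. (\<lambda>v. b v w) \<in> mhom V U)"

definition bilinear_forms ::
  "('k::field, 'v) module \<Rightarrow> ('k, 'w) module \<Rightarrow> ('k, 'v \<times> 'w \<Rightarrow> 'k) module" where
  "bilinear_forms V W =
     (ring.func_space class_ring (carrier V \<times> carrier W))
       \<lparr>carrier := {B \<in> extensional (carrier V \<times> carrier W). bilinear_map V W ground (curry B)}\<rparr>"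

type_synonym ('k, 'v, 'w) tensor = "('v \<times> 'w \<Rightarrow> 'k) \<Rightarrow> 'k"

definition tensor_space ::
  "('k::field, 'v) module \<Rightarrow> ('k, 'w) module \<Rightarrow> ('k, ('k, 'v, 'w) tensor) module"
  (infixr \<open>\<boxtimes>\<close> 75) where
  "V \<boxtimes> W = dual (bilinear_forms V W)"

definition ptens ::
  "('k::field, 'v) module \<Rightarrow> ('k, 'w) module \<Rightarrow> 'v \<Rightarrow> 'w \<Rightarrow> ('k, 'v, 'w) tensor" where
  "ptens V W v w = (\<lambda>B\<in>carrier (bilinear_forms V W). B (v, w))"

lemma mhomI:
  assumes "\<And>x. x \<in> carrier M \<Longrightarrow> f x \<in> carrier N"
    "\<And>x y. x \<in> carrier M \<Longrightarrow> y \<in> carrier M \<Longrightarrow> f (x \<oplus>\<^bsub>M\<^esub> y) = f x \<oplus>\<^bsub>N\<^esub> f y"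
    "\<And>c x. x \<in> carrier M \<Longrightarrow> f (c \<odot>\<^bsub>M\<^esub> x) = c \<odot>\<^bsub>N\<^esub> f x"
  shows "f \<in> mhom M N"
  using assms by (auto simp: LinearCombinations.module_hom_def)

lemma mhomD:
  assumes "f \<in> mhom M N"
  shows "x \<in> carrier M \<Longrightarrow> f x \<in> carrier N"
    "x \<in> carrier M \<Longrightarrow> y \<in> carrier M \<Longrightarrow> f (x \<oplus>\<^bsub>M\<^esub> y) = f x \<oplus>\<^bsub>N\<^esub> f y"
    "x \<in> carrier M \<Longrightarrow> f (c \<odot>\<^bsub>M\<^esub> x) = c \<odot>\<^bsub>N\<^esub> f x"
  using assms by (auto simp: LinearCombinations.module_hom_def)

lemma ground_simps [simp]:
  "carrier ground = UNIV" "x \<oplus>\<^bsub>ground\<^esub> y = x + y" "c \<odot>\<^bsub>ground\<^esub> x = c * x" "\<zero>\<^bsub>ground\<^esub> = 0"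
  by (auto simp: ground_def)

lemma module_ground: "module class_ring (ground :: ('k::field, 'k) module)"
proof (rule module_criteria)
  show "\<forall>v\<in>carrier (ground :: ('k, 'k) module). \<exists>n\<in>carrier ground. v \<oplus>\<^bsub>ground\<^esub> n = \<zero>\<^bsub>ground\<^esub>"
    by (auto intro: right_minus)
qed (auto simp: algebra_simps class_cring.cring_axioms)

lemma module_func_space: "module class_ring (ring.func_space (class_ring :: 'k::field ring) S)"
  by (rule class_cring.func_space_is_module)

lemma fs_simps:
  "x \<oplus>\<^bsub>ring.func_space (class_ring :: 'k::field ring) S\<^esub> y = (\<lambda>v\<in>S. x v + y v)" 
  "c \<odot>\<^bsub>ring.func_space (class_ring :: 'k::field ring) S\<^esub> x = (\<lambda>v\<in>S. c * x v)" 
  "\<zero>\<^bsub>ring.func_space (class_ring :: 'k::field ring) S\<^esub> = (\<lambda>v\<in>S. 0)"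
  "carrier (ring.func_space (class_ring :: 'k::field ring) S) = extensional S"
  by (auto simp: class_ring.func_space_def PiE_def)

lemma module_restr:
  fixes S :: "'z set" and K :: "('z \<Rightarrow> 'k::field) set"
  assumes "K \<subseteq> extensional S" "\<And>f g. f\<in>K \<Longrightarrow> g\<in>K \<Longrightarrow> (\<lambda>v\<in>S. f v + g v) \<in> K"
   "(\<lambda>v\<in>S. 0) \<in> K" "\<And>c f. f\<in>K \<Longrightarrow> (\<lambda>v\<in>S. c * f v) \<in> K"
  shows "module class_ring ((ring.func_space class_ring S)\<lparr>carrier := K\<rparr>)"
proof -
  interpret F: Module.module "class_ring :: 'k ring" "ring.func_space class_ring S" 
    by (rule module_func_space)
  show ?thesis
    by (rule F.submodule_is_module) (unfold_locales, use assms in \<open>auto simp: fs_simps\<close>)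
qed

lemma dual_simps [simp]:
  "x \<oplus>\<^bsub>dual V\<^esub> y = (\<lambda>v\<in>carrier V. x v + y v)" 
  "c \<odot>\<^bsub>dual V\<^esub> x = (\<lambda>v\<in>carrier V. c * x v)" 
  "\<zero>\<^bsub>dual V\<^esub> = (\<lambda>v\<in>carrier V. 0)"
  "carrier (dual V) = Lin V ground"
  by (auto simp: dual_def fs_simps)

lemma module_closed:
  assumes "module (class_ring :: 'k::field ring) V"
  shows "x \<in> carrier V \<Longrightarrow> y \<in> carrier V \<Longrightarrow> x \<oplus>\<^bsub>V\<^esub> y \<in> carrier V"
   "x \<in> carrier V \<Longrightarrow> (c::'k) \<odot>\<^bsub>V\<^esub> x \<in> carrier V" "\<zero>\<^bsub>V\<^esub> \<in> carrier V"
proof -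
  interpret Module.module "class_ring :: 'k ring" V by fact
  show "x \<in> carrier V \<Longrightarrow> y \<in> carrier V \<Longrightarrow> x \<oplus>\<^bsub>V\<^esub> y \<in> carrier V"
   "x \<in> carrier V \<Longrightarrow> c \<odot>\<^bsub>V\<^esub> x \<in> carrier V" "\<zero>\<^bsub>V\<^esub> \<in> carrier V"
    by auto
qed

lemma module_dual:
  fixes V :: "('k::field,'v) module"
  assumes "module class_ring V" shows "module class_ring (dual V)"
  unfolding dual_def
  by (rule module_restr)
     (use module_closed[OF assms] in \<open>auto simp: Lin_def LinearCombinations.module_hom_def algebra_simps\<close>)

lemma bf_simps [simp]:
  "x \<oplus>\<^bsub>bilinear_forms V W\<^esub> y = (\<lambda>v\<in>carrier V \<times> carrier W. x v + y v)" 
  "c \<odot>\<^bsub>bilinear_forms V W\<^esub> x = (\<lambda>v\<in>carrier V \<times> carrier W. c * x v)" 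
  "\<zero>\<^bsub>bilinear_forms V W\<^esub> = (\<lambda>v\<in>carrier V \<times> carrier W. 0)"
  "carrier (bilinear_forms V W) = {B \<in> extensional (carrier V \<times> carrier W). bilinear_map V W ground (curry B)}"
  by (auto simp: bilinear_forms_def fs_simps)

lemma module_bf:
  fixes V :: "('k::field,'v) module"
  assumes "module class_ring V" "module class_ring W" shows "module class_ring (bilinear_forms V W)"
  unfolding bilinear_forms_def
  by (rule module_restr)
     (use module_closed[OF assms(1)] module_closed[OF assms(2)] in \<open>auto simp: bilinear_map_def LinearCombinations.module_hom_def algebra_simps\<close>)

lemma module_tensor:
  fixes V :: "('k::field,'v) module"
  assumes "module class_ring V" "module class_ring W" shows "module class_ring (V \<boxtimes> W)"
  unfolding tensor_space_def by (intro module_dual module_bf assms)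

lemma hom_finsum:
  fixes M :: "('k::field,'v) module"
  assumes M: "module class_ring M" and N: "module class_ring N" and f: "f \<in> mhom M N"
    and g: "\<And>i. i \<in> I \<Longrightarrow> g i \<in> carrier M" and I: "finite I"
  shows "f (finsum M g I) = finsum N (\<lambda>i. f (g i)) I"
proof -
  interpret M: Module.module "class_ring :: 'k ring" M by fact
  interpret N: Module.module "class_ring :: 'k ring" N by fact
  interpret mod_hom "class_ring :: 'k ring" M N f by unfold_locales (rule f)
  from I g show ?thesis
  proof induct
    case (insert i I)
    have 1: "finsum M g (insert i I) = g i \<oplus>\<^bsub>M\<^esub> finsum M g I"
      by (rule M.finsum_insert) (use insert in auto)
    have 2: "finsum N (\<lambda>i. f (g i)) (insert i I) = f (g i) \<oplus>\<^bsub>N\<^esub> finsum N (\<lambda>i. f (g i)) I"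
      by (rule N.finsum_insert) (use insert in \<open>auto intro: mhomD(1)[OF f]\<close>)
    have "finsum M g I \<in> carrier M" by (rule M.finsum_closed) (use insert in auto)
    then show ?case using insert 1 2 mhomD(2)[OF f] by auto
  qed auto
qed

lemma finsum_ground: "finite I \<Longrightarrow> finsum (ground :: ('k::field, 'k) module) g I = sum g I"
proof (induct rule: finite_induct)
  interpret M: Module.module "class_ring :: 'k ring" "ground :: ('k,'k) module" by (rule module_ground)
  { case empty show ?case by simp }
  { case (insert i I) then show ?case by (subst M.finsum_insert) auto }
qed

lemma fdvs_module: "fdvs V \<Longrightarrow> module class_ring V"
  by (auto simp: fdvs_def vectorspace_def)

lemma dual_basis:
  fixes V :: "('k::field,'v) module"
  assumes "fdvs V"
  obtains A \<phi> where "finite A" "A \<subseteq> carrier V" "\<And>a. a \<in> A \<Longrightarrow> \<phi> a \<in> Lin V ground"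
    "\<And>v. v \<in> carrier V \<Longrightarrow> finsum V (\<lambda>a. \<phi> a v \<odot>\<^bsub>V\<^esub> a) A = v"
proof -
  interpret vectorspace "class_ring :: 'k ring" V using assms by (auto simp: fdvs_def)
  have fd: fin_dim using assms by (auto simp: fdvs_def)
  obtain A where A: "finite A" "basis A" using finite_basis_exists[OF fd] by auto
  then have AV: "A \<subseteq> carrier V" by (auto simp: basis_def)
  have ex: "\<exists>!a. a \<in> A \<rightarrow>\<^sub>E UNIV \<and> lincomb a A = v" if "v \<in> carrier V" for v
    using basis_criterion[OF A(1) AV] A(2) that by auto
  define c where "c v = (THE a. a \<in> A \<rightarrow>\<^sub>E UNIV \<and> lincomb a A = v)" for v
  have c: "c v \<in> A \<rightarrow>\<^sub>E UNIV \<and> lincomb (c v) A = v" if "v \<in> carrier V" for v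
    unfolding c_def using theI'[OF ex[OF that]] .
  have cu: "x = c v" if "v \<in> carrier V" "x \<in> A \<rightarrow>\<^sub>E UNIV" "lincomb x A = v" for v x
    using ex[OF that(1)] c[OF that(1)] that by blast
  interpret L: mod_hom "class_ring :: 'k ring" "ring.func_space class_ring A" V "\<lambda>a. lincomb a A"
    using lincomb_is_mod_hom[OF A(1) AV] .
  have fsc: "carrier (ring.func_space (class_ring :: 'k ring) A) = A \<rightarrow>\<^sub>E UNIV" by (simp add: fs_simps PiE_def)
  have add: "c (x \<oplus>\<^bsub>V\<^esub> y) = (\<lambda>a\<in>A. c x a + c y a)" if "x \<in> carrier V" "y \<in> carrier V" for x y
    by (rule cu[symmetric])
       (use that c[OF that(1)] c[OF that(2)] L.f_add[of "c x" "c y"] in \<open>auto simp: fsc fs_simps PiE_def\<close>)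
  have sm: "c (k \<odot>\<^bsub>V\<^esub> x) = (\<lambda>a\<in>A. k * c x a)" if "x \<in> carrier V" for x k
    by (rule cu[symmetric])
       (use that c[OF that(1)] L.f_smult[of k "c x"] in \<open>auto simp: fsc fs_simps PiE_def\<close>)
  show ?thesis
  proof (rule that[OF A(1) AV])
    show "(\<lambda>v\<in>carrier V. c v a) \<in> Lin V ground" if "a \<in> A" for a
      using that by (auto simp: Lin_def LinearCombinations.module_hom_def add sm)
    show "finsum V (\<lambda>a. (\<lambda>v\<in>carrier V. c v a) v \<odot>\<^bsub>V\<^esub> a) A = v" if "v \<in> carrier V" for v
      using c[OF that] that by (auto simp: lincomb_def)
  qed
qed

lemma fdvsI:
  fixes V :: "('k::field,'v) module"
  assumes V: "module class_ring V" and I: "finite I" and g: "\<And>i. i \<in> I \<Longrightarrow> g i \<in> carrier V"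
    and ex: "\<And>v. v \<in> carrier V \<Longrightarrow> \<exists>c. v = finsum V (\<lambda>i. c i \<odot>\<^bsub>V\<^esub> g i) I"
  shows "fdvs V"
proof -
  interpret V: vectorspace "class_ring :: 'k ring" V
    using V class_field by (auto simp: vectorspace_def)
  have gI: "g ` I \<subseteq> carrier V" using g by auto
  interpret S: submodule "class_ring :: 'k ring" "V.span (g ` I)" V by (rule V.span_is_submodule[OF gI])
  have "finsum V (\<lambda>i. c i \<odot>\<^bsub>V\<^esub> g i) J \<in> V.span (g ` I)" if "J \<subseteq> I" for c J
    using finite_subset[OF that I] that
  proof induct
    case (insert j J)
    have "c i \<odot>\<^bsub>V\<^esub> g i \<in> V.span (g ` I)" if "i \<in> I" for i
      using V.in_own_span[OF gI] that by auto
    then show ?case using insert g by (subst V.finsum_insert) auto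
  qed auto
  then have "V.gen_set (g ` I)"
    using ex V.span_is_subset2[OF gI] by fastforce
  then show ?thesis using I gI V.vectorspace_axioms by (auto simp: fdvs_def V.fin_dim_def)
qed

lemma fdvs_dual:
  fixes V :: "('k::field,'v) module"
  assumes "fdvs V" shows "fdvs (dual V)"
proof -
  note M = fdvs_module[OF assms]
  obtain A \<phi> where A: "finite A" "A \<subseteq> carrier V" and \<phi>: "\<And>a. a \<in> A \<Longrightarrow> \<phi> a \<in> Lin V ground"
    and V: "\<And>v. v \<in> carrier V \<Longrightarrow> finsum V (\<lambda>a. \<phi> a v \<odot>\<^bsub>V\<^esub> a) A = v" using dual_basis[OF assms] by blast
  interpret V: Module.module "class_ring :: 'k ring" V by (rule M)
  interpret D: Module.module "class_ring :: 'k ring" "dual V" by (rule module_dual[OF M])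
  show ?thesis
  proof (rule fdvsI[OF module_dual[OF M] A(1)])
    show "\<phi> a \<in> carrier (dual V)" if "a \<in> A" for a using \<phi>[OF that] by simp
    fix l assume l: "l \<in> carrier (dual V)"
    let ?S = "finsum (dual V) (\<lambda>a. l a \<odot>\<^bsub>dual V\<^esub> \<phi> a) A"
    have S: "?S \<in> carrier (dual V)" 
      by (rule D.finsum_closed) (use \<phi> module_closed(2)[OF module_dual[OF M]] in \<open>auto simp del: dual_simps(1-3)\<close>)
    have "l = ?S"
    proof (rule extensionalityI[of _ "carrier V"])
      fix v assume v: "v \<in> carrier V"
      have ev: "(\<lambda>l. l v) \<in> mhom (dual V) ground" using v by (intro mhomI) auto
      have lh: "l \<in> mhom V ground" using l by (simp add: Lin_def)
      have "?S v = finsum ground (\<lambda>a. (l a \<odot>\<^bsub>dual V\<^esub> \<phi> a) v) A"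
        by (rule hom_finsum[OF D.module_axioms module_ground ev _ A(1)])
           (use \<phi> module_closed(2)[OF module_dual[OF M]] in \<open>auto simp del: dual_simps(1-3)\<close>)
      also have "\<dots> = finsum ground (\<lambda>a. l (\<phi> a v \<odot>\<^bsub>V\<^esub> a)) A"
        using v A subsetD[OF A(2)] mhomD(3)[OF lh] by (subst (1 2) finsum_ground) (auto intro!: sum.cong)
      also have "\<dots> = l (finsum V (\<lambda>a. \<phi> a v \<odot>\<^bsub>V\<^esub> a) A)"
        by (rule hom_finsum[OF M module_ground lh _ A(1), symmetric]) (use A in auto)
      finally show "l v = ?S v" using V[OF v] by simp
    qed (use l S in \<open>auto simp: Lin_def\<close>)
    then show "\<exists>c. l = finsum (dual V) (\<lambda>a. c a \<odot>\<^bsub>dual V\<^esub> \<phi> a) A" by (rule exI[of _ l])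
  qed
qed

lemma finsum_swap:
  fixes U :: "('k::field,'v) module"
  assumes "module class_ring U" "finite A" "finite C" "\<And>a c. a \<in> A \<Longrightarrow> c \<in> C \<Longrightarrow> f a c \<in> carrier U"
  shows "finsum U (\<lambda>a. finsum U (f a) C) A = finsum U (\<lambda>p. f (fst p) (snd p)) (A \<times> C)"
proof -
  interpret M: Module.module "class_ring :: 'k ring" U by fact
  show ?thesis using assms(2,4)
  proof induct
    case (insert a A)
    have "insert a A \<times> C = (\<lambda>c. (a,c)) ` C \<union> A \<times> C" by auto
    also have "finsum U (\<lambda>p. f (fst p) (snd p)) \<dots> = finsum U (\<lambda>p. f (fst p) (snd p)) ((\<lambda>c. (a,c)) ` C)
      \<oplus>\<^bsub>U\<^esub> finsum U (\<lambda>p. f (fst p) (snd p)) (A \<times> C)"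
      by (rule M.finsum_Un_disjoint) (use insert assms(3) in auto)
    also have "finsum U (\<lambda>p. f (fst p) (snd p)) ((\<lambda>c. (a,c)) ` C) = finsum U (f a) C"
      by (subst M.finsum_reindex) (use insert in \<open>auto simp: inj_on_def\<close>)
    finally show ?case using insert
      by (subst M.finsum_insert) (auto intro!: M.finsum_closed)
  qed auto
qed

lemma bilinear_expand:
  fixes V :: "('k::field,'v) module" and U :: "('k,'u) module"
  assumes M: "module class_ring V" "module class_ring W" "module class_ring U"
    and b: "bilinear_map V W U b"
    and A: "finite A" "A \<subseteq> carrier V" and C: "finite C" "C \<subseteq> carrier W" 
    and v: "finsum V (\<lambda>a. \<phi> a \<odot>\<^bsub>V\<^esub> a) A \<in> carrier V" 
    and w: "finsum W (\<lambda>a. \<psi> a \<odot>\<^bsub>W\<^esub> a) C \<in> carrier W" 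
  shows "b (finsum V (\<lambda>a. \<phi> a \<odot>\<^bsub>V\<^esub> a) A) (finsum W (\<lambda>a. \<psi> a \<odot>\<^bsub>W\<^esub> a) C) =
     finsum U (\<lambda>p. (\<phi> (fst p) * \<psi> (snd p)) \<odot>\<^bsub>U\<^esub> b (fst p) (snd p)) (A \<times> C)"
proof -
  interpret V: Module.module "class_ring :: 'k ring" V by fact
  interpret W: Module.module "class_ring :: 'k ring" W by fact
  interpret U: Module.module "class_ring :: 'k ring" U by fact
  let ?w = "finsum W (\<lambda>a. \<psi> a \<odot>\<^bsub>W\<^esub> a) C"
  have h1: "b v \<in> mhom W U" if "v \<in> carrier V" for v using b that by (auto simp: bilinear_map_def)
  have h2: "(\<lambda>v. b v w) \<in> mhom V U" if "w \<in> carrier W" for w using b that by (auto simp: bilinear_map_def)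
  have "b (finsum V (\<lambda>a. \<phi> a \<odot>\<^bsub>V\<^esub> a) A) ?w = finsum U (\<lambda>a. b (\<phi> a \<odot>\<^bsub>V\<^esub> a) ?w) A"
    by (rule hom_finsum[OF M(1,3) h2[OF w]]) (use A in auto)
  also have "\<dots> = finsum U (\<lambda>a. finsum U (\<lambda>c. (\<phi> a * \<psi> c) \<odot>\<^bsub>U\<^esub> b a c) C) A"
  proof (rule U.finsum_cong')
    fix a assume a: "a \<in> A"
    then have aV: "a \<in> carrier V" "\<phi> a \<odot>\<^bsub>V\<^esub> a \<in> carrier V" using A by auto
    have "b (\<phi> a \<odot>\<^bsub>V\<^esub> a) ?w = finsum U (\<lambda>c. b (\<phi> a \<odot>\<^bsub>V\<^esub> a) (\<psi> c \<odot>\<^bsub>W\<^esub> c)) C"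
      by (rule hom_finsum[OF M(2,3) h1[OF aV(2)]]) (use C in auto)
    also have "\<dots> = finsum U (\<lambda>c. (\<phi> a * \<psi> c) \<odot>\<^bsub>U\<^esub> b a c) C"
    proof (rule U.finsum_cong')
      fix c assume c: "c \<in> C"
      then have cW: "c \<in> carrier W" using C by auto
      have "b (\<phi> a \<odot>\<^bsub>V\<^esub> a) (\<psi> c \<odot>\<^bsub>W\<^esub> c) = \<psi> c \<odot>\<^bsub>U\<^esub> (\<phi> a \<odot>\<^bsub>U\<^esub> b a c)"
        using mhomD(3)[OF h1[OF aV(2)] cW] mhomD(3)[OF h2[OF cW] aV(1)] by simp
      then show "b (\<phi> a \<odot>\<^bsub>V\<^esub> a) (\<psi> c \<odot>\<^bsub>W\<^esub> c) = (\<phi> a * \<psi> c) \<odot>\<^bsub>U\<^esub> b a c"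
        using mhomD(1)[OF h1[OF aV(1)] cW] U.smult_assoc1[of "\<psi> c" "\<phi> a" "b a c"] by (simp add: mult.commute)
    qed (use C aV mhomD(1)[OF h1] in \<open>auto\<close>)
    finally show "b (\<phi> a \<odot>\<^bsub>V\<^esub> a) ?w = finsum U (\<lambda>c. (\<phi> a * \<psi> c) \<odot>\<^bsub>U\<^esub> b a c) C" .
  qed (use subsetD[OF A(2)] subsetD[OF C(2)] mhomD(1)[OF h1] in \<open>auto intro!: U.finsum_closed module_closed(2)[OF M(3)]\<close>)
  also have "\<dots> = finsum U (\<lambda>p. (\<phi> (fst p) * \<psi> (snd p)) \<odot>\<^bsub>U\<^esub> b (fst p) (snd p)) (A \<times> C)"
    by (rule finsum_swap[OF M(3) A(1) C(1)]) (use subsetD[OF A(2)] subsetD[OF C(2)] mhomD(1)[OF h1] in \<open>auto intro!: module_closed(2)[OF M(3)]\<close>)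
  finally show ?thesis .
qed

lemma ptens_closed: "v \<in> carrier V \<Longrightarrow> w \<in> carrier W \<Longrightarrow> ptens V W v w \<in> carrier (V \<boxtimes> W)"
  if "module class_ring V" "module class_ring W" for V :: "('k::field,'v) module"
  unfolding tensor_space_def
  using module_closed[OF module_bf[OF that]]
  by (auto simp: Lin_def LinearCombinations.module_hom_def ptens_def)

lemma bilinear_forms_expand:
  fixes V :: "('k::field,'v) module" and W :: "('k,'w) module"
  assumes fd: "fdvs V" "fdvs W"
  shows "\<exists>A \<phi> C \<psi> E. finite A \<and> A \<subseteq> carrier V \<and> (\<forall>a\<in>A. \<phi> a \<in> Lin V ground) \<and>
    (\<forall>v\<in>carrier V. finsum V (\<lambda>a. \<phi> a v \<odot>\<^bsub>V\<^esub> a) A = v) \<and>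
    finite C \<and> C \<subseteq> carrier W \<and> (\<forall>c\<in>C. \<psi> c \<in> Lin W ground) \<and>
    (\<forall>w\<in>carrier W. finsum W (\<lambda>c. \<psi> c w \<odot>\<^bsub>W\<^esub> c) C = w) \<and>
    E = (\<lambda>p. \<lambda>q\<in>carrier V \<times> carrier W. \<phi> (fst p) (fst q) * \<psi> (snd p) (snd q)) \<and>
    (\<forall>p\<in>A \<times> C. E p \<in> carrier (bilinear_forms V W)) \<and>
    (\<forall>B\<in>carrier (bilinear_forms V W).
       finsum (bilinear_forms V W) (\<lambda>p. B p \<odot>\<^bsub>bilinear_forms V W\<^esub> E p) (A \<times> C) = B)"
proof -
  note M = fd[THEN fdvs_module]
  interpret V: Module.module "class_ring :: 'k ring" V by (rule M)
  interpret W: Module.module "class_ring :: 'k ring" W by (rule M)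
  obtain A \<phi> where A: "finite A" "A \<subseteq> carrier V" and \<phi>: "\<And>a. a \<in> A \<Longrightarrow> \<phi> a \<in> Lin V ground"
    and V: "\<And>v. v \<in> carrier V \<Longrightarrow> finsum V (\<lambda>a. \<phi> a v \<odot>\<^bsub>V\<^esub> a) A = v" using dual_basis[OF fd(1)] by blast
  obtain C \<psi> where C: "finite C" "C \<subseteq> carrier W" and \<psi>: "\<And>a. a \<in> C \<Longrightarrow> \<psi> a \<in> Lin W ground"
    and W: "\<And>v. v \<in> carrier W \<Longrightarrow> finsum W (\<lambda>a. \<psi> a v \<odot>\<^bsub>W\<^esub> a) C = v" using dual_basis[OF fd(2)] by blast
  have ex: "\<beta> v w = finsum X (\<lambda>p. (\<phi> (fst p) v * \<psi> (snd p) w) \<odot>\<^bsub>X\<^esub> \<beta> (fst p) (snd p)) (A \<times> C)"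
    if "module class_ring X" "bilinear_map V W X \<beta>" "v \<in> carrier V" "w \<in> carrier W" for X :: "('k,'x) module" and \<beta> v w
    using bilinear_expand[OF M(1,2) that(1,2) A C, of "\<lambda>a. \<phi> a v" "\<lambda>c. \<psi> c w"] that by (simp add: V W)
  define E where "E p = (\<lambda>q\<in>carrier V \<times> carrier W. \<phi> (fst p) (fst q) * \<psi> (snd p) (snd q))" for p
  have E: "E p \<in> carrier (bilinear_forms V W)" if "p \<in> A \<times> C" for p
  proof -
    have "\<phi> (fst p) \<in> mhom V ground" "\<psi> (snd p) \<in> mhom W ground" using \<phi> \<psi> that by (auto simp: Lin_def)
    from mhomD[OF this(1)] mhomD[OF this(2)] show ?thesis
      by (auto simp: E_def bilinear_map_def LinearCombinations.module_hom_def algebra_simps)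
  qed
  note MB = module_bf[OF M(1,2)]
  have expB: "B = finsum (bilinear_forms V W) (\<lambda>p. B p \<odot>\<^bsub>bilinear_forms V W\<^esub> E p) (A \<times> C)" 
    (is "_ = ?S") if B: "B \<in> carrier (bilinear_forms V W)" for B
  proof -
    interpret F: Module.module "class_ring :: 'k ring" "bilinear_forms V W" by (rule MB)
    have S: "?S \<in> carrier (bilinear_forms V W)" by (rule F.finsum_closed) (use E in \<open>auto simp del: bf_simps\<close>)
    show ?thesis
    proof (rule extensionalityI[of _ "carrier V \<times> carrier W"])
      fix q assume q: "q \<in> carrier V \<times> carrier W"
      have ev: "(\<lambda>B. B q) \<in> mhom (bilinear_forms V W) ground"
        using q by (intro mhomI) auto
      have "?S q = finsum ground (\<lambda>p. (B p \<odot>\<^bsub>bilinear_forms V W\<^esub> E p) q) (A \<times> C)"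
        by (rule hom_finsum[OF MB module_ground ev]) (use E A C in \<open>auto simp del: bf_simps\<close>)
      also have "\<dots> = (\<Sum>p\<in>A\<times>C. (B p \<odot>\<^bsub>bilinear_forms V W\<^esub> E p) q)"
        by (rule finsum_ground) (use A C in auto)
      also have "\<dots> = (\<Sum>p\<in>A\<times>C. \<phi> (fst p) (fst q) * \<psi> (snd p) (snd q) * B p)"
        using q by (intro sum.cong) (auto simp: E_def)
      also have "\<dots> = B q"
        using ex[OF module_ground, of "curry B" "fst q" "snd q"] B q A C by (auto simp: finsum_ground)
      finally show "B q = ?S q" ..
    qed (use B S in auto)
  qed
  have E_def': "E = (\<lambda>p. \<lambda>q\<in>carrier V \<times> carrier W. \<phi> (fst p) (fst q) * \<psi> (snd p) (snd q))"
    unfolding E_def ..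
  show ?thesis
    by (intro exI[of _ A] exI[of _ \<phi>] exI[of _ C] exI[of _ \<psi>] exI[of _ E] conjI ballI A \<phi> V C \<psi> W E_def' E
        expB[symmetric])
qed

lemma fdvs_bilinear_forms:
  fixes V :: "('k::field,'v) module" and W :: "('k,'w) module"
  assumes fd: "fdvs V" "fdvs W" shows "fdvs (bilinear_forms V W)"
proof -
  obtain A C E where A: "finite A" "finite C" 
    and E: "\<forall>p\<in>A \<times> C. E p \<in> carrier (bilinear_forms V W)"
    and B: "\<forall>B\<in>carrier (bilinear_forms V W).
       finsum (bilinear_forms V W) (\<lambda>p. B p \<odot>\<^bsub>bilinear_forms V W\<^esub> E p) (A \<times> C) = B"
    using bilinear_forms_expand[OF fd] by (elim exE conjE) (rule that)
  show ?thesis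
  proof (rule fdvsI[OF module_bf[OF fd[THEN fdvs_module]] _ bspec[OF E]])
    show "\<exists>c. B = finsum (bilinear_forms V W) (\<lambda>p. c p \<odot>\<^bsub>bilinear_forms V W\<^esub> E p) (A \<times> C)"
      if "B \<in> carrier (bilinear_forms V W)" for B
      by (rule exI[of _ B]) (rule bspec[OF B that, symmetric])
  qed (use A(1,2) in auto)
qed

lemma fdvs_tensor:
  fixes V :: "('k::field,'v) module" and W :: "('k,'w) module"
  assumes "fdvs V" "fdvs W" shows "fdvs (V \<boxtimes> W)"
  unfolding tensor_space_def by (intro fdvs_dual fdvs_bilinear_forms assms)

lemma tensor_universal:
  fixes V :: "('k::field,'v) module" and W :: "('k,'w) module" and U :: "('k,'u) module"
  assumes fd: "fdvs V" "fdvs W" "fdvs U" and b: "bilinear_map V W U b"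
  shows "\<exists>!f. f \<in> Lin (V \<boxtimes> W) U \<and> (\<forall>v\<in>carrier V. \<forall>w\<in>carrier W. f (ptens V W v w) = b v w)"
proof -
  note M = fd[THEN fdvs_module]
  interpret V: Module.module "class_ring :: 'k ring" V by (rule M)
  interpret W: Module.module "class_ring :: 'k ring" W by (rule M)
  interpret U: Module.module "class_ring :: 'k ring" U by (rule M)
  interpret T: Module.module "class_ring :: 'k ring" "V \<boxtimes> W" by (rule module_tensor[OF M(1,2)])
  obtain A \<phi> C \<psi> E where A: "finite A" "A \<subseteq> carrier V" and \<phi>: "\<forall>a\<in>A. \<phi> a \<in> Lin V ground"
    and V: "\<forall>v\<in>carrier V. finsum V (\<lambda>a. \<phi> a v \<odot>\<^bsub>V\<^esub> a) A = v" 
    and C: "finite C" "C \<subseteq> carrier W" and \<psi>: "\<forall>a\<in>C. \<psi> a \<in> Lin W ground"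
    and W: "\<forall>v\<in>carrier W. finsum W (\<lambda>a. \<psi> a v \<odot>\<^bsub>W\<^esub> a) C = v"
    and E_def: "E = (\<lambda>p. \<lambda>q\<in>carrier V \<times> carrier W. \<phi> (fst p) (fst q) * \<psi> (snd p) (snd q))"
    and E': "\<forall>p\<in>A \<times> C. E p \<in> carrier (bilinear_forms V W)"
    and expB': "\<forall>B\<in>carrier (bilinear_forms V W).
       finsum (bilinear_forms V W) (\<lambda>p. B p \<odot>\<^bsub>bilinear_forms V W\<^esub> E p) (A \<times> C) = B"
    using bilinear_forms_expand[OF fd(1,2)] by (elim exE conjE) (rule that)
  note E = bspec[OF E']
  note expB = bspec[OF expB', symmetric]
  have ex: "\<beta> v w = finsum X (\<lambda>p. (\<phi> (fst p) v * \<psi> (snd p) w) \<odot>\<^bsub>X\<^esub> \<beta> (fst p) (snd p)) (A \<times> C)"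
    if "module class_ring X" "bilinear_map V W X \<beta>" "v \<in> carrier V" "w \<in> carrier W" for X :: "('k,'x) module" and \<beta> v w
    using bilinear_expand[OF M(1,2) that(1,2) A C, of "\<lambda>a. \<phi> a v" "\<lambda>c. \<psi> c w"] that by (simp add: V W)
  note MB = module_bf[OF M(1,2)]
  have expT: "t = finsum (V \<boxtimes> W) (\<lambda>p. t (E p) \<odot>\<^bsub>V \<boxtimes> W\<^esub> ptens V W (fst p) (snd p)) (A \<times> C)" (is "_ = ?S")
    if t: "t \<in> carrier (V \<boxtimes> W)" for t
  proof -
    have t': "t \<in> mhom (bilinear_forms V W) ground" "t \<in> extensional (carrier (bilinear_forms V W))"
      using t by (auto simp: tensor_space_def Lin_def)
    have pc: "ptens V W (fst p) (snd p) \<in> carrier (V \<boxtimes> W)" if "p \<in> A \<times> C" for p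
      using ptens_closed[OF M(1,2)] subsetD[OF A(2)] subsetD[OF C(2)] that by auto
    have S: "?S \<in> carrier (V \<boxtimes> W)" by (rule T.finsum_closed) (use pc in \<open>auto simp del: bf_simps\<close>)
    show ?thesis
    proof (rule extensionalityI[of _ "carrier (bilinear_forms V W)"])
      fix B assume B: "B \<in> carrier (bilinear_forms V W)"
      interpret F: Module.module "class_ring :: 'k ring" "bilinear_forms V W" by (rule MB)
      have ev: "(\<lambda>t. t B) \<in> mhom (V \<boxtimes> W) ground"
        unfolding tensor_space_def using B by (intro mhomI) auto
      have "?S B = finsum ground (\<lambda>p. (t (E p) \<odot>\<^bsub>V \<boxtimes> W\<^esub> ptens V W (fst p) (snd p)) B) (A \<times> C)"
        by (rule hom_finsum[OF T.module_axioms module_ground ev]) (use pc A C in auto)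
      also have "\<dots> = (\<Sum>p\<in>A\<times>C. B p * t (E p))"
        using B A C by (subst finsum_ground) (auto intro!: sum.cong simp: tensor_space_def ptens_def)
      also have "\<dots> = (\<Sum>p\<in>A\<times>C. t (B p \<odot>\<^bsub>bilinear_forms V W\<^esub> E p))"
        using mhomD(3)[OF t'(1) E] by (intro sum.cong) (auto simp del: bf_simps)
      also have "\<dots> = t (finsum (bilinear_forms V W) (\<lambda>p. B p \<odot>\<^bsub>bilinear_forms V W\<^esub> E p) (A \<times> C))"
        by (subst hom_finsum[OF MB module_ground t'(1)]) (use E A C in \<open>auto simp del: bf_simps simp: finsum_ground\<close>)
      also have "\<dots> = t B" by (rule arg_cong[OF expB[OF B], symmetric])
      finally show "t B = ?S B" ..
    qed (use t' S in \<open>auto simp: tensor_space_def Lin_def simp del: bf_simps\<close>)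
  qed
  have bh1: "b v w \<in> carrier U" if "v \<in> carrier V" "w \<in> carrier W" for v w
    using b that by (auto simp: bilinear_map_def dest: mhomD)
  have bc: "b (fst p) (snd p) \<in> carrier U" if "p \<in> A \<times> C" for p
    using bh1 subsetD[OF A(2)] subsetD[OF C(2)] that by auto
  define f where "f = (\<lambda>t\<in>carrier (V \<boxtimes> W). finsum U (\<lambda>p. t (E p) \<odot>\<^bsub>U\<^esub> b (fst p) (snd p)) (A \<times> C))"
  have AC: "finite (A \<times> C)" using A C by auto
  have fl: "f \<in> Lin (V \<boxtimes> W) U"
  proof -
    have "f \<in> mhom (V \<boxtimes> W) U"
    proof (rule mhomI)
      show "f t \<in> carrier U" if "t \<in> carrier (V \<boxtimes> W)" for t
        using that bc by (auto simp: f_def intro!: U.finsum_closed)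
    next
      fix s t assume st: "s \<in> carrier (V \<boxtimes> W)" "t \<in> carrier (V \<boxtimes> W)"
      have 1: "s \<oplus>\<^bsub>V \<boxtimes> W\<^esub> t \<in> carrier (V \<boxtimes> W)" using st by auto
      have 2: "(s \<oplus>\<^bsub>V \<boxtimes> W\<^esub> t) (E p) = s (E p) + t (E p)" if "p \<in> A \<times> C" for p
        using E[OF that] by (simp add: tensor_space_def del: bf_simps)
      have "f (s \<oplus>\<^bsub>V \<boxtimes> W\<^esub> t) = finsum U (\<lambda>p. s (E p) \<odot>\<^bsub>U\<^esub> b (fst p) (snd p) \<oplus>\<^bsub>U\<^esub> t (E p) \<odot>\<^bsub>U\<^esub> b (fst p) (snd p)) (A \<times> C)"
        using 1 unfolding f_def restrict_apply
        apply simp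
        apply (rule U.finsum_cong')
        using bc 2 U.smult_l_distr[simplified] by (auto simp del: split_paired_All)
      also have "\<dots> = f s \<oplus>\<^bsub>U\<^esub> f t"
        using st bc by (auto simp: f_def Pi_def intro!: U.finsum_addf)
      finally show "f (s \<oplus>\<^bsub>V \<boxtimes> W\<^esub> t) = f s \<oplus>\<^bsub>U\<^esub> f t" .
    next
      fix k :: 'k and t assume t: "t \<in> carrier (V \<boxtimes> W)"
      have 1: "k \<odot>\<^bsub>V \<boxtimes> W\<^esub> t \<in> carrier (V \<boxtimes> W)" using t by auto
      have 2: "(k \<odot>\<^bsub>V \<boxtimes> W\<^esub> t) (E p) = k * t (E p)" if "p \<in> A \<times> C" for p
        using E[OF that] by (simp add: tensor_space_def del: bf_simps)
      have "f (k \<odot>\<^bsub>V \<boxtimes> W\<^esub> t) = finsum U (\<lambda>p. k \<odot>\<^bsub>U\<^esub> (t (E p) \<odot>\<^bsub>U\<^esub> b (fst p) (snd p))) (A \<times> C)"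
        using 1 unfolding f_def restrict_apply
        apply simp
        apply (rule U.finsum_cong')
        using bc 2 U.smult_assoc1[simplified] by (auto simp del: split_paired_All)
      also have "\<dots> = k \<odot>\<^bsub>U\<^esub> f t"
        unfolding f_def restrict_apply if_P[OF t]
        by (rule U.finsum_smult[symmetric]) (use bc in \<open>auto intro!: module_closed(2)[OF M(3)]\<close>)
      finally show "f (k \<odot>\<^bsub>V \<boxtimes> W\<^esub> t) = k \<odot>\<^bsub>U\<^esub> f t" .
    qed
    then show ?thesis by (auto simp: Lin_def f_def)
  qed
  have fp: "f (ptens V W v w) = b v w" if "v \<in> carrier V" "w \<in> carrier W" for v w
  proof -
    have "f (ptens V W v w) = finsum U (\<lambda>p. (\<phi> (fst p) v * \<psi> (snd p) w) \<odot>\<^bsub>U\<^esub> b (fst p) (snd p)) (A \<times> C)"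
      using ptens_closed[OF M(1,2) that] unfolding f_def restrict_apply
      apply simp
      apply (rule U.finsum_cong')
      using bc E that by (auto simp: ptens_def simp del: bf_simps) (auto simp: E_def)
    also have "\<dots> = b v w" using ex[OF M(3) b that] by simp
    finally show ?thesis .
  qed
  have uniq: "g = f" if g: "g \<in> Lin (V \<boxtimes> W) U" "\<forall>v\<in>carrier V. \<forall>w\<in>carrier W. g (ptens V W v w) = b v w" for g
  proof (rule extensionalityI[of _ "carrier (V \<boxtimes> W)"])
    fix t assume t: "t \<in> carrier (V \<boxtimes> W)"
    have pc: "ptens V W (fst p) (snd p) \<in> carrier (V \<boxtimes> W)" if "p \<in> A \<times> C" for p
      using ptens_closed[OF M(1,2)] subsetD[OF A(2)] subsetD[OF C(2)] that by auto
    have gh: "g \<in> mhom (V \<boxtimes> W) U" using g by (auto simp: Lin_def)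
    have "g t = g (finsum (V \<boxtimes> W) (\<lambda>p. t (E p) \<odot>\<^bsub>V \<boxtimes> W\<^esub> ptens V W (fst p) (snd p)) (A \<times> C))"
      by (rule arg_cong[OF expT[OF t]])
    also have "\<dots> = finsum U (\<lambda>p. g (t (E p) \<odot>\<^bsub>V \<boxtimes> W\<^esub> ptens V W (fst p) (snd p))) (A \<times> C)"
      by (rule hom_finsum[OF T.module_axioms M(3) gh]) (use pc AC in auto)
    also have "\<dots> = finsum U (\<lambda>p. t (E p) \<odot>\<^bsub>U\<^esub> b (fst p) (snd p)) (A \<times> C)"
    proof (rule U.finsum_cong')
      fix p assume p: "p \<in> A \<times> C"
      then have "g (ptens V W (fst p) (snd p)) = b (fst p) (snd p)" using g(2) subsetD[OF A(2)] subsetD[OF C(2)] by auto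
      then show "g (t (E p) \<odot>\<^bsub>V \<boxtimes> W\<^esub> ptens V W (fst p) (snd p)) = t (E p) \<odot>\<^bsub>U\<^esub> b (fst p) (snd p)"
        using mhomD(3)[OF gh pc[OF p]] by simp
    qed (use bc in auto)
    also have "\<dots> = f t" using t by (simp add: f_def)
    finally show "g t = f t" .
  qed (use g fl in \<open>auto simp: Lin_def\<close>)
  show ?thesis
  proof (rule ex1I[of _ f])
    show "f \<in> Lin (V \<boxtimes> W) U \<and> (\<forall>v\<in>carrier V. \<forall>w\<in>carrier W. f (ptens V W v w) = b v w)"
      using fl fp by blast
  qed (rule uniq; blast)
qed

text \<open>
  The linear map on \<open>V \<boxtimes> W\<close> induced by a bilinear map \<open>b\<close>. It also renders Sweedler notation:
  for \<open>t = t\<^sub>1 \<otimes> t\<^sub>2\<close> (summation suppressed), \<open>tlift V W U b t\<close> is \<open>b t\<^sub>1 t\<^sub>2\<close>.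
\<close>

definition tlift ::
  "('k::field, 'v) module \<Rightarrow> ('k, 'w) module \<Rightarrow> ('k, 'u) module \<Rightarrow> ('v \<Rightarrow> 'w \<Rightarrow> 'u)
     \<Rightarrow> ('k, 'v, 'w) tensor \<Rightarrow> 'u" where
  "tlift V W U b =
     (THE f. f \<in> Lin (V \<boxtimes> W) U \<and> (\<forall>v\<in>carrier V. \<forall>w\<in>carrier W. f (ptens V W v w) = b v w))"

definition tmap ::
  "('k::field, 'v) module \<Rightarrow> ('k, 'w) module \<Rightarrow> ('k, 'x) module \<Rightarrow> ('k, 'y) module
     \<Rightarrow> ('v \<Rightarrow> 'x) \<Rightarrow> ('w \<Rightarrow> 'y) \<Rightarrow> ('k, 'v, 'w) tensor \<Rightarrow> ('k, 'x, 'y) tensor" where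
  "tmap V W X Y f g = tlift V W (X \<boxtimes> Y) (\<lambda>v w. ptens X Y (f v) (g w))"

definition flip ::
  "('k::field, 'v) module \<Rightarrow> ('k, 'w) module \<Rightarrow> ('k, 'v, 'w) tensor \<Rightarrow> ('k, 'w, 'v) tensor" where
  "flip V W = tlift V W (W \<boxtimes> V) (\<lambda>v w. ptens W V w v)"

definition tassoc where
  "tassoc U V W =
     tlift (U \<boxtimes> V) W (U \<boxtimes> (V \<boxtimes> W))
       (\<lambda>t w. tlift U V (U \<boxtimes> (V \<boxtimes> W)) (\<lambda>u v. ptens U (V \<boxtimes> W) u (ptens V W v w)) t)"

definition tassoc_inv where
  "tassoc_inv U V W =
     tlift U (V \<boxtimes> W) ((U \<boxtimes> V) \<boxtimes> W)
       (\<lambda>u t. tlift V W ((U \<boxtimes> V) \<boxtimes> W) (\<lambda>v w. ptens (U \<boxtimes> V) W (ptens U V u v) w) t)"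

text \<open>
  For \<open>\<sigma> : U \<boxtimes> V \<rightarrow> V \<boxtimes> U\<close>, \<open>swap12 U V W \<sigma>\<close> is \<open>\<sigma> \<otimes> Id : (U \<boxtimes> V) \<boxtimes> W \<rightarrow> (V \<boxtimes> U) \<boxtimes> W\<close>; for
  \<open>\<sigma> : V \<boxtimes> W \<rightarrow> W \<boxtimes> V\<close>, \<open>swap23 U V W \<sigma>\<close> is \<open>Id \<otimes> \<sigma> : (U \<boxtimes> V) \<boxtimes> W \<rightarrow> (U \<boxtimes> W) \<boxtimes> V\<close>; for
  \<open>\<sigma> : V \<boxtimes> W \<rightarrow> W \<boxtimes> V\<close>, \<open>swap_mid U V W X \<sigma>\<close> is
  \<open>Id \<otimes> \<sigma> \<otimes> Id : (U \<boxtimes> V) \<boxtimes> (W \<boxtimes> X) \<rightarrow> (U \<boxtimes> W) \<boxtimes> (V \<boxtimes> X)\<close>.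
\<close>

definition swap12 where
  "swap12 U V W \<sigma> = tmap (U \<boxtimes> V) W (V \<boxtimes> U) W \<sigma> (\<lambda>w. w)"

definition swap23 where
  "swap23 U V W \<sigma> t =
     tassoc_inv U W V (tmap U (V \<boxtimes> W) U (W \<boxtimes> V) (\<lambda>u. u) \<sigma> (tassoc U V W t))"

definition swap_mid where
  "swap_mid U V W X \<sigma> t =
     tassoc_inv U W (V \<boxtimes> X)
       (tmap U (V \<boxtimes> (W \<boxtimes> X)) U (W \<boxtimes> (V \<boxtimes> X))
          (\<lambda>u. u) (\<lambda>s. tassoc W V X (swap12 V W X \<sigma> (tassoc_inv V W X s)))
          (tassoc U V (W \<boxtimes> X) t))"


section \<open>Algebras, bialgebras and their duals\<close>

record ('k, 'v) alg =
  sp :: "('k, 'v) module"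
  mu :: "('k, 'v, 'v) tensor \<Rightarrow> 'v"
  nu :: "'k \<Rightarrow> 'v"

record ('k, 'v) bialg = "('k, 'v) alg" +
  Delta :: "'v \<Rightarrow> ('k, 'v, 'v) tensor"
  eps :: "'v \<Rightarrow> 'k"

definition unital_algebra :: "('k::field, 'v, 'z) alg_scheme \<Rightarrow> bool" where
  "unital_algebra A \<longleftrightarrow>
     (let V = sp A; m = (\<lambda>a b. mu A (ptens V V a b)) in
       fdvs V \<and> mu A \<in> Lin (V \<boxtimes> V) V \<and> nu A \<in> Lin ground V \<and>
       (\<forall>a\<in>carrier V. \<forall>b\<in>carrier V. \<forall>c\<in>carrier V. m (m a b) c = m a (m b c)) \<and>
       (\<forall>a\<in>carrier V. m (nu A 1) a = a \<and> m a (nu A 1) = a))"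

definition counital_coalgebra :: "('k::field, 'v) bialg \<Rightarrow> bool" where
  "counital_coalgebra H \<longleftrightarrow>
     (let V = sp H in
       fdvs V \<and> Delta H \<in> Lin V (V \<boxtimes> V) \<and> eps H \<in> Lin V ground \<and>
       (\<forall>h\<in>carrier V.
          tassoc V V V (tmap V V (V \<boxtimes> V) V (Delta H) (\<lambda>x. x) (Delta H h)) =
            tmap V V V (V \<boxtimes> V) (\<lambda>x. x) (Delta H) (Delta H h) \<and>
          tlift V V V (\<lambda>h\<^sub>1 h\<^sub>2. eps H h\<^sub>1 \<odot>\<^bsub>V\<^esub> h\<^sub>2) (Delta H h) = h \<and>
          tlift V V V (\<lambda>h\<^sub>1 h\<^sub>2. eps H h\<^sub>2 \<odot>\<^bsub>V\<^esub> h\<^sub>1) (Delta H h) = h))"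

definition normalized_pair :: "('k::field, 'v) bialg \<Rightarrow> bool" where
  "normalized_pair H \<longleftrightarrow> (\<forall>c. eps H (nu H c) = c)"

definition bialgebra_compatibility :: "('k::field, 'v) bialg \<Rightarrow> bool" where
  "bialgebra_compatibility H \<longleftrightarrow>
     (let V = sp H in
       (\<forall>t\<in>carrier (V \<boxtimes> V).
          Delta H (mu H t) =
            tmap (V \<boxtimes> V) (V \<boxtimes> V) V V (mu H) (mu H)
              (swap_mid V V V V (flip V V)
                (tmap V V (V \<boxtimes> V) (V \<boxtimes> V) (Delta H) (Delta H) t))) \<and>
       Delta H (nu H 1) = ptens V V (nu H 1) (nu H 1) \<and>
       (\<forall>a\<in>carrier V. \<forall>b\<in>carrier V. eps H (mu H (ptens V V a b)) = eps H a * eps H b) \<and>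
       normalized_pair H)"

definition bialgebra :: "('k::field, 'v) bialg \<Rightarrow> bool" where
  "bialgebra H \<longleftrightarrow> unital_algebra H \<and> counital_coalgebra H \<and> bialgebra_compatibility H"

definition antipode :: "('k::field, 'v) bialg \<Rightarrow> ('v \<Rightarrow> 'v) \<Rightarrow> bool" where
  "antipode H s \<longleftrightarrow>
     (let V = sp H in
       s \<in> Lin V V \<and>
       (\<forall>h\<in>carrier V.
          mu H (tmap V V V V s (\<lambda>x. x) (Delta H h)) = nu H (eps H h) \<and>
          mu H (tmap V V V V (\<lambda>x. x) s (Delta H h)) = nu H (eps H h)))"

definition has_antipode :: "('k::field, 'v) bialg \<Rightarrow> bool" where
  "has_antipode H \<longleftrightarrow> (\<exists>s. antipode H s)"

text \<open>
  The dual structure, with the ``rainbow'' pairing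
  \<open>\<langle>l l', h\<rangle> = \<langle>l, h\<^sub>2\<rangle> \<langle>l', h\<^sub>1\<rangle>\<close> and \<open>\<langle>l, h h'\<rangle> = \<langle>l\<^sub>1, h'\<rangle> \<langle>l\<^sub>2, h\<rangle>\<close>.
  The latter determines \<open>\<Delta> l \<in> H\<^sup>* \<otimes> H\<^sup>*\<close> uniquely as \<open>H\<close> is finite-dimensional.
\<close>

definition dual_bialg :: "('k::field, 'v) bialg \<Rightarrow> ('k, 'v \<Rightarrow> 'k) bialg" where
  "dual_bialg H =
     (let V = sp H; D = dual V in
       \<lparr>sp = D,
        mu = tlift D D D (\<lambda>l l'. \<lambda>h\<in>carrier V. tlift V V ground (\<lambda>h\<^sub>1 h\<^sub>2. l h\<^sub>2 * l' h\<^sub>1) (Delta H h)),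
        nu = (\<lambda>c. \<lambda>h\<in>carrier V. c * eps H h),
        Delta = (\<lambda>l\<in>carrier D. THE t. t \<in> carrier (D \<boxtimes> D) \<and>
                   (\<forall>h\<in>carrier V. \<forall>h'\<in>carrier V.
                      l (mu H (ptens V V h h')) = tlift D D ground (\<lambda>l\<^sub>1 l\<^sub>2. l\<^sub>1 h' * l\<^sub>2 h) t)),
        eps = (\<lambda>l\<in>carrier D. l (nu H 1))\<rparr>)"


section \<open>Bipointed braided systems of rank 2\<close>

record ('k, 'v, 'w) brsys =
  V1 :: "('k, 'v) module"
  V2 :: "('k, 'w) module"
  sig11 :: "('k, 'v, 'v) tensor \<Rightarrow> ('k, 'v, 'v) tensor"
  sig22 :: "('k, 'w, 'w) tensor \<Rightarrow> ('k, 'w, 'w) tensor"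
  sig12 :: "('k, 'v, 'w) tensor \<Rightarrow> ('k, 'w, 'v) tensor"
  nu1 :: "'k \<Rightarrow> 'v"
  nu2 :: "'k \<Rightarrow> 'w"
  eps1 :: "'v \<Rightarrow> 'k"
  eps2 :: "'w \<Rightarrow> 'k"

definition yang_baxter where
  "yang_baxter U V W \<sigma>UV \<sigma>UW \<sigma>VW \<longleftrightarrow>
     (\<forall>t\<in>carrier ((U \<boxtimes> V) \<boxtimes> W).
        swap12 V W U \<sigma>VW (swap23 V U W \<sigma>UW (swap12 U V W \<sigma>UV t)) =
        swap23 W U V \<sigma>UV (swap12 U W V \<sigma>UW (swap23 U V W \<sigma>VW t)))"

definition bipointed_braided_system :: "('k::field, 'v, 'w) brsys \<Rightarrow> bool" where
  "bipointed_braided_system S \<longleftrightarrow>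
     fdvs (V1 S) \<and> fdvs (V2 S) \<and>
     sig11 S \<in> Lin (V1 S \<boxtimes> V1 S) (V1 S \<boxtimes> V1 S) \<and>
     sig22 S \<in> Lin (V2 S \<boxtimes> V2 S) (V2 S \<boxtimes> V2 S) \<and>
     sig12 S \<in> Lin (V1 S \<boxtimes> V2 S) (V2 S \<boxtimes> V1 S) \<and>
     yang_baxter (V1 S) (V1 S) (V1 S) (sig11 S) (sig11 S) (sig11 S) \<and>
     yang_baxter (V1 S) (V1 S) (V2 S) (sig11 S) (sig12 S) (sig12 S) \<and>
     yang_baxter (V1 S) (V2 S) (V2 S) (sig12 S) (sig12 S) (sig22 S) \<and>
     yang_baxter (V2 S) (V2 S) (V2 S) (sig22 S) (sig22 S) (sig22 S) \<and>
     nu1 S \<in> Lin ground (V1 S) \<and> eps1 S \<in> Lin (V1 S) ground \<and> (\<forall>c. eps1 S (nu1 S c) = c) \<and>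
     nu2 S \<in> Lin ground (V2 S) \<and> eps2 S \<in> Lin (V2 S) ground \<and> (\<forall>c. eps2 S (nu2 S c) = c)"

definition sigma_ass :: "('k::field, 'v, 'z) alg_scheme \<Rightarrow> ('k, 'v, 'v) tensor \<Rightarrow> ('k, 'v, 'v) tensor" where
  "sigma_ass A =
     (let V = sp A in tlift V V (V \<boxtimes> V) (\<lambda>a b. ptens V V (nu A 1) (mu A (ptens V V a b))))"

definition sigma_ass_r :: "('k::field, 'v, 'z) alg_scheme \<Rightarrow> ('k, 'v, 'v) tensor \<Rightarrow> ('k, 'v, 'v) tensor" where
  "sigma_ass_r A =
     (let V = sp A in tlift V V (V \<boxtimes> V) (\<lambda>a b. ptens V V (mu A (ptens V V a b)) (nu A 1)))"

text \<open>\<open>\<sigma>\<^sub>b\<^sub>i (h \<otimes> l) = \<langle>l\<^sub>1, h\<^sub>2\<rangle> l\<^sub>2 \<otimes> h\<^sub>1\<close>.\<close>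

definition sigma_bi ::
  "('k::field, 'v) bialg \<Rightarrow> ('k, 'v, 'v \<Rightarrow> 'k) tensor \<Rightarrow> ('k, 'v \<Rightarrow> 'k, 'v) tensor" where
  "sigma_bi H =
     (let V = sp H; D = dual V in
       tlift V D (D \<boxtimes> V) (\<lambda>h l.
         tlift V V (D \<boxtimes> V) (\<lambda>h\<^sub>1 h\<^sub>2.
           tlift D D (D \<boxtimes> V) (\<lambda>l\<^sub>1 l\<^sub>2. l\<^sub>1 h\<^sub>2 \<odot>\<^bsub>D \<boxtimes> V\<^esub> ptens D V l\<^sub>2 h\<^sub>1)
             (Delta (dual_bialg H) l))
           (Delta H h)))"

definition B_sys :: "('k::field, 'v) bialg \<Rightarrow> ('k, 'v, 'v \<Rightarrow> 'k) brsys" where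
  "B_sys H =
     \<lparr>V1 = sp H, V2 = sp (dual_bialg H),
      sig11 = sigma_ass_r H, sig22 = sigma_ass (dual_bialg H), sig12 = sigma_bi H,
      nu1 = nu H, nu2 = nu (dual_bialg H), eps1 = eps H, eps2 = eps (dual_bialg H)\<rparr>"

definition invertible_map :: "('k::field, 'v) module \<Rightarrow> ('k, 'w) module \<Rightarrow> ('v \<Rightarrow> 'w) \<Rightarrow> bool" where
  "invertible_map V W f \<longleftrightarrow>
     f \<in> Lin V W \<and>
     (\<exists>g\<in>Lin W V. (\<forall>v\<in>carrier V. g (f v) = v) \<and> (\<forall>w\<in>carrier W. f (g w) = w))"

definition inverse_map :: "('k::field, 'v) module \<Rightarrow> ('k, 'w) module \<Rightarrow> ('v \<Rightarrow> 'w) \<Rightarrow> 'w \<Rightarrow> 'v" where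
  "inverse_map V W f = (\<lambda>w\<in>carrier W. inv_into (carrier V) f w)"

text \<open>The system with the two components exchanged and \<open>\<sigma>\<^sub>1\<^sub>,\<^sub>2\<close> replaced by its inverse.\<close>

definition s1_sys :: "('k::field, 'v, 'w) brsys \<Rightarrow> ('k, 'w, 'v) brsys" where
  "s1_sys S =
     \<lparr>V1 = V2 S, V2 = V1 S,
      sig11 = sig22 S, sig22 = sig11 S,
      sig12 = inverse_map (V1 S \<boxtimes> V2 S) (V2 S \<boxtimes> V1 S) (sig12 S),
      nu1 = nu2 S, nu2 = nu1 S, eps1 = eps2 S, eps2 = eps1 S\<rparr>"

text \<open>The twisted tensor product \<open>A \<otimes>\<^sub>\<sigma> B\<close> for \<open>\<sigma> : B \<otimes> A \<rightarrow> A \<otimes> B\<close>.\<close>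

definition twisted_product ::
  "('k::field, 'v, 'y) alg_scheme \<Rightarrow> ('k, 'w, 'z) alg_scheme
     \<Rightarrow> (('k, 'w, 'v) tensor \<Rightarrow> ('k, 'v, 'w) tensor) \<Rightarrow> ('k, ('k, 'v, 'w) tensor) alg" where
  "twisted_product A B \<sigma> =
     (let V = sp A; W = sp B in
       \<lparr>sp = V \<boxtimes> W,
        mu = (\<lambda>t\<in>carrier ((V \<boxtimes> W) \<boxtimes> (V \<boxtimes> W)).
                tmap (V \<boxtimes> V) (W \<boxtimes> W) V W (mu A) (mu B) (swap_mid V W V W \<sigma> t)),
        nu = (\<lambda>c. c \<odot>\<^bsub>V \<boxtimes> W\<^esub> ptens V W (nu A 1) (nu B 1))\<rparr>)"


section \<open>Categories\<close>

record ('o, 'm) cat =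
  Obj :: "'o set"
  Hom :: "'o \<Rightarrow> 'o \<Rightarrow> 'm set"
  Idn :: "'o \<Rightarrow> 'm"
  Comp :: "'o \<Rightarrow> 'o \<Rightarrow> 'o \<Rightarrow> 'm \<Rightarrow> 'm \<Rightarrow> 'm"

definition category :: "('o, 'm) cat \<Rightarrow> bool" where
  "category C \<longleftrightarrow>
     (\<forall>a\<in>Obj C. Idn C a \<in> Hom C a a) \<and>
     (\<forall>a\<in>Obj C. \<forall>b\<in>Obj C. \<forall>c\<in>Obj C. \<forall>f\<in>Hom C a b. \<forall>g\<in>Hom C b c. Comp C a b c g f \<in> Hom C a c) \<and>
     (\<forall>a\<in>Obj C. \<forall>b\<in>Obj C. \<forall>f\<in>Hom C a b.
        Comp C a a b f (Idn C a) = f \<and> Comp C a b b (Idn C b) f = f) \<and>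
     (\<forall>a\<in>Obj C. \<forall>b\<in>Obj C. \<forall>c\<in>Obj C. \<forall>d\<in>Obj C.
        \<forall>f\<in>Hom C a b. \<forall>g\<in>Hom C b c. \<forall>h\<in>Hom C c d.
          Comp C a c d h (Comp C a b c g f) = Comp C a b d (Comp C b c d h g) f)"

definition is_iso :: "('o, 'm) cat \<Rightarrow> 'o \<Rightarrow> 'o \<Rightarrow> 'm \<Rightarrow> bool" where
  "is_iso C a b f \<longleftrightarrow>
     f \<in> Hom C a b \<and> (\<exists>g\<in>Hom C b a. Comp C a b a g f = Idn C a \<and> Comp C b a b f g = Idn C b)"

definition groupoid :: "('o, 'm) cat \<Rightarrow> bool" where
  "groupoid C \<longleftrightarrow> category C \<and> (\<forall>a\<in>Obj C. \<forall>b\<in>Obj C. \<forall>f\<in>Hom C a b. is_iso C a b f)"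

text \<open>
  A functor is given by its object map and its arrow map; as hom-sets need not be disjoint, the
  latter also takes source and target.
\<close>

definition is_functor ::
  "('o, 'm) cat \<Rightarrow> ('p, 'n) cat \<Rightarrow> ('o \<Rightarrow> 'p) \<Rightarrow> ('o \<Rightarrow> 'o \<Rightarrow> 'm \<Rightarrow> 'n) \<Rightarrow> bool" where
  "is_functor C D Fo Fa \<longleftrightarrow>
     category C \<and> category D \<and>
     (\<forall>a\<in>Obj C. Fo a \<in> Obj D) \<and>
     (\<forall>a\<in>Obj C. \<forall>b\<in>Obj C. \<forall>f\<in>Hom C a b. Fa a b f \<in> Hom D (Fo a) (Fo b)) \<and>
     (\<forall>a\<in>Obj C. Fa a a (Idn C a) = Idn D (Fo a)) \<and>
     (\<forall>a\<in>Obj C. \<forall>b\<in>Obj C. \<forall>c\<in>Obj C. \<forall>f\<in>Hom C a b. \<forall>g\<in>Hom C b c.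
        Fa a c (Comp C a b c g f) = Comp D (Fo a) (Fo b) (Fo c) (Fa b c g) (Fa a b f))"

definition fully_faithful ::
  "('o, 'm) cat \<Rightarrow> ('p, 'n) cat \<Rightarrow> ('o \<Rightarrow> 'p) \<Rightarrow> ('o \<Rightarrow> 'o \<Rightarrow> 'm \<Rightarrow> 'n) \<Rightarrow> bool" where
  "fully_faithful C D Fo Fa \<longleftrightarrow>
     (\<forall>a\<in>Obj C. \<forall>b\<in>Obj C. bij_betw (Fa a b) (Hom C a b) (Hom D (Fo a) (Fo b)))"

definition natural_iso ::
  "('o, 'm) cat \<Rightarrow> ('p, 'n) cat \<Rightarrow> ('o \<Rightarrow> 'p) \<Rightarrow> ('o \<Rightarrow> 'o \<Rightarrow> 'm \<Rightarrow> 'n)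
     \<Rightarrow> ('o \<Rightarrow> 'p) \<Rightarrow> ('o \<Rightarrow> 'o \<Rightarrow> 'm \<Rightarrow> 'n) \<Rightarrow> ('o \<Rightarrow> 'n) \<Rightarrow> bool" where
  "natural_iso C D Fo Fa Go Ga \<eta> \<longleftrightarrow>
     (\<forall>a\<in>Obj C. is_iso D (Fo a) (Go a) (\<eta> a)) \<and>
     (\<forall>a\<in>Obj C. \<forall>b\<in>Obj C. \<forall>f\<in>Hom C a b.
        Comp D (Fo a) (Fo b) (Go b) (\<eta> b) (Fa a b f) = Comp D (Fo a) (Go a) (Go b) (Ga a b f) (\<eta> a))"

definition equivalence_functor ::
  "('o, 'm) cat \<Rightarrow> ('p, 'n) cat \<Rightarrow> ('o \<Rightarrow> 'p) \<Rightarrow> ('o \<Rightarrow> 'o \<Rightarrow> 'm \<Rightarrow> 'n) \<Rightarrow> bool" where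
  "equivalence_functor C D Fo Fa \<longleftrightarrow>
     is_functor C D Fo Fa \<and>
     (\<exists>Go Ga \<eta> \<epsilon>.
        is_functor D C Go Ga \<and>
        natural_iso C C (\<lambda>a. a) (\<lambda>a b f. f) (\<lambda>a. Go (Fo a)) (\<lambda>a b f. Ga (Fo a) (Fo b) (Fa a b f)) \<eta> \<and>
        natural_iso D D (\<lambda>a. Fo (Go a)) (\<lambda>a b f. Fa (Go a) (Go b) (Ga a b f)) (\<lambda>a. a) (\<lambda>a b f. f) \<epsilon>)"

definition equivalent_cats :: "('o, 'm) cat \<Rightarrow> ('p, 'n) cat \<Rightarrow> bool" where
  "equivalent_cats C D \<longleftrightarrow> (\<exists>Fo Fa. equivalence_functor C D Fo Fa)"


section \<open>The groupoids of bialgebras and of braided systems\<close>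

definition Bialg_gpd :: "(('k::field, 'v) bialg, 'v \<Rightarrow> 'v) cat" where
  "Bialg_gpd =
     \<lparr>Obj = {H. bialgebra H},
      Hom = (\<lambda>H K. {f. invertible_map (sp H) (sp K) f \<and>
               (\<forall>t\<in>carrier (sp H \<boxtimes> sp H). f (mu H t) = mu K (tmap (sp H) (sp H) (sp K) (sp K) f f t)) \<and>
               (\<forall>c. f (nu H c) = nu K c) \<and>
               (\<forall>h\<in>carrier (sp H). Delta K (f h) = tmap (sp H) (sp H) (sp K) (sp K) f f (Delta H h)) \<and>
               (\<forall>h\<in>carrier (sp H). eps K (f h) = eps H h)}),
      Idn = (\<lambda>H. \<lambda>h\<in>carrier (sp H). h),
      Comp = (\<lambda>H K L g f. compose (carrier (sp H)) g f)\<rparr>"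

definition BrSyst_gpd :: "(('k::field, 'v, 'w) brsys, ('v \<Rightarrow> 'v) \<times> ('w \<Rightarrow> 'w)) cat" where
  "BrSyst_gpd =
     \<lparr>Obj = {S. bipointed_braided_system S},
      Hom = (\<lambda>S T. {(f, g). invertible_map (V1 S) (V1 T) f \<and> invertible_map (V2 S) (V2 T) g \<and>
               (\<forall>t\<in>carrier (V1 S \<boxtimes> V1 S).
                  tmap (V1 S) (V1 S) (V1 T) (V1 T) f f (sig11 S t) =
                  sig11 T (tmap (V1 S) (V1 S) (V1 T) (V1 T) f f t)) \<and>
               (\<forall>t\<in>carrier (V1 S \<boxtimes> V2 S).
                  tmap (V2 S) (V1 S) (V2 T) (V1 T) g f (sig12 S t) =
                  sig12 T (tmap (V1 S) (V2 S) (V1 T) (V2 T) f g t)) \<and>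
               (\<forall>t\<in>carrier (V2 S \<boxtimes> V2 S).
                  tmap (V2 S) (V2 S) (V2 T) (V2 T) g g (sig22 S t) =
                  sig22 T (tmap (V2 S) (V2 S) (V2 T) (V2 T) g g t)) \<and>
               (\<forall>c. f (nu1 S c) = nu1 T c) \<and> (\<forall>c. g (nu2 S c) = nu2 T c) \<and>
               (\<forall>v\<in>carrier (V1 S). eps1 T (f v) = eps1 S v) \<and>
               (\<forall>v\<in>carrier (V2 S). eps2 T (g v) = eps2 S v)}),
      Idn = (\<lambda>S. (\<lambda>v\<in>carrier (V1 S). v, \<lambda>v\<in>carrier (V2 S). v)),
      Comp = (\<lambda>S T U g f. (compose (carrier (V1 S)) (fst g) (fst f),
                           compose (carrier (V2 S)) (snd g) (snd f)))\<rparr>"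

definition B_arr ::
  "('k::field, 'v) bialg \<Rightarrow> ('k, 'v) bialg \<Rightarrow> ('v \<Rightarrow> 'v) \<Rightarrow> ('v \<Rightarrow> 'v) \<times> (('v \<Rightarrow> 'k) \<Rightarrow> ('v \<Rightarrow> 'k))" where
  "B_arr H K f = (f, transpose_map (sp K) (sp H) (inverse_map (sp H) (sp K) f))"


section \<open>Module categories\<close>

definition right_module ::
  "('k::field, 'a, 'z) alg_scheme \<Rightarrow> ('k, 'm) module \<Rightarrow> (('k, 'm, 'a) tensor \<Rightarrow> 'm) \<Rightarrow> bool" where
  "right_module A M \<rho> \<longleftrightarrow>
     fdvs M \<and> \<rho> \<in> Lin (M \<boxtimes> sp A) M \<and>
     (\<forall>m\<in>carrier M. \<forall>a\<in>carrier (sp A). \<forall>b\<in>carrier (sp A).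
        \<rho> (ptens M (sp A) (\<rho> (ptens M (sp A) m a)) b) =
        \<rho> (ptens M (sp A) m (mu A (ptens (sp A) (sp A) a b)))) \<and>
     (\<forall>m\<in>carrier M. \<rho> (ptens M (sp A) m (nu A 1)) = m)"

definition right_comodule ::
  "('k::field, 'a) bialg \<Rightarrow> ('k, 'm) module \<Rightarrow> ('m \<Rightarrow> ('k, 'm, 'a) tensor) \<Rightarrow> bool" where
  "right_comodule H M \<delta> \<longleftrightarrow>
     (let V = sp H in
       fdvs M \<and> \<delta> \<in> Lin M (M \<boxtimes> V) \<and>
       (\<forall>m\<in>carrier M.
          tassoc M V V (tmap M V (M \<boxtimes> V) V \<delta> (\<lambda>x. x) (\<delta> m)) =
            tmap M V M (V \<boxtimes> V) (\<lambda>x. x) (Delta H) (\<delta> m) \<and>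
          tlift M V M (\<lambda>m\<^sub>0 m\<^sub>1. eps H m\<^sub>1 \<odot>\<^bsub>M\<^esub> m\<^sub>0) (\<delta> m) = m))"

definition act_hom where
  "act_hom M N V \<rho> \<rho>' f \<longleftrightarrow>
     (\<forall>t\<in>carrier (M \<boxtimes> V). f (\<rho> t) = \<rho>' (tmap M V N V f (\<lambda>x. x) t))"

record ('k, 'm, 'a) alg_mod =
  am_sp :: "('k, 'm) module"
  am_act :: "('k, 'm, 'a) tensor \<Rightarrow> 'm"

definition Mod_alg :: "('k::field, 'a, 'z) alg_scheme \<Rightarrow> (('k, 'm, 'a) alg_mod, 'm \<Rightarrow> 'm) cat" where
  "Mod_alg A =
     \<lparr>Obj = {M. right_module A (am_sp M) (am_act M)},
      Hom = (\<lambda>M N. {f \<in> Lin (am_sp M) (am_sp N).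
                       act_hom (am_sp M) (am_sp N) (sp A) (am_act M) (am_act N) f}),
      Idn = (\<lambda>M. \<lambda>m\<in>carrier (am_sp M). m),
      Comp = (\<lambda>M N P g f. compose (carrier (am_sp M)) g f)\<rparr>"

record ('k, 'm, 'a) hopf_mod =
  hm_sp :: "('k, 'm) module"
  hm_act :: "('k, 'm, 'a) tensor \<Rightarrow> 'm"
  hm_coact :: "'m \<Rightarrow> ('k, 'm, 'a) tensor"

definition hopf_module :: "('k::field, 'a) bialg \<Rightarrow> ('k, 'm, 'a) hopf_mod \<Rightarrow> bool" where
  "hopf_module H X \<longleftrightarrow>
     (let V = sp H; M = hm_sp X in
       right_module H M (hm_act X) \<and> right_comodule H M (hm_coact X) \<and>
       (\<forall>t\<in>carrier (M \<boxtimes> V).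
          hm_coact X (hm_act X t) =
            tmap (M \<boxtimes> V) (V \<boxtimes> V) M V (hm_act X) (mu H)
              (swap_mid M V V V (flip V V)
                (tmap M V (M \<boxtimes> V) (V \<boxtimes> V) (hm_coact X) (Delta H) t))))"

definition Mod_hopf :: "('k::field, 'a) bialg \<Rightarrow> (('k, 'm, 'a) hopf_mod, 'm \<Rightarrow> 'm) cat" where
  "Mod_hopf H =
     \<lparr>Obj = {M. hopf_module H M},
      Hom = (\<lambda>M N. {f \<in> Lin (hm_sp M) (hm_sp N).
                       act_hom (hm_sp M) (hm_sp N) (sp H) (hm_act M) (hm_act N) f \<and>
                       (\<forall>m\<in>carrier (hm_sp M).
                          hm_coact N (f m) =
                          tmap (hm_sp M) (sp H) (hm_sp N) (sp H) f (\<lambda>x. x) (hm_coact M m))}),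
      Idn = (\<lambda>M. \<lambda>m\<in>carrier (hm_sp M). m),
      Comp = (\<lambda>M N P g f. compose (carrier (hm_sp M)) g f)\<rparr>"

record ('k, 'm, 'v, 'w) br_mod =
  bm_sp :: "('k, 'm) module"
  bm_act1 :: "('k, 'm, 'v) tensor \<Rightarrow> 'm"
  bm_act2 :: "('k, 'm, 'w) tensor \<Rightarrow> 'm"

text \<open>\<open>\<rho>\<^sub>j (\<rho>\<^sub>i \<otimes> Id) = \<rho>\<^sub>i (\<rho>\<^sub>j \<otimes> Id) (Id \<otimes> \<sigma>\<^sub>i\<^sub>,\<^sub>j)\<close> on \<open>(M \<otimes> V\<^sub>i) \<otimes> V\<^sub>j\<close>.\<close>

definition braided_commute where
  "braided_commute M Vi Vj \<rho>i \<rho>j \<sigma> \<longleftrightarrow>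
     (\<forall>t\<in>carrier ((M \<boxtimes> Vi) \<boxtimes> Vj).
        \<rho>j (tmap (M \<boxtimes> Vi) Vj M Vj \<rho>i (\<lambda>x. x) t) =
        \<rho>i (tmap (M \<boxtimes> Vj) Vi M Vi \<rho>j (\<lambda>x. x) (swap23 M Vi Vj \<sigma> t)))"

definition braided_module :: "('k::field, 'v, 'w) brsys \<Rightarrow> ('k, 'm, 'v, 'w) br_mod \<Rightarrow> bool" where
  "braided_module S X \<longleftrightarrow>
     (let M = bm_sp X; \<rho>1 = bm_act1 X; \<rho>2 = bm_act2 X in
       fdvs M \<and> \<rho>1 \<in> Lin (M \<boxtimes> V1 S) M \<and> \<rho>2 \<in> Lin (M \<boxtimes> V2 S) M \<and>
       braided_commute M (V1 S) (V1 S) \<rho>1 \<rho>1 (sig11 S) \<and>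
       braided_commute M (V1 S) (V2 S) \<rho>1 \<rho>2 (sig12 S) \<and>
       braided_commute M (V2 S) (V2 S) \<rho>2 \<rho>2 (sig22 S) \<and>
       (\<forall>m\<in>carrier M. \<rho>1 (ptens M (V1 S) m (nu1 S 1)) = m \<and> \<rho>2 (ptens M (V2 S) m (nu2 S 1)) = m))"

definition Mod_br :: "('k::field, 'v, 'w) brsys \<Rightarrow> (('k, 'm, 'v, 'w) br_mod, 'm \<Rightarrow> 'm) cat" where
  "Mod_br S =
     \<lparr>Obj = {M. braided_module S M},
      Hom = (\<lambda>M N. {f \<in> Lin (bm_sp M) (bm_sp N).
                       act_hom (bm_sp M) (bm_sp N) (V1 S) (bm_act1 M) (bm_act1 N) f \<and>
                       act_hom (bm_sp M) (bm_sp N) (V2 S) (bm_act2 M) (bm_act2 N) f}),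
      Idn = (\<lambda>M. \<lambda>m\<in>carrier (bm_sp M). m),
      Comp = (\<lambda>M N P g f. compose (carrier (bm_sp M)) g f)\<rparr>"

definition delta_co ::
  "('k::field, 'a) bialg \<Rightarrow> ('k, 'm) module \<Rightarrow> ('m \<Rightarrow> ('k, 'm, 'a) tensor)
     \<Rightarrow> ('k, 'm, 'a \<Rightarrow> 'k) tensor \<Rightarrow> 'm" where
  "delta_co H M \<delta> =
     tlift M (dual (sp H)) M (\<lambda>m l. tlift M (sp H) M (\<lambda>m\<^sub>0 m\<^sub>1. l m\<^sub>1 \<odot>\<^bsub>M\<^esub> m\<^sub>0) (\<delta> m))"

definition hopf_to_br ::
  "('k::field, 'a) bialg \<Rightarrow> ('k, 'm, 'a) hopf_mod \<Rightarrow> ('k, 'm, 'a, 'a \<Rightarrow> 'k) br_mod" where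
  "hopf_to_br H M =
     \<lparr>bm_sp = hm_sp M, bm_act1 = hm_act M, bm_act2 = delta_co H (hm_sp M) (hm_coact M)\<rparr>"

text \<open>The action \<open>\<rho>\<^sub>1 (\<rho>\<^sub>2 \<otimes> Id) : M \<otimes> V\<^sub>2 \<otimes> V\<^sub>1 \<rightarrow> M\<close>.\<close>

definition br_to_alg ::
  "('k::field, 'v, 'w) brsys \<Rightarrow> ('k, 'm, 'v, 'w) br_mod \<Rightarrow> ('k, 'm, ('k, 'w, 'v) tensor) alg_mod" where
  "br_to_alg S X =
     (let M = bm_sp X in
       \<lparr>am_sp = M,
        am_act = (\<lambda>t\<in>carrier (M \<boxtimes> (V2 S \<boxtimes> V1 S)).
          bm_act1 X (tmap (M \<boxtimes> V2 S) (V1 S) M (V1 S) (bm_act2 X) (\<lambda>x. x)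
            (tassoc_inv M (V2 S) (V1 S) t)))\<rparr>)"

end

theory Submission
  imports Defs
begin

text \<open>
  All spaces are finite-dimensional, so vectors are recognised by linear functionals and tensors
  by bilinear forms, indeed by products of functionals. Every identity of the theorem is proved
  after such a pairing, as an identity of scalars. For a tensor \<open>t = t\<^sub>1 \<otimes> t\<^sub>2\<close> (summation
  suppressed) and a bilinear form \<open>b\<close>, the scalar \<open>b t\<^sub>1 t\<^sub>2\<close> is \<open>sw V W t b\<close>: two such sums can
  always be interchanged, and the maps induced by bilinear maps, out of which all structure maps
  are built, disappear under a functional (\<open>functional_tlift\<close>). A calculation in Sweedler notation
  thereby becomes a chain of iterated scalar sums, and coassociativity, counit and
  multiplicativity of the comultiplication are rules for rewriting them.

  Write \<open>l(- b)\<close> for the right translate \<open>x \<mapsto> l (x b)\<close>. In the rainbow pairing, evaluating the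
  first leg of \<open>\<Delta> l\<close> at \<open>b\<close> leaves \<open>l(- b)\<close>, so that \<open>\<sigma>\<^sub>b\<^sub>i (h \<otimes> l) = l(- h\<^sub>2) \<otimes> h\<^sub>1\<close>
  (\<open>sw_sigma_bi\<close>). This formula removes the dual comultiplication from the whole argument.

  \<^emph>\<open>Yang--Baxter and compatibility.\<close> Naturality of the braiding in the two units says that the
  coproduct of \<open>1\<close> is \<open>1 \<otimes> 1\<close> and that the counit is multiplicative (\<open>natural_units_iff\<close>). Given
  this, the equation on \<open>H \<otimes> H \<otimes> H\<^sup>*\<close> applied to \<open>a \<otimes> b \<otimes> l\<close> compares \<open>l(- (a b)\<^sub>2) \<otimes> (a b)\<^sub>1 \<otimes> 1\<close>
  with \<open>l(- a\<^sub>2 b\<^sub>2) \<otimes> a\<^sub>1 b\<^sub>1 \<otimes> 1\<close>, which is multiplicativity of the coproduct; on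
  \<open>H \<otimes> H\<^sup>* \<otimes> H\<^sup>*\<close> it compares the products \<open>l(- h\<^sub>3) m(- h\<^sub>2)\<close> with the translates \<open>(l m)(- h\<^sub>2)\<close>,
  which is the same statement read in the dual algebra (\<open>compatibility_iff_yang_baxter\<close>).

  \<^emph>\<open>Antipode.\<close> If \<open>s\<close> is an antipode, \<open>l \<otimes> h \<mapsto> h\<^sub>1 \<otimes> l(- s h\<^sub>2)\<close> inverts the braiding. Conversely
  the inverse \<open>\<theta>\<close> determines \<open>s\<close>: applying the counits of \<open>H\<close> and \<open>H\<^sup>*\<close> to \<open>\<theta> (l \<otimes> h)\<close> gives a
  scalar bilinear in \<open>l\<close> and \<open>h\<close>, hence of the form \<open>l (s h)\<close>. One of the two antipode identities
  comes from \<open>\<theta> \<sigma>\<^sub>b\<^sub>i = Id\<close>. For the other, the braiding commutes with left translation of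
  functionals and with splitting off the first leg of the coproduct of the vector, so \<open>\<theta>\<close> does,
  and this recovers \<open>\<theta> (l \<otimes> h) = h\<^sub>1 \<otimes> l(- s h\<^sub>2)\<close> from \<open>s\<close>; then \<open>\<sigma>\<^sub>b\<^sub>i \<theta> = Id\<close> gives it
  (\<open>antipode_invertible\<close>, \<open>invertible_antipode\<close>).

  \<^emph>\<open>Full faithfulness.\<close> Let \<open>(f, g)\<close> be a morphism of the associated braided systems. Applying
  counits to both legs of its compatibility with \<open>\<sigma>\<^sub>b\<^sub>i\<close> leaves \<open>\<langle>g l, f h\<rangle> = \<langle>l, h\<rangle>\<close>, so \<open>g\<close> is
  the inverse transpose of \<open>f\<close>. Applying the counit to the unit leg of the diagonal braidings
  shows that \<open>f\<close> and \<open>g\<close> are multiplicative, and multiplicativity of \<open>g\<close> means that \<open>f\<close> respects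
  the coproducts (\<open>B_arr_iso\<close>, \<open>br_iso_B_arr\<close>).

  \<^emph>\<open>Modules.\<close> The functors between module categories change the structure on an underlying space
  and leave linear maps alone, so each is an equivalence as soon as it is bijective on structures
  and the two notions of morphism agree (\<open>equivalence_functorI\<close>). As \<open>H\<close> is finite-dimensional,
  linear maps \<open>M \<rightarrow> M \<otimes> H\<close> are the same as linear maps \<open>M \<otimes> H\<^sup>* \<rightarrow> M\<close>, and coassociativity,
  colinearity and the Hopf compatibility translate into associativity, \<open>H\<^sup>*\<close>-linearity and the
  braided commutation of the two actions. Braided modules over two algebras are modules over their
  twisted tensor product, to which both algebras map because the twisting is natural in the units
  (\<open>pair_act_module\<close>, \<open>module_split\<close>). When the braiding is invertible, the commutation relation
  can be solved for the opposite order of the actions, which exchanges the roles of \<open>H\<close> and \<open>H\<^sup>*\<close>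
  (\<open>braided_commute_inverse\<close>).
\<close>

section \<open>Linear functionals and coordinates\<close>

lemma in_Lin [simp]: "f \<in> Lin V W \<Longrightarrow> f \<in> mhom V W"
  by (simp add: Lin_def)

lemma LinI: "f \<in> mhom V W \<Longrightarrow> (\<And>x. x \<notin> carrier V \<Longrightarrow> f x = undefined) \<Longrightarrow> f \<in> Lin V W"
  by (auto simp: Lin_def extensional_def)

lemma restrict_Lin:
  assumes "module class_ring V" "f \<in> mhom V W" shows "(\<lambda>x\<in>carrier V. f x) \<in> Lin V W"
  using module_closed[OF assms(1)] assms(2) by (auto simp: Lin_def LinearCombinations.module_hom_def)

lemma Lin_eqI:
  assumes "f \<in> Lin V W" "g \<in> Lin V W" "\<And>x. x \<in> carrier V \<Longrightarrow> f x = g x" shows "f = g"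
  using assms by (auto simp: Lin_def intro: extensionalityI)

lemma mhom_compose: "f \<in> mhom U V \<Longrightarrow> g \<in> mhom V W \<Longrightarrow> (\<lambda>x. g (f x)) \<in> mhom U W"
  using mhomD[of f U V] mhomD[of g V W] by (intro mhomI) auto

lemma Lin_compose:
  assumes "module class_ring V" "f \<in> Lin V W" "g \<in> Lin W X"
  shows "compose (carrier V) g f \<in> Lin V X"
  unfolding compose_def by (rule restrict_Lin[OF assms(1) mhom_compose[OF in_Lin[OF assms(2)] in_Lin[OF assms(3)]]])

lemma mhom_id: "(\<lambda>x. x) \<in> mhom V V"
  by (auto simp: LinearCombinations.module_hom_def)

lemma mhom_cong:
  fixes V :: "('k::field,'v) module"
  assumes "\<And>x. x \<in> carrier V \<Longrightarrow> f x = g x" "module class_ring V" "f \<in> mhom V W"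
  shows "g \<in> mhom V W"
proof (rule mhomI)
  note V = module_closed[OF assms(2)]
  show "g x \<in> carrier W" if "x \<in> carrier V" for x
    using mhomD(1)[OF assms(3) that] assms(1)[OF that] by simp
  show "g (x \<oplus>\<^bsub>V\<^esub> y) = g x \<oplus>\<^bsub>W\<^esub> g y" if "x \<in> carrier V" "y \<in> carrier V" for x y
    using mhomD(2)[OF assms(3) that] assms(1)[OF that(1)] assms(1)[OF that(2)] assms(1)[OF V(1)[OF that]] by simp
  show "g (c \<odot>\<^bsub>V\<^esub> x) = c \<odot>\<^bsub>W\<^esub> g x" if "x \<in> carrier V" for c x
    using mhomD(3)[OF assms(3) that] assms(1)[OF that] assms(1)[OF V(2)[OF that]] by simp
qed

lemma mhom_ground_mult1: "f \<in> mhom V ground \<Longrightarrow> (\<lambda>x. f x * c) \<in> mhom V ground"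
  by (auto simp: LinearCombinations.module_hom_def algebra_simps)

lemma mhom_ground_mult2: "f \<in> mhom V ground \<Longrightarrow> (\<lambda>x. c * f x) \<in> mhom V ground"
  by (auto simp: LinearCombinations.module_hom_def algebra_simps)

lemma mhom_ground_sum:
  assumes "\<And>i. i \<in> I \<Longrightarrow> f i \<in> mhom V ground"
  shows "(\<lambda>x. \<Sum>i\<in>I. f i x) \<in> mhom V ground"
proof (rule mhomI)
  show "(\<Sum>i\<in>I. f i (x \<oplus>\<^bsub>V\<^esub> y)) = (\<Sum>i\<in>I. f i x) \<oplus>\<^bsub>ground\<^esub> (\<Sum>i\<in>I. f i y)"
    if "x \<in> carrier V" "y \<in> carrier V" for x y
    using mhomD(2)[OF assms that] by (simp add: sum.distrib)
  show "(\<Sum>i\<in>I. f i (c \<odot>\<^bsub>V\<^esub> x)) = c \<odot>\<^bsub>ground\<^esub> (\<Sum>i\<in>I. f i x)"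
    if "x \<in> carrier V" for c x
    using mhomD(3)[OF assms that] by (simp add: sum_distrib_left)
qed auto

definition dual_basis_pair ::
  "('k::field, 'v) module \<Rightarrow> 'v set \<times> ('v \<Rightarrow> 'v \<Rightarrow> 'k) \<Rightarrow> bool" where
  "dual_basis_pair V p \<longleftrightarrow> finite (fst p) \<and> fst p \<subseteq> carrier V \<and> (\<forall>a\<in>fst p. snd p a \<in> Lin V ground) \<and>
     (\<forall>v\<in>carrier V. finsum V (\<lambda>a. snd p a v \<odot>\<^bsub>V\<^esub> a) (fst p) = v)"

text \<open>
  A space that is not finite-dimensional gets the empty basis. The basis then always lies in the
  carrier, so that a coordinate sum may be rewritten pointwise on the carrier without first
  knowing that the space is finite-dimensional; this is what makes \<open>sw_cong\<close> below usable as a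
  congruence rule.
\<close>

definition dual_basis_choice :: "('k::field, 'v) module \<Rightarrow> 'v set \<times> ('v \<Rightarrow> 'v \<Rightarrow> 'k)" where
  "dual_basis_choice V = (if fdvs V then SOME p. dual_basis_pair V p else ({}, \<lambda>_ _. 0))"

definition bas :: "('k::field, 'v) module \<Rightarrow> 'v set" where
  "bas V = fst (dual_basis_choice V)"

definition coo :: "('k::field, 'v) module \<Rightarrow> 'v \<Rightarrow> 'v \<Rightarrow> 'k" where
  "coo V = snd (dual_basis_choice V)"

lemma dual_basis_pair_bas: "fdvs V \<Longrightarrow> dual_basis_pair V (bas V, coo V)"
proof -
  assume V: "fdvs V"
  have "\<exists>p. dual_basis_pair V p"
  proof (rule dual_basis[OF V])
    fix A \<phi>
    assume "finite A" "A \<subseteq> carrier V" "\<And>a. a \<in> A \<Longrightarrow> \<phi> a \<in> Lin V ground"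
      "\<And>v. v \<in> carrier V \<Longrightarrow> finsum V (\<lambda>a. \<phi> a v \<odot>\<^bsub>V\<^esub> a) A = v"
    then have "dual_basis_pair V (A, \<phi>)" by (simp add: dual_basis_pair_def)
    then show ?thesis ..
  qed
  from someI_ex[OF this] show ?thesis
    unfolding bas_def coo_def prod.collapse dual_basis_choice_def if_P[OF V] .
qed

lemma bas_carrier: "a \<in> bas V \<Longrightarrow> a \<in> carrier V"
  using dual_basis_pair_bas[of V]
  by (cases "fdvs V") (auto simp: dual_basis_pair_def bas_def dual_basis_choice_def)

lemma bas_props:
  assumes "fdvs V"
  shows "finite (bas V)" "a \<in> bas V \<Longrightarrow> a \<in> carrier V" "a \<in> bas V \<Longrightarrow> coo V a \<in> Lin V ground"
    "v \<in> carrier V \<Longrightarrow> finsum V (\<lambda>a. coo V a v \<odot>\<^bsub>V\<^esub> a) (bas V) = v"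
  using dual_basis_pair_bas[OF assms] by (auto simp: dual_basis_pair_def)

lemma coo_mhom: "fdvs V \<Longrightarrow> a \<in> bas V \<Longrightarrow> coo V a \<in> mhom V ground"
  by (rule in_Lin[OF bas_props(3)])

text \<open>
  The vector with prescribed coordinates; with \<open>dual_functional_expand\<close> below it realises every
  linear form on the dual space as evaluation at a vector.
\<close>

definition vector_of :: "('k::field, 'v) module \<Rightarrow> ('v \<Rightarrow> 'k) \<Rightarrow> 'v" where
  "vector_of V c = finsum V (\<lambda>a. c a \<odot>\<^bsub>V\<^esub> a) (bas V)"

lemma vector_of_closed: assumes "fdvs V" shows "vector_of V c \<in> carrier V"
proof -
  interpret Module.module class_ring V using assms by (rule fdvs_module)
  show ?thesis unfolding vector_of_def by (rule finsum_closed) (auto intro: bas_carrier)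
qed

lemma functional_vector_of:
  assumes V: "fdvs V" and f: "f \<in> mhom V ground"
  shows "f (vector_of V c) = (\<Sum>a\<in>bas V. c a * f a)"
proof -
  note M = fdvs_module[OF V]
  have "f (vector_of V c) = finsum ground (\<lambda>a. f (c a \<odot>\<^bsub>V\<^esub> a)) (bas V)"
    unfolding vector_of_def
    by (rule hom_finsum[OF M module_ground f _ bas_props(1)[OF V]])
       (auto intro: bas_carrier module_closed(2)[OF M])
  then show ?thesis using mhomD(3)[OF f bas_carrier] bas_props(1)[OF V] by (simp add: finsum_ground)
qed

lemma functional_expand:
  assumes "fdvs V" "f \<in> mhom V ground" "v \<in> carrier V"
  shows "f v = (\<Sum>a\<in>bas V. coo V a v * f a)"
  using functional_vector_of[OF assms(1,2), of "\<lambda>a. coo V a v"] bas_props(4)[OF assms(1,3)] by (simp add: vector_of_def)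

text \<open>
  Coordinates are functionals, so functionals separate vectors. Identities between vectors are
  turned into identities between scalars by this rule, and by the next one it suffices to check
  linearity of a map after composing with functionals.
\<close>

lemma vec_eqI:
  assumes "fdvs V" "v \<in> carrier V" "w \<in> carrier V"
    and "\<And>f. f \<in> Lin V ground \<Longrightarrow> f v = f w"
  shows "v = w"
proof -
  interpret Module.module class_ring V using assms(1) by (rule fdvs_module)
  have "v = finsum V (\<lambda>a. coo V a v \<odot>\<^bsub>V\<^esub> a) (bas V)" using bas_props(4)[OF assms(1,2)] by simp
  also have "\<dots> = finsum V (\<lambda>a. coo V a w \<odot>\<^bsub>V\<^esub> a) (bas V)"
    by (rule finsum_cong') (auto simp: assms(4)[OF bas_props(3)[OF assms(1)]] bas_carrier)
  also have "\<dots> = w" using bas_props(4)[OF assms(1,3)] .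
  finally show ?thesis .
qed

lemma mhom_weakI:
  assumes "module class_ring V" "fdvs W" "\<And>v. v \<in> carrier V \<Longrightarrow> f v \<in> carrier W"
    and l: "\<And>g. g \<in> Lin W ground \<Longrightarrow> (\<lambda>v. g (f v)) \<in> mhom V ground"
  shows "f \<in> mhom V W"
proof (rule mhomI)
  note W = module_closed[OF fdvs_module[OF assms(2)]] and V = module_closed[OF assms(1)]
  show "f (x \<oplus>\<^bsub>V\<^esub> y) = f x \<oplus>\<^bsub>W\<^esub> f y" if xy: "x \<in> carrier V" "y \<in> carrier V" for x y
  proof (rule vec_eqI[OF assms(2)])
    fix g assume g: "g \<in> Lin W ground"
    show "g (f (x \<oplus>\<^bsub>V\<^esub> y)) = g (f x \<oplus>\<^bsub>W\<^esub> f y)"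
      using mhomD(2)[OF l[OF g] xy] mhomD(2)[OF in_Lin[OF g] assms(3)[OF xy(1)] assms(3)[OF xy(2)]] by simp
  qed (intro assms(3) W V xy)+
  show "f (c \<odot>\<^bsub>V\<^esub> x) = c \<odot>\<^bsub>W\<^esub> f x" if x: "x \<in> carrier V" for c x
  proof (rule vec_eqI[OF assms(2)])
    fix g assume g: "g \<in> Lin W ground"
    show "g (f (c \<odot>\<^bsub>V\<^esub> x)) = g (c \<odot>\<^bsub>W\<^esub> f x)"
      using mhomD(3)[OF l[OF g] x] mhomD(3)[OF in_Lin[OF g] assms(3)[OF x]] by simp
  qed (intro assms(3) W V x)+
qed (rule assms)

text \<open>
  The coordinate functionals span the dual, with the values at the basis vectors as coefficients.
  Hence a linear form on the dual is determined by its values on the coordinate functionals, which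
  is the source of every passage between \<open>H\<close> and its dual below.
\<close>

lemma dual_functional_expand:
  assumes V: "fdvs V" and g: "g \<in> mhom (dual V) ground" and l: "l \<in> Lin V ground"
  shows "g l = (\<Sum>a\<in>bas V. l a * g (coo V a))"
proof -
  note M = fdvs_module[OF V]
  let ?D = "dual V"
  note DM = module_dual[OF M]
  interpret D: Module.module class_ring ?D by (rule DM)
  have c: "coo V a \<in> carrier ?D" if "a \<in> bas V" for a using bas_props(3)[OF V that] by simp
  let ?S = "finsum ?D (\<lambda>a. l a \<odot>\<^bsub>?D\<^esub> coo V a) (bas V)"
  have "?S = l"
  proof (rule Lin_eqI)
    have "?S \<in> carrier ?D"
      by (rule D.finsum_closed) (rule Pi_I, intro c module_closed(2)[OF DM])
    then show "?S \<in> Lin V ground" by simp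
    fix v assume v: "v \<in> carrier V"
    have "?S v = finsum ground (\<lambda>a. (l a \<odot>\<^bsub>?D\<^esub> coo V a) v) (bas V)"
      by (rule hom_finsum[OF DM module_ground _ _ bas_props(1)[OF V], where f = "\<lambda>l. l v"])
         (use v in \<open>intro mhomI; simp\<close>, intro module_closed(2)[OF DM] c)
    also have "\<dots> = l v" using v functional_expand[OF V in_Lin[OF l] v]
      by (simp add: finsum_ground bas_props(1)[OF V] mult.commute)
    finally show "?S v = l v" .
  qed (rule l)
  moreover have "g ?S = finsum ground (\<lambda>a. g (l a \<odot>\<^bsub>?D\<^esub> coo V a)) (bas V)"
    by (rule hom_finsum[OF DM module_ground g _ bas_props(1)[OF V]])
       (intro c module_closed(2)[OF DM]; assumption)
  moreover have "\<dots> = (\<Sum>a\<in>bas V. l a * g (coo V a))"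
    using mhomD(3)[OF g c] by (simp add: finsum_ground bas_props(1)[OF V] del: dual_simps)
  ultimately show ?thesis by simp
qed


lemma fdvs_ground: "fdvs (ground :: ('k::field, 'k) module)"
proof (rule fdvsI[OF module_ground, of "{()}" "\<lambda>_. 1"])
  interpret G: Module.module class_ring "ground :: ('k, 'k) module" by (rule module_ground)
  show "\<exists>c. v = finsum ground (\<lambda>i. c i \<odot>\<^bsub>ground\<^esub> 1) {()}" for v :: 'k
    by (intro exI[of _ "\<lambda>_. v"]) (simp add: finsum_ground)
qed auto


section \<open>Scalar Sweedler sums\<close>

text \<open>
  The scalar Sweedler sum \<open>b t\<^sub>1 t\<^sub>2\<close>. A tensor being a functional on bilinear forms, this is just
  \<open>t\<close> applied to \<open>b\<close> (\<open>sw_eval\<close>); spelling it out in coordinates makes sense for every function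
  \<open>b\<close>, bilinear or not, so that sums can be nested, interchanged and rewritten without side
  conditions, and bilinearity enters when a pure tensor is evaluated.
\<close>

definition sw ::
  "('k::field, 'v) module \<Rightarrow> ('k, 'w) module \<Rightarrow> ('k, 'v, 'w) tensor \<Rightarrow> ('v \<Rightarrow> 'w \<Rightarrow> 'k) \<Rightarrow> 'k" where
  "sw V W t b = (\<Sum>i\<in>bas V. \<Sum>j\<in>bas W.
     t (\<lambda>q\<in>carrier V \<times> carrier W. coo V i (fst q) * coo W j (snd q)) * b i j)"

abbreviation bilin :: "('k::field, 'v) module \<Rightarrow> ('k, 'w) module \<Rightarrow> ('v \<Rightarrow> 'w \<Rightarrow> 'k) \<Rightarrow> bool" where
  "bilin V W b \<equiv> bilinear_map V W ground b"

lemma bilinear_mapI: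
  "(\<And>v. v \<in> carrier V \<Longrightarrow> b v \<in> mhom W U) \<Longrightarrow> (\<And>w. w \<in> carrier W \<Longrightarrow> (\<lambda>v. b v w) \<in> mhom V U) \<Longrightarrow> bilinear_map V W U b"
  by (simp add: bilinear_map_def)

lemma bilinear_mapD:
  "bilinear_map V W U b \<Longrightarrow> v \<in> carrier V \<Longrightarrow> b v \<in> mhom W U"
  "bilinear_map V W U b \<Longrightarrow> w \<in> carrier W \<Longrightarrow> (\<lambda>v. b v w) \<in> mhom V U"
  by (simp_all add: bilinear_map_def)

lemma sw_cong [cong]:
  assumes "\<And>v w. v \<in> carrier V \<Longrightarrow> w \<in> carrier W \<Longrightarrow> b v w = b' v w" "t = t'"
  shows "sw V W t b = sw V W t' b'"
  unfolding sw_def assms(2) by (intro sum.cong refl arg_cong2[where f = "(*)"] assms(1) bas_carrier)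

text \<open>
  Independent Sweedler sums commute: as finite sums over chosen bases they do so for arbitrary
  summands.
\<close>

lemma sw_swap: "sw V W t (\<lambda>v w. sw X Y s (\<lambda>x y. b v w x y)) = sw X Y s (\<lambda>x y. sw V W t (\<lambda>v w. b v w x y))"
proof -
  have "(\<Sum>i\<in>bas V. \<Sum>j\<in>bas W. \<Sum>k\<in>bas X. \<Sum>l\<in>bas Y. f i j k l) =
        (\<Sum>k\<in>bas X. \<Sum>l\<in>bas Y. \<Sum>i\<in>bas V. \<Sum>j\<in>bas W. f i j k l)" for f :: "_ \<Rightarrow> _ \<Rightarrow> _ \<Rightarrow> _ \<Rightarrow> 'a"
    using sum.swap[of "\<lambda>p q. f (fst p) (snd p) (fst q) (snd q)" "bas X \<times> bas Y" "bas V \<times> bas W"]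
    by (simp add: sum.cartesian_product')
  then show ?thesis
    unfolding sw_def sum_distrib_left by (simp add: mult.left_commute)
qed

lemma sw_mult1: "sw V W t (\<lambda>v w. b v w * c) = sw V W t b * c"
  by (simp add: sw_def sum_distrib_left sum_distrib_right mult_ac)

lemma sw_mult2: "sw V W t (\<lambda>v w. c * b v w) = c * sw V W t b"
  by (simp add: sw_def sum_distrib_left sum_distrib_right mult_ac)

lemma sw_sum: "sw V W t (\<lambda>v w. \<Sum>i\<in>I. b i v w) = (\<Sum>i\<in>I. sw V W t (b i))"
  by (induct I rule: infinite_finite_induct) (simp_all add: sw_def sum.distrib algebra_simps)

lemma coo_prod_bilinear:
  assumes "fdvs V" "fdvs W" "f \<in> mhom V ground" "g \<in> mhom W ground"
  shows "(\<lambda>q\<in>carrier V \<times> carrier W. f (fst q) * g (snd q)) \<in> carrier (bilinear_forms V W)"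
  using mhomD[OF assms(3)] mhomD[OF assms(4)] module_closed[OF fdvs_module[OF assms(1)]]
    module_closed[OF fdvs_module[OF assms(2)]]
  by (auto simp: bilinear_map_def LinearCombinations.module_hom_def algebra_simps)

lemma restrict_bilinear:
  assumes "fdvs V" "fdvs W" "bilin V W b"
  shows "(\<lambda>q\<in>carrier V \<times> carrier W. b (fst q) (snd q)) \<in> carrier (bilinear_forms V W)"
proof -
  note V = module_closed[OF fdvs_module[OF assms(1)]] and W = module_closed[OF fdvs_module[OF assms(2)]]
  show ?thesis
    using bilinear_mapD[OF assms(3)] V W
    by (auto simp: bilinear_map_def LinearCombinations.module_hom_def)
qed

lemma tensor_mhom: "t \<in> carrier (V \<boxtimes> W) \<Longrightarrow> t \<in> mhom (bilinear_forms V W) ground"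
  by (simp add: tensor_space_def)

text \<open>
  A bilinear form is the combination of products of coordinate functionals whose coefficients are
  its values on basis pairs; applying \<open>t\<close> to this combination gives the Sweedler sum.
\<close>

lemma sw_eval:
  fixes V :: "('k::field, 'v) module" and W :: "('k, 'w) module"
  assumes V: "fdvs V" and W: "fdvs W" and t: "t \<in> carrier (V \<boxtimes> W)" and b: "bilin V W b"
  shows "sw V W t b = t (\<lambda>q\<in>carrier V \<times> carrier W. b (fst q) (snd q))"
proof -
  let ?F = "bilinear_forms V W"
  let ?E = "\<lambda>p. \<lambda>q\<in>carrier V \<times> carrier W. coo V (fst p) (fst q) * coo W (snd p) (snd q)"
  let ?I = "bas V \<times> bas W"
  let ?B = "\<lambda>q\<in>carrier V \<times> carrier W. b (fst q) (snd q)"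
  note FM = module_bf[OF V[THEN fdvs_module] W[THEN fdvs_module]]
  interpret F: Module.module class_ring ?F by (rule FM)
  have I: "finite ?I" using bas_props(1)[OF V] bas_props(1)[OF W] by simp
  have E: "?E p \<in> carrier ?F" if "p \<in> ?I" for p
    using that by (intro coo_prod_bilinear V W coo_mhom) auto
  have cE: "b (fst p) (snd p) \<odot>\<^bsub>?F\<^esub> ?E p \<in> carrier ?F" if "p \<in> ?I" for p
    by (intro module_closed(2)[OF FM] E that)
  let ?S = "finsum ?F (\<lambda>p. b (fst p) (snd p) \<odot>\<^bsub>?F\<^esub> ?E p) ?I"
  have S: "?S \<in> carrier ?F" by (rule F.finsum_closed) (rule Pi_I, rule cE)
  have "?S = ?B"
  proof (rule extensionalityI[of _ "carrier V \<times> carrier W"])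
    fix q assume q: "q \<in> carrier V \<times> carrier W"
    have "?S q = finsum ground (\<lambda>p. (b (fst p) (snd p) \<odot>\<^bsub>?F\<^esub> ?E p) q) ?I"
      by (rule hom_finsum[OF FM module_ground _ _ I, where f = "\<lambda>l. l q"])
         (use q in \<open>intro mhomI; simp\<close>, rule cE)
    also have "\<dots> = (\<Sum>i\<in>bas V. \<Sum>j\<in>bas W. coo V i (fst q) * (coo W j (snd q) * b i j))"
      using q I by (auto simp: finsum_ground sum.cartesian_product mult_ac intro!: sum.cong)
    also have "\<dots> = (\<Sum>i\<in>bas V. coo V i (fst q) * b i (snd q))"
    proof (rule sum.cong[OF refl])
      fix i assume "i \<in> bas V"
      then have "b i \<in> mhom W ground" by (intro bilinear_mapD(1)[OF b] bas_carrier)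
      from functional_expand[OF W this, of "snd q"] q
      show "(\<Sum>j\<in>bas W. coo V i (fst q) * (coo W j (snd q) * b i j)) = coo V i (fst q) * b i (snd q)"
        by (auto simp: sum_distrib_left)
    qed
    also have "\<dots> = b (fst q) (snd q)"
      using functional_expand[OF V bilinear_mapD(2)[OF b, of "snd q"], of "fst q"] q by auto
    finally show "?S q = ?B q" using q by simp
  qed (use S in auto)
  then have "t ?B = t ?S" by simp
  also have "\<dots> = finsum ground (\<lambda>p. t (b (fst p) (snd p) \<odot>\<^bsub>?F\<^esub> ?E p)) ?I"
    by (rule hom_finsum[OF FM module_ground tensor_mhom[OF t] cE I])
  also have "\<dots> = (\<Sum>p\<in>?I. b (fst p) (snd p) * t (?E p))"
    using mhomD(3)[OF tensor_mhom[OF t] E] I by (simp add: finsum_ground del: bf_simps)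
  also have "\<dots> = sw V W t b"
    unfolding sw_def by (auto simp: sum.cartesian_product mult_ac intro!: sum.cong)
  finally show ?thesis ..
qed

lemma sw_mhom_left:
  assumes "fdvs V" "fdvs W" shows "(\<lambda>t. sw V W t b) \<in> mhom (V \<boxtimes> W) ground"
proof -
  have E: "(\<lambda>q\<in>carrier V \<times> carrier W. coo V i (fst q) * coo W j (snd q)) \<in> carrier (bilinear_forms V W)"
    if "i \<in> bas V" "j \<in> bas W" for i j
    using that by (intro coo_prod_bilinear assms coo_mhom)
  show ?thesis unfolding sw_def
    by (intro mhom_ground_sum mhom_ground_mult1 mhomI) (use E in \<open>auto simp: tensor_space_def\<close>)
qed

lemma sw_mhom_right:
  assumes "\<And>v w. v \<in> carrier V \<Longrightarrow> w \<in> carrier W \<Longrightarrow> (\<lambda>x. b x v w) \<in> mhom X ground"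
  shows "(\<lambda>x. sw V W t (b x)) \<in> mhom X ground"
  unfolding sw_def by (intro mhom_ground_sum mhom_ground_mult2 assms bas_carrier)

lemma tensor_ptens [simp]:
  "fdvs V \<Longrightarrow> fdvs W \<Longrightarrow> v \<in> carrier V \<Longrightarrow> w \<in> carrier W \<Longrightarrow> ptens V W v w \<in> carrier (V \<boxtimes> W)"
  by (rule ptens_closed[OF fdvs_module fdvs_module])

lemma sw_ptens:
  assumes "fdvs V" "fdvs W" "v \<in> carrier V" "w \<in> carrier W" "bilin V W b"
  shows "sw V W (ptens V W v w) b = b v w"
proof -
  have "sw V W (ptens V W v w) b = ptens V W v w (\<lambda>q\<in>carrier V \<times> carrier W. b (fst q) (snd q))"
    by (rule sw_eval) (use assms in auto)
  then show ?thesis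
    using restrict_bilinear[OF assms(1,2,5)] assms(3,4) by (simp add: ptens_def del: bf_simps)
qed

lemma ptens_bilinear:
  assumes "fdvs V" "fdvs W"
  shows "bilinear_map V W (V \<boxtimes> W) (ptens V W)"
proof -
  note V = module_closed[OF fdvs_module[OF assms(1)]] and W = module_closed[OF fdvs_module[OF assms(2)]]
  note P = tensor_ptens[OF assms]
  have B: "b (v, w \<oplus>\<^bsub>W\<^esub> w') = b (v, w) + b (v, w')" "b (v, c \<odot>\<^bsub>W\<^esub> w) = c * b (v, w)"
      "b (v \<oplus>\<^bsub>V\<^esub> v', w) = b (v, w) + b (v', w)" "b (c \<odot>\<^bsub>V\<^esub> v, w) = c * b (v, w)"
    if "b \<in> carrier (bilinear_forms V W)" "v \<in> carrier V" "w \<in> carrier W" "v' \<in> carrier V" "w' \<in> carrier W" for b v w v' w' c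
    using that by (auto simp: bilinear_map_def LinearCombinations.module_hom_def)
  show ?thesis
    by (intro bilinear_mapI mhomI P) (auto simp: ptens_def tensor_space_def B V W simp del: bf_simps intro!: restrict_ext)
qed

text \<open>
  Tensors are functionals on bilinear forms by construction, so the forms separate them.
\<close>

lemma tensor_eqI:
  assumes V: "fdvs V" and W: "fdvs W" and s: "s \<in> carrier (V \<boxtimes> W)" and t: "t \<in> carrier (V \<boxtimes> W)"
    and eq: "\<And>b. bilin V W b \<Longrightarrow> sw V W s b = sw V W t b"
  shows "s = t"
proof (rule Lin_eqI)
  show "s \<in> Lin (bilinear_forms V W) ground" "t \<in> Lin (bilinear_forms V W) ground"
    using s t by (simp_all add: tensor_space_def)
  fix B assume B: "B \<in> carrier (bilinear_forms V W)"
  then have b: "bilin V W (curry B)" by simp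
  have "(\<lambda>q\<in>carrier V \<times> carrier W. curry B (fst q) (snd q)) = B"
    using B by (auto simp: extensional_def)
  with eq[OF b] show "s B = t B"
    unfolding sw_eval[OF V W s b] sw_eval[OF V W t b] by simp
qed

text \<open>
  The uniqueness half of the universal property. It is used most often with scalar-valued maps, to
  verify an equation between Sweedler sums on pure tensors only.
\<close>

lemma Lin_tensor_eq:
  fixes U :: "('k::field, 'u) module"
  assumes V: "fdvs V" and W: "fdvs W" and U: "fdvs U" and f: "f \<in> mhom (V \<boxtimes> W) U" and g: "g \<in> mhom (V \<boxtimes> W) U"
    and eq: "\<And>v w. v \<in> carrier V \<Longrightarrow> w \<in> carrier W \<Longrightarrow> f (ptens V W v w) = g (ptens V W v w)"
    and t: "t \<in> carrier (V \<boxtimes> W)"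
  shows "f t = g t"
proof -
  let ?r = "\<lambda>h. \<lambda>x\<in>carrier (V \<boxtimes> W). h x"
  note T = fdvs_module[OF fdvs_tensor[OF V W]]
  have b: "bilinear_map V W U (\<lambda>v w. f (ptens V W v w))"
    using mhom_compose[OF bilinear_mapD(1)[OF ptens_bilinear[OF V W]] f]
      mhom_compose[OF bilinear_mapD(2)[OF ptens_bilinear[OF V W]] f] by (auto intro: bilinear_mapI)
  have "?r f = ?r g"
    by (rule ex1E[OF tensor_universal[OF V W U b]])
       (use restrict_Lin[OF T f] restrict_Lin[OF T g] eq V W in \<open>metis (no_types, lifting) restrict_apply' tensor_ptens\<close>)
  then show ?thesis using t by (metis restrict_apply')
qed

lemma tlift_props:
  fixes U :: "('k::field, 'u) module"
  assumes "fdvs V" "fdvs W" "fdvs U" "bilinear_map V W U b"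
  shows tlift_Lin: "tlift V W U b \<in> Lin (V \<boxtimes> W) U"
    and tlift_ptens: "v \<in> carrier V \<Longrightarrow> w \<in> carrier W \<Longrightarrow> tlift V W U b (ptens V W v w) = b v w"
  using theI'[OF tensor_universal[OF assms]] unfolding tlift_def by auto

text \<open>
  A functional on a tensor product is the Sweedler sum of the bilinear form that it defines, since
  both agree on pure tensors. The case of a functional composed with an induced map is the rule by
  which \<open>tlift\<close>, and with it every structure map defined by it, is eliminated.
\<close>

lemma functional_sw:
  assumes V: "fdvs V" and W: "fdvs W" and f: "f \<in> mhom (V \<boxtimes> W) ground" and t: "t \<in> carrier (V \<boxtimes> W)"
  shows "f t = sw V W t (\<lambda>v w. f (ptens V W v w))"
proof (rule Lin_tensor_eq[OF V W fdvs_ground f sw_mhom_left[OF V W] _ t])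
  have b: "bilin V W (\<lambda>v w. f (ptens V W v w))"
    using mhom_compose[OF bilinear_mapD(1)[OF ptens_bilinear[OF V W]] f]
      mhom_compose[OF bilinear_mapD(2)[OF ptens_bilinear[OF V W]] f] by (auto intro: bilinear_mapI)
  show "f (ptens V W v w) = sw V W (ptens V W v w) (\<lambda>v w. f (ptens V W v w))"
    if "v \<in> carrier V" "w \<in> carrier W" for v w
    using sw_ptens[OF V W that b] by simp
qed

lemma functional_tlift:
  assumes V: "fdvs V" and W: "fdvs W" and U: "fdvs U" and b: "bilinear_map V W U b"
    and f: "f \<in> mhom U ground" and t: "t \<in> carrier (V \<boxtimes> W)"
  shows "f (tlift V W U b t) = sw V W t (\<lambda>v w. f (b v w))"
  using functional_sw[OF V W mhom_compose[OF in_Lin[OF tlift_Lin[OF V W U b]] f] t] tlift_ptens[OF V W U b]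
  by simp

section \<open>Multilinear bookkeeping\<close>

lemma sw_mhom_left':
  "fdvs V \<Longrightarrow> fdvs W \<Longrightarrow> f \<in> mhom U (V \<boxtimes> W) \<Longrightarrow> (\<lambda>x. sw V W (f x) b) \<in> mhom U ground"
  by (rule mhom_compose[OF _ sw_mhom_left])

lemma bilinear_compose1:
  "bilinear_map V W U b \<Longrightarrow> f \<in> mhom X V \<Longrightarrow> w \<in> carrier W \<Longrightarrow> (\<lambda>x. b (f x) w) \<in> mhom X U"
  by (rule mhom_compose[OF _ bilinear_mapD(2)])

lemma bilinear_compose2:
  "bilinear_map V W U b \<Longrightarrow> v \<in> carrier V \<Longrightarrow> f \<in> mhom X W \<Longrightarrow> (\<lambda>x. b v (f x)) \<in> mhom X U"
  by (rule mhom_compose[OF _ bilinear_mapD(1)])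

lemma ptens_mhom1:
  "fdvs V \<Longrightarrow> fdvs W \<Longrightarrow> f \<in> mhom X V \<Longrightarrow> w \<in> carrier W \<Longrightarrow> (\<lambda>x. ptens V W (f x) w) \<in> mhom X (V \<boxtimes> W)"
  by (rule bilinear_compose1[OF ptens_bilinear])

lemma ptens_mhom2:
  "fdvs V \<Longrightarrow> fdvs W \<Longrightarrow> v \<in> carrier V \<Longrightarrow> f \<in> mhom X W \<Longrightarrow> (\<lambda>x. ptens V W v (f x)) \<in> mhom X (V \<boxtimes> W)"
  by (rule bilinear_compose2[OF ptens_bilinear])

lemma ptens_mhom2': "fdvs V \<Longrightarrow> fdvs W \<Longrightarrow> v \<in> carrier V \<Longrightarrow> ptens V W v \<in> mhom W (V \<boxtimes> W)"
  by (rule bilinear_mapD(1)[OF ptens_bilinear])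

text \<open>
  Linearity of the scalar expressions in each of their variables is decided by applying these
  rules repeatedly; the rules that expose a bilinear or trilinear form in head position are kept
  apart, to be added for the particular form at hand.
\<close>

lemmas linear_intros =
  bilinear_mapI sw_mhom_left' sw_mhom_right ptens_mhom1 ptens_mhom2 ptens_mhom2' mhom_id
  mhom_ground_mult1 mhom_ground_mult2 fdvs_tensor fdvs_dual fdvs_ground tensor_ptens

lemmas bilinear_intros = bilinear_compose1 bilinear_compose2 bilinear_mapD

definition trilin where
  "trilin U V W T \<longleftrightarrow> (\<forall>u\<in>carrier U. bilin V W (T u)) \<and>
     (\<forall>v\<in>carrier V. \<forall>w\<in>carrier W. (\<lambda>u. T u v w) \<in> mhom U ground)"

lemma trilin_compose:
  assumes "trilin U V W T"
  shows "f \<in> mhom X U \<Longrightarrow> v \<in> carrier V \<Longrightarrow> w \<in> carrier W \<Longrightarrow> (\<lambda>x. T (f x) v w) \<in> mhom X ground"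
    "u \<in> carrier U \<Longrightarrow> g \<in> mhom X V \<Longrightarrow> w \<in> carrier W \<Longrightarrow> (\<lambda>x. T u (g x) w) \<in> mhom X ground"
    "u \<in> carrier U \<Longrightarrow> v \<in> carrier V \<Longrightarrow> h \<in> mhom X W \<Longrightarrow> (\<lambda>x. T u v (h x)) \<in> mhom X ground"
    "u \<in> carrier U \<Longrightarrow> v \<in> carrier V \<Longrightarrow> T u v \<in> mhom W ground"
  using assms mhom_compose[of f X U "\<lambda>u. T u v w" ground]
    bilinear_compose1[of V W ground "T u" g X w] bilinear_compose2[of V W ground "T u" v h X]
  by (auto simp: trilin_def bilinear_mapD)

lemma trilinI:
  "(\<And>v w. v \<in> carrier V \<Longrightarrow> w \<in> carrier W \<Longrightarrow> (\<lambda>u. T u v w) \<in> mhom U ground) \<Longrightarrow>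
   (\<And>u w. u \<in> carrier U \<Longrightarrow> w \<in> carrier W \<Longrightarrow> (\<lambda>v. T u v w) \<in> mhom V ground) \<Longrightarrow>
   (\<And>u v. u \<in> carrier U \<Longrightarrow> v \<in> carrier V \<Longrightarrow> (\<lambda>w. T u v w) \<in> mhom W ground) \<Longrightarrow> trilin U V W T"
  by (simp add: trilin_def bilinear_map_def)


lemma Lin_closed: "f \<in> Lin V W \<Longrightarrow> v \<in> carrier V \<Longrightarrow> f v \<in> carrier W"
  by (rule mhomD(1)[OF in_Lin])

lemma mhom_tlift_left:
  assumes "fdvs V" "fdvs W" "fdvs U" "bilinear_map V W U b" "f \<in> mhom X (V \<boxtimes> W)"
  shows "(\<lambda>x. tlift V W U b (f x)) \<in> mhom X U"
  by (rule mhom_compose[OF assms(5) in_Lin[OF tlift_Lin[OF assms(1-4)]]])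

lemma tlift_closed:
  assumes "fdvs V" "fdvs W" "fdvs U" "bilinear_map V W U b" "t \<in> carrier (V \<boxtimes> W)"
  shows "tlift V W U b t \<in> carrier U"
  by (rule Lin_closed[OF tlift_Lin[OF assms(1-4)] assms(5)])

lemma mhom_tlift_right:
  assumes fd: "fdvs V" "fdvs W" "fdvs U" "fdvs X" and t: "t \<in> carrier (V \<boxtimes> W)"
    and b: "\<And>x. x \<in> carrier X \<Longrightarrow> bilinear_map V W U (b x)"
    and l: "\<And>v w. v \<in> carrier V \<Longrightarrow> w \<in> carrier W \<Longrightarrow> (\<lambda>x. b x v w) \<in> mhom X U"
  shows "(\<lambda>x. tlift V W U (b x) t) \<in> mhom X U"
proof (rule mhom_weakI[OF fdvs_module[OF fd(4)] fd(3) tlift_closed[OF fd(1-3) b t]])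
  fix g assume g: "g \<in> Lin U ground"
  show "(\<lambda>x. g (tlift V W U (b x) t)) \<in> mhom X ground"
    by (rule mhom_cong[OF _ fdvs_module[OF fd(4)] sw_mhom_right[where b = "\<lambda>x v w. g (b x v w)"]])
       (auto simp: functional_tlift[OF fd(1-3) b in_Lin[OF g] t] intro: mhom_compose[OF l in_Lin[OF g]])
qed

section \<open>Structural maps of tensor products\<close>

lemma tmap_props:
  assumes "fdvs V" "fdvs W" "fdvs X" "fdvs Y" "f \<in> mhom V X" "g \<in> mhom W Y"
  shows tmap_Lin: "tmap V W X Y f g \<in> Lin (V \<boxtimes> W) (X \<boxtimes> Y)"
    and tmap_ptens: "v \<in> carrier V \<Longrightarrow> w \<in> carrier W \<Longrightarrow> tmap V W X Y f g (ptens V W v w) = ptens X Y (f v) (g w)"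
    and sw_tmap: "t \<in> carrier (V \<boxtimes> W) \<Longrightarrow> bilin X Y b \<Longrightarrow>
      sw X Y (tmap V W X Y f g t) b = sw V W t (\<lambda>v w. b (f v) (g w))"
proof -
  have b: "bilinear_map V W (X \<boxtimes> Y) (\<lambda>v w. ptens X Y (f v) (g w))"
    by (intro linear_intros assms mhomD(1)[OF assms(5)] mhomD(1)[OF assms(6)])
  note V = assms(1,2) fdvs_tensor[OF assms(3,4)]
  show "tmap V W X Y f g \<in> Lin (V \<boxtimes> W) (X \<boxtimes> Y)"
    "v \<in> carrier V \<Longrightarrow> w \<in> carrier W \<Longrightarrow> tmap V W X Y f g (ptens V W v w) = ptens X Y (f v) (g w)"
    unfolding tmap_def using tlift_Lin[OF V b] tlift_ptens[OF V b] by auto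
  show "sw X Y (tmap V W X Y f g t) c = sw V W t (\<lambda>v w. c (f v) (g w))"
    if "t \<in> carrier (V \<boxtimes> W)" "bilin X Y c" for c
    unfolding tmap_def functional_tlift[OF V b sw_mhom_left[OF assms(3,4)] that(1)]
    by (rule sw_cong) (simp_all add: sw_ptens assms(3,4) that(2) mhomD(1)[OF assms(5)] mhomD(1)[OF assms(6)])
qed

context
  fixes U :: "('k::field, 'u) module" and V :: "('k, 'v) module" and W :: "('k, 'w) module"
  assumes fd: "fdvs U" "fdvs V" "fdvs W"
begin

text \<open>
  The associators are doubly induced maps, and each yields two nested Sweedler sums when paired
  with a bilinear form. The rules \<open>sw_tmap\<close>, \<open>sw_tassoc\<close>, \<open>sw_tassoc_inv\<close> and their consequences
  for \<open>swap12\<close>, \<open>swap23\<close> and \<open>swap_mid\<close> express the value of a composite of structural maps by the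
  argument tensor alone; the composite is peeled off from the outside.
\<close>

lemma tassoc_inner_bilinear:
  "w \<in> carrier W \<Longrightarrow> bilinear_map U V (U \<boxtimes> (V \<boxtimes> W)) (\<lambda>u v. ptens U (V \<boxtimes> W) u (ptens V W v w))"
  by (intro linear_intros fd)

lemma tassoc_bilinear:
  "bilinear_map (U \<boxtimes> V) W (U \<boxtimes> (V \<boxtimes> W))
     (\<lambda>t w. tlift U V (U \<boxtimes> (V \<boxtimes> W)) (\<lambda>u v. ptens U (V \<boxtimes> W) u (ptens V W v w)) t)"
  by (rule bilinear_mapI)
    (intro mhom_tlift_right in_Lin[OF tlift_Lin] tassoc_inner_bilinear linear_intros fd | assumption)+

lemma tassoc_Lin: "tassoc U V W \<in> Lin ((U \<boxtimes> V) \<boxtimes> W) (U \<boxtimes> (V \<boxtimes> W))"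
  unfolding tassoc_def by (intro tlift_Lin fdvs_tensor fd tassoc_bilinear)

lemma sw_tassoc:
  assumes t: "t \<in> carrier ((U \<boxtimes> V) \<boxtimes> W)" and b: "bilin U (V \<boxtimes> W) b"
  shows "sw U (V \<boxtimes> W) (tassoc U V W t) b =
    sw (U \<boxtimes> V) W t (\<lambda>s w. sw U V s (\<lambda>u v. b u (ptens V W v w)))"
proof -
  have U: "fdvs (U \<boxtimes> V)" "fdvs (V \<boxtimes> W)" "fdvs (U \<boxtimes> (V \<boxtimes> W))" by (intro fdvs_tensor fd)+
  note L = sw_mhom_left[OF fd(1) U(2)]
  show ?thesis
    unfolding tassoc_def functional_tlift[OF U(1) fd(3) U(3) tassoc_bilinear L t]
    by (intro sw_cong refl)
       (simp add: functional_tlift[OF fd(1,2) U(3) tassoc_inner_bilinear L] sw_ptens fd U b cong: sw_cong)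
qed

lemma tassoc_inv_inner_bilinear:
  "u \<in> carrier U \<Longrightarrow> bilinear_map V W ((U \<boxtimes> V) \<boxtimes> W) (\<lambda>v w. ptens (U \<boxtimes> V) W (ptens U V u v) w)"
  by (intro linear_intros fd)

lemma tassoc_inv_bilinear:
  "bilinear_map U (V \<boxtimes> W) ((U \<boxtimes> V) \<boxtimes> W)
     (\<lambda>u t. tlift V W ((U \<boxtimes> V) \<boxtimes> W) (\<lambda>v w. ptens (U \<boxtimes> V) W (ptens U V u v) w) t)"
  by (rule bilinear_mapI)
    (intro mhom_tlift_right in_Lin[OF tlift_Lin] tassoc_inv_inner_bilinear linear_intros fd | assumption)+

lemma tassoc_inv_Lin: "tassoc_inv U V W \<in> Lin (U \<boxtimes> (V \<boxtimes> W)) ((U \<boxtimes> V) \<boxtimes> W)"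
  unfolding tassoc_inv_def by (intro tlift_Lin fdvs_tensor fd tassoc_inv_bilinear)

lemma sw_tassoc_inv:
  assumes t: "t \<in> carrier (U \<boxtimes> (V \<boxtimes> W))" and b: "bilin (U \<boxtimes> V) W b"
  shows "sw (U \<boxtimes> V) W (tassoc_inv U V W t) b =
    sw U (V \<boxtimes> W) t (\<lambda>u s. sw V W s (\<lambda>v w. b (ptens U V u v) w))"
proof -
  have U: "fdvs (U \<boxtimes> V)" "fdvs (V \<boxtimes> W)" "fdvs ((U \<boxtimes> V) \<boxtimes> W)" by (intro fdvs_tensor fd)+
  note L = sw_mhom_left[OF U(1) fd(3)]
  show ?thesis
    unfolding tassoc_inv_def functional_tlift[OF fd(1) U(2) U(3) tassoc_inv_bilinear L t]
    by (intro sw_cong refl)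
       (simp add: functional_tlift[OF fd(2,3) U(3) tassoc_inv_inner_bilinear L] sw_ptens fd U b cong: sw_cong)
qed

lemma Lin_tensor3_eq:
  fixes X :: "('k, 'x) module"
  assumes X: "fdvs X" and f: "f \<in> mhom ((U \<boxtimes> V) \<boxtimes> W) X" and g: "g \<in> mhom ((U \<boxtimes> V) \<boxtimes> W) X"
    and t: "t \<in> carrier ((U \<boxtimes> V) \<boxtimes> W)"
    and eq: "\<And>u v w. u \<in> carrier U \<Longrightarrow> v \<in> carrier V \<Longrightarrow> w \<in> carrier W \<Longrightarrow>
      f (ptens (U \<boxtimes> V) W (ptens U V u v) w) = g (ptens (U \<boxtimes> V) W (ptens U V u v) w)"
  shows "f t = g t"
proof (rule Lin_tensor_eq[OF fdvs_tensor[OF fd(1,2)] fd(3) X f g _ t])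
  fix s w assume s: "s \<in> carrier (U \<boxtimes> V)" and w: "w \<in> carrier W"
  show "f (ptens (U \<boxtimes> V) W s w) = g (ptens (U \<boxtimes> V) W s w)"
    by (rule Lin_tensor_eq[OF fd(1,2) X _ _ _ s, where f = "\<lambda>s. f (ptens (U \<boxtimes> V) W s w)"])
       (intro mhom_compose[OF _ f] mhom_compose[OF _ g] linear_intros fd w eq | assumption)+
qed

text \<open>
  Threefold tensors are separated by trilinear forms, since a bilinear form on \<open>U \<boxtimes> V\<close> and \<open>W\<close> is,
  by \<open>functional_sw\<close>, the Sweedler sum of the trilinear form obtained by restriction to pure
  tensors.
\<close>

lemma tensor3_eqI:
  assumes s: "s \<in> carrier ((U \<boxtimes> V) \<boxtimes> W)" and t: "t \<in> carrier ((U \<boxtimes> V) \<boxtimes> W)"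
    and eq: "\<And>T. trilin U V W T \<Longrightarrow> sw (U \<boxtimes> V) W s (\<lambda>s w. sw U V s (\<lambda>u v. T u v w)) =
      sw (U \<boxtimes> V) W t (\<lambda>s w. sw U V s (\<lambda>u v. T u v w))"
  shows "s = t"
proof (rule tensor_eqI[OF fdvs_tensor[OF fd(1,2)] fd(3) s t])
  fix b assume b: "bilin (U \<boxtimes> V) W b"
  have T: "trilin U V W (\<lambda>u v w. b (ptens U V u v) w)"
    by (intro trilinI linear_intros fd bilinear_compose1[OF b] bilinear_compose2[OF b])
  have "sw U V s (\<lambda>u v. b (ptens U V u v) w) = b s w" if "s \<in> carrier (U \<boxtimes> V)" "w \<in> carrier W" for s w
    by (rule functional_sw[OF fd(1,2) bilinear_mapD(2)[OF b] that(1), symmetric]) (rule that)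
  with eq[OF T] show "sw (U \<boxtimes> V) W s b = sw (U \<boxtimes> V) W t b" by (simp cong: sw_cong)
qed

lemma tensor3_eqI':
  assumes s: "s \<in> carrier (U \<boxtimes> (V \<boxtimes> W))" and t: "t \<in> carrier (U \<boxtimes> (V \<boxtimes> W))"
    and eq: "\<And>T. trilin U V W T \<Longrightarrow> sw U (V \<boxtimes> W) s (\<lambda>u s. sw V W s (\<lambda>v w. T u v w)) =
      sw U (V \<boxtimes> W) t (\<lambda>u s. sw V W s (\<lambda>v w. T u v w))"
  shows "s = t"
proof (rule tensor_eqI[OF fd(1) fdvs_tensor[OF fd(2,3)] s t])
  fix b assume b: "bilin U (V \<boxtimes> W) b"
  have T: "trilin U V W (\<lambda>u v w. b u (ptens V W v w))"
    by (intro trilinI linear_intros fd bilinear_compose1[OF b] bilinear_compose2[OF b])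
  have "sw V W s (\<lambda>v w. b u (ptens V W v w)) = b u s" if "s \<in> carrier (V \<boxtimes> W)" "u \<in> carrier U" for s u
    by (rule functional_sw[OF fd(2,3) bilinear_mapD(1)[OF b] that(1), symmetric]) (rule that)
  with eq[OF T] show "sw U (V \<boxtimes> W) s b = sw U (V \<boxtimes> W) t b" by (simp cong: sw_cong)
qed

lemma swap12_Lin:
  "\<sigma> \<in> Lin (U \<boxtimes> V) (V \<boxtimes> U) \<Longrightarrow> swap12 U V W \<sigma> \<in> Lin ((U \<boxtimes> V) \<boxtimes> W) ((V \<boxtimes> U) \<boxtimes> W)"
  unfolding swap12_def by (intro tmap_Lin fdvs_tensor fd in_Lin mhom_id)

lemma sw_swap12:
  assumes "\<sigma> \<in> Lin (U \<boxtimes> V) (V \<boxtimes> U)" "t \<in> carrier ((U \<boxtimes> V) \<boxtimes> W)" "bilin (V \<boxtimes> U) W b"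
  shows "sw (V \<boxtimes> U) W (swap12 U V W \<sigma> t) b = sw (U \<boxtimes> V) W t (\<lambda>s w. b (\<sigma> s) w)"
  unfolding swap12_def by (rule sw_tmap) (intro fdvs_tensor fd in_Lin mhom_id assms)+

end

context
  fixes U :: "('k::field, 'u) module" and V :: "('k, 'v) module" and W :: "('k, 'w) module"
  assumes fd: "fdvs U" "fdvs V" "fdvs W"
begin

lemma swap23_mhom:
  assumes s: "\<sigma> \<in> Lin (V \<boxtimes> W) (W \<boxtimes> V)"
  shows "swap23 U V W \<sigma> \<in> mhom ((U \<boxtimes> V) \<boxtimes> W) ((U \<boxtimes> W) \<boxtimes> V)"
  unfolding swap23_def
  by (intro mhom_compose[OF _ in_Lin[OF tassoc_inv_Lin]] mhom_compose[OF _ in_Lin[OF tmap_Lin]]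
      in_Lin[OF tassoc_Lin] fdvs_tensor fd mhom_id in_Lin[OF s])

text \<open>
  Pushing the associators outwards leaves \<open>\<sigma>\<close> applied to the second leg of the inner tensor and
  the outer leg, with the first leg untouched.
\<close>

lemma sw_swap23:
  assumes s: "\<sigma> \<in> Lin (V \<boxtimes> W) (W \<boxtimes> V)" and t: "t \<in> carrier ((U \<boxtimes> V) \<boxtimes> W)" and b: "bilin (U \<boxtimes> W) V b"
  shows "sw (U \<boxtimes> W) V (swap23 U V W \<sigma> t) b = sw (U \<boxtimes> V) W t (\<lambda>s w. sw U V s (\<lambda>u v.
     sw W V (\<sigma> (ptens V W v w)) (\<lambda>w' v'. b (ptens U W u w') v')))"
proof -
  have T: "tassoc U V W t \<in> carrier (U \<boxtimes> (V \<boxtimes> W))" by (rule Lin_closed[OF tassoc_Lin[OF fd] t])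
  have T': "tmap U (V \<boxtimes> W) U (W \<boxtimes> V) (\<lambda>u. u) \<sigma> (tassoc U V W t) \<in> carrier (U \<boxtimes> (W \<boxtimes> V))"
    by (rule Lin_closed[OF tmap_Lin T]) (intro fd fdvs_tensor mhom_id in_Lin[OF s])+
  note I = linear_intros fd bilinear_intros[OF b] in_Lin[OF s] mhom_compose[OF _ in_Lin[OF s]]
  have 1: "bilin U (W \<boxtimes> V) (\<lambda>u s. sw W V s (\<lambda>w v. b (ptens U W u w) v))" by (intro I)
  have 2: "bilin U (V \<boxtimes> W) (\<lambda>u s. sw W V (\<sigma> s) (\<lambda>w v. b (ptens U W u w) v))"
    by (intro I Lin_closed[OF s])
  have "sw (U \<boxtimes> W) V (swap23 U V W \<sigma> t) b = sw U (W \<boxtimes> V) (tmap U (V \<boxtimes> W) U (W \<boxtimes> V) (\<lambda>u. u) \<sigma> (tassoc U V W t))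
    (\<lambda>u s. sw W V s (\<lambda>w v. b (ptens U W u w) v))"
    unfolding swap23_def by (rule sw_tassoc_inv[OF fd(1,3,2) T' b])
  also have "\<dots> = sw U (V \<boxtimes> W) (tassoc U V W t) (\<lambda>u s. sw W V (\<sigma> s) (\<lambda>w v. b (ptens U W u w) v))"
    by (rule sw_tmap) (intro fd fdvs_tensor mhom_id in_Lin[OF s] T 1)+
  also have "\<dots> = sw (U \<boxtimes> V) W t (\<lambda>s w. sw U V s (\<lambda>u v.
     sw W V (\<sigma> (ptens V W v w)) (\<lambda>w' v'. b (ptens U W u w') v')))"
    by (rule sw_tassoc[OF fd t 2])
  finally show ?thesis .
qed

end

context
  fixes U :: "('k::field, 'u) module" and V :: "('k, 'v) module" and W :: "('k, 'w) module" and X :: "('k, 'x) module"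
  assumes fd: "fdvs U" "fdvs V" "fdvs W" "fdvs X"
begin

lemma swap_mid_inner_mhom:
  assumes s: "\<sigma> \<in> Lin (V \<boxtimes> W) (W \<boxtimes> V)"
  shows "(\<lambda>s. tassoc W V X (swap12 V W X \<sigma> (tassoc_inv V W X s))) \<in> mhom (V \<boxtimes> (W \<boxtimes> X)) (W \<boxtimes> (V \<boxtimes> X))"
  by (intro mhom_compose[OF _ in_Lin[OF tassoc_Lin]] mhom_compose[OF _ in_Lin[OF swap12_Lin]]
      in_Lin[OF tassoc_inv_Lin] fd s)

lemma swap_mid_mhom:
  assumes s: "\<sigma> \<in> Lin (V \<boxtimes> W) (W \<boxtimes> V)"
  shows "swap_mid U V W X \<sigma> \<in> mhom ((U \<boxtimes> V) \<boxtimes> (W \<boxtimes> X)) ((U \<boxtimes> W) \<boxtimes> (V \<boxtimes> X))"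
  unfolding swap_mid_def
  by (intro mhom_compose[OF _ in_Lin[OF tassoc_inv_Lin]] mhom_compose[OF _ in_Lin[OF tmap_Lin]]
      in_Lin[OF tassoc_Lin] fdvs_tensor fd mhom_id swap_mid_inner_mhom[OF s])

text \<open>
  Both pairs are unfolded first and \<open>\<sigma>\<close> acts on the two middle legs; the auxiliary bilinear forms
  are those met while the factors of \<open>swap_mid\<close> are peeled off one by one.
\<close>

lemma sw_swap_mid:
  assumes s: "\<sigma> \<in> Lin (V \<boxtimes> W) (W \<boxtimes> V)" and t: "t \<in> carrier ((U \<boxtimes> V) \<boxtimes> (W \<boxtimes> X))"
    and b: "bilin (U \<boxtimes> W) (V \<boxtimes> X) b"
  shows "sw (U \<boxtimes> W) (V \<boxtimes> X) (swap_mid U V W X \<sigma> t) b =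
    sw (U \<boxtimes> V) (W \<boxtimes> X) t (\<lambda>p q. sw U V p (\<lambda>u v. sw W X q (\<lambda>w x.
      sw W V (\<sigma> (ptens V W v w)) (\<lambda>w' v'. b (ptens U W u w') (ptens V X v' x)))))"
proof -
  let ?g = "\<lambda>s. tassoc W V X (swap12 V W X \<sigma> (tassoc_inv V W X s))"
  note g = swap_mid_inner_mhom[OF s]
  have T: "tassoc U V (W \<boxtimes> X) t \<in> carrier (U \<boxtimes> (V \<boxtimes> (W \<boxtimes> X)))"
    by (rule Lin_closed[OF tassoc_Lin t]) (intro fd fdvs_tensor)+
  have T': "tmap U (V \<boxtimes> (W \<boxtimes> X)) U (W \<boxtimes> (V \<boxtimes> X)) (\<lambda>u. u) ?g (tassoc U V (W \<boxtimes> X) t) \<in> carrier (U \<boxtimes> (W \<boxtimes> (V \<boxtimes> X)))"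
    by (rule Lin_closed[OF tmap_Lin T]) (intro fd fdvs_tensor mhom_id g)+
  note I = linear_intros fd bilinear_intros[OF b] in_Lin[OF s] mhom_compose[OF _ in_Lin[OF s]]
  have 1: "bilin U (W \<boxtimes> (V \<boxtimes> X)) (\<lambda>u s. sw W (V \<boxtimes> X) s (\<lambda>w r. b (ptens U W u w) r))" by (intro I)
  have 2: "bilin U (V \<boxtimes> (W \<boxtimes> X)) (\<lambda>u s. sw W (V \<boxtimes> X) (?g s) (\<lambda>w r. b (ptens U W u w) r))"
    by (intro I g mhomD(1)[OF g])
  have 3: "sw W (V \<boxtimes> X) (?g (ptens V (W \<boxtimes> X) v q)) (\<lambda>w r. b (ptens U W u w) r) =
     sw W X q (\<lambda>w x. sw W V (\<sigma> (ptens V W v w)) (\<lambda>w' v'. b (ptens U W u w') (ptens V X v' x)))"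
    if u: "u \<in> carrier U" and v: "v \<in> carrier V" and q: "q \<in> carrier (W \<boxtimes> X)" for u v q
  proof -
    have P: "ptens V (W \<boxtimes> X) v q \<in> carrier (V \<boxtimes> (W \<boxtimes> X))" by (intro tensor_ptens fd fdvs_tensor v q)
    have P': "tassoc_inv V W X (ptens V (W \<boxtimes> X) v q) \<in> carrier ((V \<boxtimes> W) \<boxtimes> X)"
      by (rule Lin_closed[OF tassoc_inv_Lin P]) (rule fd)+
    have P'': "swap12 V W X \<sigma> (tassoc_inv V W X (ptens V (W \<boxtimes> X) v q)) \<in> carrier ((W \<boxtimes> V) \<boxtimes> X)"
      by (rule Lin_closed[OF swap12_Lin P']) (rule fd s)+
    note J = I trilinI u v q Lin_closed[OF s]
    have a: "bilin W (V \<boxtimes> X) (\<lambda>w r. b (ptens U W u w) r)" by (intro J)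
    have b': "bilin (W \<boxtimes> V) X (\<lambda>s x. sw W V s (\<lambda>w v. b (ptens U W u w) (ptens V X v x)))" by (intro J)
    have c: "bilin (V \<boxtimes> W) X (\<lambda>s x. sw W V (\<sigma> s) (\<lambda>w v. b (ptens U W u w) (ptens V X v x)))" by (intro J)
    have d: "bilin V (W \<boxtimes> X) (\<lambda>v q. sw W X q (\<lambda>w x. sw W V (\<sigma> (ptens V W v w)) (\<lambda>w v. b (ptens U W u w) (ptens V X v x))))"
      by (intro J)
    show ?thesis
      unfolding sw_tassoc[OF fd(3,2,4) P'' a] sw_swap12[OF fd(2,3,4) s P' b'] sw_tassoc_inv[OF fd(2,3,4) P c]
      by (rule sw_ptens) (intro fd fdvs_tensor v q d)+
  qed
  have "sw (U \<boxtimes> W) (V \<boxtimes> X) (swap_mid U V W X \<sigma> t) b =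
      sw U (W \<boxtimes> (V \<boxtimes> X)) (tmap U (V \<boxtimes> (W \<boxtimes> X)) U (W \<boxtimes> (V \<boxtimes> X)) (\<lambda>u. u) ?g (tassoc U V (W \<boxtimes> X) t))
    (\<lambda>u s. sw W (V \<boxtimes> X) s (\<lambda>w r. b (ptens U W u w) r))"
    unfolding swap_mid_def by (rule sw_tassoc_inv[OF fd(1,3) fdvs_tensor[OF fd(2,4)] T' b])
  also have "\<dots> = sw U (V \<boxtimes> (W \<boxtimes> X)) (tassoc U V (W \<boxtimes> X) t) (\<lambda>u s. sw W (V \<boxtimes> X) (?g s) (\<lambda>w r. b (ptens U W u w) r))"
    by (rule sw_tmap) (intro fd fdvs_tensor mhom_id g T 1)+
  also have "\<dots> = sw (U \<boxtimes> V) (W \<boxtimes> X) t (\<lambda>p q. sw U V p (\<lambda>u v. sw W (V \<boxtimes> X) (?g (ptens V (W \<boxtimes> X) v q)) (\<lambda>w r. b (ptens U W u w) r)))"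
    by (rule sw_tassoc[OF fd(1,2) fdvs_tensor[OF fd(3,4)] t 2])
  also have "\<dots> = sw (U \<boxtimes> V) (W \<boxtimes> X) t (\<lambda>p q. sw U V p (\<lambda>u v. sw W X q (\<lambda>w x.
      sw W V (\<sigma> (ptens V W v w)) (\<lambda>w' v'. b (ptens U W u w') (ptens V X v' x)))))"
    by (intro sw_cong refl 3)
  finally show ?thesis .
qed

end

(* From here on the dual space is handled through the rules below rather than through restricted functions. *)
declare dual_simps [simp del]

section \<open>Linear maps into duals and induced maps\<close>

lemma dual_carrier: "carrier (dual V) = Lin V ground"
  by (simp add: dual_simps)

lemma dual_mhom: "l \<in> carrier (dual V) \<Longrightarrow> l \<in> mhom V ground"
  by (simp add: dual_carrier)

lemma dual_compose: "l \<in> carrier (dual V) \<Longrightarrow> f \<in> mhom X V \<Longrightarrow> (\<lambda>x. l (f x)) \<in> mhom X ground"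
  by (rule mhom_compose[OF _ dual_mhom])

lemma dual_eqI:
  "l \<in> carrier (dual V) \<Longrightarrow> l' \<in> carrier (dual V) \<Longrightarrow> (\<And>v. v \<in> carrier V \<Longrightarrow> l v = l' v) \<Longrightarrow> l = l'"
  unfolding dual_carrier by (rule Lin_eqI)

lemma dual_restrictI:
  "fdvs V \<Longrightarrow> f \<in> mhom V ground \<Longrightarrow> (\<lambda>v\<in>carrier V. f v) \<in> carrier (dual V)"
  unfolding dual_carrier by (rule restrict_Lin[OF fdvs_module])

lemma eval_mhom: "v \<in> carrier V \<Longrightarrow> (\<lambda>l. l v) \<in> mhom (dual V) ground"
  by (rule mhomI) (simp_all add: dual_simps)

text \<open>
  A functional on the dual is a combination of evaluations, so linearity of a map into the dual
  may be tested by evaluating at vectors.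
\<close>

lemma mhom_dualI:
  assumes "fdvs X" "fdvs V" "\<And>x. x \<in> carrier X \<Longrightarrow> f x \<in> carrier (dual V)"
    and "\<And>v. v \<in> carrier V \<Longrightarrow> (\<lambda>x. f x v) \<in> mhom X ground"
  shows "f \<in> mhom X (dual V)"
proof (rule mhom_weakI[OF fdvs_module fdvs_dual])
  fix g assume g: "g \<in> Lin (dual V) ground"
  have "(\<lambda>x. \<Sum>a\<in>bas V. f x a * g (coo V a)) \<in> mhom X ground"
    by (intro mhom_ground_sum mhom_ground_mult1 assms bas_carrier)
  then show "(\<lambda>x. g (f x)) \<in> mhom X ground"
    by (rule mhom_cong[OF _ fdvs_module[OF assms(1)], rotated])
       (use dual_functional_expand[OF assms(2) in_Lin[OF g]] assms(3) dual_carrier in metis)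
qed (use assms in auto)

lemma mhom_smult1:
  assumes "fdvs X" "fdvs W" "f \<in> mhom X ground" "w \<in> carrier W"
  shows "(\<lambda>x. f x \<odot>\<^bsub>W\<^esub> w) \<in> mhom X W"
proof (rule mhom_weakI[OF fdvs_module[OF assms(1)] assms(2)])
  fix g assume g: "g \<in> Lin W ground"
  show "(\<lambda>x. g (f x \<odot>\<^bsub>W\<^esub> w)) \<in> mhom X ground"
    using mhom_ground_mult1[OF assms(3), of "g w"] mhomD(3)[OF in_Lin[OF g] assms(4)] by simp
qed (rule module_closed(2)[OF fdvs_module[OF assms(2)] assms(4)])

lemma mhom_smult2:
  assumes "fdvs X" "fdvs W" "f \<in> mhom X W"
  shows "(\<lambda>x. c \<odot>\<^bsub>W\<^esub> f x) \<in> mhom X W"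
proof (rule mhom_weakI[OF fdvs_module[OF assms(1)] assms(2)])
  fix g assume g: "g \<in> Lin W ground"
  show "(\<lambda>x. g (c \<odot>\<^bsub>W\<^esub> f x)) \<in> mhom X ground"
    by (rule mhom_cong[OF _ fdvs_module[OF assms(1)] mhom_ground_mult2[OF mhom_compose[OF assms(3) in_Lin[OF g]]], of c])
       (use mhomD(3)[OF in_Lin[OF g]] mhomD(1)[OF assms(3)] in simp)
qed (rule module_closed(2)[OF fdvs_module[OF assms(2)] mhomD(1)[OF assms(3)]])

lemma tlift_ground:
  "fdvs V \<Longrightarrow> fdvs W \<Longrightarrow> bilin V W b \<Longrightarrow> t \<in> carrier (V \<boxtimes> W) \<Longrightarrow> tlift V W ground b t = sw V W t b"
  using functional_tlift[OF _ _ fdvs_ground _ mhom_id, of V W b t] by simp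

text \<open>
  The values of a tensor on products of coordinate functionals are its coordinates, hence products
  of functionals already separate tensors.
\<close>

lemma tensor_eqI_prod:
  assumes V: "fdvs V" and W: "fdvs W" and s: "s \<in> carrier (V \<boxtimes> W)" and t: "t \<in> carrier (V \<boxtimes> W)"
    and eq: "\<And>f g. f \<in> Lin V ground \<Longrightarrow> g \<in> Lin W ground \<Longrightarrow>
      sw V W s (\<lambda>v w. f v * g w) = sw V W t (\<lambda>v w. f v * g w)"
  shows "s = t"
proof (rule tensor_eqI[OF V W s t])
  fix b
  let ?E = "\<lambda>i j. \<lambda>q\<in>carrier V \<times> carrier W. coo V i (fst q) * coo W j (snd q)"
  have E: "sw V W r (\<lambda>v w. coo V i v * coo W j w) = r (?E i j)"
    if "i \<in> bas V" "j \<in> bas W" "r \<in> carrier (V \<boxtimes> W)" for r i j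
    by (rule sw_eval[OF V W that(3)]) (intro linear_intros coo_mhom V W that)
  have "s (?E i j) = t (?E i j)" if "i \<in> bas V" "j \<in> bas W" for i j
    using E[OF that s] E[OF that t] eq[OF bas_props(3)[OF V that(1)] bas_props(3)[OF W that(2)]] by simp
  then show "sw V W s b = sw V W t b"
    unfolding sw_def by (intro sum.cong refl) simp
qed


section \<open>The Yang--Baxter equation in scalar form\<close>

text \<open>
  Both composites are linear, so they may be compared on pure tensors, and their values may be
  compared by trilinear forms \<open>T\<close>. The composites then turn into iterated Sweedler sums in which
  only values of the braidings at pure tensors occur, in the order in which the strands cross.
\<close>

lemma yang_baxter_iff:
  fixes U :: "('k::field, 'u) module" and V :: "('k, 'v) module" and W :: "('k, 'w) module"
  assumes fd: "fdvs U" "fdvs V" "fdvs W"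
    and s: "\<sigma>UV \<in> Lin (U \<boxtimes> V) (V \<boxtimes> U)" "\<sigma>UW \<in> Lin (U \<boxtimes> W) (W \<boxtimes> U)" "\<sigma>VW \<in> Lin (V \<boxtimes> W) (W \<boxtimes> V)"
  shows "yang_baxter U V W \<sigma>UV \<sigma>UW \<sigma>VW \<longleftrightarrow>
    (\<forall>u\<in>carrier U. \<forall>v\<in>carrier V. \<forall>w\<in>carrier W. \<forall>T. trilin W V U T \<longrightarrow>
      sw V U (\<sigma>UV (ptens U V u v)) (\<lambda>v1 u1. sw W U (\<sigma>UW (ptens U W u1 w)) (\<lambda>w1 u2.
        sw W V (\<sigma>VW (ptens V W v1 w1)) (\<lambda>w2 v2. T w2 v2 u2))) =
      sw W V (\<sigma>VW (ptens V W v w)) (\<lambda>w1 v1. sw W U (\<sigma>UW (ptens U W u w1)) (\<lambda>w2 u1.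
        sw V U (\<sigma>UV (ptens U V u1 v1)) (\<lambda>v2 u2. T w2 v2 u2))))"
    (is "_ \<longleftrightarrow> (\<forall>u\<in>_. \<forall>v\<in>_. \<forall>w\<in>_. \<forall>T. _ \<longrightarrow> ?l T u v w = ?r T u v w)")
proof -
  let ?L = "\<lambda>t. swap12 V W U \<sigma>VW (swap23 V U W \<sigma>UW (swap12 U V W \<sigma>UV t))"
  let ?R = "\<lambda>t. swap23 W U V \<sigma>UV (swap12 U W V \<sigma>UW (swap23 U V W \<sigma>VW t))"
  let ?P = "\<lambda>u v w. ptens (U \<boxtimes> V) W (ptens U V u v) w"
  note sc = Lin_closed[OF s(1)] Lin_closed[OF s(2)] Lin_closed[OF s(3)]
  note sm = mhom_compose[OF _ in_Lin[OF s(1)]] mhom_compose[OF _ in_Lin[OF s(2)]] mhom_compose[OF _ in_Lin[OF s(3)]] in_Lin[OF s(1)] in_Lin[OF s(2)] in_Lin[OF s(3)]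
  have Lm: "?L \<in> mhom ((U \<boxtimes> V) \<boxtimes> W) ((W \<boxtimes> V) \<boxtimes> U)"
    by (intro mhom_compose[OF _ in_Lin[OF swap12_Lin]] mhom_compose[OF _ swap23_mhom] in_Lin[OF swap12_Lin] fd s)
  have Rm: "?R \<in> mhom ((U \<boxtimes> V) \<boxtimes> W) ((W \<boxtimes> V) \<boxtimes> U)"
    by (intro mhom_compose[OF _ swap23_mhom] mhom_compose[OF _ in_Lin[OF swap12_Lin]] mhom_id fd s)
  have P: "?P u v w \<in> carrier ((U \<boxtimes> V) \<boxtimes> W)" if "u \<in> carrier U" "v \<in> carrier V" "w \<in> carrier W" for u v w
    by (intro tensor_ptens fd fdvs_tensor that)
  have L: "sw (W \<boxtimes> V) U (?L (?P u v w)) (\<lambda>s u. sw W V s (\<lambda>w v. T w v u)) =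
      ?l T u v w"
    if T: "trilin W V U T" and uvw: "u \<in> carrier U" "v \<in> carrier V" "w \<in> carrier W" for T u v w
  proof -
    note I = linear_intros fd trilin_compose[OF T] sm sc
    have p: "swap12 U V W \<sigma>UV (?P u v w) = ptens (V \<boxtimes> U) W (\<sigma>UV (ptens U V u v)) w"
      unfolding swap12_def by (rule tmap_ptens) (intro fd fdvs_tensor in_Lin s mhom_id tensor_ptens uvw)+
    have c1: "ptens (V \<boxtimes> U) W (\<sigma>UV (ptens U V u v)) w \<in> carrier ((V \<boxtimes> U) \<boxtimes> W)" by (intro I uvw)
    have c2: "swap23 V U W \<sigma>UW (ptens (V \<boxtimes> U) W (\<sigma>UV (ptens U V u v)) w) \<in> carrier ((V \<boxtimes> W) \<boxtimes> U)"
      by (rule mhomD(1)[OF swap23_mhom c1]) (rule fd s)+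
    have b1: "bilin (W \<boxtimes> V) U (\<lambda>s u. sw W V s (\<lambda>w v. T w v u))" by (intro I)
    have b2: "bilin (V \<boxtimes> W) U (\<lambda>s u. sw W V (\<sigma>VW s) (\<lambda>w v. T w v u))" by (intro I)
    have b3: "bilin (V \<boxtimes> U) W (\<lambda>s w. sw V U s (\<lambda>v1 u1. sw W U (\<sigma>UW (ptens U W u1 w)) (\<lambda>w1 u2.
        sw W V (\<sigma>VW (ptens V W v1 w1)) (\<lambda>w2 v2. T w2 v2 u2))))" by (intro I)
    show ?thesis
      unfolding p sw_swap12[OF fd(2,3,1) s(3) c2 b1] sw_swap23[OF fd(2,1,3) s(2) c1 b2]
      by (rule sw_ptens) (intro I uvw b3)+
  qed
  have R: "sw (W \<boxtimes> V) U (?R (?P u v w)) (\<lambda>s u. sw W V s (\<lambda>w v. T w v u)) =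
      ?r T u v w"
    if T: "trilin W V U T" and uvw: "u \<in> carrier U" "v \<in> carrier V" "w \<in> carrier W" for T u v w
  proof -
    note I = linear_intros fd trilin_compose[OF T] sm sc
    have c1: "swap23 U V W \<sigma>VW (?P u v w) \<in> carrier ((U \<boxtimes> W) \<boxtimes> V)"
      by (rule mhomD(1)[OF swap23_mhom P]) (rule fd s uvw)+
    have c2: "swap12 U W V \<sigma>UW (swap23 U V W \<sigma>VW (?P u v w)) \<in> carrier ((W \<boxtimes> U) \<boxtimes> V)"
      by (rule Lin_closed[OF swap12_Lin c1]) (rule fd s)+
    have b1: "bilin (W \<boxtimes> V) U (\<lambda>s u. sw W V s (\<lambda>w v. T w v u))" by (intro I)
    have e: "sw W V (ptens W V w v) (\<lambda>w v. T w v u) = T w v u" if "w \<in> carrier W" "v \<in> carrier V" "u \<in> carrier U" for u v w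
      by (rule sw_ptens) (intro I that)+
    have b2: "bilin (W \<boxtimes> U) V (\<lambda>s v. sw W U s (\<lambda>w u. sw V U (\<sigma>UV (ptens U V u v)) (\<lambda>v' u'. T w v' u')))" by (intro I)
    have b3: "bilin (U \<boxtimes> W) V (\<lambda>s v. sw W U (\<sigma>UW s) (\<lambda>w u. sw V U (\<sigma>UV (ptens U V u v)) (\<lambda>v' u'. T w v' u')))" by (intro I)
    have b4: "bilin (U \<boxtimes> V) W (\<lambda>s w. sw U V s (\<lambda>u v. ?r T u v w))" by (intro I)
    have b5: "bilin U V (\<lambda>u v. ?r T u v w)" by (intro I uvw)
    have "sw (W \<boxtimes> V) U (?R (?P u v w)) (\<lambda>s u. sw W V s (\<lambda>w v. T w v u)) =
       sw (W \<boxtimes> U) V (swap12 U W V \<sigma>UW (swap23 U V W \<sigma>VW (?P u v w))) (\<lambda>s v. sw W U s (\<lambda>w u. sw V U (\<sigma>UV (ptens U V u v)) (\<lambda>v' u'. T w v' u')))"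
      unfolding sw_swap23[OF fd(3,1,2) s(1) c2 b1] by (intro sw_cong refl e)
    also have "\<dots> = sw (U \<boxtimes> V) W (?P u v w) (\<lambda>s w. sw U V s (\<lambda>u v. ?r T u v w))"
      unfolding sw_swap12[OF fd(1,3,2) s(2) c1 b2] by (rule sw_swap23[OF fd s(3) P[OF uvw] b3])
    also have "\<dots> = sw U V (ptens U V u v) (\<lambda>u v. ?r T u v w)"
      by (rule sw_ptens) (intro I uvw b4)+
    also have "\<dots> = ?r T u v w"
      by (rule sw_ptens) (intro I uvw b5)+
    finally show ?thesis .
  qed
  show ?thesis
  proof
    assume yb: "yang_baxter U V W \<sigma>UV \<sigma>UW \<sigma>VW"
    then have "?L t = ?R t" if "t \<in> carrier ((U \<boxtimes> V) \<boxtimes> W)" for t using that by (simp add: yang_baxter_def)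
    then show "\<forall>u\<in>carrier U. \<forall>v\<in>carrier V. \<forall>w\<in>carrier W. \<forall>T. trilin W V U T \<longrightarrow>
      ?l T u v w =
      ?r T u v w"
      using L R P by metis
  next
    assume *: "\<forall>u\<in>carrier U. \<forall>v\<in>carrier V. \<forall>w\<in>carrier W. \<forall>T. trilin W V U T \<longrightarrow>
      ?l T u v w =
      ?r T u v w"
    have "?L t = ?R t" if t: "t \<in> carrier ((U \<boxtimes> V) \<boxtimes> W)" for t
    proof (rule Lin_tensor3_eq[OF fd _ Lm Rm t])
      fix u v w assume uvw: "u \<in> carrier U" "v \<in> carrier V" "w \<in> carrier W"
      show "?L (?P u v w) = ?R (?P u v w)"
      proof (rule tensor3_eqI[OF fd(3,2,1) mhomD(1)[OF Lm P[OF uvw]] mhomD(1)[OF Rm P[OF uvw]]])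
        fix T assume "trilin W V U T"
        then show "sw (W \<boxtimes> V) U (?L (?P u v w)) (\<lambda>s u. sw W V s (\<lambda>w v. T w v u)) =
          sw (W \<boxtimes> V) U (?R (?P u v w)) (\<lambda>s u. sw W V s (\<lambda>w v. T w v u))"
          using L[OF _ uvw] R[OF _ uvw] * uvw by simp
      qed
    qed (intro fd fdvs_tensor)
    then show "yang_baxter U V W \<sigma>UV \<sigma>UW \<sigma>VW" by (simp add: yang_baxter_def)
  qed
qed

section \<open>Unital algebras and their braidings\<close>

lemma unital_algebraD:
  assumes "unital_algebra A"
  shows "fdvs (sp A)" "mu A \<in> Lin (sp A \<boxtimes> sp A) (sp A)" "nu A \<in> Lin ground (sp A)"
    "nu A c \<in> carrier (sp A)"
    "a \<in> carrier (sp A) \<Longrightarrow> b \<in> carrier (sp A) \<Longrightarrow> mu A (ptens (sp A) (sp A) a b) \<in> carrier (sp A)"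
    "a \<in> carrier (sp A) \<Longrightarrow> b \<in> carrier (sp A) \<Longrightarrow> c' \<in> carrier (sp A) \<Longrightarrow>
       mu A (ptens (sp A) (sp A) (mu A (ptens (sp A) (sp A) a b)) c') =
       mu A (ptens (sp A) (sp A) a (mu A (ptens (sp A) (sp A) b c')))"
    "a \<in> carrier (sp A) \<Longrightarrow> mu A (ptens (sp A) (sp A) (nu A 1) a) = a"
    "a \<in> carrier (sp A) \<Longrightarrow> mu A (ptens (sp A) (sp A) a (nu A 1)) = a"
proof -
  show 1: "fdvs (sp A)" "mu A \<in> Lin (sp A \<boxtimes> sp A) (sp A)" "nu A \<in> Lin ground (sp A)"
    using assms by (auto simp: unital_algebra_def Let_def)
  show "nu A c \<in> carrier (sp A)" using Lin_closed[OF 1(3)] by simp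
  show "mu A (ptens (sp A) (sp A) a b) \<in> carrier (sp A)" if "a \<in> carrier (sp A)" "b \<in> carrier (sp A)"
    by (intro Lin_closed[OF 1(2)] tensor_ptens 1 that)
qed (use assms in \<open>auto simp: unital_algebra_def Let_def\<close>)

lemma mu_mhom: "unital_algebra A \<Longrightarrow> f \<in> mhom X (sp A \<boxtimes> sp A) \<Longrightarrow> (\<lambda>x. mu A (f x)) \<in> mhom X (sp A)"
  by (rule mhom_compose[OF _ in_Lin[OF unital_algebraD(2)]])

lemma nu_scale: "unital_algebra A \<Longrightarrow> nu A c = c \<odot>\<^bsub>sp A\<^esub> nu A 1"
  using mhomD(3)[OF in_Lin[OF unital_algebraD(3)], of A 1 c] by simp

lemma functional_nu: "unital_algebra A \<Longrightarrow> f \<in> mhom (sp A) ground \<Longrightarrow> f (nu A c) = c * f (nu A 1)"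
  by (subst nu_scale) (simp_all add: mhomD(3) unital_algebraD)

lemma sigma_ass_props:
  assumes A: "unital_algebra A"
  shows sigma_ass_Lin: "sigma_ass A \<in> Lin (sp A \<boxtimes> sp A) (sp A \<boxtimes> sp A)"
    and sigma_ass_ptens: "a \<in> carrier (sp A) \<Longrightarrow> b \<in> carrier (sp A) \<Longrightarrow>
      sigma_ass A (ptens (sp A) (sp A) a b) = ptens (sp A) (sp A) (nu A 1) (mu A (ptens (sp A) (sp A) a b))"
    and sigma_ass_r_Lin: "sigma_ass_r A \<in> Lin (sp A \<boxtimes> sp A) (sp A \<boxtimes> sp A)"
    and sigma_ass_r_ptens: "a \<in> carrier (sp A) \<Longrightarrow> b \<in> carrier (sp A) \<Longrightarrow>
      sigma_ass_r A (ptens (sp A) (sp A) a b) = ptens (sp A) (sp A) (mu A (ptens (sp A) (sp A) a b)) (nu A 1)"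
proof -
  let ?V = "sp A"
  note V = unital_algebraD[OF A]
  have b: "bilinear_map ?V ?V (?V \<boxtimes> ?V) (\<lambda>a b. ptens ?V ?V (nu A 1) (mu A (ptens ?V ?V a b)))"
    "bilinear_map ?V ?V (?V \<boxtimes> ?V) (\<lambda>a b. ptens ?V ?V (mu A (ptens ?V ?V a b)) (nu A 1))"
    by ((intro linear_intros V(1,4) mu_mhom[OF A]; assumption)+)
  note L = tlift_props[OF V(1,1) fdvs_tensor[OF V(1,1)] b(1)] tlift_props[OF V(1,1) fdvs_tensor[OF V(1,1)] b(2)]
  show "sigma_ass A \<in> Lin (sp A \<boxtimes> sp A) (sp A \<boxtimes> sp A)" "sigma_ass_r A \<in> Lin (sp A \<boxtimes> sp A) (sp A \<boxtimes> sp A)"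
    unfolding sigma_ass_def sigma_ass_r_def Let_def using L(1,3) by auto
  show "sigma_ass A (ptens ?V ?V a b) = ptens ?V ?V (nu A 1) (mu A (ptens ?V ?V a b))"
    "sigma_ass_r A (ptens ?V ?V a b) = ptens ?V ?V (mu A (ptens ?V ?V a b)) (nu A 1)"
    if "a \<in> carrier ?V" "b \<in> carrier ?V"
    unfolding sigma_ass_def sigma_ass_r_def Let_def using L(2,4) that by auto
qed

lemmas linear_simps =
  bilinear_map_def sw_mhom_left' sw_mhom_right ptens_mhom1 ptens_mhom2 ptens_mhom2' mhom_id
  mhom_ground_mult1 mhom_ground_mult2 fdvs_tensor fdvs_dual fdvs_ground

text \<open>
  On \<open>u \<otimes> v \<otimes> w\<close> both sides are \<open>1 \<otimes> 1 \<otimes> u v w\<close>, respectively \<open>u v w \<otimes> 1 \<otimes> 1\<close>: associativity and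
  the unit laws are what the equation asks for.
\<close>

lemma yang_baxter_sigma_ass:
  assumes A: "unital_algebra A"
  shows "yang_baxter (sp A) (sp A) (sp A) (sigma_ass A) (sigma_ass A) (sigma_ass A)"
    and "yang_baxter (sp A) (sp A) (sp A) (sigma_ass_r A) (sigma_ass_r A) (sigma_ass_r A)"
proof -
  note V = unital_algebraD[OF A]
  show "yang_baxter (sp A) (sp A) (sp A) (sigma_ass A) (sigma_ass A) (sigma_ass A)"
    unfolding yang_baxter_iff[OF V(1,1,1) sigma_ass_Lin[OF A] sigma_ass_Lin[OF A] sigma_ass_Lin[OF A]]
  proof (intro ballI allI impI, goal_cases)
    case (1 u v w T)
    then show ?case
      by (simp add: sigma_ass_ptens[OF A] V sw_ptens linear_simps mu_mhom[OF A] trilin_compose[OF 1(4)])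
  qed
  show "yang_baxter (sp A) (sp A) (sp A) (sigma_ass_r A) (sigma_ass_r A) (sigma_ass_r A)"
    unfolding yang_baxter_iff[OF V(1,1,1) sigma_ass_r_Lin[OF A] sigma_ass_r_Lin[OF A] sigma_ass_r_Lin[OF A]]
  proof (intro ballI allI impI, goal_cases)
    case (1 u v w T)
    then show ?case
      by (simp add: sigma_ass_r_ptens[OF A] V sw_ptens linear_simps mu_mhom[OF A] trilin_compose[OF 1(4)])
  qed
qed


section \<open>Algebra-coalgebras and the dual structure\<close>

locale algebra_coalgebra =
  fixes H :: "('k::field, 'h) bialg"
  assumes alg: "unital_algebra H" and coalg: "counital_coalgebra H"
begin

abbreviation V :: "('k, 'h) module" where "V \<equiv> sp H"
abbreviation D :: "('k, 'h \<Rightarrow> 'k) module" where "D \<equiv> dual (sp H)"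
abbreviation prd :: "'h \<Rightarrow> 'h \<Rightarrow> 'h" (infixl \<open>\<cdot>\<close> 70) where "a \<cdot> b \<equiv> mu H (ptens (sp H) (sp H) a b)"
abbreviation one :: 'h where "one \<equiv> nu H 1"
abbreviation SW :: "'h \<Rightarrow> ('h \<Rightarrow> 'h \<Rightarrow> 'k) \<Rightarrow> 'k" where "SW h b \<equiv> sw (sp H) (sp H) (Delta H h) b"

lemmas algD [simp] = unital_algebraD(1,4-8)[OF alg]

lemma fdD [simp]: "fdvs D"
  by (simp add: fdvs_dual)

lemmas mu_Lin = unital_algebraD(2)[OF alg]

lemma Delta_Lin: "Delta H \<in> Lin V (V \<boxtimes> V)" and eps_Lin: "eps H \<in> Lin V ground"
  using coalg by (auto simp: counital_coalgebra_def Let_def)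

lemma eps_dual [simp]: "eps H \<in> carrier D"
  by (simp add: dual_carrier eps_Lin)

lemma Delta_closed [simp]: "h \<in> carrier V \<Longrightarrow> Delta H h \<in> carrier (V \<boxtimes> V)"
  by (rule Lin_closed[OF Delta_Lin])

lemma prd_mhom: "f \<in> mhom X V \<Longrightarrow> b \<in> carrier V \<Longrightarrow> (\<lambda>x. f x \<cdot> b) \<in> mhom X V"
  "a \<in> carrier V \<Longrightarrow> g \<in> mhom X V \<Longrightarrow> (\<lambda>x. a \<cdot> g x) \<in> mhom X V"
  by (intro mu_mhom[OF alg] linear_intros; simp)+

lemma Delta_mhom: "f \<in> mhom X V \<Longrightarrow> (\<lambda>x. Delta H (f x)) \<in> mhom X (V \<boxtimes> V)" "Delta H \<in> mhom V (V \<boxtimes> V)"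
  using mhom_compose[of f X V "Delta H"] in_Lin[OF Delta_Lin] by auto

lemma SW_mhom: "f \<in> mhom X V \<Longrightarrow> (\<lambda>x. SW (f x) b) \<in> mhom X ground"
  by (intro sw_mhom_left' Delta_mhom) simp_all

lemma eps_mhom: "f \<in> mhom X V \<Longrightarrow> (\<lambda>x. eps H (f x)) \<in> mhom X ground" "eps H \<in> mhom V ground"
  using mhom_compose[of f X V "eps H"] in_Lin[OF eps_Lin] by auto

lemmas intros = linear_intros prd_mhom Delta_mhom SW_mhom eps_mhom algD Delta_closed fdD
lemmas simps = linear_simps prd_mhom Delta_mhom SW_mhom eps_mhom

text \<open>
  Coassociativity as a rule for rewriting scalar sums. It is stated for a coaction on any space:
  the comultiplication is the case \<open>M = V\<close>, and the coaction axiom of a comodule is the general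
  one.
\<close>

lemma coassoc_iff:
  assumes M: "fdvs M" and d: "\<delta> \<in> Lin M (M \<boxtimes> V)" and m: "m \<in> carrier M"
  shows "tassoc M V V (tmap M V (M \<boxtimes> V) V \<delta> (\<lambda>x. x) (\<delta> m)) = tmap M V M (V \<boxtimes> V) (\<lambda>x. x) (Delta H) (\<delta> m)
    \<longleftrightarrow> (\<forall>T. trilin M V V T \<longrightarrow> sw M V (\<delta> m) (\<lambda>a c. sw M V (\<delta> a) (\<lambda>x y. T x y c)) =
          sw M V (\<delta> m) (\<lambda>x c. SW c (\<lambda>y z. T x y z)))" (is "?l = ?r \<longleftrightarrow> _")
proof -
  note dm = Lin_closed[OF d m]
  note d' = in_Lin[OF d] mhom_compose[OF _ in_Lin[OF d]]
  have t1: "tmap M V (M \<boxtimes> V) V \<delta> (\<lambda>x. x) (\<delta> m) \<in> carrier ((M \<boxtimes> V) \<boxtimes> V)"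
    by (rule Lin_closed[OF tmap_Lin dm]) (intro intros M d')+
  have l: "?l \<in> carrier (M \<boxtimes> (V \<boxtimes> V))"
    by (rule Lin_closed[OF tassoc_Lin t1]) (intro intros M)+
  have r: "?r \<in> carrier (M \<boxtimes> (V \<boxtimes> V))"
    by (rule Lin_closed[OF tmap_Lin dm]) (intro intros M)+
  have L: "sw M (V \<boxtimes> V) ?l (\<lambda>x s. sw V V s (\<lambda>y z. T x y z)) = sw M V (\<delta> m) (\<lambda>a c. sw M V (\<delta> a) (\<lambda>x y. T x y c))"
    and R: "sw M (V \<boxtimes> V) ?r (\<lambda>x s. sw V V s (\<lambda>y z. T x y z)) = sw M V (\<delta> m) (\<lambda>x c. SW c (\<lambda>y z. T x y z))"
    if T: "trilin M V V T" for T
  proof -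
    note I = intros M trilin_compose[OF T] d'
    have b1: "bilin M (V \<boxtimes> V) (\<lambda>x s. sw V V s (\<lambda>y z. T x y z))" by (intro I)
    have b2: "bilin (M \<boxtimes> V) V (\<lambda>s c. sw M V s (\<lambda>x y. T x y c))" by (intro I)
    have e: "sw V V (ptens V V y z) (\<lambda>y z. T x y z) = T x y z" if "x \<in> carrier M" "y \<in> carrier V" "z \<in> carrier V" for x y z
      by (rule sw_ptens) (intro I that)+
    have "sw M (V \<boxtimes> V) ?l (\<lambda>x s. sw V V s (\<lambda>y z. T x y z)) =
      sw (M \<boxtimes> V) V (tmap M V (M \<boxtimes> V) V \<delta> (\<lambda>x. x) (\<delta> m)) (\<lambda>s c. sw M V s (\<lambda>x y. T x y c))"
      unfolding sw_tassoc[OF M algD(1,1) t1 b1] by (intro sw_cong refl e)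
    also have "\<dots> = sw M V (\<delta> m) (\<lambda>a c. sw M V (\<delta> a) (\<lambda>x y. T x y c))"
      by (rule sw_tmap) (intro I dm b2)+
    finally show "sw M (V \<boxtimes> V) ?l (\<lambda>x s. sw V V s (\<lambda>y z. T x y z)) = sw M V (\<delta> m) (\<lambda>a c. sw M V (\<delta> a) (\<lambda>x y. T x y c))" .
    show "sw M (V \<boxtimes> V) ?r (\<lambda>x s. sw V V s (\<lambda>y z. T x y z)) = sw M V (\<delta> m) (\<lambda>x c. SW c (\<lambda>y z. T x y z))"
      by (rule sw_tmap) (intro I dm b1)+
  qed
  show ?thesis
  proof
    assume "?l = ?r"
    then show "\<forall>T. trilin M V V T \<longrightarrow> sw M V (\<delta> m) (\<lambda>a c. sw M V (\<delta> a) (\<lambda>x y. T x y c)) =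
          sw M V (\<delta> m) (\<lambda>x c. SW c (\<lambda>y z. T x y z))" using L R by metis
  next
    assume "\<forall>T. trilin M V V T \<longrightarrow> sw M V (\<delta> m) (\<lambda>a c. sw M V (\<delta> a) (\<lambda>x y. T x y c)) =
          sw M V (\<delta> m) (\<lambda>x c. SW c (\<lambda>y z. T x y z))"
    then show "?l = ?r" using L R by (intro tensor3_eqI'[OF M algD(1,1) l r]) auto
  qed
qed

lemma coassoc:
  assumes "h \<in> carrier V" "trilin V V V T"
  shows "SW h (\<lambda>a c. SW a (\<lambda>x y. T x y c)) = SW h (\<lambda>x c. SW c (\<lambda>y z. T x y z))"
  using coalg coassoc_iff[OF _ Delta_Lin assms(1)] assms by (simp add: counital_coalgebra_def Let_def)

lemma counit:
  assumes h: "h \<in> carrier V" and f: "f \<in> mhom V ground"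
  shows "SW h (\<lambda>a b. eps H a * f b) = f h" "SW h (\<lambda>a b. eps H b * f a) = f h"
proof -
  have c: "tlift V V V (\<lambda>a b. eps H a \<odot>\<^bsub>V\<^esub> b) (Delta H h) = h" "tlift V V V (\<lambda>a b. eps H b \<odot>\<^bsub>V\<^esub> a) (Delta H h) = h"
    using coalg h by (auto simp: counital_coalgebra_def Let_def)
  have b: "bilinear_map V V V (\<lambda>a b. eps H a \<odot>\<^bsub>V\<^esub> b)" "bilinear_map V V V (\<lambda>a b. eps H b \<odot>\<^bsub>V\<^esub> a)"
    by (intro bilinear_mapI mhom_smult1 mhom_smult2 intros; assumption?)+
  have "f h = SW h (\<lambda>a b. f (eps H a \<odot>\<^bsub>V\<^esub> b))" "f h = SW h (\<lambda>a b. f (eps H b \<odot>\<^bsub>V\<^esub> a))"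
    using functional_tlift[OF algD(1,1,1) b(1) f Delta_closed[OF h]] functional_tlift[OF algD(1,1,1) b(2) f Delta_closed[OF h]]
    by (simp_all add: c)
  then show "SW h (\<lambda>a b. eps H a * f b) = f h" "SW h (\<lambda>a b. eps H b * f a) = f h"
    by (simp_all add: mhomD(3)[OF f])
qed

text \<open>
  The functional \<open>l(- b)\<close>. Translation is a left action of the algebra on its dual: translating by
  \<open>b\<close> and then by \<open>a\<close> is translating by \<open>a b\<close> (\<open>rtrans_rtrans\<close>).
\<close>

definition rtrans :: "'h \<Rightarrow> ('h \<Rightarrow> 'k) \<Rightarrow> ('h \<Rightarrow> 'k)" where
  "rtrans b l = (\<lambda>x\<in>carrier V. l (x \<cdot> b))"

lemma rtrans_apply [simp]: "x \<in> carrier V \<Longrightarrow> rtrans b l x = l (x \<cdot> b)"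
  by (simp add: rtrans_def)

lemma rtrans_closed [simp]: "b \<in> carrier V \<Longrightarrow> l \<in> carrier D \<Longrightarrow> rtrans b l \<in> carrier D"
  unfolding rtrans_def by (intro dual_restrictI dual_compose[of l V "\<lambda>x. x \<cdot> b"] intros)

lemma rtrans_mhom:
  "l \<in> carrier D \<Longrightarrow> f \<in> mhom X V \<Longrightarrow> (\<lambda>x. rtrans (f x) l) \<in> mhom X D"
  "b \<in> carrier V \<Longrightarrow> g \<in> mhom X D \<Longrightarrow> (\<lambda>x. rtrans b (g x)) \<in> mhom X D"
  "b \<in> carrier V \<Longrightarrow> rtrans b \<in> mhom D D"
proof -
  have 1: "(\<lambda>b. rtrans b l) \<in> mhom V D" if l: "l \<in> carrier D" for l
    by (rule mhom_dualI) (use l in \<open>auto intro!: dual_compose[OF l] intros\<close>)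
  show 2: "rtrans b \<in> mhom D D" if b: "b \<in> carrier V" for b
    by (rule mhom_dualI) (use b in \<open>auto intro!: eval_mhom\<close>)
  show "(\<lambda>x. rtrans (f x) l) \<in> mhom X D" if "l \<in> carrier D" "f \<in> mhom X V"
    by (rule mhom_compose[OF that(2) 1[OF that(1)]])
  show "(\<lambda>x. rtrans b (g x)) \<in> mhom X D" if "b \<in> carrier V" "g \<in> mhom X D"
    by (rule mhom_compose[OF that(2) 2[OF that(1)]])
qed

lemma rtrans_rtrans [simp]:
  "a \<in> carrier V \<Longrightarrow> b \<in> carrier V \<Longrightarrow> l \<in> carrier D \<Longrightarrow> rtrans a (rtrans b l) = rtrans (a \<cdot> b) l"
  by (rule dual_eqI[of _ V]) simp_all

lemma rtrans_one [simp]: "l \<in> carrier D \<Longrightarrow> rtrans one l = l"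
  by (rule dual_eqI[of _ V]) simp_all

abbreviation dprd :: "('h \<Rightarrow> 'k) \<Rightarrow> ('h \<Rightarrow> 'k) \<Rightarrow> 'h \<Rightarrow> 'k" (infixl \<open>\<star>\<close> 70) where
  "l \<star> l' \<equiv> mu (dual_bialg H) (ptens (dual (sp H)) (dual (sp H)) l l')"

lemma dual_bialg_simps [simp]:
  "sp (dual_bialg H) = D"
  "nu (dual_bialg H) c = (\<lambda>h\<in>carrier V. c * eps H h)"
  by (simp_all add: dual_bialg_def Let_def)

lemma nu_dual_one: "(\<lambda>h\<in>carrier V. eps H h) = eps H"
  using eps_Lin by (auto simp: Lin_def extensional_def)

lemma eps_dual_bialg: "l \<in> carrier D \<Longrightarrow> eps (dual_bialg H) l = l one"
  "eps (dual_bialg H) \<in> Lin D ground"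
  using restrict_Lin[OF fdvs_module[OF fdD] eval_mhom[of one]]
  by (simp_all add: dual_bialg_def Let_def)

lemma convolution_bilinear:
  "bilinear_map D D D (\<lambda>l l'. \<lambda>h\<in>carrier V. tlift V V ground (\<lambda>h\<^sub>1 h\<^sub>2. l h\<^sub>2 * l' h\<^sub>1) (Delta H h))"
  and convolution_tlift: "l \<in> carrier D \<Longrightarrow> l' \<in> carrier D \<Longrightarrow> h \<in> carrier V \<Longrightarrow>
    tlift V V ground (\<lambda>h\<^sub>1 h\<^sub>2. l h\<^sub>2 * l' h\<^sub>1) (Delta H h) = SW h (\<lambda>h\<^sub>1 h\<^sub>2. l h\<^sub>2 * l' h\<^sub>1)"
proof -
  have b: "bilin V V (\<lambda>h\<^sub>1 h\<^sub>2. l h\<^sub>2 * l' h\<^sub>1)" if "l \<in> carrier D" "l' \<in> carrier D" for l l'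
    by (intro intros dual_mhom that)
  show t: "tlift V V ground (\<lambda>h\<^sub>1 h\<^sub>2. l h\<^sub>2 * l' h\<^sub>1) (Delta H h) = SW h (\<lambda>h\<^sub>1 h\<^sub>2. l h\<^sub>2 * l' h\<^sub>1)"
    if "l \<in> carrier D" "l' \<in> carrier D" "h \<in> carrier V" for l l' h
    by (rule tlift_ground) (simp_all add: b that)
  have c: "(\<lambda>h\<in>carrier V. tlift V V ground (\<lambda>h\<^sub>1 h\<^sub>2. l h\<^sub>2 * l' h\<^sub>1) (Delta H h)) \<in> carrier D"
    if "l \<in> carrier D" "l' \<in> carrier D" for l l'
    by (intro dual_restrictI mhom_tlift_left intros b that)
  show "bilinear_map D D D (\<lambda>l l'. \<lambda>h\<in>carrier V. tlift V V ground (\<lambda>h\<^sub>1 h\<^sub>2. l h\<^sub>2 * l' h\<^sub>1) (Delta H h))"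
    by (rule bilinear_mapI; rule mhom_dualI; (intro c)?)
       (auto simp: restrict_apply intro!: mhom_tlift_right intros b eval_mhom)
qed

lemma dprd_apply [simp]:
  assumes "l \<in> carrier D" "l' \<in> carrier D" "h \<in> carrier V"
  shows "(l \<star> l') h = SW h (\<lambda>a b. l b * l' a)"
  using assms tlift_ptens[OF fdD fdD fdD convolution_bilinear] convolution_tlift
  by (simp add: dual_bialg_def Let_def)

lemma mu_dual_Lin: "mu (dual_bialg H) \<in> Lin (D \<boxtimes> D) D"
  using tlift_Lin[OF fdD fdD fdD convolution_bilinear] by (simp add: dual_bialg_def Let_def)

lemma dprd_closed [simp]: "l \<in> carrier D \<Longrightarrow> l' \<in> carrier D \<Longrightarrow> l \<star> l' \<in> carrier D"
  by (rule Lin_closed[OF mu_dual_Lin]) simp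

lemma dprd_mhom:
  "f \<in> mhom X D \<Longrightarrow> l \<in> carrier D \<Longrightarrow> (\<lambda>x. f x \<star> l) \<in> mhom X D"
  "f \<in> mhom X D \<Longrightarrow> l \<in> carrier D \<Longrightarrow> (\<lambda>x. l \<star> f x) \<in> mhom X D"
  by (intro mhom_compose[OF _ in_Lin[OF mu_dual_Lin]] linear_intros; simp)+

text \<open>
  Coassociativity transposes to associativity and the counit to the unit. The product \<open>l \<star> l'\<close>
  evaluates \<open>l\<close> on the second leg, but associativity is insensitive to this reversal.
\<close>

lemma unital_algebra_dual: "unital_algebra (dual_bialg H)"
proof -
  have "(l \<star> l') \<star> l'' = l \<star> (l' \<star> l'')" if "l \<in> carrier D" "l' \<in> carrier D" "l'' \<in> carrier D" for l l' l''
  proof (rule dual_eqI[of _ V])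
    fix h assume h: "h \<in> carrier V"
    have T: "trilin V V V (\<lambda>x y z. l z * l' y * l'' x)"
      by (intro trilinI intros dual_mhom that)
    show "((l \<star> l') \<star> l'') h = (l \<star> (l' \<star> l'')) h"
      using coassoc[OF h T] that h by (simp add: sw_mult1 sw_mult2[symmetric] mult_ac)
  qed (use that in simp_all)
  moreover have "eps H \<star> l = l \<and> l \<star> eps H = l" if "l \<in> carrier D" for l
    using that counit[OF _ dual_mhom[OF that]] by (auto intro!: dual_eqI[of _ V] simp: mult.commute)
  moreover have "nu (dual_bialg H) \<in> Lin ground D"
    by (rule LinI, rule mhom_dualI) (auto intro!: dual_restrictI intros)
  ultimately show ?thesis
    by (simp add: unital_algebra_def Let_def mu_dual_Lin nu_dual_one)
qed

end

context algebra_coalgebra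
begin

declare nu_dual_one [simp]

section \<open>The dual comultiplication and the braiding\<close>

text \<open>
  Tensors over the dual are determined by their pairings with evaluations at pairs of basis
  vectors.
\<close>

lemma sw_dual_expand:
  assumes t: "t \<in> carrier (D \<boxtimes> D)" and b: "bilin D D B"
  shows "sw D D t B = (\<Sum>i\<in>bas V. \<Sum>j\<in>bas V. sw D D t (\<lambda>l l'. l i * l' j) * B (coo V i) (coo V j))"
proof -
  have c: "coo V i \<in> carrier D" if "i \<in> bas V" for i using bas_props(3)[OF algD(1) that] by (simp add: dual_carrier)
  have "B l l' = (\<Sum>i\<in>bas V. \<Sum>j\<in>bas V. l i * l' j * B (coo V i) (coo V j))"
    if "l \<in> carrier D" "l' \<in> carrier D" for l l'
  proof -
    have "B l l' = (\<Sum>i\<in>bas V. l i * B (coo V i) l')"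
      by (rule dual_functional_expand[OF algD(1) bilinear_mapD(2)[OF b that(2)]]) (use that dual_carrier in blast)
    also have "\<dots> = (\<Sum>i\<in>bas V. l i * (\<Sum>j\<in>bas V. l' j * B (coo V i) (coo V j)))"
      using dual_functional_expand[OF algD(1) bilinear_mapD(1)[OF b c]] that(2) by (simp add: dual_carrier)
    finally show ?thesis by (simp add: sum_distrib_left mult_ac)
  qed
  then have "sw D D t B = sw D D t (\<lambda>l l'. \<Sum>i\<in>bas V. \<Sum>j\<in>bas V. l i * l' j * B (coo V i) (coo V j))"
    by (intro sw_cong refl)
  then show ?thesis by (simp only: sw_sum sw_mult1)
qed

text \<open>
  The witness is the element \<open>\<Sum> l (i j) \<phi>\<^sub>j \<otimes> \<phi>\<^sub>i\<close> over the chosen basis with coordinate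
  functionals \<open>\<phi>\<close>; the order of the factors is that of the rainbow pairing.
\<close>

lemma Delta_dual_exists:
  assumes l: "l \<in> carrier D"
  shows "\<exists>t. t \<in> carrier (D \<boxtimes> D) \<and> (\<forall>a\<in>carrier V. \<forall>b\<in>carrier V. sw D D t (\<lambda>l\<^sub>1 l\<^sub>2. l\<^sub>1 b * l\<^sub>2 a) = l (a \<cdot> b))"
proof -
  let ?F = "bilinear_forms D D"
  let ?I = "bas V \<times> bas V"
  define t where "t = (\<lambda>B\<in>carrier ?F. \<Sum>p\<in>?I. B (coo V (snd p), coo V (fst p)) * l (fst p \<cdot> snd p))"
  have c: "coo V i \<in> carrier D" if "i \<in> bas V" for i using bas_props(3)[OF algD(1) that] by (simp add: dual_carrier)
  have "(\<lambda>B. \<Sum>p\<in>?I. B (coo V (snd p), coo V (fst p)) * l (fst p \<cdot> snd p)) \<in> mhom ?F ground"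
    by (intro mhom_ground_sum mhom_ground_mult1 mhomI) (use c in \<open>auto\<close>)
  then have t: "t \<in> carrier (D \<boxtimes> D)"
    unfolding t_def tensor_space_def dual_carrier
    by (rule restrict_Lin[OF module_bf[OF fdvs_module fdvs_module, OF fdD fdD]])
  have "sw D D t (\<lambda>l\<^sub>1 l\<^sub>2. l\<^sub>1 b * l\<^sub>2 a) = l (a \<cdot> b)" if a: "a \<in> carrier V" and b: "b \<in> carrier V" for a b
  proof -
    have B: "bilin D D (\<lambda>l\<^sub>1 l\<^sub>2. l\<^sub>1 b * l\<^sub>2 a)" by (intro intros eval_mhom a b)
    have "sw D D t (\<lambda>l\<^sub>1 l\<^sub>2. l\<^sub>1 b * l\<^sub>2 a) = t (\<lambda>q\<in>carrier D \<times> carrier D. fst q b * snd q a)"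
      by (rule sw_eval[OF fdD fdD t B])
    also have "\<dots> = (\<Sum>p\<in>?I. (coo V (snd p) b * coo V (fst p) a) * l (fst p \<cdot> snd p))"
      unfolding t_def using restrict_bilinear[OF fdD fdD B] c
      by (auto simp del: bf_simps intro!: sum.cong)
    also have "\<dots> = (\<Sum>i\<in>bas V. coo V i a * (\<Sum>j\<in>bas V. coo V j b * l (i \<cdot> j)))"
      by (simp add: sum.cartesian_product' sum_distrib_left mult_ac)
    also have "\<dots> = (\<Sum>i\<in>bas V. coo V i a * l (i \<cdot> b))"
      using functional_expand[OF algD(1) dual_compose[OF l prd_mhom(2)[OF bas_carrier mhom_id]] b] by simp
    also have "\<dots> = l (a \<cdot> b)"
      using functional_expand[OF algD(1) dual_compose[OF l prd_mhom(1)[OF mhom_id b]] a] by simp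
    finally show ?thesis .
  qed
  with t show ?thesis by blast
qed

text \<open>
  The description of \<open>\<Delta> l\<close> by its pairings with pairs of vectors is unambiguous, because such
  pairings separate tensors over the dual.
\<close>

lemma Delta_dual:
  assumes l: "l \<in> carrier D"
  shows Delta_dual_closed: "Delta (dual_bialg H) l \<in> carrier (D \<boxtimes> D)"
    and Delta_dual_apply: "a \<in> carrier V \<Longrightarrow> b \<in> carrier V \<Longrightarrow>
      sw D D (Delta (dual_bialg H) l) (\<lambda>l\<^sub>1 l\<^sub>2. l\<^sub>1 b * l\<^sub>2 a) = l (a \<cdot> b)"
proof -
  define P where "P t \<longleftrightarrow> t \<in> carrier (D \<boxtimes> D) \<and>
    (\<forall>h\<in>carrier V. \<forall>h'\<in>carrier V. l (mu H (ptens V V h h')) = tlift D D ground (\<lambda>l\<^sub>1 l\<^sub>2. l\<^sub>1 h' * l\<^sub>2 h) t)" for t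
  have "tlift D D ground (\<lambda>l\<^sub>1 l\<^sub>2. l\<^sub>1 b * l\<^sub>2 a) t = sw D D t (\<lambda>l\<^sub>1 l\<^sub>2. l\<^sub>1 b * l\<^sub>2 a)"
    if "a \<in> carrier V" "b \<in> carrier V" "t \<in> carrier (D \<boxtimes> D)" for a b t
    by (rule tlift_ground) (intro intros eval_mhom that)+
  then have P: "P t \<longleftrightarrow> t \<in> carrier (D \<boxtimes> D) \<and>
    (\<forall>a\<in>carrier V. \<forall>b\<in>carrier V. sw D D t (\<lambda>l\<^sub>1 l\<^sub>2. l\<^sub>1 b * l\<^sub>2 a) = l (a \<cdot> b))" for t
    unfolding P_def by auto
  have u: "s = t" if "P s" "P t" for s t
  proof (rule tensor_eqI[OF fdD fdD])
    show "sw D D s B = sw D D t B" if "bilin D D B" for B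
      using \<open>P s\<close> \<open>P t\<close> sw_dual_expand[OF _ that, of s] sw_dual_expand[OF _ that, of t]
      unfolding P by (simp add: bas_carrier)
  qed (use that P in auto)
  obtain t where t: "P t" using Delta_dual_exists[OF l] P by blast
  have "Delta (dual_bialg H) l = (THE t. P t)"
    using l unfolding P_def by (simp add: dual_bialg_def Let_def)
  also have "\<dots> = t" by (rule the_equality[of P, OF t]) (rule u[OF _ t])
  finally have "P (Delta (dual_bialg H) l)" using t by simp
  then show "Delta (dual_bialg H) l \<in> carrier (D \<boxtimes> D)" "a \<in> carrier V \<Longrightarrow> b \<in> carrier V \<Longrightarrow>
      sw D D (Delta (dual_bialg H) l) (\<lambda>l\<^sub>1 l\<^sub>2. l\<^sub>1 b * l\<^sub>2 a) = l (a \<cdot> b)"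
    unfolding P by auto
qed

lemma Delta_dual_mhom: "Delta (dual_bialg H) \<in> mhom D (D \<boxtimes> D)"
proof (rule mhom_weakI[OF fdvs_module[OF fdD] fdvs_tensor[OF fdD fdD] Delta_dual_closed])
  fix g assume g: "g \<in> Lin (D \<boxtimes> D) ground"
  have B: "bilin D D (\<lambda>l l'. g (ptens D D l l'))" by (intro intros mhom_compose[OF _ in_Lin[OF g]])
  have "(\<lambda>l. \<Sum>i\<in>bas V. \<Sum>j\<in>bas V. l (j \<cdot> i) * g (ptens D D (coo V i) (coo V j))) \<in> mhom D ground"
    by (intro mhom_ground_sum mhom_ground_mult1 eval_mhom algD bas_carrier)
  then show "(\<lambda>l. g (Delta (dual_bialg H) l)) \<in> mhom D ground"
    by (rule mhom_cong[OF _ fdvs_module[OF fdD], rotated])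
       (simp add: functional_sw[OF fdD fdD in_Lin[OF g] Delta_dual_closed]
          sw_dual_expand[OF Delta_dual_closed B] Delta_dual_apply bas_carrier cong: sum.cong)
qed

text \<open>
  Evaluating the first leg of \<open>\<Delta> l\<close> at \<open>b\<close> leaves the functional \<open>x \<mapsto> l (x b)\<close>: both sides are
  linear in \<open>g\<close>, and for the evaluation at \<open>x\<close> this is the defining property of \<open>\<Delta> l\<close>.
\<close>

lemma Delta_dual_contract:
  assumes l: "l \<in> carrier D" and b: "b \<in> carrier V" and g: "g \<in> mhom D ground"
  shows "sw D D (Delta (dual_bialg H) l) (\<lambda>l\<^sub>1 l\<^sub>2. l\<^sub>1 b * g l\<^sub>2) = g (rtrans b l)"
proof -
  have "sw D D (Delta (dual_bialg H) l) (\<lambda>l\<^sub>1 l\<^sub>2. l\<^sub>1 b * g l\<^sub>2) =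
    sw D D (Delta (dual_bialg H) l) (\<lambda>l\<^sub>1 l\<^sub>2. \<Sum>a\<in>bas V. l\<^sub>1 b * l\<^sub>2 a * g (coo V a))"
    by (intro sw_cong refl) (simp add: dual_functional_expand[OF algD(1) g] dual_carrier sum_distrib_left mult_ac)
  also have "\<dots> = (\<Sum>a\<in>bas V. l (a \<cdot> b) * g (coo V a))"
    using Delta_dual_apply[OF l bas_carrier b] by (simp add: sw_sum sw_mult1)
  also have "\<dots> = g (rtrans b l)"
    using dual_functional_expand[OF algD(1) g, of "rtrans b l"] rtrans_closed[OF b l]
    by (simp add: dual_carrier bas_carrier)
  finally show ?thesis .
qed

text \<open>
  The formula \<open>\<sigma>\<^sub>b\<^sub>i (h \<otimes> l) = l(- h\<^sub>2) \<otimes> h\<^sub>1\<close>, in scalar form. All later arguments use the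
  braiding only through it.
\<close>

lemma sigma_bi_props:
  shows sigma_bi_Lin: "sigma_bi H \<in> Lin (V \<boxtimes> D) (D \<boxtimes> V)"
    and sw_sigma_bi: "h \<in> carrier V \<Longrightarrow> l \<in> carrier D \<Longrightarrow> bilin D V T \<Longrightarrow>
      sw D V (sigma_bi H (ptens V D h l)) T = SW h (\<lambda>a b. T (rtrans b l) a)"
proof -
  let ?X = "D \<boxtimes> V"
  let ?b1 = "\<lambda>a b l\<^sub>1 l\<^sub>2. l\<^sub>1 b \<odot>\<^bsub>?X\<^esub> ptens D V l\<^sub>2 a"
  let ?b2 = "\<lambda>l a b. tlift D D ?X (?b1 a b) (Delta (dual_bialg H) l)"
  let ?b3 = "\<lambda>h l. tlift V V ?X (?b2 l) (Delta H h)"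
  note J = intros mhom_smult1 mhom_smult2 eval_mhom
  have b1: "bilinear_map D D ?X (?b1 a b)" if "a \<in> carrier V" "b \<in> carrier V" for a b by (intro J that)
  have b2: "bilinear_map V V ?X (?b2 l)" if l: "l \<in> carrier D" for l
    by (intro J mhom_tlift_right b1 Delta_dual_closed l dual_mhom)
  have X: "fdvs ?X" by (intro intros)
  have b3: "bilinear_map V D ?X ?b3"
  proof (rule bilinear_mapI)
    show "?b3 h \<in> mhom D ?X" if h: "h \<in> carrier V" for h
      by (rule mhom_tlift_right[OF algD(1,1) X fdD Delta_closed[OF h] b2])
         (assumption, rule mhom_tlift_left[OF fdD fdD X b1 Delta_dual_mhom])
    show "(\<lambda>h. ?b3 h l) \<in> mhom V ?X" if l: "l \<in> carrier D" for l
      by (rule mhom_tlift_left[OF algD(1,1) X b2[OF l] Delta_mhom(2)])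
  qed
  show "sigma_bi H \<in> Lin (V \<boxtimes> D) (D \<boxtimes> V)"
    unfolding sigma_bi_def Let_def by (rule tlift_Lin[OF algD(1) fdD _ b3]) (intro intros)
  assume h: "h \<in> carrier V" and l: "l \<in> carrier D" and T: "bilin D V T"
  note L = sw_mhom_left[OF fdD algD(1), of T]
  have "sw D V (sigma_bi H (ptens V D h l)) T = sw D V (?b3 h l) T"
    unfolding sigma_bi_def Let_def by (rule arg_cong[OF tlift_ptens[OF algD(1) fdD X b3 h l]])
  also have "\<dots> = SW h (\<lambda>a b. sw D V (?b2 l a b) T)"
    by (rule functional_tlift[OF algD(1,1) X b2[OF l] L Delta_closed[OF h]])
  also have "\<dots> = SW h (\<lambda>a b. T (rtrans b l) a)"
  proof (intro sw_cong refl)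
    fix a b assume a: "a \<in> carrier V" and b: "b \<in> carrier V"
    (* Contract the first leg of the dual coproduct with b. *)
    have "sw D V (?b2 l a b) T = sw D D (Delta (dual_bialg H) l) (\<lambda>l\<^sub>1 l\<^sub>2. sw D V (?b1 a b l\<^sub>1 l\<^sub>2) T)"
      by (rule functional_tlift[OF fdD fdD X b1[OF a b] L Delta_dual_closed[OF l]])
    also have "\<dots> = sw D D (Delta (dual_bialg H) l) (\<lambda>l\<^sub>1 l\<^sub>2. l\<^sub>1 b * T l\<^sub>2 a)"
      by (intro sw_cong refl) (simp add: mhomD(3)[OF L] sw_ptens a T)
    also have "\<dots> = T (rtrans b l) a"
      by (rule Delta_dual_contract[OF l b bilinear_mapD(2)[OF T a]])
    finally show "sw D V (?b2 l a b) T = T (rtrans b l) a" .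
  qed
  finally show "sw D V (sigma_bi H (ptens V D h l)) T = SW h (\<lambda>a b. T (rtrans b l) a)" .
qed

lemmas sigma_bi_mhom = in_Lin[OF sigma_bi_Lin] mhom_compose[OF _ in_Lin[OF sigma_bi_Lin]]

lemma sigma_bi_closed [simp]: "t \<in> carrier (V \<boxtimes> D) \<Longrightarrow> sigma_bi H t \<in> carrier (D \<boxtimes> V)"
  by (rule Lin_closed[OF sigma_bi_Lin])

lemmas intros2 = intros rtrans_mhom rtrans_closed sigma_bi_mhom sigma_bi_closed eps_dual


section \<open>Bialgebra compatibility and the Yang--Baxter equation\<close>

text \<open>
  The right-hand side of the Hopf module condition, \<open>m \<otimes> h \<mapsto> m\<^sub>0 h\<^sub>1 \<otimes> m\<^sub>1 h\<^sub>2\<close>. For the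
  comultiplication and multiplication of \<open>H\<close> in place of \<open>\<delta>\<close> and \<open>\<rho>\<close> it is the right-hand side of
  the bialgebra axiom, so one computation serves both.
\<close>

definition codiagonal ::
  "('k, 'm) module \<Rightarrow> ('m \<Rightarrow> ('k, 'm, 'h) tensor) \<Rightarrow> (('k, 'm, 'h) tensor \<Rightarrow> 'm) \<Rightarrow> ('k, 'm, 'h) tensor \<Rightarrow> ('k, 'm, 'h) tensor"
where
  "codiagonal M \<delta> \<rho> t = tmap (M \<boxtimes> V) (V \<boxtimes> V) M V \<rho> (mu H)
     (swap_mid M V V V (flip V V) (tmap M V (M \<boxtimes> V) (V \<boxtimes> V) \<delta> (Delta H) t))"

lemma codiagonal_props:
  assumes M: "fdvs M" and d: "\<delta> \<in> Lin M (M \<boxtimes> V)" and r: "\<rho> \<in> Lin (M \<boxtimes> V) M"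
  shows codiagonal_mhom: "codiagonal M \<delta> \<rho> \<in> mhom (M \<boxtimes> V) (M \<boxtimes> V)"
    and sw_codiagonal: "m \<in> carrier M \<Longrightarrow> h \<in> carrier V \<Longrightarrow> bilin M V B \<Longrightarrow>
      sw M V (codiagonal M \<delta> \<rho> (ptens M V m h)) B = sw M V (\<delta> m) (\<lambda>a b. SW h (\<lambda>x y. B (\<rho> (ptens M V a x)) (b \<cdot> y)))"
proof -
  note mm = in_Lin[OF mu_Lin] and dd = in_Lin[OF d] and rr = in_Lin[OF r] and DD = Delta_mhom(2)
  note dc = Lin_closed[OF d] and rc = Lin_closed[OF r]
  have fl: "bilinear_map V V (V \<boxtimes> V) (\<lambda>v w. ptens V V w v)" by (intro intros)
  have flL: "flip V V \<in> Lin (V \<boxtimes> V) (V \<boxtimes> V)"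
    unfolding flip_def by (rule tlift_Lin[OF algD(1,1) _ fl]) (intro intros)
  have flp: "flip V V (ptens V V v w) = ptens V V w v" if "v \<in> carrier V" "w \<in> carrier V" for v w
    unfolding flip_def using tlift_ptens[OF algD(1,1) _ fl that] by (simp add: fdvs_tensor)
  note sm = swap_mid_mhom[OF M algD(1,1,1) flL]
  show "codiagonal M \<delta> \<rho> \<in> mhom (M \<boxtimes> V) (M \<boxtimes> V)"
    unfolding codiagonal_def
    by (intro mhom_compose[OF _ in_Lin[OF tmap_Lin]] mhom_compose[OF _ sm] in_Lin[OF tmap_Lin] fdvs_tensor M algD dd rr DD mm)
  assume m: "m \<in> carrier M" and h: "h \<in> carrier V" and B: "bilin M V B"
  have d2: "tmap M V (M \<boxtimes> V) (V \<boxtimes> V) \<delta> (Delta H) (ptens M V m h) = ptens (M \<boxtimes> V) (V \<boxtimes> V) (\<delta> m) (Delta H h)"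
    by (rule tmap_ptens) (intro intros M dd DD m h)+
  have c: "ptens (M \<boxtimes> V) (V \<boxtimes> V) (\<delta> m) (Delta H h) \<in> carrier ((M \<boxtimes> V) \<boxtimes> (V \<boxtimes> V))"
    by (intro intros M m h dc)
  note I = intros M bilinear_intros[OF B] mm mhom_compose[OF _ mm] rr mhom_compose[OF _ rr] in_Lin[OF flL] mhom_compose[OF _ in_Lin[OF flL]]
    Lin_closed[OF mu_Lin] rc Lin_closed[OF flL]
  have b1: "bilin (M \<boxtimes> V) (V \<boxtimes> V) (\<lambda>p q. B (\<rho> p) (mu H q))" by (intro I)
  have b2: "bilin (M \<boxtimes> V) (V \<boxtimes> V) (\<lambda>p q. sw M V p (\<lambda>u v. sw V V q (\<lambda>w x.
      sw V V (flip V V (ptens V V v w)) (\<lambda>w' v'. B (\<rho> (ptens M V u w')) (v' \<cdot> x)))))" by (intro I)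
  have "sw M V (codiagonal M \<delta> \<rho> (ptens M V m h)) B =
      sw (M \<boxtimes> V) (V \<boxtimes> V) (swap_mid M V V V (flip V V) (ptens (M \<boxtimes> V) (V \<boxtimes> V) (\<delta> m) (Delta H h)))
        (\<lambda>p q. B (\<rho> p) (mu H q))"
    unfolding codiagonal_def d2 by (rule sw_tmap) (intro intros M mm rr mhomD(1)[OF sm c] B)+
  also have "\<dots> = sw M V (\<delta> m) (\<lambda>a b. SW h (\<lambda>x y. sw V V (flip V V (ptens V V b x)) (\<lambda>w' v'. B (\<rho> (ptens M V a w')) (v' \<cdot> y))))"
    unfolding sw_swap_mid[OF M algD(1,1,1) flL c b1] by (rule sw_ptens) (intro intros M m h dc b2)+
  also have "\<dots> = sw M V (\<delta> m) (\<lambda>a b. SW h (\<lambda>x y. B (\<rho> (ptens M V a x)) (b \<cdot> y)))"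
  proof (intro sw_cong refl)
    fix a b x y assume *: "a \<in> carrier M" "b \<in> carrier V" "x \<in> carrier V" "y \<in> carrier V"
    show "sw V V (flip V V (ptens V V b x)) (\<lambda>w' v'. B (\<rho> (ptens M V a w')) (v' \<cdot> y)) = B (\<rho> (ptens M V a x)) (b \<cdot> y)"
      unfolding flp[OF *(2,3)] by (rule sw_ptens) (intro I *)+
  qed
  finally show "sw M V (codiagonal M \<delta> \<rho> (ptens M V m h)) B = sw M V (\<delta> m) (\<lambda>a b. SW h (\<lambda>x y. B (\<rho> (ptens M V a x)) (b \<cdot> y)))" .
qed

text \<open>
  Multiplicativity of the comultiplication, tested on products of functionals: this is the form in
  which the Yang--Baxter equation delivers it. The full strength, for all bilinear forms, is
  \<open>SW_mult\<close>.
\<close>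

definition Delta_multiplicative :: bool where
  "Delta_multiplicative \<longleftrightarrow> (\<forall>a\<in>carrier V. \<forall>b\<in>carrier V. \<forall>f\<in>carrier D. \<forall>g\<in>carrier D.
     SW (a \<cdot> b) (\<lambda>x y. f x * g y) =
     SW a (\<lambda>a\<^sub>1 a\<^sub>2. SW b (\<lambda>b\<^sub>1 b\<^sub>2. f (a\<^sub>1 \<cdot> b\<^sub>1) * g (a\<^sub>2 \<cdot> b\<^sub>2))))"

lemma compatibility_iff:
  "bialgebra_compatibility H \<longleftrightarrow> Delta_multiplicative \<and> Delta H one = ptens V V one one \<and>
     (\<forall>a\<in>carrier V. \<forall>b\<in>carrier V. eps H (a \<cdot> b) = eps H a * eps H b) \<and> normalized_pair H"
  and SW_mult: "bialgebra_compatibility H \<Longrightarrow> a \<in> carrier V \<Longrightarrow> b \<in> carrier V \<Longrightarrow> bilin V V B \<Longrightarrow>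
     SW (a \<cdot> b) B = SW a (\<lambda>a\<^sub>1 a\<^sub>2. SW b (\<lambda>b\<^sub>1 b\<^sub>2. B (a\<^sub>1 \<cdot> b\<^sub>1) (a\<^sub>2 \<cdot> b\<^sub>2)))"
proof -
  let ?X = "codiagonal V (Delta H) (mu H)"
  let ?M = "\<forall>t\<in>carrier (V \<boxtimes> V). Delta H (mu H t) = ?X t"
  note Xm = codiagonal_mhom[OF algD(1) Delta_Lin mu_Lin] and Xs = sw_codiagonal[OF algD(1) Delta_Lin mu_Lin]
  have 1: "SW (a \<cdot> b) B = SW a (\<lambda>a\<^sub>1 a\<^sub>2. SW b (\<lambda>b\<^sub>1 b\<^sub>2. B (a\<^sub>1 \<cdot> b\<^sub>1) (a\<^sub>2 \<cdot> b\<^sub>2)))"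
    if "?M" "a \<in> carrier V" "b \<in> carrier V" "bilin V V B" for a b B
    using Xs[OF that(2-4)] that(1)[THEN bspec, OF tensor_ptens[OF algD(1,1) that(2,3)]] by simp
  have 2: ?M if "Delta_multiplicative"
  proof (rule ballI, rule Lin_tensor_eq[OF algD(1,1) fdvs_tensor[OF algD(1,1)] mhom_compose[OF in_Lin[OF mu_Lin] in_Lin[OF Delta_Lin]] Xm])
    fix a b assume ab: "a \<in> carrier V" "b \<in> carrier V"
    show "Delta H (a \<cdot> b) = ?X (ptens V V a b)"
    proof (rule tensor_eqI_prod[OF algD(1,1) _ mhomD(1)[OF Xm]])
      fix f g assume fg: "f \<in> Lin V ground" "g \<in> Lin V ground"
      have B: "bilin V V (\<lambda>x y. f x * g y)" by (intro intros in_Lin fg)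
      show "SW (a \<cdot> b) (\<lambda>x y. f x * g y) = sw V V (?X (ptens V V a b)) (\<lambda>x y. f x * g y)"
        unfolding Xs[OF ab B] using that ab fg by (simp add: Delta_multiplicative_def dual_carrier)
    qed (use ab in simp_all)
  qed
  have 3: Delta_multiplicative if ?M
    unfolding Delta_multiplicative_def by (intro ballI 1[OF that] intros dual_mhom)
  show "bialgebra_compatibility H \<longleftrightarrow> Delta_multiplicative \<and> Delta H one = ptens V V one one \<and>
     (\<forall>a\<in>carrier V. \<forall>b\<in>carrier V. eps H (a \<cdot> b) = eps H a * eps H b) \<and> normalized_pair H"
    using 2 3 unfolding bialgebra_compatibility_def Let_def codiagonal_def by blast
  show "SW (a \<cdot> b) B = SW a (\<lambda>a\<^sub>1 a\<^sub>2. SW b (\<lambda>b\<^sub>1 b\<^sub>2. B (a\<^sub>1 \<cdot> b\<^sub>1) (a\<^sub>2 \<cdot> b\<^sub>2)))"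
    if "bialgebra_compatibility H" "a \<in> carrier V" "b \<in> carrier V" "bilin V V B"
    using 1[OF _ that(2-4)] that(1) unfolding bialgebra_compatibility_def Let_def codiagonal_def by blast
qed

definition natural_units :: bool where
  "natural_units \<longleftrightarrow> (\<forall>l\<in>carrier D. sigma_bi H (ptens V D one l) = ptens D V l one) \<and>
     (\<forall>h\<in>carrier V. sigma_bi H (ptens V D h (eps H)) = ptens D V (eps H) h)"

text \<open>
  Here \<open>\<sigma>\<^sub>b\<^sub>i (1 \<otimes> l) = l(- 1\<^sub>2) \<otimes> 1\<^sub>1\<close>, and evaluating the functional at \<open>1\<close> recovers the
  coproduct of \<open>1\<close>. Likewise \<open>\<sigma>\<^sub>b\<^sub>i (h \<otimes> \<epsilon>) = \<epsilon>(- h\<^sub>2) \<otimes> h\<^sub>1\<close>, and applying \<open>\<epsilon>\<close> to the vector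
  leaves the functional \<open>a \<mapsto> \<epsilon> (a h)\<close>, to be compared with \<open>\<epsilon>(a) \<epsilon>(h)\<close>.
\<close>

lemma natural_units_iff:
  assumes n: "normalized_pair H"
  shows "natural_units \<longleftrightarrow> Delta H one = ptens V V one one \<and>
     (\<forall>a\<in>carrier V. \<forall>b\<in>carrier V. eps H (a \<cdot> b) = eps H a * eps H b)"
proof
  have e1: "eps H one = 1" using n by (simp add: normalized_pair_def)
  assume N: natural_units
  have "Delta H one = ptens V V one one"
  proof (rule tensor_eqI_prod[OF algD(1,1)])
    fix f g assume f: "f \<in> Lin V ground" and g: "g \<in> Lin V ground"
    have T: "bilin D V (\<lambda>l x. f x * l one)" by (intro intros in_Lin[OF f] eval_mhom)
    have b: "bilin V V (\<lambda>x y. f x * g y)" by (intro intros in_Lin f g)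
    have "SW one (\<lambda>x y. f x * g y) = sw D V (sigma_bi H (ptens V D one g)) (\<lambda>l x. f x * l one)"
      using g by (simp add: sw_sigma_bi[OF _ _ T] dual_carrier)
    also have "\<dots> = f one * g one"
      using N g sw_ptens[OF fdD algD(1) _ _ T] by (simp add: natural_units_def dual_carrier)
    finally show "SW one (\<lambda>x y. f x * g y) = sw V V (ptens V V one one) (\<lambda>x y. f x * g y)"
      by (simp add: sw_ptens[OF algD(1,1) _ _ b])
  qed simp_all
  moreover have "eps H (a \<cdot> b) = eps H a * eps H b" if a: "a \<in> carrier V" and b: "b \<in> carrier V" for a b
  proof -
    have T: "bilin D V (\<lambda>l x. eps H x * l a)" by (intro intros eval_mhom a)
    have "eps H (a \<cdot> b) = SW b (\<lambda>x y. eps H x * eps H (a \<cdot> y))"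
      using counit(1)[OF b, of "\<lambda>y. eps H (a \<cdot> y)"] by (simp add: simps a)
    also have "\<dots> = sw D V (sigma_bi H (ptens V D b (eps H))) (\<lambda>l x. eps H x * l a)"
      by (simp add: sw_sigma_bi[OF _ _ T] a b)
    also have "\<dots> = eps H b * eps H a"
      using N b sw_ptens[OF fdD algD(1) _ _ T] by (simp add: natural_units_def)
    finally show ?thesis by simp
  qed
  ultimately show "Delta H one = ptens V V one one \<and>
     (\<forall>a\<in>carrier V. \<forall>b\<in>carrier V. eps H (a \<cdot> b) = eps H a * eps H b)" by blast
next
  assume *: "Delta H one = ptens V V one one \<and>
     (\<forall>a\<in>carrier V. \<forall>b\<in>carrier V. eps H (a \<cdot> b) = eps H a * eps H b)"
  have "sigma_bi H (ptens V D one l) = ptens D V l one" if l: "l \<in> carrier D" for l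
  proof (rule tensor_eqI[OF fdD algD(1)])
    fix T assume T: "bilin D V T"
    have b: "bilin V V (\<lambda>x y. T (rtrans y l) x)" by (intro intros2 bilinear_intros[OF T] l)
    show "sw D V (sigma_bi H (ptens V D one l)) T = sw D V (ptens D V l one) T"
      using * l by (simp add: sw_sigma_bi T sw_ptens b)
  qed (simp_all add: l)
  moreover have "sigma_bi H (ptens V D h (eps H)) = ptens D V (eps H) h" if h: "h \<in> carrier V" for h
  proof (rule tensor_eqI[OF fdD algD(1)])
    fix T assume T: "bilin D V T"
    have r: "rtrans y (eps H) = eps H y \<odot>\<^bsub>D\<^esub> eps H" if y: "y \<in> carrier V" for y
      by (rule dual_eqI[of _ V]) (use * y module_closed(2)[OF fdvs_module[OF fdD]] in \<open>simp_all add: dual_simps(2)\<close>)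
    have "SW h (\<lambda>x y. T (rtrans y (eps H)) x) = SW h (\<lambda>x y. eps H y * T (eps H) x)"
      by (intro sw_cong refl) (simp add: r mhomD(3)[OF bilinear_mapD(2)[OF T]])
    also have "\<dots> = T (eps H) h" by (rule counit(2)[OF h bilinear_mapD(1)[OF T eps_dual]])
    finally show "sw D V (sigma_bi H (ptens V D h (eps H))) T = sw D V (ptens D V (eps H) h) T"
      by (simp add: sw_sigma_bi T sw_ptens h)
  qed (simp_all add: h)
  ultimately show natural_units by (simp add: natural_units_def)
qed

text \<open>
  The unit created by \<open>\<mu> \<otimes> \<nu>\<close> passes through the dual strand by naturality, so one side involves
  the coproduct of the product \<open>a b\<close> and the other the two coproducts separately.
\<close>

lemma yang_baxter_HHD_iff:
  assumes N: natural_units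
  shows "yang_baxter V V D (sigma_ass_r H) (sigma_bi H) (sigma_bi H) \<longleftrightarrow>
    (\<forall>a\<in>carrier V. \<forall>b\<in>carrier V. \<forall>l\<in>carrier D. \<forall>T. trilin D V V T \<longrightarrow>
      SW (a \<cdot> b) (\<lambda>x y. T (rtrans y l) x one) =
      SW b (\<lambda>b\<^sub>1 b\<^sub>2. SW a (\<lambda>a\<^sub>1 a\<^sub>2. T (rtrans (a\<^sub>2 \<cdot> b\<^sub>2) l) (a\<^sub>1 \<cdot> b\<^sub>1) one)))"
  unfolding yang_baxter_iff[OF algD(1,1) fdD sigma_ass_r_Lin[OF alg] sigma_bi_Lin sigma_bi_Lin]
proof (intro ball_cong refl all_cong, goal_cases)
  case (1 a b l T)
  note T = trilin_compose[OF 1(4)]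
  note I = intros2 T 1(1-3)
  have b1: "bilin D V (\<lambda>w v. T w v u)" if "u \<in> carrier V" for u by (intro I that)
  have b2: "bilin D V (\<lambda>w u. sw D V (sigma_bi H (ptens V D v w)) (\<lambda>w v. T w v u))" if "v \<in> carrier V" for v by (intro I that)
  have b3: "bilin V V (\<lambda>v u. sw D V (sigma_bi H (ptens V D u l)) (\<lambda>w1 u2. sw D V (sigma_bi H (ptens V D v w1)) (\<lambda>w2 v2. T w2 v2 u2)))"
    by (intro I)
  have b4: "bilin V V (\<lambda>v u. T w v u)" if "w \<in> carrier D" for w by (intro I that)
  have b5: "bilin D V (\<lambda>w u. T w (u \<cdot> v) one)" if "v \<in> carrier V" for v by (intro I that)
  have b6: "bilin D V (\<lambda>w v. SW a (\<lambda>x y. T (rtrans y w) (x \<cdot> v) one))" by (intro I)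
  have "sw V V (sigma_ass_r H (ptens V V a b)) (\<lambda>v1 u1. sw D V (sigma_bi H (ptens V D u1 l)) (\<lambda>w1 u2.
        sw D V (sigma_bi H (ptens V D v1 w1)) (\<lambda>w2 v2. T w2 v2 u2))) =
      SW (a \<cdot> b) (\<lambda>x y. T (rtrans y l) x one)"
  proof -
    have n: "sigma_bi H (ptens V D one l) = ptens D V l one" using N 1(3) by (simp add: natural_units_def)
    have "sw V V (sigma_ass_r H (ptens V V a b)) (\<lambda>v1 u1. sw D V (sigma_bi H (ptens V D u1 l)) (\<lambda>w1 u2.
        sw D V (sigma_bi H (ptens V D v1 w1)) (\<lambda>w2 v2. T w2 v2 u2))) =
        sw D V (ptens D V l one) (\<lambda>w u. sw D V (sigma_bi H (ptens V D (a \<cdot> b) w)) (\<lambda>w v. T w v u))"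
      unfolding sigma_ass_r_ptens[OF alg 1(1,2)] n[symmetric] by (rule sw_ptens) (intro I b3)+
    also have "\<dots> = sw D V (sigma_bi H (ptens V D (a \<cdot> b) l)) (\<lambda>w v. T w v one)"
      by (rule sw_ptens) (intro I b2)+
    also have "\<dots> = SW (a \<cdot> b) (\<lambda>x y. T (rtrans y l) x one)"
      by (rule sw_sigma_bi) (intro I b1)+
    finally show ?thesis .
  qed
  moreover have "sw D V (sigma_bi H (ptens V D b l)) (\<lambda>w1 v1. sw D V (sigma_bi H (ptens V D a w1)) (\<lambda>w2 u1.
        sw V V (sigma_ass_r H (ptens V V u1 v1)) (\<lambda>v2 u2. T w2 v2 u2))) =
      SW b (\<lambda>b\<^sub>1 b\<^sub>2. SW a (\<lambda>a\<^sub>1 a\<^sub>2. T (rtrans (a\<^sub>2 \<cdot> b\<^sub>2) l) (a\<^sub>1 \<cdot> b\<^sub>1) one))"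
    using 1 by (simp add: sigma_ass_r_ptens[OF alg] sw_ptens[OF _ _ _ _ b4]
      sw_sigma_bi[OF _ _ b5] sw_sigma_bi[OF _ _ b6])
  ultimately show ?case by simp
qed

text \<open>
  The unit \<open>\<epsilon>\<close> created by the braiding of the dual algebra passes through \<open>H\<close> by naturality. On
  one side the two functionals are translated separately by the last two legs of the coproduct of
  \<open>h\<close> and then multiplied, on the other the product is translated.
\<close>

lemma yang_baxter_HDD_iff:
  assumes N: natural_units
  shows "yang_baxter V D D (sigma_bi H) (sigma_bi H) (sigma_ass (dual_bialg H)) \<longleftrightarrow>
    (\<forall>h\<in>carrier V. \<forall>l\<in>carrier D. \<forall>m\<in>carrier D. \<forall>T. trilin D D V T \<longrightarrow>
      SW h (\<lambda>a b. SW a (\<lambda>x y. T (eps H) (rtrans b l \<star> rtrans y m) x)) =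
      SW h (\<lambda>a b. T (eps H) (rtrans b (l \<star> m)) a))"
proof -
  note alg' = unital_algebra_dual
  note sL = sigma_ass_Lin[OF alg', simplified dual_bialg_simps]
  note sp = sigma_ass_ptens[OF alg', simplified dual_bialg_simps, simplified]
  show ?thesis
  unfolding yang_baxter_iff[OF algD(1) fdD fdD sigma_bi_Lin sigma_bi_Lin sL]
  proof (intro ball_cong refl all_cong, goal_cases)
    case (1 h l m T)
    note T = trilin_compose[OF 1(4)]
    note I = intros2 T 1(1-3) in_Lin[OF sL] mhom_compose[OF _ in_Lin[OF sL]] dprd_mhom dprd_closed
    have b1: "bilin D D (\<lambda>w v. T w v u)" if "u \<in> carrier V" for u by (intro I that)
    have b2: "bilin D V (\<lambda>w u. T (eps H) (v \<star> w) u)" if "v \<in> carrier D" for v by (intro I that)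
    have b3: "bilin D V (\<lambda>w u. SW u (\<lambda>x y. T (eps H) (w \<star> rtrans y m) x))" by (intro I)
    have b4: "bilin D D (\<lambda>w1 v1. sw D V (sigma_bi H (ptens V D h w1)) (\<lambda>w2 u1. sw D V (sigma_bi H (ptens V D u1 v1)) (\<lambda>v2 u2. T w2 v2 u2)))"
      by (intro I)
    have b5: "bilin D V (\<lambda>w2 u1. sw D V (sigma_bi H (ptens V D u1 v1)) (\<lambda>v2 u2. T w2 v2 u2))" if "v1 \<in> carrier D" for v1 by (intro I that)
    have b6: "bilin D V (\<lambda>w u. T (eps H) w u)" by (intro I)
    have "sw D V (sigma_bi H (ptens V D h l)) (\<lambda>v1 u1. sw D V (sigma_bi H (ptens V D u1 m)) (\<lambda>w1 u2.
        sw D D (sigma_ass (dual_bialg H) (ptens D D v1 w1)) (\<lambda>w2 v2. T w2 v2 u2))) =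
      SW h (\<lambda>a b. SW a (\<lambda>x y. T (eps H) (rtrans b l \<star> rtrans y m) x))"
      using 1 by (simp add: sp sw_ptens[OF _ _ _ _ b1] sw_sigma_bi[OF _ _ b2] sw_sigma_bi[OF _ _ b3])
    moreover have "sw D D (sigma_ass (dual_bialg H) (ptens D D l m)) (\<lambda>w1 v1. sw D V (sigma_bi H (ptens V D h w1)) (\<lambda>w2 u1.
        sw D V (sigma_bi H (ptens V D u1 v1)) (\<lambda>v2 u2. T w2 v2 u2))) = SW h (\<lambda>a b. T (eps H) (rtrans b (l \<star> m)) a)"
      using 1 N by (simp add: sp sw_ptens[OF _ _ _ _ b4] natural_units_def sw_ptens[OF _ _ _ _ b5] sw_sigma_bi[OF _ _ b6])
    ultimately show ?case by simp
  qed
qed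

text \<open>
  Multiplicativity of the comultiplication read in the dual algebra: at \<open>a\<close> the left-hand product
  is \<open>l (a\<^sub>2 c\<^sub>2) m (a\<^sub>1 c\<^sub>1)\<close>, which is the value of \<open>l \<star> m\<close> at \<open>a c\<close>. The functional \<open>g\<close> is
  arbitrary so that the identity can be used inside further Sweedler sums.
\<close>

lemma rtrans_dprd:
  assumes C: "bialgebra_compatibility H" and c: "c \<in> carrier V" and l: "l \<in> carrier D" and m: "m \<in> carrier D"
    and g: "g \<in> mhom D ground"
  shows "SW c (\<lambda>y z. g (rtrans z l \<star> rtrans y m)) = g (rtrans c (l \<star> m))"
proof -
  have "SW c (\<lambda>y z. g (rtrans z l \<star> rtrans y m)) =
      SW c (\<lambda>y z. \<Sum>a\<in>bas V. SW a (\<lambda>a\<^sub>1 a\<^sub>2. l (a\<^sub>2 \<cdot> z) * m (a\<^sub>1 \<cdot> y)) * g (coo V a))"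
  proof (intro sw_cong refl)
    fix y z assume "y \<in> carrier V" "z \<in> carrier V"
    then show "g (rtrans z l \<star> rtrans y m) = (\<Sum>a\<in>bas V. SW a (\<lambda>a\<^sub>1 a\<^sub>2. l (a\<^sub>2 \<cdot> z) * m (a\<^sub>1 \<cdot> y)) * g (coo V a))"
      using dual_functional_expand[OF algD(1) g, of "rtrans z l \<star> rtrans y m"] l m dprd_closed[of "rtrans z l" "rtrans y m"]
      by (simp add: bas_carrier dual_carrier[symmetric])
  qed
  also have "\<dots> = (\<Sum>a\<in>bas V. SW a (\<lambda>a\<^sub>1 a\<^sub>2. SW c (\<lambda>y z. l (a\<^sub>2 \<cdot> z) * m (a\<^sub>1 \<cdot> y))) * g (coo V a))"
    by (simp add: sw_sum sw_mult1 sw_swap[of _ _ "Delta H c"])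
  also have "\<dots> = (\<Sum>a\<in>bas V. (l \<star> m) (a \<cdot> c) * g (coo V a))"
  proof (rule sum.cong[OF refl])
    fix a assume "a \<in> bas V"
    then have a: "a \<in> carrier V" by (rule bas_carrier)
    have b: "bilin V V (\<lambda>x y. l y * m x)" by (intro intros dual_mhom l m)
    show "SW a (\<lambda>a\<^sub>1 a\<^sub>2. SW c (\<lambda>y z. l (a\<^sub>2 \<cdot> z) * m (a\<^sub>1 \<cdot> y))) * g (coo V a) = (l \<star> m) (a \<cdot> c) * g (coo V a)"
      using SW_mult[OF C a c b] a c l m by simp
  qed
  also have "\<dots> = g (rtrans c (l \<star> m))"
    using dual_functional_expand[OF algD(1) g, of "rtrans c (l \<star> m)"] rtrans_closed[OF c dprd_closed[OF l m]]
    by (simp add: bas_carrier dual_carrier[symmetric])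
  finally show ?thesis .
qed

text \<open>
  Given naturality, each of the two equations has to be matched with \<open>Delta_multiplicative\<close>. For
  the equation on two copies of \<open>H\<close> the rule \<open>SW_mult\<close> gives one direction at once; the other
  three implications are obtained from well-chosen test forms, or by coassociativity and
  \<open>rtrans_dprd\<close>.
\<close>

lemma compatibility_iff_yang_baxter:
  assumes n: "normalized_pair H"
  shows "yang_baxter V V D (sigma_ass_r H) (sigma_bi H) (sigma_bi H) \<and> natural_units \<longleftrightarrow> bialgebra_compatibility H"
    and "yang_baxter V D D (sigma_bi H) (sigma_bi H) (sigma_ass (dual_bialg H)) \<and> natural_units \<longleftrightarrow> bialgebra_compatibility H"
proof -
  have e1: "eps H one = 1" using n by (simp add: normalized_pair_def)
  have N: natural_units if "bialgebra_compatibility H"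
    using that natural_units_iff[OF n] compatibility_iff by blast
  have C: "bialgebra_compatibility H" if natural_units Delta_multiplicative
    using that natural_units_iff[OF n] compatibility_iff n by blast
  show "yang_baxter V V D (sigma_ass_r H) (sigma_bi H) (sigma_bi H) \<and> natural_units \<longleftrightarrow> bialgebra_compatibility H"
  proof (intro iffI conjI)
    assume *: "yang_baxter V V D (sigma_ass_r H) (sigma_bi H) (sigma_bi H) \<and> natural_units"
    have Delta_multiplicative unfolding Delta_multiplicative_def
    proof (intro ballI)
      fix a b f g assume ab: "a \<in> carrier V" "b \<in> carrier V" and fg: "f \<in> carrier D" "g \<in> carrier D"
      (* Evaluating at 1 turns the translate of g by y into g y, and the counit absorbs the leg
         that carries the unit. *)
      have T: "trilin D V V (\<lambda>l x y. f x * l one * eps H y)" by (intro trilinI intros dual_mhom eval_mhom fg)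
      let ?T = "\<lambda>l x y. f x * l one * eps H y"
      have "SW (a \<cdot> b) (\<lambda>x y. ?T (rtrans y g) x one) =
          SW b (\<lambda>b\<^sub>1 b\<^sub>2. SW a (\<lambda>a\<^sub>1 a\<^sub>2. ?T (rtrans (a\<^sub>2 \<cdot> b\<^sub>2) g) (a\<^sub>1 \<cdot> b\<^sub>1) one))"
        using * ab fg T yang_baxter_HHD_iff by blast
      then have "SW (a \<cdot> b) (\<lambda>x y. f x * g y) = SW b (\<lambda>b\<^sub>1 b\<^sub>2. SW a (\<lambda>a\<^sub>1 a\<^sub>2. f (a\<^sub>1 \<cdot> b\<^sub>1) * g (a\<^sub>2 \<cdot> b\<^sub>2)))"
        by (simp add: e1)
      then show "SW (a \<cdot> b) (\<lambda>x y. f x * g y) = SW a (\<lambda>a\<^sub>1 a\<^sub>2. SW b (\<lambda>b\<^sub>1 b\<^sub>2. f (a\<^sub>1 \<cdot> b\<^sub>1) * g (a\<^sub>2 \<cdot> b\<^sub>2)))"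
        by (simp add: sw_swap[of _ _ "Delta H b"])
    qed
    with * C show "bialgebra_compatibility H" by blast
  next
    assume B: "bialgebra_compatibility H"
    show "yang_baxter V V D (sigma_ass_r H) (sigma_bi H) (sigma_bi H)"
      unfolding yang_baxter_HHD_iff[OF N[OF B]]
    proof (intro ballI allI impI)
      fix a b l T assume ab: "a \<in> carrier V" "b \<in> carrier V" and l: "l \<in> carrier D" and T: "trilin D V V T"
      have b: "bilin V V (\<lambda>x y. T (rtrans y l) x one)" by (intro intros2 trilin_compose[OF T] l)
      show "SW (a \<cdot> b) (\<lambda>x y. T (rtrans y l) x one) =
        SW b (\<lambda>b\<^sub>1 b\<^sub>2. SW a (\<lambda>a\<^sub>1 a\<^sub>2. T (rtrans (a\<^sub>2 \<cdot> b\<^sub>2) l) (a\<^sub>1 \<cdot> b\<^sub>1) one))"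
        using SW_mult[OF B ab b] by (simp add: sw_swap[of _ _ "Delta H b"])
    qed
  qed (rule N)
  show "yang_baxter V D D (sigma_bi H) (sigma_bi H) (sigma_ass (dual_bialg H)) \<and> natural_units \<longleftrightarrow> bialgebra_compatibility H"
  proof (intro iffI conjI)
    assume *: "yang_baxter V D D (sigma_bi H) (sigma_bi H) (sigma_ass (dual_bialg H)) \<and> natural_units"
    have Delta_multiplicative unfolding Delta_multiplicative_def
    proof (intro ballI)
      fix a b f g assume ab: "a \<in> carrier V" "b \<in> carrier V" and fg: "f \<in> carrier D" "g \<in> carrier D"
      (* The leg w is the unit of the dual and is absorbed by evaluation at 1; the counit removes the
         remaining vector, and the product of functionals is evaluated at a. *)
      let ?T = "\<lambda>w v u. eps H u * (w one * v a)"
      have T: "trilin D D V ?T" by (intro trilinI intros eval_mhom ab)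
      have L: "(\<lambda>h. SW a (\<lambda>a\<^sub>1 a\<^sub>2. g (a\<^sub>2 \<cdot> z) * f (a\<^sub>1 \<cdot> h))) \<in> mhom V ground" if "z \<in> carrier V" for z
        by (intro intros dual_compose[OF fg(1)] that)
      have "SW b (\<lambda>x y. SW x (\<lambda>p q. ?T (eps H) (rtrans y g \<star> rtrans q f) p)) = SW b (\<lambda>x y. ?T (eps H) (rtrans y (g \<star> f)) x)"
        using * ab fg T yang_baxter_HDD_iff by blast
      moreover have "SW b (\<lambda>x y. SW x (\<lambda>p q. ?T (eps H) (rtrans y g \<star> rtrans q f) p)) =
        SW b (\<lambda>x y. SW a (\<lambda>a\<^sub>1 a\<^sub>2. g (a\<^sub>2 \<cdot> y) * f (a\<^sub>1 \<cdot> x)))"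
        using ab fg counit(1)[OF _ L] by (simp add: e1)
      moreover have "SW b (\<lambda>x y. ?T (eps H) (rtrans y (g \<star> f)) x) = (g \<star> f) (a \<cdot> b)"
        using ab fg counit(1)[OF ab(2) dual_compose[OF dprd_closed[OF fg(2,1)] prd_mhom(2)[OF ab(1) mhom_id]]]
        by (simp add: e1)
      ultimately show "SW (a \<cdot> b) (\<lambda>x y. f x * g y) = SW a (\<lambda>a\<^sub>1 a\<^sub>2. SW b (\<lambda>b\<^sub>1 b\<^sub>2. f (a\<^sub>1 \<cdot> b\<^sub>1) * g (a\<^sub>2 \<cdot> b\<^sub>2)))"
        using ab fg by (simp add: sw_swap[of _ _ "Delta H b"] mult.commute)
    qed
    with * C show "bialgebra_compatibility H" by blast
  next
    assume B: "bialgebra_compatibility H"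
    show "yang_baxter V D D (sigma_bi H) (sigma_bi H) (sigma_ass (dual_bialg H))"
      unfolding yang_baxter_HDD_iff[OF N[OF B]]
    proof (intro ballI allI impI)
      fix h l m T assume h: "h \<in> carrier V" and l: "l \<in> carrier D" and m: "m \<in> carrier D" and T: "trilin D D V T"
      have t: "trilin V V V (\<lambda>x y z. T (eps H) (rtrans z l \<star> rtrans y m) x)"
        by (intro trilinI intros2 trilin_compose[OF T] dprd_mhom dprd_closed l m)
      have "SW h (\<lambda>a b. SW a (\<lambda>x y. T (eps H) (rtrans b l \<star> rtrans y m) x)) =
        SW h (\<lambda>x c. SW c (\<lambda>y z. T (eps H) (rtrans z l \<star> rtrans y m) x))"
        by (rule coassoc[OF h t])
      also have "\<dots> = SW h (\<lambda>x c. T (eps H) (rtrans c (l \<star> m)) x)"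
        by (intro sw_cong refl rtrans_dprd[OF B _ l m]) (assumption, intro intros2 trilin_compose[OF T])
      finally show "SW h (\<lambda>a b. SW a (\<lambda>x y. T (eps H) (rtrans b l \<star> rtrans y m) x)) =
        SW h (\<lambda>a b. T (eps H) (rtrans b (l \<star> m)) a)" .
    qed
  qed (rule N)
qed

end

section \<open>Invertibility of the braiding and the antipode\<close>

text \<open>
  The chosen inverse agrees with the linear one that invertibility provides, and is therefore
  linear.
\<close>

lemma inverse_map_props:
  assumes f: "invertible_map V W f"
  shows "inverse_map V W f \<in> Lin W V" "v \<in> carrier V \<Longrightarrow> inverse_map V W f (f v) = v"
    "w \<in> carrier W \<Longrightarrow> f (inverse_map V W f w) = w" "f \<in> Lin V W"
    "v \<in> carrier V \<Longrightarrow> f v \<in> carrier W" "w \<in> carrier W \<Longrightarrow> inverse_map V W f w \<in> carrier V"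
    "f \<in> mhom V W" "inverse_map V W f \<in> mhom W V"
proof -
  obtain g where g: "g \<in> Lin W V" "\<forall>v\<in>carrier V. g (f v) = v" "\<forall>w\<in>carrier W. f (g w) = w" and f': "f \<in> Lin V W"
    using f by (auto simp: invertible_map_def)
  have inj: "inj_on f (carrier V)" using g(2) by (metis inj_onI)
  have "inverse_map V W f = g"
  proof (rule extensionalityI[of _ "carrier W"])
    show "inverse_map V W f w = g w" if "w \<in> carrier W" for w
      using that inv_into_f_f[OF inj Lin_closed[OF g(1) that]] g(3) by (simp add: inverse_map_def)
  qed (use g(1) in \<open>auto simp: inverse_map_def Lin_def\<close>)
  then show "inverse_map V W f \<in> Lin W V" "v \<in> carrier V \<Longrightarrow> inverse_map V W f (f v) = v"
    "w \<in> carrier W \<Longrightarrow> f (inverse_map V W f w) = w" "f \<in> Lin V W"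
    "v \<in> carrier V \<Longrightarrow> f v \<in> carrier W" "w \<in> carrier W \<Longrightarrow> inverse_map V W f w \<in> carrier V"
    "f \<in> mhom V W" "inverse_map V W f \<in> mhom W V"
    using g f' by (auto intro: Lin_closed)
qed

lemma invertible_inverse_map: "invertible_map V W f \<Longrightarrow> invertible_map W V (inverse_map V W f)"
  using inverse_map_props[of V W f] unfolding invertible_map_def by blast

context algebra_coalgebra
begin

lemma antipode_iff:
  "antipode H s \<longleftrightarrow> s \<in> Lin V V \<and> (\<forall>h\<in>carrier V. \<forall>f\<in>carrier D.
     SW h (\<lambda>a b. f (s a \<cdot> b)) = eps H h * f one \<and> SW h (\<lambda>a b. f (a \<cdot> s b)) = eps H h * f one)"
proof (cases "s \<in> Lin V V")
  case True
  note sm = in_Lin[OF True]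
  have *: "mu H (tmap V V V V p q (Delta H h)) = nu H (eps H h) \<longleftrightarrow>
      (\<forall>f\<in>carrier D. SW h (\<lambda>a b. f (p a \<cdot> q b)) = eps H h * f one)"
    if h: "h \<in> carrier V" and p: "p \<in> mhom V V" and q: "q \<in> mhom V V" for h p q
  proof -
    let ?t = "tmap V V V V p q (Delta H h)"
    have t: "?t \<in> carrier (V \<boxtimes> V)" by (rule Lin_closed[OF tmap_Lin]) (intro intros p q h)+
    have e: "f (mu H ?t) = SW h (\<lambda>a b. f (p a \<cdot> q b))" if f: "f \<in> carrier D" for f
    proof -
      have b: "bilin V V (\<lambda>a b. f (a \<cdot> b))"
        by (intro bilinear_mapI dual_compose[OF f] intros)
      have "f (mu H ?t) = sw V V ?t (\<lambda>a b. f (a \<cdot> b))"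
        by (rule functional_sw[OF algD(1,1) mhom_compose[OF in_Lin[OF mu_Lin] dual_mhom[OF f]] t])
      also have "\<dots> = SW h (\<lambda>a b. f (p a \<cdot> q b))"
        by (rule sw_tmap) (intro intros p q h b)+
      finally show ?thesis .
    qed
    have "mu H ?t = nu H (eps H h) \<longleftrightarrow> (\<forall>f\<in>carrier D. f (mu H ?t) = f (nu H (eps H h)))"
      using vec_eqI[OF algD(1) Lin_closed[OF mu_Lin t] algD(2)] by (auto simp: dual_carrier)
    also have "\<dots> \<longleftrightarrow> (\<forall>f\<in>carrier D. SW h (\<lambda>a b. f (p a \<cdot> q b)) = eps H h * f one)"
      using functional_nu[OF alg dual_mhom] e by auto
    finally show ?thesis .
  qed
  show ?thesis
    using *[OF _ sm mhom_id] *[OF _ mhom_id sm] True unfolding antipode_def Let_def by auto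
qed (simp add: antipode_def Let_def)

text \<open>
  The candidate inverse \<open>l \<otimes> h \<mapsto> h\<^sub>1 \<otimes> l(- s h\<^sub>2)\<close> of the braiding.
\<close>

definition theta :: "('h \<Rightarrow> 'h) \<Rightarrow> ('k, 'h \<Rightarrow> 'k, 'h) tensor \<Rightarrow> ('k, 'h, 'h \<Rightarrow> 'k) tensor" where
  "theta s = tlift D V (V \<boxtimes> D) (\<lambda>l h. tlift V V (V \<boxtimes> D) (\<lambda>a b. ptens V D a (rtrans (s b) l)) (Delta H h))"

lemma theta_props:
  assumes s: "s \<in> Lin V V"
  shows theta_Lin: "theta s \<in> Lin (D \<boxtimes> V) (V \<boxtimes> D)"
    and sw_theta: "l \<in> carrier D \<Longrightarrow> h \<in> carrier V \<Longrightarrow> bilin V D B \<Longrightarrow>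
      sw V D (theta s (ptens D V l h)) B = SW h (\<lambda>a b. B a (rtrans (s b) l))"
proof -
  note sm = in_Lin[OF s] and sc = Lin_closed[OF s]
  have X: "fdvs (V \<boxtimes> D)" by (intro intros)
  have b1: "bilinear_map V V (V \<boxtimes> D) (\<lambda>a b. ptens V D a (rtrans (s b) l))" if "l \<in> carrier D" for l
    by (intro intros2 that sm sc)
  have b2: "bilinear_map D V (V \<boxtimes> D) (\<lambda>l h. tlift V V (V \<boxtimes> D) (\<lambda>a b. ptens V D a (rtrans (s b) l)) (Delta H h))"
  proof (rule bilinear_mapI)
    show "(\<lambda>h. tlift V V (V \<boxtimes> D) (\<lambda>a b. ptens V D a (rtrans (s b) l)) (Delta H h)) \<in> mhom V (V \<boxtimes> D)" if "l \<in> carrier D" for l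
      by (rule mhom_tlift_left[OF algD(1,1) X b1[OF that] Delta_mhom(2)])
    show "(\<lambda>l. tlift V V (V \<boxtimes> D) (\<lambda>a b. ptens V D a (rtrans (s b) l)) (Delta H h)) \<in> mhom D (V \<boxtimes> D)" if h: "h \<in> carrier V" for h
      by (rule mhom_tlift_right[OF algD(1,1) X fdD Delta_closed[OF h] b1]) (assumption, intro intros2 sc)
  qed
  show "theta s \<in> Lin (D \<boxtimes> V) (V \<boxtimes> D)"
    unfolding theta_def by (rule tlift_Lin[OF fdD algD(1) X b2])
  assume l: "l \<in> carrier D" and h: "h \<in> carrier V" and B: "bilin V D B"
  show "sw V D (theta s (ptens D V l h)) B = SW h (\<lambda>a b. B a (rtrans (s b) l))"
    unfolding theta_def tlift_ptens[OF fdD algD(1) X b2 l h]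
      functional_tlift[OF algD(1,1) X b1[OF l] sw_mhom_left[OF algD(1) fdD] Delta_closed[OF h]]
    by (intro sw_cong refl sw_ptens intros2 sc l B)
qed

text \<open>
  Composing with \<open>theta s\<close> in either order gives \<open>h\<^sub>1 \<otimes> l(- s(h\<^sub>2) h\<^sub>3)\<close> and
  \<open>l(- h\<^sub>2 s(h\<^sub>3)) \<otimes> h\<^sub>1\<close>; each antipode identity cancels one of them.
\<close>

lemma antipode_invertible:
  assumes a: "antipode H s"
  shows "invertible_map (V \<boxtimes> D) (D \<boxtimes> V) (sigma_bi H)"
proof -
  have s: "s \<in> Lin V V" and s1: "\<And>h f. h \<in> carrier V \<Longrightarrow> f \<in> carrier D \<Longrightarrow> SW h (\<lambda>a b. f (s a \<cdot> b)) = eps H h * f one"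
    and s2: "\<And>h f. h \<in> carrier V \<Longrightarrow> f \<in> carrier D \<Longrightarrow> SW h (\<lambda>a b. f (a \<cdot> s b)) = eps H h * f one"
    using a antipode_iff by auto
  note sm = in_Lin[OF s] mhom_compose[OF _ in_Lin[OF s]] and sc = Lin_closed[OF s]
  note tm = in_Lin[OF theta_Lin[OF s]] and tc = Lin_closed[OF theta_Lin[OF s]]
  (* The functionals to which the antipode identities are applied below. *)
  have rD: "(\<lambda>x\<in>carrier V. g (rtrans x l)) \<in> carrier D" if "g \<in> mhom D ground" "l \<in> carrier D" for g l
    by (intro dual_restrictI mhom_compose[OF rtrans_mhom(1) that(1)] that intros)
  have 1: "theta s (sigma_bi H (ptens V D h l)) = ptens V D h l" if h: "h \<in> carrier V" and l: "l \<in> carrier D" for h l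
  proof (rule tensor_eqI[OF algD(1) fdD])
    fix B assume B: "bilin V D B"
    note I = intros2 bilinear_intros[OF B] h l sm sc
    have b1: "bilin D V (\<lambda>l h. sw V D (theta s (ptens D V l h)) B)"
      by (intro I tm mhom_compose[OF _ tm])
    have T: "trilin V V V (\<lambda>x y z. B x (rtrans (s y \<cdot> z) l))" by (intro trilinI I)
    have "sw V D (theta s (sigma_bi H (ptens V D h l))) B =
        sw D V (sigma_bi H (ptens V D h l)) (\<lambda>l h. sw V D (theta s (ptens D V l h)) B)"
      by (rule functional_sw[OF fdD algD(1) mhom_compose[OF tm sw_mhom_left[OF algD(1) fdD]]]) (intro I)
    also have "\<dots> = SW h (\<lambda>a b. SW a (\<lambda>x y. B x (rtrans (s y \<cdot> b) l)))"
      unfolding sw_sigma_bi[OF h l b1] by (simp add: sw_theta[OF s _ _ B] l sc)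
    also have "\<dots> = SW h (\<lambda>x c. SW c (\<lambda>y z. B x (rtrans (s y \<cdot> z) l)))" by (rule coassoc[OF h T])
    also have "\<dots> = SW h (\<lambda>x c. eps H c * B x l)"
    proof (intro sw_cong refl)
      fix x c assume x: "x \<in> carrier V" and c: "c \<in> carrier V"
      show "SW c (\<lambda>y z. B x (rtrans (s y \<cdot> z) l)) = eps H c * B x l"
        using s1[OF c rD[OF bilinear_mapD(1)[OF B x] l]] by (simp add: sc l)
    qed
    also have "\<dots> = B h l" by (rule counit(2)[OF h bilinear_mapD(2)[OF B l]])
    finally show "sw V D (theta s (sigma_bi H (ptens V D h l))) B = sw V D (ptens V D h l) B"
      by (simp add: sw_ptens h l B)
  qed (intro intros2 tc h l)+
  have 2: "sigma_bi H (theta s (ptens D V l h)) = ptens D V l h" if h: "h \<in> carrier V" and l: "l \<in> carrier D" for h l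
  proof (rule tensor_eqI[OF fdD algD(1)])
    fix B assume B: "bilin D V B"
    note I = intros2 bilinear_intros[OF B] h l sm sc
    have b1: "bilin V D (\<lambda>h l. sw D V (sigma_bi H (ptens V D h l)) B)" by (intro I)
    have T: "trilin V V V (\<lambda>x y z. B (rtrans (y \<cdot> s z) l) x)" by (intro trilinI I)
    have "sw D V (sigma_bi H (theta s (ptens D V l h))) B =
        sw V D (theta s (ptens D V l h)) (\<lambda>h l. sw D V (sigma_bi H (ptens V D h l)) B)"
      by (rule functional_sw[OF algD(1) fdD mhom_compose[OF sigma_bi_mhom(1) sw_mhom_left[OF fdD algD(1)]]]) (intro I tc)
    also have "\<dots> = SW h (\<lambda>a b. SW a (\<lambda>x y. B (rtrans (y \<cdot> s b) l) x))"
      unfolding sw_theta[OF s l h b1] by (simp add: sw_sigma_bi[OF _ _ B] l sc)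
    also have "\<dots> = SW h (\<lambda>x c. SW c (\<lambda>y z. B (rtrans (y \<cdot> s z) l) x))" by (rule coassoc[OF h T])
    also have "\<dots> = SW h (\<lambda>x c. eps H c * B l x)"
    proof (intro sw_cong refl)
      fix x c assume x: "x \<in> carrier V" and c: "c \<in> carrier V"
      show "SW c (\<lambda>y z. B (rtrans (y \<cdot> s z) l) x) = eps H c * B l x"
        using s2[OF c rD[OF bilinear_mapD(2)[OF B x] l]] by (simp add: sc l)
    qed
    also have "\<dots> = B l h" by (rule counit(2)[OF h bilinear_mapD(1)[OF B l]])
    finally show "sw D V (sigma_bi H (theta s (ptens D V l h))) B = sw D V (ptens D V l h) B"
      by (simp add: sw_ptens h l B)
  qed (intro intros2 tc h l)+
  show ?thesis unfolding invertible_map_def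
  proof (intro conjI bexI[of _ "theta s"] ballI)
    show "theta s (sigma_bi H t) = t" if "t \<in> carrier (V \<boxtimes> D)" for t
      by (rule Lin_tensor_eq[OF algD(1) fdD _ mhom_compose[OF sigma_bi_mhom(1) tm] mhom_id _ that]) (intro intros, simp add: 1)
    show "sigma_bi H (theta s t) = t" if "t \<in> carrier (D \<boxtimes> V)" for t
      by (rule Lin_tensor_eq[OF fdD algD(1) _ mhom_compose[OF tm sigma_bi_mhom(1)] mhom_id _ that]) (intro intros, simp add: 2)
  qed (rule sigma_bi_Lin theta_Lin[OF s])+
qed

text \<open>
  The functional \<open>l(b -)\<close>. Left translation commutes with right translation, hence with the
  braiding, which translates on the right.
\<close>

definition ltrans :: "'h \<Rightarrow> ('h \<Rightarrow> 'k) \<Rightarrow> ('h \<Rightarrow> 'k)" where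
  "ltrans b l = (\<lambda>x\<in>carrier V. l (b \<cdot> x))"

lemma ltrans_apply [simp]: "x \<in> carrier V \<Longrightarrow> ltrans b l x = l (b \<cdot> x)"
  by (simp add: ltrans_def)

lemma ltrans_closed [simp]: "b \<in> carrier V \<Longrightarrow> l \<in> carrier D \<Longrightarrow> ltrans b l \<in> carrier D"
  unfolding ltrans_def by (intro dual_restrictI dual_compose[of l V "\<lambda>x. b \<cdot> x"] intros)

lemma ltrans_mhom: "b \<in> carrier V \<Longrightarrow> g \<in> mhom X D \<Longrightarrow> (\<lambda>x. ltrans b (g x)) \<in> mhom X D"
proof -
  have "ltrans b \<in> mhom D D" if b: "b \<in> carrier V" for b
    by (rule mhom_dualI) (use b in \<open>auto intro!: eval_mhom\<close>)
  then show ?thesis if "b \<in> carrier V" "g \<in> mhom X D" using mhom_compose[OF that(2)] that(1) by blast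
qed

lemma rtrans_ltrans:
  "a \<in> carrier V \<Longrightarrow> b \<in> carrier V \<Longrightarrow> l \<in> carrier D \<Longrightarrow> ltrans b (rtrans a l) = rtrans a (ltrans b l)"
  by (rule dual_eqI[of _ V]) simp_all

text \<open>
  Let \<open>\<theta>\<close> be the inverse of the braiding and \<open>K l h\<close> the result of applying the counit of \<open>H\<close> and
  evaluation at \<open>1\<close> to \<open>\<theta> (l \<otimes> h)\<close>. If there is an antipode, \<open>K l h = l(s(h))\<close>; this is now taken
  as the definition of \<open>s\<close>. Applying the same form to \<open>\<theta> \<sigma>\<^sub>b\<^sub>i (h \<otimes> l) = h \<otimes> l\<close> gives
  \<open>l(s(h\<^sub>1) h\<^sub>2) = \<epsilon>(h) l(1)\<close>.

  For the other antipode identity \<open>K\<close> must determine all of \<open>\<theta>\<close>, as it does because \<open>\<theta>\<close> commutes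
  with left translation of functionals and with splitting off the first leg of the coproduct of
  the vector: the value of \<open>f \<otimes> b\<close> on \<open>\<theta> (l \<otimes> h)\<close> is \<open>f(h\<^sub>1) K (l(b -)) h\<^sub>2\<close>. Now \<open>\<epsilon>(h) l(1)\<close> is
  obtained from \<open>l \<otimes> h = \<sigma>\<^sub>b\<^sub>i \<theta> (l \<otimes> h)\<close>, where the form used on the left becomes the evaluation
  pairing of \<open>\<theta> (l \<otimes> h)\<close> on the right, and hence \<open>l(h\<^sub>1 s(h\<^sub>2))\<close>.
\<close>

lemma invertible_antipode:
  assumes inv: "invertible_map (V \<boxtimes> D) (D \<boxtimes> V) (sigma_bi H)"
  shows "has_antipode H"
proof -
  define \<theta> where "\<theta> = inverse_map (V \<boxtimes> D) (D \<boxtimes> V) (sigma_bi H)"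
  note th = inverse_map_props[OF inv, folded \<theta>_def]
  note tm = th(8) mhom_compose[OF _ th(8)]
  define K where "K l h = sw V D (\<theta> (ptens D V l h)) (\<lambda>h l. eps H h * l one)" for l h
  have K: "bilin D V K" unfolding K_def by (intro intros tm)
  (* K is linear in the functional, so it is evaluation at a vector, namely the one whose i-th
     coordinate is the value of K at the i-th coordinate functional. *)
  define s where "s = (\<lambda>h\<in>carrier V. vector_of V (\<lambda>i. K (coo V i) h))"
  have sK: "l (s h) = K l h" if "l \<in> carrier D" "h \<in> carrier V" for l h
    using functional_vector_of[OF algD(1) dual_mhom[OF that(1)], of "\<lambda>i. K (coo V i) h"]
      dual_functional_expand[OF algD(1) bilinear_mapD(2)[OF K that(2)], of l] that
    by (simp add: s_def dual_carrier mult.commute)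
  have sc: "s h \<in> carrier V" if "h \<in> carrier V" for h
    using that vector_of_closed[OF algD(1)] by (simp add: s_def)
  have s: "s \<in> Lin V V"
  proof (rule LinI)
    show "s \<in> mhom V V"
    proof (rule mhom_weakI[OF fdvs_module[OF algD(1)] algD(1) sc])
      fix g assume "g \<in> Lin V ground"
      then have g: "g \<in> carrier D" by (simp add: dual_carrier)
      show "(\<lambda>h. g (s h)) \<in> mhom V ground"
        by (rule mhom_cong[OF _ fdvs_module[OF algD(1)] bilinear_mapD(1)[OF K g]]) (simp add: sK g)
    qed
  qed (simp add: s_def)
  have Ks: "SW c (\<lambda>a b. K (rtrans b l) a) = eps H c * l one" if c: "c \<in> carrier V" and l: "l \<in> carrier D" for c l
  proof -
    have b: "bilin V D (\<lambda>h l. eps H h * l one)" by (intro intros eval_mhom)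
    have "SW c (\<lambda>a b. K (rtrans b l) a) = sw D V (sigma_bi H (ptens V D c l)) K"
      using sw_sigma_bi[OF c l K] by simp
    also have "\<dots> = sw V D (\<theta> (sigma_bi H (ptens V D c l))) (\<lambda>h l. eps H h * l one)"
      unfolding K_def
      by (rule functional_sw[symmetric, OF fdD algD(1) mhom_compose[OF th(8) sw_mhom_left[OF algD(1) fdD]]])
         (intro intros2 c l)
    also have "\<dots> = eps H c * l one"
      by (simp add: th c l sw_ptens b)
    finally show ?thesis .
  qed
  (* Stated for t and its image under the braiding, so that it can be checked on pure tensors
     h \<otimes> l: there it reduces to Ks by coassociativity. It is used for the tensor t with image l \<otimes> h. *)
  have key: "sw V D t (\<lambda>h l. f h * l b) =
      sw D V (sigma_bi H t) (\<lambda>l h. SW h (\<lambda>x y. f x * K (ltrans b l) y))"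
    if t: "t \<in> carrier (V \<boxtimes> D)" and f: "f \<in> carrier D" and b: "b \<in> carrier V" for t f b
  proof (rule Lin_tensor_eq[OF algD(1) fdD fdvs_ground sw_mhom_left[OF algD(1) fdD] _ _ t])
    show "(\<lambda>t. sw D V (sigma_bi H t) (\<lambda>l h. SW h (\<lambda>x y. f x * K (ltrans b l) y))) \<in> mhom (V \<boxtimes> D) ground"
      by (intro intros2)
    fix h l assume h: "h \<in> carrier V" and l: "l \<in> carrier D"
    note I = intros2 bilinear_intros[OF K] dual_compose[OF f] dual_mhom[OF f] ltrans_mhom ltrans_closed b h l eval_mhom
    have b1: "bilin D V (\<lambda>l h. SW h (\<lambda>x y. f x * K (ltrans b l) y))" by (intro I)
    have T: "trilin V V V (\<lambda>x y z. f x * K (rtrans z (ltrans b l)) y)" by (intro trilinI I)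
    have b2: "bilin V D (\<lambda>h l. f h * l b)" by (intro I)
    have "sw D V (sigma_bi H (ptens V D h l)) (\<lambda>l h. SW h (\<lambda>x y. f x * K (ltrans b l) y)) =
        SW h (\<lambda>p q. SW p (\<lambda>x y. f x * K (rtrans q (ltrans b l)) y))"
      unfolding sw_sigma_bi[OF h l b1] by (simp add: rtrans_ltrans b l)
    also have "\<dots> = SW h (\<lambda>x c. SW c (\<lambda>y z. f x * K (rtrans z (ltrans b l)) y))" by (rule coassoc[OF h T])
    also have "\<dots> = SW h (\<lambda>x c. eps H c * (f x * l b))"
      by (intro sw_cong refl) (simp add: sw_mult2 Ks b l)
    also have "\<dots> = f h * l b" by (rule counit(2)[OF h]) (intro I)
    also have "\<dots> = sw V D (ptens V D h l) (\<lambda>h l. f h * l b)" by (simp add: sw_ptens h l b2)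
    finally show "sw V D (ptens V D h l) (\<lambda>h l. f h * l b) =
      sw D V (sigma_bi H (ptens V D h l)) (\<lambda>l h. SW h (\<lambda>x y. f x * K (ltrans b l) y))" ..
  qed
  have "antipode H s" unfolding antipode_iff
  proof (intro conjI ballI s)
    fix h l assume h: "h \<in> carrier V" and l: "l \<in> carrier D"
    show "SW h (\<lambda>a b. l (s a \<cdot> b)) = eps H h * l one"
    proof -
      have "SW h (\<lambda>a b. l (s a \<cdot> b)) = SW h (\<lambda>a b. K (rtrans b l) a)"
        by (intro sw_cong refl) (simp add: sK[symmetric] l sc)
      then show ?thesis using Ks[OF h l] by simp
    qed
    let ?t = "\<theta> (ptens D V l h)"
    have t: "?t \<in> carrier (V \<boxtimes> D)" by (intro th intros l h)
    have b: "bilin D V (\<lambda>l h. eps H h * l one)" by (intro intros eval_mhom)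
    (* The form sending l \<otimes> h to eps h * l 1 becomes, after the braiding, the evaluation pairing.
       Expanding the latter in coordinates makes each summand an instance of the key identity. *)
    have "eps H h * l one = sw D V (sigma_bi H ?t) (\<lambda>l h. eps H h * l one)"
      by (simp add: th l h sw_ptens b)
    also have "\<dots> = sw V D ?t (\<lambda>h' l'. sw D V (sigma_bi H (ptens V D h' l')) (\<lambda>l h. eps H h * l one))"
      by (rule functional_sw[OF algD(1) fdD mhom_compose[OF sigma_bi_mhom(1) sw_mhom_left[OF fdD algD(1)]] t])
    also have "\<dots> = sw V D ?t (\<lambda>h' l'. \<Sum>i\<in>bas V. coo V i h' * l' i)"
    proof (intro sw_cong refl)
      fix h' l' assume h': "h' \<in> carrier V" and l': "l' \<in> carrier D"
      have "sw D V (sigma_bi H (ptens V D h' l')) (\<lambda>l h. eps H h * l one) = l' h'"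
        unfolding sw_sigma_bi[OF h' l' b] using counit(1)[OF h' dual_mhom[OF l']] by simp
      then show "sw D V (sigma_bi H (ptens V D h' l')) (\<lambda>l h. eps H h * l one) = (\<Sum>i\<in>bas V. coo V i h' * l' i)"
        using functional_expand[OF algD(1) dual_mhom[OF l'] h'] by simp
    qed
    also have "\<dots> = (\<Sum>i\<in>bas V. SW h (\<lambda>x y. coo V i x * l (i \<cdot> s y)))"
      unfolding sw_sum
    proof (rule sum.cong[OF refl])
      fix i assume i': "i \<in> bas V"
      then have i: "i \<in> carrier V" and ci: "coo V i \<in> carrier D"
        using bas_carrier bas_props(3)[OF algD(1)] by (auto simp: dual_carrier)
      note I = intros2 bilinear_intros[OF K] dual_compose[OF ci] dual_mhom[OF ci] ltrans_mhom ltrans_closed i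
      have b2: "bilin D V (\<lambda>l h. SW h (\<lambda>x y. coo V i x * K (ltrans i l) y))" by (intro I)
      have "sw V D ?t (\<lambda>h' l'. coo V i h' * l' i) = SW h (\<lambda>x y. coo V i x * K (ltrans i l) y)"
        using key[OF t ci i] by (simp add: th l h sw_ptens b2)
      also have "\<dots> = SW h (\<lambda>x y. coo V i x * l (i \<cdot> s y))"
        by (intro sw_cong refl) (simp add: sK[symmetric] l i sc)
      finally show "sw V D ?t (\<lambda>h' l'. coo V i h' * l' i) = SW h (\<lambda>x y. coo V i x * l (i \<cdot> s y))" .
    qed
    also have "\<dots> = SW h (\<lambda>a b. l (a \<cdot> s b))"
      unfolding sw_sum[symmetric]
    proof (intro sw_cong refl)
      fix a b assume a: "a \<in> carrier V" and b: "b \<in> carrier V"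
      show "(\<Sum>i\<in>bas V. coo V i a * l (i \<cdot> s b)) = l (a \<cdot> s b)"
        using functional_expand[OF algD(1) dual_compose[OF l prd_mhom(1)[OF mhom_id sc[OF b]]] a] by simp
    qed
    finally show "SW h (\<lambda>a b. l (a \<cdot> s b)) = eps H h * l one" ..
  qed
  then show ?thesis by (auto simp: has_antipode_def)
qed

lemma invertible_iff_antipode: "invertible_map (V \<boxtimes> D) (D \<boxtimes> V) (sigma_bi H) \<longleftrightarrow> has_antipode H"
  using antipode_invertible invertible_antipode by (auto simp: has_antipode_def)

end


section \<open>The groupoids and the functor\<close>

lemma tlift_cong:
  "(\<And>v w. v \<in> carrier V \<Longrightarrow> w \<in> carrier W \<Longrightarrow> b v w = b' v w) \<Longrightarrow> tlift V W U b = tlift V W U b'"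
  unfolding tlift_def by (metis (no_types, lifting))

lemma tmap_cong:
  "(\<And>v. v \<in> carrier V \<Longrightarrow> f v = f' v) \<Longrightarrow> (\<And>w. w \<in> carrier W \<Longrightarrow> g w = g' w) \<Longrightarrow>
   tmap V W X Y f g = tmap V W X Y f' g'"
  unfolding tmap_def by (rule tlift_cong) simp

lemma tmap_id:
  assumes "fdvs V" "fdvs W" "t \<in> carrier (V \<boxtimes> W)"
    "\<And>v. v \<in> carrier V \<Longrightarrow> f v = v" "\<And>w. w \<in> carrier W \<Longrightarrow> g w = w"
  shows "tmap V W V W f g t = t"
proof -
  have "tmap V W V W (\<lambda>x. x) (\<lambda>x. x) t = t"
    by (rule Lin_tensor_eq[OF assms(1,2) fdvs_tensor[OF assms(1,2)] in_Lin[OF tmap_Lin] mhom_id _ assms(3)])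
       (simp_all add: assms mhom_id tmap_ptens)
  then show ?thesis using tmap_cong[of V f "\<lambda>x. x" W g "\<lambda>x. x" V W] assms(4,5) by simp
qed

lemma tmap_tmap:
  assumes fd: "fdvs V" "fdvs W" "fdvs X" "fdvs Y" "fdvs X'" "fdvs Y'"
    and m: "f \<in> mhom V X" "g \<in> mhom W Y" "f' \<in> mhom X X'" "g' \<in> mhom Y Y'" and t: "t \<in> carrier (V \<boxtimes> W)"
  shows "tmap X Y X' Y' f' g' (tmap V W X Y f g t) = tmap V W X' Y' (\<lambda>x. f' (f x)) (\<lambda>x. g' (g x)) t"
proof -
  note c = mhom_compose[OF m(1,3)] mhom_compose[OF m(2,4)]
  show ?thesis
    by (rule Lin_tensor_eq[OF fd(1,2) fdvs_tensor[OF fd(5,6)] mhom_compose[OF in_Lin[OF tmap_Lin] in_Lin[OF tmap_Lin]] in_Lin[OF tmap_Lin] _ t])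
       (simp_all add: fd m c tmap_ptens mhomD(1)[OF m(1)] mhomD(1)[OF m(2)])
qed

lemma tmap_closed:
  "fdvs V \<Longrightarrow> fdvs W \<Longrightarrow> fdvs X \<Longrightarrow> fdvs Y \<Longrightarrow> f \<in> mhom V X \<Longrightarrow> g \<in> mhom W Y \<Longrightarrow> t \<in> carrier (V \<boxtimes> W) \<Longrightarrow>
   tmap V W X Y f g t \<in> carrier (X \<boxtimes> Y)"
  by (rule Lin_closed[OF tmap_Lin])

text \<open>
  The braiding components of an isomorphism of braided systems are inverted by conjugating the
  intertwining relation with the inverse pair.
\<close>

lemma intertwine_inverse:
  assumes fd: "fdvs U" "fdvs V" "fdvs U'" "fdvs V'"
    and f: "invertible_map U U' f" and g: "invertible_map V V' g"
    and s: "\<sigma> \<in> Lin (U \<boxtimes> V) (V \<boxtimes> U)"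
    and eq: "\<forall>t\<in>carrier (U \<boxtimes> V). tmap V U V' U' g f (\<sigma> t) = \<sigma>' (tmap U V U' V' f g t)"
    and t: "t \<in> carrier (U' \<boxtimes> V')"
  shows "tmap V' U' V U (inverse_map V V' g) (inverse_map U U' f) (\<sigma>' t) =
    \<sigma> (tmap U' V' U V (inverse_map U U' f) (inverse_map V V' g) t)"
proof -
  note F = inverse_map_props[OF f] and G = inverse_map_props[OF g]
  let ?r = "tmap U' V' U V (inverse_map U U' f) (inverse_map V V' g) t"
  have r: "?r \<in> carrier (U \<boxtimes> V)" by (intro tmap_closed fd F G t)
  have "tmap U V U' V' f g ?r = t"
    by (simp add: tmap_tmap fd F G t) (rule tmap_id; simp add: fd t F G)
  then have "tmap V' U' V U (inverse_map V V' g) (inverse_map U U' f) (\<sigma>' t) =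
    tmap V' U' V U (inverse_map V V' g) (inverse_map U U' f) (tmap V U V' U' g f (\<sigma> ?r))"
    using eq r by simp
  also have "\<dots> = \<sigma> ?r"
    using Lin_closed[OF s r] by (simp add: tmap_tmap fd F G) (rule tmap_id; simp add: fd F G)
  finally show ?thesis .
qed

lemma invertible_id: "module class_ring V \<Longrightarrow> invertible_map V V (\<lambda>v\<in>carrier V. v)"
  unfolding invertible_map_def
  by (intro conjI bexI[of _ "\<lambda>v\<in>carrier V. v"] restrict_Lin mhom_id) auto

lemma invertible_compose:
  assumes "module class_ring U" "module class_ring W" "invertible_map U V f" "invertible_map V W g"
  shows "invertible_map U W (compose (carrier U) g f)"
proof -
  note F = inverse_map_props[OF assms(3)] and G = inverse_map_props[OF assms(4)]
  show ?thesis unfolding invertible_map_def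
    by (intro conjI bexI[of _ "compose (carrier W) (inverse_map U V f) (inverse_map V W g)"]
          Lin_compose[OF assms(1) F(4) G(4)] Lin_compose[OF assms(2) G(1) F(1)])
       (auto simp: compose_def F G)
qed

lemma compose_inverse:
  assumes "invertible_map U V f"
  shows "compose (carrier U) (inverse_map U V f) f = (\<lambda>x\<in>carrier U. x)"
    "compose (carrier V) f (inverse_map U V f) = (\<lambda>x\<in>carrier V. x)"
  using inverse_map_props[OF assms] by (auto simp: compose_def)

lemma compose_id_Lin:
  assumes "f \<in> Lin V W"
  shows "compose (carrier V) f (\<lambda>x\<in>carrier V. x) = f" "compose (carrier V) (\<lambda>x\<in>carrier W. x) f = f"
  using assms Lin_closed[OF assms] by (auto simp: compose_def Lin_def extensional_def fun_eq_iff)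

lemma compose_assoc_Lin:
  assumes "f \<in> Lin U V"
  shows "compose (carrier U) h (compose (carrier U) g f) = compose (carrier U) (compose (carrier V) h g) f"
  using Lin_closed[OF assms] by (auto simp: compose_def)

lemma bialgebra_algebra_coalgebra: "bialgebra H \<Longrightarrow> algebra_coalgebra H"
  by (simp add: bialgebra_def algebra_coalgebra_def)

text \<open>
  Predicates for membership in the sets of morphisms, so that their conditions are unfolded only
  on demand.
\<close>

definition bialg_iso :: "('k::field, 'v) bialg \<Rightarrow> ('k, 'v) bialg \<Rightarrow> ('v \<Rightarrow> 'v) \<Rightarrow> bool" where
  "bialg_iso H K f \<longleftrightarrow> f \<in> Hom Bialg_gpd H K"

lemma bialg_iso_iff:
  "bialg_iso H K f \<longleftrightarrow> invertible_map (sp H) (sp K) f \<and>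
     (\<forall>t\<in>carrier (sp H \<boxtimes> sp H). f (mu H t) = mu K (tmap (sp H) (sp H) (sp K) (sp K) f f t)) \<and>
     (\<forall>c. f (nu H c) = nu K c) \<and>
     (\<forall>h\<in>carrier (sp H). Delta K (f h) = tmap (sp H) (sp H) (sp K) (sp K) f f (Delta H h)) \<and>
     (\<forall>h\<in>carrier (sp H). eps K (f h) = eps H h)"
  by (simp add: bialg_iso_def Bialg_gpd_def)

lemma bialg_iso_id:
  assumes "algebra_coalgebra H" shows "bialg_iso H H (\<lambda>h\<in>carrier (sp H). h)"
proof -
  interpret algebra_coalgebra H by fact
  show ?thesis unfolding bialg_iso_iff
    by (intro conjI invertible_id fdvs_module algD ballI allI)
       (simp_all add: tmap_id Lin_closed[OF mu_Lin])
qed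

lemma bialg_iso_compose:
  assumes "algebra_coalgebra H" "algebra_coalgebra K" "algebra_coalgebra L"
    and f: "bialg_iso H K f" and g: "bialg_iso K L g"
  shows "bialg_iso H L (compose (carrier (sp H)) g f)"
proof -
  interpret H: algebra_coalgebra H by fact
  interpret K: algebra_coalgebra K by fact
  interpret L: algebra_coalgebra L by fact
  have fi: "invertible_map H.V K.V f" and gi: "invertible_map K.V L.V g"
    using f g by (auto simp: bialg_iso_iff)
  note F = inverse_map_props[OF fi] and G = inverse_map_props[OF gi]
  have t: "tmap K.V K.V L.V L.V g g (tmap H.V H.V K.V K.V f f t) =
      tmap H.V H.V L.V L.V (compose (carrier H.V) g f) (compose (carrier H.V) g f) t"
    if "t \<in> carrier (H.V \<boxtimes> H.V)" for t
    by (subst tmap_tmap) (simp_all add: that F G compose_def cong: tmap_cong)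
  have c: "tmap H.V H.V K.V K.V f f t \<in> carrier (K.V \<boxtimes> K.V)"
    if "t \<in> carrier (H.V \<boxtimes> H.V)" for t
    by (intro tmap_closed H.algD K.algD F that)
  show ?thesis unfolding bialg_iso_iff
    using f g by (intro conjI ballI allI invertible_compose[OF _ _ fi gi] fdvs_module H.algD L.algD)
       (simp_all add: bialg_iso_iff compose_eq Lin_closed[OF H.mu_Lin] t[symmetric] c F)
qed

lemma bialg_iso_inverse:
  assumes "algebra_coalgebra H" "algebra_coalgebra K" and f: "bialg_iso H K f"
  shows "bialg_iso K H (inverse_map (sp H) (sp K) f)"
proof -
  interpret H: algebra_coalgebra H by fact
  interpret K: algebra_coalgebra K by fact
  have fi: "invertible_map H.V K.V f" using f by (auto simp: bialg_iso_iff)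
  note F = inverse_map_props[OF fi]
  let ?g = "inverse_map H.V K.V f"
  show ?thesis unfolding bialg_iso_iff
  proof (intro conjI ballI allI invertible_inverse_map[OF fi])
    fix t assume t: "t \<in> carrier (K.V \<boxtimes> K.V)"
    let ?r = "tmap K.V K.V H.V H.V ?g ?g t"
    have r: "?r \<in> carrier (H.V \<boxtimes> H.V)" by (intro tmap_closed H.algD K.algD F t)
    have "tmap H.V H.V K.V K.V f f ?r = t"
      by (simp add: tmap_tmap F t) (rule tmap_id; simp add: t F)
    then have "mu K t = f (mu H ?r)" using f r by (simp add: bialg_iso_iff)
    then show "?g (mu K t) = mu H ?r" using Lin_closed[OF H.mu_Lin r] by (simp add: F)
  next
    fix h assume h: "h \<in> carrier K.V"
    have "Delta K h = tmap H.V H.V K.V K.V f f (Delta H (?g h))"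
      using f F(6)[OF h] F(3)[OF h] unfolding bialg_iso_iff by metis
    then show "Delta H (?g h) = tmap K.V K.V H.V H.V ?g ?g (Delta K h)"
      by (simp add: tmap_tmap F h) (rule tmap_id[symmetric]; simp add: h F)
    show "eps H (?g h) = eps K h"
      using f F(6)[OF h] F(3)[OF h] by (auto simp: bialg_iso_iff)
  next
    fix c show "?g (nu K c) = nu H c"
      using f F(2)[of "nu H c"] by (simp add: bialg_iso_iff)
  qed
qed

lemma Bialg_gpd_simps:
  "Obj Bialg_gpd = {H. bialgebra H}" "Hom Bialg_gpd H K = {f. bialg_iso H K f}"
  "Idn Bialg_gpd H = (\<lambda>h\<in>carrier (sp H). h)" "Comp Bialg_gpd H K L g f = compose (carrier (sp H)) g f"
  unfolding bialg_iso_def by (simp_all add: Bialg_gpd_def)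

lemma bialg_iso_Lin: "bialg_iso H K f \<Longrightarrow> f \<in> Lin (sp H) (sp K)"
  by (simp add: bialg_iso_iff inverse_map_props(4))

lemma groupoid_Bialg: "groupoid Bialg_gpd"
proof -
  note b = bialgebra_algebra_coalgebra
  have "category Bialg_gpd"
    unfolding category_def Bialg_gpd_simps
    by (auto intro: bialg_iso_id bialg_iso_compose b compose_id_Lin bialg_iso_Lin compose_assoc_Lin)
  moreover have "is_iso Bialg_gpd H K f" if "bialgebra H" "bialgebra K" "bialg_iso H K f" for H K :: "('k::field, 'v) bialg" and f
    unfolding is_iso_def Bialg_gpd_simps
    using that bialg_iso_inverse[OF b b that(3)] compose_inverse[of "sp H" "sp K" f]
    by (intro conjI bexI[of _ "inverse_map (sp H) (sp K) f"]) (auto simp: bialg_iso_iff[of H K])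
  ultimately show ?thesis unfolding groupoid_def Bialg_gpd_simps by blast
qed

definition br_iso ::
  "('k::field, 'v, 'w) brsys \<Rightarrow> ('k, 'v, 'w) brsys \<Rightarrow> ('v \<Rightarrow> 'v) \<Rightarrow> ('w \<Rightarrow> 'w) \<Rightarrow> bool" where
  "br_iso S T f g \<longleftrightarrow> (f, g) \<in> Hom BrSyst_gpd S T"

lemma br_iso_iff:
  "br_iso S T f g \<longleftrightarrow> invertible_map (V1 S) (V1 T) f \<and> invertible_map (V2 S) (V2 T) g \<and>
               (\<forall>t\<in>carrier (V1 S \<boxtimes> V1 S).
                  tmap (V1 S) (V1 S) (V1 T) (V1 T) f f (sig11 S t) =
                  sig11 T (tmap (V1 S) (V1 S) (V1 T) (V1 T) f f t)) \<and>
               (\<forall>t\<in>carrier (V1 S \<boxtimes> V2 S).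
                  tmap (V2 S) (V1 S) (V2 T) (V1 T) g f (sig12 S t) =
                  sig12 T (tmap (V1 S) (V2 S) (V1 T) (V2 T) f g t)) \<and>
               (\<forall>t\<in>carrier (V2 S \<boxtimes> V2 S).
                  tmap (V2 S) (V2 S) (V2 T) (V2 T) g g (sig22 S t) =
                  sig22 T (tmap (V2 S) (V2 S) (V2 T) (V2 T) g g t)) \<and>
               (\<forall>c. f (nu1 S c) = nu1 T c) \<and> (\<forall>c. g (nu2 S c) = nu2 T c) \<and>
               (\<forall>v\<in>carrier (V1 S). eps1 T (f v) = eps1 S v) \<and>
               (\<forall>v\<in>carrier (V2 S). eps2 T (g v) = eps2 S v)"
  by (simp add: br_iso_def BrSyst_gpd_def)

lemma br_sysD:
  assumes "bipointed_braided_system S"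
  shows "fdvs (V1 S)" "fdvs (V2 S)" "sig11 S \<in> Lin (V1 S \<boxtimes> V1 S) (V1 S \<boxtimes> V1 S)"
    "sig22 S \<in> Lin (V2 S \<boxtimes> V2 S) (V2 S \<boxtimes> V2 S)" "sig12 S \<in> Lin (V1 S \<boxtimes> V2 S) (V2 S \<boxtimes> V1 S)"
    "nu1 S c \<in> carrier (V1 S)" "nu2 S c \<in> carrier (V2 S)"
  using assms Lin_closed[of "nu1 S" ground] Lin_closed[of "nu2 S" ground]
  by (auto simp: bipointed_braided_system_def)

lemma br_iso_id:
  assumes S: "bipointed_braided_system S"
  shows "br_iso S S (\<lambda>v\<in>carrier (V1 S). v) (\<lambda>v\<in>carrier (V2 S). v)"
proof -
  note s = br_sysD[OF S]
  note c = Lin_closed[OF s(3)] Lin_closed[OF s(4)] Lin_closed[OF s(5)]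
  show ?thesis unfolding br_iso_iff
    by (intro conjI invertible_id fdvs_module s ballI allI) (simp_all add: tmap_id s c)
qed

lemma intertwine_compose:
  assumes fd: "fdvs U" "fdvs V" "fdvs U'" "fdvs V'" "fdvs U''" "fdvs V''"
    and m: "f \<in> mhom U U'" "g \<in> mhom V V'" "f' \<in> mhom U' U''" "g' \<in> mhom V' V''"
    and s: "\<sigma> \<in> Lin (U \<boxtimes> V) (V \<boxtimes> U)"
    and eq: "\<forall>t\<in>carrier (U \<boxtimes> V). tmap V U V' U' g f (\<sigma> t) = \<sigma>' (tmap U V U' V' f g t)"
    and eq': "\<forall>t\<in>carrier (U' \<boxtimes> V'). tmap V' U' V'' U'' g' f' (\<sigma>' t) = \<sigma>'' (tmap U' V' U'' V'' f' g' t)"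
    and t: "t \<in> carrier (U \<boxtimes> V)"
  shows "tmap V U V'' U'' (compose (carrier V) g' g) (compose (carrier U) f' f) (\<sigma> t) =
    \<sigma>'' (tmap U V U'' V'' (compose (carrier U) f' f) (compose (carrier V) g' g) t)"
proof -
  have 1: "tmap U V U'' V'' (compose (carrier U) f' f) (compose (carrier V) g' g) t =
    tmap U' V' U'' V'' f' g' (tmap U V U' V' f g t)" if "t \<in> carrier (U \<boxtimes> V)" for t
    by (subst tmap_tmap) (simp_all add: that fd m compose_def cong: tmap_cong)
  have 2: "tmap V U V'' U'' (compose (carrier V) g' g) (compose (carrier U) f' f) t =
    tmap V' U' V'' U'' g' f' (tmap V U V' U' g f t)" if "t \<in> carrier (V \<boxtimes> U)" for t
    by (subst tmap_tmap) (simp_all add: that fd m compose_def cong: tmap_cong)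
  have c: "tmap U V U' V' f g t \<in> carrier (U' \<boxtimes> V')" by (intro tmap_closed fd m t)
  show ?thesis
    using eq t eq' c by (simp add: 1[OF t] 2[OF Lin_closed[OF s t]])
qed

lemma br_iso_compose:
  assumes S: "bipointed_braided_system S" and T: "bipointed_braided_system T" and U: "bipointed_braided_system U"
    and f: "br_iso S T f g" and f': "br_iso T U f' g'"
  shows "br_iso S U (compose (carrier (V1 S)) f' f) (compose (carrier (V2 S)) g' g)"
proof -
  note s = br_sysD[OF S] and t = br_sysD[OF T] and u = br_sysD[OF U]
  have i: "invertible_map (V1 S) (V1 T) f" "invertible_map (V2 S) (V2 T) g"
    "invertible_map (V1 T) (V1 U) f'" "invertible_map (V2 T) (V2 U) g'"
    using f f' by (auto simp: br_iso_iff)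
  note F = inverse_map_props[OF i(1)] inverse_map_props[OF i(2)]
    inverse_map_props[OF i(3)] inverse_map_props[OF i(4)]
  show ?thesis
    unfolding br_iso_iff
  proof (intro conjI)
    show "\<forall>ta\<in>carrier (V1 S \<boxtimes> V1 S).
       tmap (V1 S) (V1 S) (V1 U) (V1 U) (compose (carrier (V1 S)) f' f) (compose (carrier (V1 S)) f' f) (sig11 S ta) =
       sig11 U (tmap (V1 S) (V1 S) (V1 U) (V1 U) (compose (carrier (V1 S)) f' f) (compose (carrier (V1 S)) f' f) ta)"
      by (intro ballI intertwine_compose[OF s(1,1) t(1,1) u(1,1) F(7,7) F(23,23) s(3)])
         (use f f' in \<open>auto simp: br_iso_iff\<close>)
    show "\<forall>ta\<in>carrier (V1 S \<boxtimes> V2 S).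
       tmap (V2 S) (V1 S) (V2 U) (V1 U) (compose (carrier (V2 S)) g' g) (compose (carrier (V1 S)) f' f) (sig12 S ta) =
       sig12 U (tmap (V1 S) (V2 S) (V1 U) (V2 U) (compose (carrier (V1 S)) f' f) (compose (carrier (V2 S)) g' g) ta)"
      by (intro ballI intertwine_compose[OF s(1,2) t(1,2) u(1,2) F(7,15) F(23,31) s(5)])
         (use f f' in \<open>auto simp: br_iso_iff\<close>)
    show "\<forall>ta\<in>carrier (V2 S \<boxtimes> V2 S).
       tmap (V2 S) (V2 S) (V2 U) (V2 U) (compose (carrier (V2 S)) g' g) (compose (carrier (V2 S)) g' g) (sig22 S ta) =
       sig22 U (tmap (V2 S) (V2 S) (V2 U) (V2 U) (compose (carrier (V2 S)) g' g) (compose (carrier (V2 S)) g' g) ta)"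
      by (intro ballI intertwine_compose[OF s(2,2) t(2,2) u(2,2) F(15,15) F(31,31) s(4)])
         (use f f' in \<open>auto simp: br_iso_iff\<close>)
  qed (use f f' in \<open>auto intro!: invertible_compose fdvs_module s u i simp: br_iso_iff compose_eq s F\<close>)
qed

lemma br_iso_inverse:
  assumes S: "bipointed_braided_system S" and T: "bipointed_braided_system T" and f: "br_iso S T f g"
  shows "br_iso T S (inverse_map (V1 S) (V1 T) f) (inverse_map (V2 S) (V2 T) g)"
proof -
  note s = br_sysD[OF S] and t = br_sysD[OF T]
  have i: "invertible_map (V1 S) (V1 T) f" "invertible_map (V2 S) (V2 T) g" using f by (auto simp: br_iso_iff)
  note F = inverse_map_props[OF i(1)] and G = inverse_map_props[OF i(2)]
  note I = intertwine_inverse[OF s(1,1) t(1,1) i(1,1) s(3)] intertwine_inverse[OF s(1,2) t(1,2) i(1,2) s(5)]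
    intertwine_inverse[OF s(2,2) t(2,2) i(2,2) s(4)]
  show ?thesis
    unfolding br_iso_iff
  proof (intro conjI ballI allI)
    show "inverse_map (V1 S) (V1 T) f (nu1 T c) = nu1 S c" for c
      using f F(2)[OF s(6), of c] by (simp add: br_iso_iff)
    show "inverse_map (V2 S) (V2 T) g (nu2 T c) = nu2 S c" for c
      using f G(2)[OF s(7), of c] by (simp add: br_iso_iff)
    show "eps1 S (inverse_map (V1 S) (V1 T) f v) = eps1 T v" if "v \<in> carrier (V1 T)" for v
      using f F(3,6)[OF that] by (auto simp: br_iso_iff)
    show "eps2 S (inverse_map (V2 S) (V2 T) g v) = eps2 T v" if "v \<in> carrier (V2 T)" for v
      using f G(3,6)[OF that] by (auto simp: br_iso_iff)
  qed (use f in \<open>auto intro!: I invertible_inverse_map i simp: br_iso_iff\<close>)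
qed

lemma BrSyst_gpd_simps:
  "Obj BrSyst_gpd = {S. bipointed_braided_system S}" "Hom BrSyst_gpd S T = {p. br_iso S T (fst p) (snd p)}"
  "Idn BrSyst_gpd S = (\<lambda>v\<in>carrier (V1 S). v, \<lambda>v\<in>carrier (V2 S). v)"
  "Comp BrSyst_gpd S T U q p = (compose (carrier (V1 S)) (fst q) (fst p), compose (carrier (V2 S)) (snd q) (snd p))"
  unfolding br_iso_def by (simp_all add: BrSyst_gpd_def)

lemma br_iso_Lin: "br_iso S T f g \<Longrightarrow> f \<in> Lin (V1 S) (V1 T)" "br_iso S T f g \<Longrightarrow> g \<in> Lin (V2 S) (V2 T)"
  by (simp_all add: br_iso_iff inverse_map_props(4))

lemma groupoid_BrSyst: "groupoid BrSyst_gpd"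
proof -
  have "category BrSyst_gpd"
    unfolding category_def BrSyst_gpd_simps
    by (auto intro: br_iso_id br_iso_compose compose_id_Lin br_iso_Lin compose_assoc_Lin)
  moreover have "is_iso BrSyst_gpd S T p" if "bipointed_braided_system S" "bipointed_braided_system T" "br_iso S T (fst p) (snd p)"
    for S T :: "('k::field, 'v, 'w) brsys" and p
    unfolding is_iso_def BrSyst_gpd_simps
    using that br_iso_inverse[OF that] compose_inverse[of "V1 S" "V1 T" "fst p"] compose_inverse[of "V2 S" "V2 T" "snd p"]
    by (intro conjI bexI[of _ "(inverse_map (V1 S) (V1 T) (fst p), inverse_map (V2 S) (V2 T) (snd p))"])
       (auto simp: br_iso_iff[of S T])
  ultimately show ?thesis unfolding groupoid_def BrSyst_gpd_simps by blast
qed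

lemma sp_dual_bialg: "sp (dual_bialg H) = dual (sp H)"
  by (simp add: dual_bialg_def Let_def)

lemma B_sys_simps [simp]:
  "V1 (B_sys H) = sp H" "V2 (B_sys H) = dual (sp H)" "sig11 (B_sys H) = sigma_ass_r H"
  "sig22 (B_sys H) = sigma_ass (dual_bialg H)" "sig12 (B_sys H) = sigma_bi H"
  "nu1 (B_sys H) = nu H" "nu2 (B_sys H) = nu (dual_bialg H)" "eps1 (B_sys H) = eps H"
  "eps2 (B_sys H) = eps (dual_bialg H)"
  by (simp_all add: B_sys_def sp_dual_bialg)

locale bialg = algebra_coalgebra H for H :: "('k::field, 'h) bialg" +
  assumes compat: "bialgebra_compatibility H"
begin

lemma normalized: "normalized_pair H" and eps_one [simp]: "eps H one = 1"
  using compat by (auto simp: bialgebra_compatibility_def Let_def normalized_pair_def)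

lemma natural: natural_units
  using compatibility_iff_yang_baxter(1)[OF normalized] compat by blast

text \<open>
  The diagonal equations hold by associativity, the two mixed ones by compatibility.
\<close>

lemma B_sys_bipointed: "bipointed_braided_system (B_sys H)"
proof -
  note alg' = unital_algebra_dual
  have "eps (dual_bialg H) (nu (dual_bialg H) c) = c" for c
    using unital_algebraD(4)[OF alg', of c] by (simp add: eps_dual_bialg)
  then show ?thesis
    unfolding bipointed_braided_system_def B_sys_simps
    using compatibility_iff_yang_baxter[OF normalized] compat yang_baxter_sigma_ass[OF alg]
      yang_baxter_sigma_ass[OF alg'] unital_algebraD(3)[OF alg] unital_algebraD(3)[OF alg'] eps_Lin eps_dual_bialg(2)
      sigma_ass_r_Lin[OF alg] sigma_ass_Lin[OF alg'] sigma_bi_Lin normalized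
    by (simp add: normalized_pair_def)
qed

end

lemma bialgebra_bialg: "bialgebra H \<Longrightarrow> bialg H"
  by (simp add: bialgebra_def bialg_def bialg_axioms_def algebra_coalgebra_def)

lemma transpose_map_props:
  assumes "fdvs V" "fdvs W" "f \<in> mhom V W"
  shows "transpose_map V W f \<in> Lin (dual W) (dual V)"
    "l \<in> carrier (dual W) \<Longrightarrow> v \<in> carrier V \<Longrightarrow> transpose_map V W f l v = l (f v)"
    "l \<in> carrier (dual W) \<Longrightarrow> transpose_map V W f l \<in> carrier (dual V)"
proof -
  have c: "(\<lambda>v\<in>carrier V. l (f v)) \<in> carrier (dual V)" if "l \<in> carrier (dual W)" for l
    by (intro dual_restrictI assms dual_compose[OF that])
  show "transpose_map V W f \<in> Lin (dual W) (dual V)"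
    unfolding transpose_map_def
    by (rule restrict_Lin[OF fdvs_module[OF fdvs_dual[OF assms(2)]]], rule mhom_dualI[OF fdvs_dual[OF assms(2)] assms(1) c])
       (simp_all add: eval_mhom mhomD(1)[OF assms(3)])
qed (use assms(1) in \<open>simp_all add: transpose_map_def dual_restrictI dual_compose assms(3)\<close>)

lemma invertible_transpose:
  assumes V: "fdvs V" and W: "fdvs W" and f: "invertible_map V W f"
  shows "invertible_map (dual V) (dual W) (transpose_map W V (inverse_map V W f))"
proof -
  note F = inverse_map_props[OF f]
  note t = transpose_map_props[OF V W F(7)] and t' = transpose_map_props[OF W V F(8)]
  have 1: "transpose_map V W f (transpose_map W V (inverse_map V W f) l) = l" if l: "l \<in> carrier (dual V)" for l
  proof (rule dual_eqI[OF t(3)[OF t'(3)[OF l]] l])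
    fix v assume v: "v \<in> carrier V"
    show "transpose_map V W f (transpose_map W V (inverse_map V W f) l) v = l v"
      unfolding t(2)[OF t'(3)[OF l] v] t'(2)[OF l F(5)[OF v]] F(2)[OF v] ..
  qed
  have 2: "transpose_map W V (inverse_map V W f) (transpose_map V W f l) = l" if l: "l \<in> carrier (dual W)" for l
  proof (rule dual_eqI[OF t'(3)[OF t(3)[OF l]] l])
    fix v assume v: "v \<in> carrier W"
    show "transpose_map W V (inverse_map V W f) (transpose_map V W f l) v = l v"
      unfolding t'(2)[OF t(3)[OF l] v] t(2)[OF l F(6)[OF v]] F(3)[OF v] ..
  qed
  show ?thesis unfolding invertible_map_def using 1 2 t(1) t'(1) by blast
qed

context
  fixes H K :: "('k::field, 'h) bialg"
  assumes H: "bialg H" and K: "bialg K"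
begin

interpretation H: bialg H by (rule H)
interpretation K: bialg K by (rule K)

lemma bialg_iso_mult:
  assumes f: "bialg_iso H K f" and a: "a \<in> carrier H.V" and b: "b \<in> carrier H.V"
  shows "f (mu H (ptens H.V H.V a b)) = mu K (ptens K.V K.V (f a) (f b))"
proof -
  have fi: "invertible_map H.V K.V f" using f by (auto simp: bialg_iso_iff)
  show ?thesis
    using f tmap_ptens[OF H.algD(1,1) K.algD(1,1) inverse_map_props(7)[OF fi] inverse_map_props(7)[OF fi] a b] a b
    by (simp add: bialg_iso_iff)
qed

lemma bialg_iso_SW:
  assumes f: "bialg_iso H K f" and h: "h \<in> carrier H.V" and B: "bilin K.V K.V B"
  shows "sw K.V K.V (Delta K (f h)) B = sw H.V H.V (Delta H h) (\<lambda>a b. B (f a) (f b))"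
proof -
  have fi: "invertible_map H.V K.V f" using f by (auto simp: bialg_iso_iff)
  have "Delta K (f h) = tmap H.V H.V K.V K.V f f (Delta H h)" using f h unfolding bialg_iso_iff by metis
  then show ?thesis
    using sw_tmap[OF H.algD(1,1) K.algD(1,1) inverse_map_props(7)[OF fi] inverse_map_props(7)[OF fi] H.Delta_closed[OF h] B] by simp
qed

text \<open>
  With \<open>g\<close> the inverse transpose of \<open>f\<close>, a bialgebra isomorphism carries translates and products
  of functionals to translates and products; all braiding components are built from these.
\<close>

lemma B_arr_iso:
  assumes f: "bialg_iso H K f"
  defines "g \<equiv> transpose_map K.V H.V (inverse_map H.V K.V f)"
  shows "br_iso (B_sys H) (B_sys K) f g"
proof -
  have fi: "invertible_map H.V K.V f" and fn: "\<And>c. f (nu H c) = nu K c"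
    and fe: "\<And>h. h \<in> carrier H.V \<Longrightarrow> eps K (f h) = eps H h"
    using f by (auto simp: bialg_iso_iff)
  note F = inverse_map_props[OF fi]
  note gi = invertible_transpose[OF H.algD(1) K.algD(1) fi, folded g_def]
  note G = inverse_map_props[OF gi]
  note gt = transpose_map_props[OF K.algD(1) H.algD(1) F(8), folded g_def]
  note aH = H.unital_algebra_dual and aK = K.unital_algebra_dual
  note sH = sigma_ass_Lin[OF aH, simplified H.dual_bialg_simps] and sK = sigma_ass_Lin[OF aK, simplified K.dual_bialg_simps]
  note pH = sigma_ass_ptens[OF aH, simplified H.dual_bialg_simps, simplified]
    and pK = sigma_ass_ptens[OF aK, simplified K.dual_bialg_simps, simplified]
  note tm = in_Lin[OF tmap_Lin]
  have ge: "g (eps H) = eps K"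
    using fe[OF F(6)] by (intro dual_eqI[of _ "K.V"]) (simp_all add: gt F)
  have gm: "g (H.dprd l l') = K.dprd (g l) (g l')" if l: "l \<in> carrier H.D" and l': "l' \<in> carrier H.D" for l l'
  proof (rule dual_eqI[of _ "K.V"])
    fix v assume v: "v \<in> carrier K.V"
    let ?v = "inverse_map H.V K.V f v"
    have b: "bilin K.V K.V (\<lambda>a b. g l b * g l' a)" by (intro K.intros dual_mhom gt l l')
    have "K.dprd (g l) (g l') v = K.SW (f ?v) (\<lambda>a b. g l b * g l' a)" using v l l' by (simp add: G F)
    also have "\<dots> = H.SW ?v (\<lambda>a b. g l (f b) * g l' (f a))" by (rule bialg_iso_SW[OF f F(6)[OF v] b])
    also have "\<dots> = g (H.dprd l l') v" using v l l' by (simp add: gt F)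
    finally show "g (H.dprd l l') v = K.dprd (g l) (g l') v" ..
  qed (simp_all add: gt l l')
  have gr: "g (H.rtrans b l) = K.rtrans (f b) (g l)" if l: "l \<in> carrier H.D" and b: "b \<in> carrier H.V" for l b
  proof (rule dual_eqI[of _ "K.V"])
    fix v assume v: "v \<in> carrier K.V"
    have "inverse_map H.V K.V f (K.prd v (f b)) = H.prd (inverse_map H.V K.V f v) b"
      using bialg_iso_mult[OF f F(6)[OF v] b] F(2)[of "H.prd (inverse_map H.V K.V f v) b"] v b by (simp add: F)
    then show "g (H.rtrans b l) v = K.rtrans (f b) (g l) v" using v l b by (simp add: gt F)
  qed (simp_all add: gt l b F)
  show ?thesis
    unfolding br_iso_iff B_sys_simps
  proof (intro conjI fi gi ballI)
    show "tmap H.V H.V K.V K.V f f (sigma_ass_r H t) = sigma_ass_r K (tmap H.V H.V K.V K.V f f t)"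
      if t: "t \<in> carrier (H.V \<boxtimes> H.V)" for t
      by (rule Lin_tensor_eq[OF H.algD(1,1) _ mhom_compose[OF in_Lin[OF sigma_ass_r_Lin[OF H.alg]] tm] mhom_compose[OF tm in_Lin[OF sigma_ass_r_Lin[OF K.alg]]] _ t])
         (simp_all add: fdvs_tensor F sigma_ass_r_ptens[OF H.alg] sigma_ass_r_ptens[OF K.alg] tmap_ptens bialg_iso_mult[OF f] fn)
    show "tmap H.D H.D K.D K.D g g (sigma_ass (dual_bialg H) t) =
       sigma_ass (dual_bialg K) (tmap H.D H.D K.D K.D g g t)"
      if t: "t \<in> carrier (H.D \<boxtimes> H.D)" for t
      by (rule Lin_tensor_eq[OF H.fdD H.fdD _ mhom_compose[OF in_Lin[OF sH] tm] mhom_compose[OF tm in_Lin[OF sK]] _ t])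
         (simp_all add: fdvs_tensor G pH pK tmap_ptens gm ge)
    show "tmap H.D H.V K.D K.V g f (sigma_bi H t) =
       sigma_bi K (tmap H.V H.D K.V K.D f g t)"
      if t: "t \<in> carrier (H.V \<boxtimes> H.D)" for t
    proof (rule Lin_tensor_eq[OF H.algD(1) H.fdD _ mhom_compose[OF H.sigma_bi_mhom(1) tm] mhom_compose[OF tm K.sigma_bi_mhom(1)] _ t])
      fix h l assume h: "h \<in> carrier H.V" and l: "l \<in> carrier H.D"
      have e: "tmap H.V H.D K.V K.D f g (ptens H.V H.D h l) = ptens K.V K.D (f h) (g l)"
        by (rule tmap_ptens) (simp_all add: F G h l)
      show "tmap H.D H.V K.D K.V g f (sigma_bi H (ptens H.V H.D h l)) =
         sigma_bi K (tmap H.V H.D K.V K.D f g (ptens H.V H.D h l))"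
        unfolding e
      proof (rule tensor_eqI[OF K.fdD K.algD(1)])
        fix T assume T: "bilin K.D K.V T"
        have b1: "bilin H.D H.V (\<lambda>l x. T (g l) (f x))"
          by (intro bilinear_mapI bilinear_intros[OF T] F G)
        have b2: "bilin K.V K.V (\<lambda>a b. T (K.rtrans b (g l)) a)"
          by (intro K.intros2 bilinear_intros[OF T] G l)
        have "sw K.D K.V (tmap H.D H.V K.D K.V g f (sigma_bi H (ptens H.V H.D h l))) T
          = sw H.D H.V (sigma_bi H (ptens H.V H.D h l)) (\<lambda>l x. T (g l) (f x))"
          by (rule sw_tmap) (simp_all add: F G T h l)
        also have "\<dots> = H.SW h (\<lambda>a b. T (K.rtrans (f b) (g l)) (f a))"
          unfolding H.sw_sigma_bi[OF h l b1] by (simp add: gr l)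
        also have "\<dots> = K.SW (f h) (\<lambda>a b. T (K.rtrans b (g l)) a)"
          by (rule bialg_iso_SW[OF f h b2, symmetric])
        also have "\<dots> = sw K.D K.V (sigma_bi K (ptens K.V K.D (f h) (g l))) T"
          by (rule K.sw_sigma_bi[symmetric]) (simp_all add: F G T h l)
        finally show "sw K.D K.V (tmap H.D H.V K.D K.V g f (sigma_bi H (ptens H.V H.D h l))) T
          = sw K.D K.V (sigma_bi K (ptens K.V K.D (f h) (g l))) T" .
      qed (simp_all add: F G h l tmap_closed)
    qed (simp_all add: F G fdvs_tensor)
    show "eps K (f v) = eps H v" if "v \<in> carrier H.V" for v by (rule fe[OF that])
    show "eps (dual_bialg K) (g v) = eps (dual_bialg H) v" if "v \<in> carrier H.D" for v
      using that fn[of 1] F(2)[OF H.algD(2), of 1] by (simp add: H.eps_dual_bialg K.eps_dual_bialg G gt)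
    show "\<forall>c. f (nu H c) = nu K c" using fn by blast
    show "\<forall>c. g (nu (dual_bialg H) c) = nu (dual_bialg K) c"
    proof
      fix c
      note n = nu_scale[OF aH, of c] nu_scale[OF aK, of c]
      show "g (nu (dual_bialg H) c) = nu (dual_bialg K) c"
        unfolding n using mhomD(3)[OF G(7) H.eps_dual, of c] by (simp add: ge)
    qed
  qed
qed

text \<open>
  Each braiding relation is collapsed by the counits, which \<open>f\<close> and \<open>g\<close> preserve. The diagonal
  relations compare \<open>f (a b) \<otimes> 1\<close> with \<open>(f a) (f b) \<otimes> 1\<close>, and similarly for \<open>g\<close>. In the mixed
  relation, applying \<open>\<epsilon>\<close> to the vector and evaluation at \<open>1\<close> to the functional turns the braiding
  into the evaluation pairing, whence \<open>\<langle>g l, f h\<rangle> = \<langle>l, h\<rangle>\<close>. Through this pairing multiplicativity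
  of \<open>g\<close> dualises to compatibility of \<open>f\<close> with the coproducts.
\<close>

lemma br_iso_B_arr:
  assumes fg: "br_iso (B_sys H) (B_sys K) f g"
  shows "bialg_iso H K f" "g = transpose_map K.V H.V (inverse_map H.V K.V f)"
proof -
  have fi: "invertible_map H.V K.V f" and gi: "invertible_map H.D K.D g"
    and fn: "\<And>c. f (nu H c) = nu K c" and fe: "\<And>h. h \<in> carrier H.V \<Longrightarrow> eps K (f h) = eps H h"
    and gn: "\<And>c. g (nu (dual_bialg H) c) = nu (dual_bialg K) c"
    and ge: "\<And>l. l \<in> carrier H.D \<Longrightarrow> eps (dual_bialg K) (g l) = eps (dual_bialg H) l"
    and s1: "\<And>t. t \<in> carrier (H.V \<boxtimes> H.V) \<Longrightarrow> tmap H.V H.V K.V K.V f f (sigma_ass_r H t) = sigma_ass_r K (tmap H.V H.V K.V K.V f f t)"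
    and s2: "\<And>t. t \<in> carrier (H.D \<boxtimes> H.D) \<Longrightarrow> tmap H.D H.D K.D K.D g g (sigma_ass (dual_bialg H) t) =
       sigma_ass (dual_bialg K) (tmap H.D H.D K.D K.D g g t)"
    and s3: "\<And>t. t \<in> carrier (H.V \<boxtimes> H.D) \<Longrightarrow> tmap H.D H.V K.D K.V g f (sigma_bi H t) =
       sigma_bi K (tmap H.V H.D K.V K.D f g t)"
    using fg by (auto simp: br_iso_iff)
  note F = inverse_map_props[OF fi] and G = inverse_map_props[OF gi]
  note aH = H.unital_algebra_dual and aK = K.unital_algebra_dual
  note pH = sigma_ass_ptens[OF aH, simplified H.dual_bialg_simps, simplified]
    and pK = sigma_ass_ptens[OF aK, simplified K.dual_bialg_simps, simplified]
  have ge': "g l K.one = l H.one" if "l \<in> carrier H.D" for l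
    using ge[OF that] that by (simp add: H.eps_dual_bialg K.eps_dual_bialg G)
  have geps: "g (eps H) = eps K" using gn[of 1] by simp
  have fm: "f (H.prd a b) = K.prd (f a) (f b)" if a: "a \<in> carrier H.V" and b: "b \<in> carrier H.V" for a b
  proof (rule vec_eqI[OF K.algD(1)])
    fix p assume p: "p \<in> Lin K.V ground"
    have e: "ptens K.V K.V (f (H.prd a b)) K.one = ptens K.V K.V (K.prd (f a) (f b)) K.one"
      using s1[of "ptens H.V H.V a b"] a b
      by (simp add: sigma_ass_r_ptens[OF H.alg] sigma_ass_r_ptens[OF K.alg] tmap_ptens F fn)
    have B: "bilin K.V K.V (\<lambda>x y. p x * eps K y)" by (intro K.intros in_Lin[OF p])
    from arg_cong[OF e, of "\<lambda>t. sw K.V K.V t (\<lambda>x y. p x * eps K y)"]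
    show "p (f (H.prd a b)) = p (K.prd (f a) (f b))"
      using a b by (simp add: sw_ptens B F)
  qed (simp_all add: a b F)
  have gm: "g (H.dprd a b) = K.dprd (g a) (g b)" if a: "a \<in> carrier H.D" and b: "b \<in> carrier H.D" for a b
  proof (rule vec_eqI[OF K.fdD])
    fix p assume p: "p \<in> Lin K.D ground"
    have e: "ptens K.D K.D (eps K) (g (H.dprd a b)) = ptens K.D K.D (eps K) (K.dprd (g a) (g b))"
      using s2[of "ptens H.D H.D a b"] a b
      by (simp add: pH pK tmap_ptens G geps)
    have B: "bilin K.D K.D (\<lambda>x y. x K.one * p y)" by (intro K.intros eval_mhom in_Lin[OF p])
    from arg_cong[OF e, of "\<lambda>t. sw K.D K.D t (\<lambda>x y. x K.one * p y)"]
    show "p (g (H.dprd a b)) = p (K.dprd (g a) (g b))"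
      using a b by (simp add: sw_ptens B G)
  qed (simp_all add: a b G)
  have gf: "g l (f h) = l h" if l: "l \<in> carrier H.D" and h: "h \<in> carrier H.V" for l h
  proof -
    let ?T = "\<lambda>l x. eps K x * l K.one" and ?T' = "\<lambda>l x. eps H x * l H.one"
    have T: "bilin K.D K.V ?T" by (intro K.intros eval_mhom)
    have T': "bilin H.D H.V ?T'" by (intro H.intros eval_mhom)
    have e: "tmap H.V H.D K.V K.D f g (ptens H.V H.D h l) = ptens K.V K.D (f h) (g l)"
      by (rule tmap_ptens) (simp_all add: F G h l)
    have "g l (f h) = K.SW (f h) (\<lambda>a b. eps K a * g l b)"
      using K.counit(1)[OF F(5)[OF h] dual_mhom[OF G(5)[OF l]]] by simp
    also have "\<dots> = sw K.D K.V (sigma_bi K (ptens K.V K.D (f h) (g l))) ?T"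
      by (simp add: K.sw_sigma_bi T F G h l)
    also have "\<dots> = sw K.D K.V (tmap H.D H.V K.D K.V g f (sigma_bi H (ptens H.V H.D h l))) ?T"
      using s3[of "ptens H.V H.D h l"] h l by (simp add: e)
    also have "\<dots> = sw H.D H.V (sigma_bi H (ptens H.V H.D h l)) (\<lambda>l x. ?T (g l) (f x))"
      by (rule sw_tmap) (simp_all add: F G T h l)
    also have "\<dots> = sw H.D H.V (sigma_bi H (ptens H.V H.D h l)) ?T'"
      by (intro sw_cong refl) (simp add: fe ge')
    also have "\<dots> = l h"
      using H.counit(1)[OF h dual_mhom[OF l]] by (simp add: H.sw_sigma_bi[OF h l T'] l)
    finally show ?thesis .
  qed
  show "g = transpose_map K.V H.V (inverse_map H.V K.V f)"
  proof (rule Lin_eqI[OF G(4) transpose_map_props(1)[OF K.algD(1) H.algD(1) F(8)]])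
    fix l assume l: "l \<in> carrier H.D"
    show "g l = transpose_map K.V H.V (inverse_map H.V K.V f) l"
    proof (rule dual_eqI[OF G(5)[OF l] transpose_map_props(3)[OF K.algD(1) H.algD(1) F(8) l]])
      show "g l v = transpose_map K.V H.V (inverse_map H.V K.V f) l v" if v: "v \<in> carrier K.V" for v
        using gf[OF l F(6)[OF v]] by (simp add: transpose_map_props(2)[OF K.algD(1) H.algD(1) F(8) l v] F v)
    qed
  qed
  show "bialg_iso H K f" unfolding bialg_iso_iff
  proof (intro conjI fi ballI allI fn fe)
    show "f (mu H t) = mu K (tmap H.V H.V K.V K.V f f t)" if t: "t \<in> carrier (H.V \<boxtimes> H.V)" for t
      by (rule Lin_tensor_eq[OF H.algD(1,1) K.algD(1) mhom_compose[OF in_Lin[OF H.mu_Lin] F(7)] mhom_compose[OF in_Lin[OF tmap_Lin] in_Lin[OF K.mu_Lin]] _ t])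
         (simp_all add: F tmap_ptens fm)
    fix h assume h: "h \<in> carrier H.V"
    show "Delta K (f h) = tmap H.V H.V K.V K.V f f (Delta H h)"
    proof (rule tensor_eqI_prod[OF K.algD(1,1)])
      fix p q assume "p \<in> Lin K.V ground" "q \<in> Lin K.V ground"
      then have p: "p \<in> carrier K.D" and q: "q \<in> carrier K.D" by (simp_all add: dual_carrier)
      let ?i = "inverse_map H.D K.D g"
      have ip: "?i p x = p (f x)" "?i q x = q (f x)" if "x \<in> carrier H.V" for x
        using gf[OF G(6)[OF p] that] gf[OF G(6)[OF q] that] by (simp_all add: G p q)
      have B: "bilin K.V K.V (\<lambda>x y. p x * q y)" by (intro K.intros dual_mhom p q)
      have "K.SW (f h) (\<lambda>x y. p x * q y) = K.dprd q p (f h)" by (simp add: p q F h mult.commute)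
      also have "\<dots> = g (H.dprd (?i q) (?i p)) (f h)" using gm[OF G(6)[OF q] G(6)[OF p]] by (simp add: G p q)
      also have "\<dots> = H.dprd (?i q) (?i p) h" by (rule gf) (simp_all add: G p q h)
      also have "\<dots> = H.SW h (\<lambda>a b. p (f a) * q (f b))" by (simp add: G p q h ip mult.commute)
      also have "\<dots> = sw K.V K.V (tmap H.V H.V K.V K.V f f (Delta H h)) (\<lambda>x y. p x * q y)"
        by (rule sw_tmap[symmetric]) (simp_all add: F h B)
      finally show "K.SW (f h) (\<lambda>x y. p x * q y) = sw K.V K.V (tmap H.V H.V K.V K.V f f (Delta H h)) (\<lambda>x y. p x * q y)" .
    qed (simp_all add: F h tmap_closed)
  qed
qed

end

lemma B_functor:
  "is_functor (Bialg_gpd :: (('k::field, 'h) bialg, 'h \<Rightarrow> 'h) cat) BrSyst_gpd B_sys B_arr"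
proof -
  note b = bialgebra_bialg
  have obj: "bipointed_braided_system (B_sys H)" if "bialgebra H" for H :: "('k, 'h) bialg"
    by (rule bialg.B_sys_bipointed[OF b[OF that]])
  have i: "invertible_map (sp H) (sp K) f" if "bialg_iso H K f" for H K :: "('k, 'h) bialg" and f
    using that by (simp add: bialg_iso_iff)
  have inv_id: "inverse_map V V (\<lambda>v\<in>carrier V. v) = (\<lambda>v\<in>carrier V. v)" if "module class_ring V" for V :: "('k, 'h) module"
    using inverse_map_props[OF invertible_id[OF that]] by (auto simp: Lin_def intro!: extensionalityI)
  have id: "B_arr H H (\<lambda>h\<in>carrier (sp H). h) = Idn BrSyst_gpd (B_sys H)" if H: "bialgebra H" for H :: "('k, 'h) bialg"
  proof -
    interpret bialg H by (rule b[OF H])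
    have "transpose_map V V (\<lambda>v\<in>carrier V. v) = (\<lambda>l\<in>carrier D. l)"
      using fdvs_module[OF algD(1)] transpose_map_props(3)[OF algD(1,1), of "\<lambda>v\<in>carrier V. v"]
      by (auto simp: transpose_map_def dual_carrier Lin_def extensional_def fun_eq_iff)
    then show ?thesis
      by (simp add: B_arr_def BrSyst_gpd_simps inv_id[OF fdvs_module[OF algD(1)]])
  qed
  have comp: "B_arr H L (compose (carrier (sp H)) g f) =
      Comp BrSyst_gpd (B_sys H) (B_sys K) (B_sys L) (B_arr K L g) (B_arr H K f)"
    if H: "bialgebra H" and K: "bialgebra K" and L: "bialgebra L" and f: "bialg_iso H K f" and g: "bialg_iso K L g"
    for H K L :: "('k, 'h) bialg" and f g
  proof -
    interpret H: bialg H by (rule b[OF H])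
    interpret K: bialg K by (rule b[OF K])
    interpret L: bialg L by (rule b[OF L])
    note F = inverse_map_props[OF i[OF f]] and G = inverse_map_props[OF i[OF g]]
    note c = invertible_compose[OF fdvs_module[OF H.algD(1)] fdvs_module[OF L.algD(1)] i[OF f] i[OF g]]
    note C = inverse_map_props[OF c]
    have inv: "inverse_map H.V L.V (compose (carrier H.V) g f) v = inverse_map H.V K.V f (inverse_map K.V L.V g v)"
      if v: "v \<in> carrier L.V" for v
      using C(2)[of "inverse_map H.V K.V f (inverse_map K.V L.V g v)"] v by (simp add: compose_eq F G)
    have "transpose_map L.V H.V (inverse_map H.V L.V (compose (carrier H.V) g f)) =
      compose (carrier H.D) (transpose_map L.V K.V (inverse_map K.V L.V g))
        (transpose_map K.V H.V (inverse_map H.V K.V f))" (is "?l = ?r")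
    proof (rule Lin_eqI)
      show "?l \<in> Lin H.D L.D" by (rule transpose_map_props(1)[OF L.algD(1) H.algD(1) C(8)])
      show "?r \<in> Lin H.D L.D"
        by (rule Lin_compose[OF fdvs_module[OF H.fdD] transpose_map_props(1)[OF K.algD(1) H.algD(1) F(8)] transpose_map_props(1)[OF L.algD(1) K.algD(1) G(8)]])
      show "?l l = ?r l" if l: "l \<in> carrier H.D" for l
        by (rule dual_eqI[of _ "L.V"])
           (simp_all add: l compose_eq transpose_map_props[OF L.algD(1) H.algD(1) C(8)] transpose_map_props[OF K.algD(1) H.algD(1) F(8)]
              transpose_map_props[OF L.algD(1) K.algD(1) G(8)] inv G)
    qed
    then show ?thesis by (simp add: B_arr_def BrSyst_gpd_simps)
  qed
  show ?thesis
    unfolding is_functor_def Bialg_gpd_simps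
    using groupoid_Bialg groupoid_BrSyst B_arr_iso[OF b b] id comp obj
    by (auto simp: groupoid_def BrSyst_gpd_simps(1,2)) (simp_all add: B_arr_def)
qed

text \<open>
  Faithfulness is clear as \<open>f\<close> is the first component of its image; fullness is \<open>br_iso_B_arr\<close>.
\<close>

lemma B_fully_faithful:
  "fully_faithful (Bialg_gpd :: (('k::field, 'h) bialg, 'h \<Rightarrow> 'h) cat) BrSyst_gpd B_sys B_arr"
  unfolding fully_faithful_def Bialg_gpd_simps BrSyst_gpd_simps
proof (intro ballI)
  fix H K :: "('k, 'h) bialg" assume "H \<in> {H. bialgebra H}" "K \<in> {H. bialgebra H}"
  then have H: "bialg H" and K: "bialg K" by (auto intro: bialgebra_bialg)
  show "bij_betw (B_arr H K) {f. bialg_iso H K f} {p. br_iso (B_sys H) (B_sys K) (fst p) (snd p)}"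
    unfolding bij_betw_def
  proof
    show "inj_on (B_arr H K) {f. bialg_iso H K f}" by (rule inj_onI) (simp add: B_arr_def)
    show "B_arr H K ` {f. bialg_iso H K f} = {p. br_iso (B_sys H) (B_sys K) (fst p) (snd p)}"
    proof (rule subset_antisym; rule subsetI)
      fix p assume "p \<in> {p. br_iso (B_sys H) (B_sys K) (fst p) (snd p)}"
      then have p: "br_iso (B_sys H) (B_sys K) (fst p) (snd p)" by simp
      have "p = B_arr H K (fst p)" using br_iso_B_arr(2)[OF H K p] by (simp add: B_arr_def prod_eq_iff)
      then show "p \<in> B_arr H K ` {f. bialg_iso H K f}" using br_iso_B_arr(1)[OF H K p] by blast
    qed (use B_arr_iso[OF H K] in \<open>auto simp: B_arr_def\<close>)
  qed
qed

section \<open>Equivalences that are the identity on morphisms\<close>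

text \<open>
  If a functor is bijective on objects and the identity on sets of morphisms, identities and
  composites, the inverse bijection is a functor of the same kind and the identities form the unit
  and counit. The reverse equivalence is recorded too, because it is the direction in which some
  of the equivalences are needed.
\<close>

lemma equivalence_functorI:
  assumes C: "category C" and D: "category D" and bij: "bij_betw Fo (Obj C) (Obj D)"
    and hom: "\<And>a b. a \<in> Obj C \<Longrightarrow> b \<in> Obj C \<Longrightarrow> Hom D (Fo a) (Fo b) = Hom C a b"
    and idn: "\<And>a. a \<in> Obj C \<Longrightarrow> Idn D (Fo a) = Idn C a"
    and comp: "\<And>a b c g f. a \<in> Obj C \<Longrightarrow> b \<in> Obj C \<Longrightarrow> c \<in> Obj C \<Longrightarrow>
      Comp D (Fo a) (Fo b) (Fo c) g f = Comp C a b c g f"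
  shows "equivalence_functor C D Fo (\<lambda>a b f. f)" "equivalent_cats D C"
proof -
  let ?G = "inv_into (Obj C) Fo"
  have Fc: "Fo a \<in> Obj D" if "a \<in> Obj C" for a using bij that by (auto simp: bij_betw_def)
  have Gc: "?G d \<in> Obj C" "Fo (?G d) = d" if "d \<in> Obj D" for d
    using bij that by (auto simp: bij_betw_def inv_into_into f_inv_into_f)
  have GF: "?G (Fo a) = a" if "a \<in> Obj C" for a using bij that by (auto simp: bij_betw_def)
  have i: "is_iso X a a (Idn X a)" if "category X" "a \<in> Obj X" for X :: "('x, 'y) cat" and a
    using that unfolding category_def is_iso_def by blast
  have u: "Comp X a b b (Idn X b) f = Comp X a a b f (Idn X a)"
    if "category X" "a \<in> Obj X" "b \<in> Obj X" "f \<in> Hom X a b" for X :: "('x, 'y) cat" and a b f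
    using that unfolding category_def by metis
  have F: "is_functor C D Fo (\<lambda>a b f. f)"
    using C D Fc hom idn comp by (simp add: is_functor_def)
  have hom': "Hom C (?G a) (?G b) = Hom D a b" if "a \<in> Obj D" "b \<in> Obj D" for a b
    using hom[of "?G a" "?G b"] Gc that by simp
  have idn': "Idn C (?G a) = Idn D a" if "a \<in> Obj D" for a
    using idn[of "?G a"] Gc that by simp
  have comp': "Comp C (?G a) (?G b) (?G c) g f = Comp D a b c g f"
    if "a \<in> Obj D" "b \<in> Obj D" "c \<in> Obj D" for a b c g f
    using comp[of "?G a" "?G b" "?G c"] Gc that by simp
  have G: "is_functor D C ?G (\<lambda>a b f. f)"
    using C D Gc hom' idn' comp' by (simp add: is_functor_def)
  have n1: "natural_iso C C (\<lambda>a. a) (\<lambda>a b f. f) (\<lambda>a. ?G (Fo a)) (\<lambda>a b f. f) (Idn C)"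
    using i[OF C] u[OF C] by (simp add: natural_iso_def GF)
  have n2: "natural_iso D D (\<lambda>a. Fo (?G a)) (\<lambda>a b f. f) (\<lambda>a. a) (\<lambda>a b f. f) (Idn D)"
    using i[OF D] u[OF D] by (simp add: natural_iso_def Gc)
  have n3: "natural_iso D D (\<lambda>a. a) (\<lambda>a b f. f) (\<lambda>a. Fo (?G a)) (\<lambda>a b f. f) (Idn D)"
    using i[OF D] u[OF D] by (simp add: natural_iso_def Gc)
  have n4: "natural_iso C C (\<lambda>a. ?G (Fo a)) (\<lambda>a b f. f) (\<lambda>a. a) (\<lambda>a b f. f) (Idn C)"
    using i[OF C] u[OF C] by (simp add: natural_iso_def GF)
  show "equivalence_functor C D Fo (\<lambda>a b f. f)"
    unfolding equivalence_functor_def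
    by (intro conjI F exI[of _ ?G] exI[of _ "\<lambda>a b f. f"] exI[of _ "Idn C"] exI[of _ "Idn D"] G n1 n2)
  show "equivalent_cats D C"
    unfolding equivalent_cats_def equivalence_functor_def
    by (intro exI[of _ ?G] exI[of _ "\<lambda>a b f. f"] conjI G exI[of _ Fo] exI[of _ "Idn C"] exI[of _ "Idn D"] F n3 n4)
qed

text \<open>
  All module categories have this shape: only the closure of the condition \<open>P\<close> on linear maps
  under identities and composition has to be checked for each.
\<close>

lemma category_of_linear_maps:
  assumes m: "\<And>M. M \<in> Ob \<Longrightarrow> fdvs (U M)"
    and id: "\<And>M. M \<in> Ob \<Longrightarrow> P M M (\<lambda>m\<in>carrier (U M). m)"
    and comp: "\<And>M N L f g. M \<in> Ob \<Longrightarrow> N \<in> Ob \<Longrightarrow> L \<in> Ob \<Longrightarrow> f \<in> Lin (U M) (U N) \<Longrightarrow> g \<in> Lin (U N) (U L) \<Longrightarrow>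
      P M N f \<Longrightarrow> P N L g \<Longrightarrow> P M L (compose (carrier (U M)) g f)"
  shows "category \<lparr>Obj = Ob, Hom = (\<lambda>M N. {f \<in> Lin (U M) (U N). P M N f}),
    Idn = (\<lambda>M. \<lambda>m\<in>carrier (U M). m), Comp = (\<lambda>M N L g f. compose (carrier (U M)) g f)\<rparr>"
  unfolding category_def
  by (auto intro: restrict_Lin[OF fdvs_module[OF m] mhom_id] id comp compose_id_Lin compose_assoc_Lin
      Lin_compose[OF fdvs_module[OF m]])


section \<open>Modules in scalar form\<close>

lemma act_hom_iff:
  assumes fd: "fdvs M" "fdvs N" "fdvs V" and r: "\<rho> \<in> Lin (M \<boxtimes> V) M" and r': "\<rho>' \<in> Lin (N \<boxtimes> V) N" and f: "f \<in> Lin M N"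
  shows "act_hom M N V \<rho> \<rho>' f \<longleftrightarrow>
    (\<forall>m\<in>carrier M. \<forall>v\<in>carrier V. f (\<rho> (ptens M V m v)) = \<rho>' (ptens N V (f m) v))"
proof -
  have e: "tmap M V N V f (\<lambda>x. x) (ptens M V m v) = ptens N V (f m) v" if "m \<in> carrier M" "v \<in> carrier V" for m v
    by (rule tmap_ptens[OF fd(1,3,2,3) in_Lin[OF f] mhom_id that])
  note l = mhom_compose[OF in_Lin[OF r] in_Lin[OF f]]
  note r = mhom_compose[OF in_Lin[OF tmap_Lin[OF fd(1,3,2,3) in_Lin[OF f] mhom_id]] in_Lin[OF r']]
  show ?thesis unfolding act_hom_def
  proof (intro iffI ballI)
    fix m v assume "\<forall>t\<in>carrier (M \<boxtimes> V). f (\<rho> t) = \<rho>' (tmap M V N V f (\<lambda>x. x) t)" "m \<in> carrier M" "v \<in> carrier V"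
    then show "f (\<rho> (ptens M V m v)) = \<rho>' (ptens N V (f m) v)" using e fd by simp
  next
    fix t assume *: "\<forall>m\<in>carrier M. \<forall>v\<in>carrier V. f (\<rho> (ptens M V m v)) = \<rho>' (ptens N V (f m) v)" and t: "t \<in> carrier (M \<boxtimes> V)"
    show "f (\<rho> t) = \<rho>' (tmap M V N V f (\<lambda>x. x) t)"
      by (rule Lin_tensor_eq[OF fd(1,3,2) l r _ t]) (simp add: e *)
  qed
qed

lemma act_hom_id:
  assumes "fdvs M" "fdvs V" "\<rho> \<in> Lin (M \<boxtimes> V) M"
  shows "act_hom M M V \<rho> \<rho> (\<lambda>m\<in>carrier M. m)"
  unfolding act_hom_iff[OF assms(1,1,2,3,3) restrict_Lin[OF fdvs_module[OF assms(1)] mhom_id]]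
  by (simp add: Lin_closed[OF assms(3)] assms)

lemma act_hom_compose:
  assumes fd: "fdvs M" "fdvs N" "fdvs L" "fdvs V"
    and r: "\<rho> \<in> Lin (M \<boxtimes> V) M" "\<rho>' \<in> Lin (N \<boxtimes> V) N" "\<rho>'' \<in> Lin (L \<boxtimes> V) L"
    and f: "f \<in> Lin M N" and g: "g \<in> Lin N L" and h: "act_hom M N V \<rho> \<rho>' f" "act_hom N L V \<rho>' \<rho>'' g"
  shows "act_hom M L V \<rho> \<rho>'' (compose (carrier M) g f)"
  using h
  unfolding act_hom_iff[OF fd(1,2,4) r(1,2) f] act_hom_iff[OF fd(2,3,4) r(2,3) g]
    act_hom_iff[OF fd(1,3,4) r(1,3) Lin_compose[OF fdvs_module[OF fd(1)] f g]]
  by (simp add: compose_eq Lin_closed[OF r(1)] Lin_closed[OF f] fd)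

text \<open>
  The relation \<open>\<rho>\<^sub>j (\<rho>\<^sub>i \<otimes> Id) = \<rho>\<^sub>i (\<rho>\<^sub>j \<otimes> Id) (Id \<otimes> \<sigma>)\<close> on pure tensors and under functionals of
  \<open>M\<close>, where the only Sweedler sum left is over the value of \<open>\<sigma>\<close>.
\<close>

lemma braided_commute_iff:
  assumes fd: "fdvs M" "fdvs Vi" "fdvs Vj" and ri: "\<rho>i \<in> Lin (M \<boxtimes> Vi) M" and rj: "\<rho>j \<in> Lin (M \<boxtimes> Vj) M"
    and s: "\<sigma> \<in> Lin (Vi \<boxtimes> Vj) (Vj \<boxtimes> Vi)"
  shows "braided_commute M Vi Vj \<rho>i \<rho>j \<sigma> \<longleftrightarrow>
    (\<forall>m\<in>carrier M. \<forall>f\<in>Lin M ground. \<forall>a\<in>carrier Vi. \<forall>b\<in>carrier Vj.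
      f (\<rho>j (ptens M Vj (\<rho>i (ptens M Vi m a)) b)) =
      sw Vj Vi (\<sigma> (ptens Vi Vj a b)) (\<lambda>b' a'. f (\<rho>i (ptens M Vi (\<rho>j (ptens M Vj m b')) a'))))"
proof -
  note c = Lin_closed[OF ri] Lin_closed[OF rj] Lin_closed[OF s]
  note m = in_Lin[OF ri] in_Lin[OF rj] in_Lin[OF s] mhom_compose[OF _ in_Lin[OF ri]] mhom_compose[OF _ in_Lin[OF rj]] mhom_compose[OF _ in_Lin[OF s]]
  let ?l = "\<lambda>t. \<rho>j (tmap (M \<boxtimes> Vi) Vj M Vj \<rho>i (\<lambda>x. x) t)"
  let ?h = "\<lambda>t. \<rho>i (tmap (M \<boxtimes> Vj) Vi M Vi \<rho>j (\<lambda>x. x) t)"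
  let ?r = "\<lambda>t. ?h (swap23 M Vi Vj \<sigma> t)"
  let ?P = "\<lambda>m a b. ptens (M \<boxtimes> Vi) Vj (ptens M Vi m a) b"
  have L: "?l \<in> mhom ((M \<boxtimes> Vi) \<boxtimes> Vj) M"
    by (intro m in_Lin[OF tmap_Lin] fd fdvs_tensor mhom_id)
  have Hm: "?h \<in> mhom ((M \<boxtimes> Vj) \<boxtimes> Vi) M"
    by (intro m in_Lin[OF tmap_Lin] fd fdvs_tensor mhom_id)
  have R: "?r \<in> mhom ((M \<boxtimes> Vi) \<boxtimes> Vj) M"
    by (rule mhom_compose[OF swap23_mhom[OF fd s] Hm])
  have P: "?P m a b \<in> carrier ((M \<boxtimes> Vi) \<boxtimes> Vj)" if "m \<in> carrier M" "a \<in> carrier Vi" "b \<in> carrier Vj" for m a b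
    by (intro tensor_ptens fd fdvs_tensor that)
  have l: "?l (?P m a b) = \<rho>j (ptens M Vj (\<rho>i (ptens M Vi m a)) b)"
    if "m \<in> carrier M" "a \<in> carrier Vi" "b \<in> carrier Vj" for m a b
    using tmap_ptens[OF fdvs_tensor[OF fd(1,2)] fd(3,1,3) in_Lin[OF ri] mhom_id tensor_ptens[OF fd(1,2) that(1,2)] that(3)] by simp
  have r: "f (?r (?P m a b)) = sw Vj Vi (\<sigma> (ptens Vi Vj a b)) (\<lambda>b' a'. f (\<rho>i (ptens M Vi (\<rho>j (ptens M Vj m b')) a')))"
    if f: "f \<in> Lin M ground" and mab: "m \<in> carrier M" "a \<in> carrier Vi" "b \<in> carrier Vj" for f m a b
  proof -
    note fm = mhom_compose[OF _ in_Lin[OF f]]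
    note I = linear_intros fd c m mab fm
    let ?B = "\<lambda>s a. f (?h (ptens (M \<boxtimes> Vj) Vi s a))"
    have B: "bilin (M \<boxtimes> Vj) Vi ?B" by (intro linear_intros fd fm mhom_compose[OF _ Hm])
    have b3: "bilin (M \<boxtimes> Vi) Vj (\<lambda>s b. sw M Vi s (\<lambda>u v. sw Vj Vi (\<sigma> (ptens Vi Vj v b)) (\<lambda>b' a'. ?B (ptens M Vj u b') a')))"
      by (intro linear_intros fd bilinear_intros[OF B] m c)
    have b4: "bilin M Vi (\<lambda>u v. sw Vj Vi (\<sigma> (ptens Vi Vj v b)) (\<lambda>b' a'. ?B (ptens M Vj u b') a'))"
      by (intro linear_intros fd bilinear_intros[OF B] m c mab)
    have e: "sw (M \<boxtimes> Vj) Vi (swap23 M Vi Vj \<sigma> (?P m a b)) ?B =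
        sw (M \<boxtimes> Vi) Vj (?P m a b) (\<lambda>s b. sw M Vi s (\<lambda>u v. sw Vj Vi (\<sigma> (ptens Vi Vj v b)) (\<lambda>b' a'. ?B (ptens M Vj u b') a')))"
      by (rule sw_swap23[OF fd s P[OF mab] B])
    have "f (?r (?P m a b)) = sw (M \<boxtimes> Vj) Vi (swap23 M Vi Vj \<sigma> (?P m a b)) ?B"
      by (rule functional_sw[OF fdvs_tensor[OF fd(1,3)] fd(2) mhom_compose[OF Hm in_Lin[OF f]] mhomD(1)[OF swap23_mhom[OF fd s] P[OF mab]]])
    also have "\<dots> = sw M Vi (ptens M Vi m a) (\<lambda>u v. sw Vj Vi (\<sigma> (ptens Vi Vj v b)) (\<lambda>b' a'. ?B (ptens M Vj u b') a'))"
      unfolding e by (rule sw_ptens) (intro linear_intros fd mab b3)+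
    also have "\<dots> = sw Vj Vi (\<sigma> (ptens Vi Vj a b)) (\<lambda>b' a'. ?B (ptens M Vj m b') a')"
      by (rule sw_ptens) (intro linear_intros fd mab b4)+
    also have "\<dots> = sw Vj Vi (\<sigma> (ptens Vi Vj a b)) (\<lambda>b' a'. f (\<rho>i (ptens M Vi (\<rho>j (ptens M Vj m b')) a')))"
    proof (intro sw_cong refl arg_cong[where f = f] arg_cong[where f = \<rho>i])
      fix b' a' assume "b' \<in> carrier Vj" "a' \<in> carrier Vi"
      then show "tmap (M \<boxtimes> Vj) Vi M Vi \<rho>j (\<lambda>x. x) (ptens (M \<boxtimes> Vj) Vi (ptens M Vj m b') a') = ptens M Vi (\<rho>j (ptens M Vj m b')) a'"
        using tmap_ptens[OF fdvs_tensor[OF fd(1,3)] fd(2,1,2) in_Lin[OF rj] mhom_id tensor_ptens[OF fd(1,3) mab(1)]] by simp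
    qed
    finally show ?thesis .
  qed
  have "braided_commute M Vi Vj \<rho>i \<rho>j \<sigma> \<longleftrightarrow> (\<forall>m\<in>carrier M. \<forall>a\<in>carrier Vi. \<forall>b\<in>carrier Vj. ?l (?P m a b) = ?r (?P m a b))"
    unfolding braided_commute_def using P Lin_tensor3_eq[OF fd fd(1) L R] by blast
  also have "\<dots> \<longleftrightarrow> (\<forall>m\<in>carrier M. \<forall>a\<in>carrier Vi. \<forall>b\<in>carrier Vj. \<forall>f\<in>Lin M ground. f (?l (?P m a b)) = f (?r (?P m a b)))"
    using vec_eqI[OF fd(1) mhomD(1)[OF L P] mhomD(1)[OF R P]] by (intro ball_cong refl) metis
  also have "\<dots> \<longleftrightarrow> (\<forall>m\<in>carrier M. \<forall>f\<in>Lin M ground. \<forall>a\<in>carrier Vi. \<forall>b\<in>carrier Vj.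
      f (\<rho>j (ptens M Vj (\<rho>i (ptens M Vi m a)) b)) =
      sw Vj Vi (\<sigma> (ptens Vi Vj a b)) (\<lambda>b' a'. f (\<rho>i (ptens M Vi (\<rho>j (ptens M Vj m b')) a'))))"
    using l r by auto
  finally show ?thesis .
qed

text \<open>
  For fixed \<open>m\<close> and \<open>f\<close> the relation has the form \<open>F t = G (\<sigma> t)\<close> with linear forms \<open>F\<close> and \<open>G\<close>,
  where exchanging the roles of the two actions exchanges \<open>F\<close> and \<open>G\<close>. Hence it says the same for
  \<open>\<sigma>\<close> and all \<open>t\<close> as for the inverse of \<open>\<sigma>\<close> and all \<open>\<sigma> t\<close>.
\<close>

lemma braided_commute_inverse:
  fixes M :: "('k::field, 'm) module" and Vi :: "('k, 'v) module" and Vj :: "('k, 'w) module"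
  assumes fd: "fdvs M" "fdvs Vi" "fdvs Vj" and ri: "\<rho>i \<in> Lin (M \<boxtimes> Vi) M" and rj: "\<rho>j \<in> Lin (M \<boxtimes> Vj) M"
    and inv: "invertible_map (Vi \<boxtimes> Vj) (Vj \<boxtimes> Vi) \<sigma>"
  shows "braided_commute M Vj Vi \<rho>j \<rho>i (inverse_map (Vi \<boxtimes> Vj) (Vj \<boxtimes> Vi) \<sigma>) \<longleftrightarrow> braided_commute M Vi Vj \<rho>i \<rho>j \<sigma>"
proof -
  let ?\<theta> = "inverse_map (Vi \<boxtimes> Vj) (Vj \<boxtimes> Vi) \<sigma>"
  note S = inverse_map_props[OF inv]
  (* From pure tensors to all tensors, so that the substitution of \<sigma> t for t becomes possible. *)
  have 1: "(\<forall>a\<in>carrier X. \<forall>b\<in>carrier Y. F a b = sw Y X (\<tau> (ptens X Y a b)) G) \<longleftrightarrow>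
      (\<forall>t\<in>carrier (X \<boxtimes> Y). sw X Y t F = sw Y X (\<tau> t) G)"
    if X: "fdvs X" and Y: "fdvs Y" and F: "bilin X Y F" and t: "\<tau> \<in> mhom (X \<boxtimes> Y) (Y \<boxtimes> X)"
    for X :: "('k, 'x) module" and Y :: "('k, 'y) module" and F G \<tau>
  proof (intro iffI ballI)
    fix t' assume *: "\<forall>a\<in>carrier X. \<forall>b\<in>carrier Y. F a b = sw Y X (\<tau> (ptens X Y a b)) G" and t': "t' \<in> carrier (X \<boxtimes> Y)"
    show "sw X Y t' F = sw Y X (\<tau> t') G"
    proof (rule Lin_tensor_eq[OF X Y fdvs_ground sw_mhom_left[OF X Y] mhom_compose[OF t sw_mhom_left[OF Y X]] _ t'])
      fix v w assume v: "v \<in> carrier X" and w: "w \<in> carrier Y"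
      show "sw X Y (ptens X Y v w) F = sw Y X (\<tau> (ptens X Y v w)) G"
        unfolding sw_ptens[OF X Y v w F] using * v w by blast
    qed
  next
    fix a b assume "\<forall>t\<in>carrier (X \<boxtimes> Y). sw X Y t F = sw Y X (\<tau> t) G" "a \<in> carrier X" "b \<in> carrier Y"
    then show "F a b = sw Y X (\<tau> (ptens X Y a b)) G" using sw_ptens[OF X Y _ _ F] tensor_ptens[OF X Y] by metis
  qed
  have 2: "bilin Vi Vj (\<lambda>a b. f (\<rho>j (ptens M Vj (\<rho>i (ptens M Vi m a)) b)))"
    "bilin Vj Vi (\<lambda>b a. f (\<rho>i (ptens M Vi (\<rho>j (ptens M Vj m b)) a)))"
    if "m \<in> carrier M" "f \<in> Lin M ground" for m f
    by (intro linear_intros fd that mhom_compose[OF _ in_Lin[OF that(2)]] mhom_compose[OF _ in_Lin[OF ri]] mhom_compose[OF _ in_Lin[OF rj]] Lin_closed[OF ri] Lin_closed[OF rj]; assumption)+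
  show ?thesis
    unfolding braided_commute_iff[OF fd ri rj S(4)] braided_commute_iff[OF fd(1,3,2) rj ri S(1)]
  proof (intro ball_cong refl)
    fix m f assume mf: "m \<in> carrier M" "f \<in> Lin M ground"
    show "(\<forall>a\<in>carrier Vj. \<forall>b\<in>carrier Vi. f (\<rho>i (ptens M Vi (\<rho>j (ptens M Vj m a)) b)) =
        sw Vi Vj (?\<theta> (ptens Vj Vi a b)) (\<lambda>b' a'. f (\<rho>j (ptens M Vj (\<rho>i (ptens M Vi m b')) a')))) \<longleftrightarrow>
      (\<forall>a\<in>carrier Vi. \<forall>b\<in>carrier Vj. f (\<rho>j (ptens M Vj (\<rho>i (ptens M Vi m a)) b)) =
        sw Vj Vi (\<sigma> (ptens Vi Vj a b)) (\<lambda>b' a'. f (\<rho>i (ptens M Vi (\<rho>j (ptens M Vj m b')) a'))))"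
      unfolding 1[OF fd(2,3) 2(1)[OF mf] S(7)] 1[OF fd(3,2) 2(2)[OF mf] S(8)]
    proof (intro iffI ballI, goal_cases)
      case (1 t)
      from 1(1)[rule_format, OF S(5)[OF 1(2)]] show ?case using S(2)[OF 1(2)] by simp
    next
      case (2 t)
      from 2(1)[rule_format, OF S(6)[OF 2(2)]] show ?case using S(3)[OF 2(2)] by simp
    qed
  qed
qed

lemma right_moduleD:
  assumes "right_module A M \<rho>"
  shows "fdvs M" "\<rho> \<in> Lin (M \<boxtimes> sp A) M"
    "m \<in> carrier M \<Longrightarrow> a \<in> carrier (sp A) \<Longrightarrow> b \<in> carrier (sp A) \<Longrightarrow>
       \<rho> (ptens M (sp A) (\<rho> (ptens M (sp A) m a)) b) = \<rho> (ptens M (sp A) m (mu A (ptens (sp A) (sp A) a b)))"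
    "m \<in> carrier M \<Longrightarrow> \<rho> (ptens M (sp A) m (nu A 1)) = m"
  using assms by (auto simp: right_module_def)

text \<open>
  As \<open>\<sigma>\<close> sends \<open>a \<otimes> b\<close> to \<open>1 \<otimes> a b\<close> or \<open>a b \<otimes> 1\<close> and the unit acts trivially, braided commutation
  of an action with itself reads \<open>(m a) b = m (a b)\<close>.
\<close>

lemma right_module_iff_braided:
  assumes A: "unital_algebra A" and s: "\<sigma> = sigma_ass A \<or> \<sigma> = sigma_ass_r A"
  shows "fdvs M \<and> \<rho> \<in> Lin (M \<boxtimes> sp A) M \<and> braided_commute M (sp A) (sp A) \<rho> \<rho> \<sigma> \<and>
     (\<forall>m\<in>carrier M. \<rho> (ptens M (sp A) m (nu A 1)) = m) \<longleftrightarrow> right_module A M \<rho>"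
proof (cases "fdvs M \<and> \<rho> \<in> Lin (M \<boxtimes> sp A) M \<and> (\<forall>m\<in>carrier M. \<rho> (ptens M (sp A) m (nu A 1)) = m)")
  case True
  then have M: "fdvs M" and r: "\<rho> \<in> Lin (M \<boxtimes> sp A) M" and u: "\<And>m. m \<in> carrier M \<Longrightarrow> \<rho> (ptens M (sp A) m (nu A 1)) = m"
    by auto
  note V = unital_algebraD[OF A]
  have sL: "\<sigma> \<in> Lin (sp A \<boxtimes> sp A) (sp A \<boxtimes> sp A)" using s sigma_ass_Lin[OF A] sigma_ass_r_Lin[OF A] by auto
  have e: "sw (sp A) (sp A) (\<sigma> (ptens (sp A) (sp A) a b)) (\<lambda>b' a'. f (\<rho> (ptens M (sp A) (\<rho> (ptens M (sp A) m b')) a'))) =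
      f (\<rho> (ptens M (sp A) m (mu A (ptens (sp A) (sp A) a b))))"
    if "m \<in> carrier M" "f \<in> Lin M ground" "a \<in> carrier (sp A)" "b \<in> carrier (sp A)" for m f a b
  proof -
    note c = Lin_closed[OF r]
    have B: "bilin (sp A) (sp A) (\<lambda>b' a'. f (\<rho> (ptens M (sp A) (\<rho> (ptens M (sp A) m b')) a')))"
      by (intro linear_intros M V that mhom_compose[OF _ in_Lin[OF that(2)]] mhom_compose[OF _ in_Lin[OF r]] c)
    show ?thesis
      using s that by (elim disjE) (simp_all add: sigma_ass_ptens[OF A] sigma_ass_r_ptens[OF A] sw_ptens V B u M c)
  qed
  have "braided_commute M (sp A) (sp A) \<rho> \<rho> \<sigma> \<longleftrightarrow>
    (\<forall>m\<in>carrier M. \<forall>f\<in>Lin M ground. \<forall>a\<in>carrier (sp A). \<forall>b\<in>carrier (sp A).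
       f (\<rho> (ptens M (sp A) (\<rho> (ptens M (sp A) m a)) b)) = f (\<rho> (ptens M (sp A) m (mu A (ptens (sp A) (sp A) a b)))))"
    unfolding braided_commute_iff[OF M V(1,1) r r sL] using e by auto
  also have "\<dots> \<longleftrightarrow> (\<forall>m\<in>carrier M. \<forall>a\<in>carrier (sp A). \<forall>b\<in>carrier (sp A).
        \<rho> (ptens M (sp A) (\<rho> (ptens M (sp A) m a)) b) = \<rho> (ptens M (sp A) m (mu A (ptens (sp A) (sp A) a b))))"
  proof (intro ball_cong refl iffI ballI, goal_cases)
    case (1 m a b)
    show ?case
    proof (rule vec_eqI[OF M])
      show "\<rho> (ptens M (sp A) (\<rho> (ptens M (sp A) m a)) b) \<in> carrier M"
        "\<rho> (ptens M (sp A) m (mu A (ptens (sp A) (sp A) a b))) \<in> carrier M"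
        by (intro Lin_closed[OF r] tensor_ptens M V 1)+
    qed (use 1 in blast)
  qed auto
  finally show ?thesis using True by (auto simp: right_module_def)
qed (auto simp: right_module_def)

lemma braided_module_iff:
  assumes 1: "unital_algebra A1" and 2: "unital_algebra A2"
    and S: "V1 S = sp A1" "V2 S = sp A2" "sig11 S = sigma_ass A1 \<or> sig11 S = sigma_ass_r A1"
      "sig22 S = sigma_ass A2 \<or> sig22 S = sigma_ass_r A2" "nu1 S = nu A1" "nu2 S = nu A2"
  shows "braided_module S X \<longleftrightarrow> right_module A1 (bm_sp X) (bm_act1 X) \<and> right_module A2 (bm_sp X) (bm_act2 X) \<and>
     braided_commute (bm_sp X) (sp A1) (sp A2) (bm_act1 X) (bm_act2 X) (sig12 S)"
  unfolding braided_module_def Let_def S(1,2,5,6)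
    right_module_iff_braided[OF 1 S(3), symmetric] right_module_iff_braided[OF 2 S(4), symmetric] by blast


section \<open>Modules over a twisted tensor product\<close>

text \<open>
  Naturality in the units makes \<open>a \<mapsto> a \<otimes> 1\<close> and \<open>b \<mapsto> 1 \<otimes> b\<close> multiplicative maps into the twisted
  product, whose images generate it: \<open>(a \<otimes> 1) (1 \<otimes> b) = a \<otimes> b\<close>, while the product in the opposite
  order is \<open>\<sigma> (b \<otimes> a)\<close> (\<open>mu_T_units\<close>). A module over it is therefore the same as a pair of actions
  that commute up to \<open>\<sigma>\<close>.
\<close>

locale twisting =
  fixes A :: "('k::field, 'v, 'y) alg_scheme" and B :: "('k, 'w, 'z) alg_scheme"
    and \<sigma> :: "('k, 'w, 'v) tensor \<Rightarrow> ('k, 'v, 'w) tensor"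
  assumes A: "unital_algebra A" and B: "unital_algebra B"
    and sigma: "\<sigma> \<in> Lin (sp B \<boxtimes> sp A) (sp A \<boxtimes> sp B)"
    and nat1: "a \<in> carrier (sp A) \<Longrightarrow> \<sigma> (ptens (sp B) (sp A) (nu B 1) a) = ptens (sp A) (sp B) a (nu B 1)"
    and nat2: "b \<in> carrier (sp B) \<Longrightarrow> \<sigma> (ptens (sp B) (sp A) b (nu A 1)) = ptens (sp A) (sp B) (nu A 1) b"
begin

abbreviation "P \<equiv> sp A"
abbreviation "Q \<equiv> sp B"
abbreviation "PQ \<equiv> sp A \<boxtimes> sp B"
abbreviation "T \<equiv> twisted_product A B \<sigma>"

lemmas AD [simp] = unital_algebraD(1,4-8)[OF A]
lemmas BD [simp] = unital_algebraD(1,4-8)[OF B]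

lemma fdPQ [simp]: "fdvs PQ"
  by (simp add: fdvs_tensor)

lemma sp_T [simp]: "sp T = PQ" and nu_T [simp]: "nu T 1 = ptens P Q (nu A 1) (nu B 1)"
proof -
  interpret M: Module.module class_ring "PQ" using fdPQ by (rule fdvs_module)
  show "sp T = PQ" by (simp add: twisted_product_def Let_def)
  show "nu T 1 = ptens P Q (nu A 1) (nu B 1)"
    using M.smult_one[of "ptens P Q (nu A 1) (nu B 1)"] by (simp add: twisted_product_def Let_def)
qed

lemma
  assumes t: "t \<in> carrier (PQ \<boxtimes> PQ)"
  shows mu_T_closed: "mu T t \<in> carrier PQ"
    and sw_mu_T: "bilin P Q F \<Longrightarrow> sw P Q (mu T t) F = sw PQ PQ t (\<lambda>x y. sw P Q x (\<lambda>a b. sw P Q y (\<lambda>a' b'.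
       sw P Q (\<sigma> (ptens Q P b a')) (\<lambda>a'' b''. F (mu A (ptens P P a a'')) (mu B (ptens Q Q b'' b'))))))"
proof -
  note m = unital_algebraD(2)[OF A] unital_algebraD(2)[OF B]
  note sm = swap_mid_mhom[OF AD(1) BD(1) AD(1) BD(1) sigma]
  have e: "mu T t = tmap (P \<boxtimes> P) (Q \<boxtimes> Q) P Q (mu A) (mu B) (swap_mid P Q P Q \<sigma> t)"
    using t by (simp add: twisted_product_def Let_def)
  show "mu T t \<in> carrier PQ"
    unfolding e by (intro tmap_closed fdvs_tensor AD BD in_Lin[OF m(1)] in_Lin[OF m(2)] mhomD(1)[OF sm t])
  assume F: "bilin P Q F"
  have b: "bilin (P \<boxtimes> P) (Q \<boxtimes> Q) (\<lambda>p q. F (mu A p) (mu B q))"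
    by (intro bilinear_mapI bilinear_intros[OF F] in_Lin[OF m(1)] in_Lin[OF m(2)] Lin_closed[OF m(1)] Lin_closed[OF m(2)])
  have "sw P Q (mu T t) F = sw (P \<boxtimes> P) (Q \<boxtimes> Q) (swap_mid P Q P Q \<sigma> t) (\<lambda>p q. F (mu A p) (mu B q))"
    unfolding e by (rule sw_tmap) (intro fdvs_tensor AD BD in_Lin[OF m(1)] in_Lin[OF m(2)] mhomD(1)[OF sm t] F)+
  then show "sw P Q (mu T t) F = sw PQ PQ t (\<lambda>x y. sw P Q x (\<lambda>a b. sw P Q y (\<lambda>a' b'.
       sw P Q (\<sigma> (ptens Q P b a')) (\<lambda>a'' b''. F (mu A (ptens P P a a'')) (mu B (ptens Q Q b'' b'))))))"
    unfolding sw_swap_mid[OF AD(1) BD(1) AD(1) BD(1) sigma t b] .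
qed

lemma mu_T_mhom: "mu T \<in> mhom (PQ \<boxtimes> PQ) PQ"
proof (rule mhom_cong)
  note m = unital_algebraD(2)[OF A] unital_algebraD(2)[OF B]
  note sm = swap_mid_mhom[OF AD(1) BD(1) AD(1) BD(1) sigma]
  show "(\<lambda>t. tmap (P \<boxtimes> P) (Q \<boxtimes> Q) P Q (mu A) (mu B) (swap_mid P Q P Q \<sigma> t)) \<in> mhom (PQ \<boxtimes> PQ) PQ"
    by (rule mhom_compose[OF sm in_Lin[OF tmap_Lin]]) (intro fdvs_tensor AD BD in_Lin[OF m(1)] in_Lin[OF m(2)])+
qed (auto simp: twisted_product_def Let_def intro!: fdvs_module fdvs_tensor)

lemma mulmhom:
  "f \<in> mhom X P \<Longrightarrow> a \<in> carrier P \<Longrightarrow> (\<lambda>x. mu A (ptens P P a (f x))) \<in> mhom X P"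
  "f \<in> mhom X P \<Longrightarrow> a \<in> carrier P \<Longrightarrow> (\<lambda>x. mu A (ptens P P (f x) a)) \<in> mhom X P"
  "g \<in> mhom X Q \<Longrightarrow> b \<in> carrier Q \<Longrightarrow> (\<lambda>x. mu B (ptens Q Q b (g x))) \<in> mhom X Q"
  "g \<in> mhom X Q \<Longrightarrow> b \<in> carrier Q \<Longrightarrow> (\<lambda>x. mu B (ptens Q Q (g x) b)) \<in> mhom X Q"
  by (intro mu_mhom[OF A] mu_mhom[OF B] linear_intros AD BD; assumption)+

lemma sw_mu_T_ptens:
  assumes c: "a \<in> carrier P" "b \<in> carrier Q" "a' \<in> carrier P" "b' \<in> carrier Q" and F: "bilin P Q F"
  shows "sw P Q (mu T (ptens PQ PQ (ptens P Q a b) (ptens P Q a' b'))) F =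
     sw P Q (\<sigma> (ptens Q P b a')) (\<lambda>a'' b''. F (mu A (ptens P P a a'')) (mu B (ptens Q Q b'' b')))"
proof -
  note I = linear_intros AD BD fdPQ c bilinear_intros[OF F] mulmhom in_Lin[OF sigma] mhom_compose[OF _ in_Lin[OF sigma]] Lin_closed[OF sigma]
  let ?t = "ptens PQ PQ (ptens P Q a b) (ptens P Q a' b')"
  have t: "?t \<in> carrier (PQ \<boxtimes> PQ)" by (intro I)
  have b1: "bilin PQ PQ (\<lambda>x y. sw P Q x (\<lambda>a b. sw P Q y (\<lambda>a' b'.
       sw P Q (\<sigma> (ptens Q P b a')) (\<lambda>a'' b''. F (mu A (ptens P P a a'')) (mu B (ptens Q Q b'' b'))))))" by (intro I)
  have b2: "bilin P Q (\<lambda>a b. sw P Q (ptens P Q a' b') (\<lambda>a' b'.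
       sw P Q (\<sigma> (ptens Q P b a')) (\<lambda>a'' b''. F (mu A (ptens P P a a'')) (mu B (ptens Q Q b'' b')))))" by (intro I)
  have b3: "bilin P Q (\<lambda>a' b'.
       sw P Q (\<sigma> (ptens Q P b a')) (\<lambda>a'' b''. F (mu A (ptens P P a a'')) (mu B (ptens Q Q b'' b'))))" by (intro I)
  show ?thesis
    unfolding sw_mu_T[OF t F] sw_ptens[OF fdPQ fdPQ tensor_ptens[OF AD(1) BD(1) c(1,2)] tensor_ptens[OF AD(1) BD(1) c(3,4)] b1]
      sw_ptens[OF AD(1) BD(1) c(1,2) b2] by (rule sw_ptens[OF AD(1) BD(1) c(3,4) b3])
qed

lemma mu_T_units:
  assumes a: "a \<in> carrier P" and b: "b \<in> carrier Q"
  shows "mu T (ptens PQ PQ (ptens P Q a (nu B 1)) (ptens P Q (nu A 1) b)) = ptens P Q a b"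
    "a' \<in> carrier P \<Longrightarrow> mu T (ptens PQ PQ (ptens P Q a (nu B 1)) (ptens P Q a' (nu B 1))) =
       ptens P Q (mu A (ptens P P a a')) (nu B 1)"
    "b' \<in> carrier Q \<Longrightarrow> mu T (ptens PQ PQ (ptens P Q (nu A 1) b) (ptens P Q (nu A 1) b')) =
       ptens P Q (nu A 1) (mu B (ptens Q Q b b'))"
    "mu T (ptens PQ PQ (ptens P Q (nu A 1) b) (ptens P Q a (nu B 1))) = \<sigma> (ptens Q P b a)"
proof -
  have c: "mu T (ptens PQ PQ (ptens P Q a b) (ptens P Q a' b')) \<in> carrier PQ"
    if "a \<in> carrier P" "b \<in> carrier Q" "a' \<in> carrier P" "b' \<in> carrier Q" for a b a' b'
    by (rule mu_T_closed) (simp add: that)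
  have b: "bilin P Q (\<lambda>a'' b''. F (mu A (ptens P P a a'')) (mu B (ptens Q Q b'' b')))"
    if "bilin P Q F" "a \<in> carrier P" "b' \<in> carrier Q" for F a b'
    by (intro linear_intros AD BD that bilinear_intros[OF that(1)] mulmhom)
  note E = sw_mu_T_ptens sw_ptens[OF AD(1) BD(1)] nat1 nat2 b
  show "mu T (ptens PQ PQ (ptens P Q a (nu B 1)) (ptens P Q (nu A 1) b)) = ptens P Q a b"
    by (rule tensor_eqI[OF AD(1) BD(1) c]) (simp_all add: assms E)
  show "mu T (ptens PQ PQ (ptens P Q a (nu B 1)) (ptens P Q a' (nu B 1))) =
       ptens P Q (mu A (ptens P P a a')) (nu B 1)" if "a' \<in> carrier P"
  proof (rule tensor_eqI[OF AD(1) BD(1) c])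
    fix F assume F: "bilin P Q F"
    show "sw P Q (mu T (ptens PQ PQ (ptens P Q a (nu B 1)) (ptens P Q a' (nu B 1)))) F =
        sw P Q (ptens P Q (mu A (ptens P P a a')) (nu B 1)) F"
      using sw_ptens[OF AD(1) BD(1) that BD(2) b[OF F a BD(2)], of 1 1] by (simp add: E assms that F)
  qed (simp_all add: assms that)
  show "mu T (ptens PQ PQ (ptens P Q (nu A 1) b) (ptens P Q (nu A 1) b')) =
       ptens P Q (nu A 1) (mu B (ptens Q Q b b'))" if "b' \<in> carrier Q"
  proof (rule tensor_eqI[OF AD(1) BD(1) c])
    fix F assume F: "bilin P Q F"
    show "sw P Q (mu T (ptens PQ PQ (ptens P Q (nu A 1) b) (ptens P Q (nu A 1) b'))) F =
        sw P Q (ptens P Q (nu A 1) (mu B (ptens Q Q b b'))) F"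
      using sw_ptens[OF AD(1) BD(1) AD(2) assms(2) b[OF F AD(2) that], of 1 1] by (simp add: E assms that F)
  qed (simp_all add: assms that)
  show "mu T (ptens PQ PQ (ptens P Q (nu A 1) b) (ptens P Q a (nu B 1))) = \<sigma> (ptens Q P b a)"
    by (rule tensor_eqI[OF AD(1) BD(1) c]) (simp_all add: assms E Lin_closed[OF sigma])
qed

text \<open>
  The action \<open>m (a \<otimes> b) = (m a) b\<close> of the twisted product, given the two actions.
\<close>

definition pair_act :: "('k, 'm) module \<Rightarrow> (('k, 'm, 'w) tensor \<Rightarrow> 'm) \<Rightarrow> (('k, 'm, 'v) tensor \<Rightarrow> 'm)
    \<Rightarrow> ('k, 'm, ('k, 'v, 'w) tensor) tensor \<Rightarrow> 'm" where
  "pair_act M \<rho>1 \<rho>2 = (\<lambda>t\<in>carrier (M \<boxtimes> PQ). \<rho>1 (tmap (M \<boxtimes> P) Q M Q \<rho>2 (\<lambda>x. x) (tassoc_inv M P Q t)))"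

lemma pair_act_props:
  assumes M: "fdvs M" and r1: "\<rho>1 \<in> Lin (M \<boxtimes> Q) M" and r2: "\<rho>2 \<in> Lin (M \<boxtimes> P) M"
  shows pair_act_Lin: "pair_act M \<rho>1 \<rho>2 \<in> Lin (M \<boxtimes> PQ) M"
    and pair_act_ptens: "m \<in> carrier M \<Longrightarrow> a \<in> carrier P \<Longrightarrow> b \<in> carrier Q \<Longrightarrow>
      pair_act M \<rho>1 \<rho>2 (ptens M PQ m (ptens P Q a b)) = \<rho>1 (ptens M Q (\<rho>2 (ptens M P m a)) b)"
proof -
  note h = mhom_compose[OF in_Lin[OF tassoc_inv_Lin] mhom_compose[OF in_Lin[OF tmap_Lin] in_Lin[OF r1]]]
  show "pair_act M \<rho>1 \<rho>2 \<in> Lin (M \<boxtimes> PQ) M"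
    unfolding pair_act_def
    by (rule restrict_Lin[OF fdvs_module[OF fdvs_tensor[OF M fdPQ]] h]) (intro AD BD M fdvs_tensor in_Lin[OF r2] mhom_id)+
  assume m: "m \<in> carrier M" and a: "a \<in> carrier P" and b: "b \<in> carrier Q"
  have t: "tassoc_inv M P Q (ptens M PQ m (ptens P Q a b)) = ptens (M \<boxtimes> P) Q (ptens M P m a) b"
    unfolding tassoc_inv_def
      tlift_ptens[OF M fdPQ fdvs_tensor[OF fdvs_tensor[OF M AD(1)] BD(1)] tassoc_inv_bilinear[OF M AD(1) BD(1)] m tensor_ptens[OF AD(1) BD(1) a b]]
    by (rule tlift_ptens[OF AD(1) BD(1) fdvs_tensor[OF fdvs_tensor[OF M AD(1)] BD(1)] tassoc_inv_inner_bilinear[OF M AD(1) BD(1) m] a b])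
  have c: "ptens M PQ m (ptens P Q a b) \<in> carrier (M \<boxtimes> PQ)" by (simp add: M m a b)
  show "pair_act M \<rho>1 \<rho>2 (ptens M PQ m (ptens P Q a b)) = \<rho>1 (ptens M Q (\<rho>2 (ptens M P m a)) b)"
    using c tmap_ptens[OF fdvs_tensor[OF M AD(1)] BD(1) M BD(1) in_Lin[OF r2] mhom_id tensor_ptens[OF M AD(1) m a] b]
    by (simp add: pair_act_def t)
qed

lemma act_eqI:
  fixes N :: "('k, 'n) module"
  assumes M: "fdvs M" and N: "fdvs N" and f: "f \<in> mhom (M \<boxtimes> PQ) N" and g: "g \<in> mhom (M \<boxtimes> PQ) N"
    and e: "\<And>m a b. m \<in> carrier M \<Longrightarrow> a \<in> carrier P \<Longrightarrow> b \<in> carrier Q \<Longrightarrow>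
      f (ptens M PQ m (ptens P Q a b)) = g (ptens M PQ m (ptens P Q a b))"
    and t: "t \<in> carrier (M \<boxtimes> PQ)"
  shows "f t = g t"
proof (rule Lin_tensor_eq[OF M fdPQ N f g _ t])
  fix m x assume m: "m \<in> carrier M" and x: "x \<in> carrier PQ"
  show "f (ptens M PQ m x) = g (ptens M PQ m x)"
    by (rule Lin_tensor_eq[OF AD(1) BD(1) N mhom_compose[OF ptens_mhom2'[OF M fdPQ m] f] mhom_compose[OF ptens_mhom2'[OF M fdPQ m] g] _ x])
       (rule e[OF m])
qed

text \<open>
  On pure tensors, \<open>((m a) b) a'\<close> is rewritten by the commutation relation so that \<open>a'\<close> acts
  before \<open>b\<close>; associativity of the two actions then collects the product.
\<close>

lemma pair_act_module:
  assumes r1: "right_module B M \<rho>1" and r2: "right_module A M \<rho>2" and bc: "braided_commute M Q P \<rho>1 \<rho>2 \<sigma>"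
  shows "right_module T M (pair_act M \<rho>1 \<rho>2)"
proof -
  note 1 = right_moduleD[OF r1] and 2 = right_moduleD[OF r2]
  note M = 1(1)
  let ?\<alpha> = "pair_act M \<rho>1 \<rho>2"
  note aL = pair_act_Lin[OF M 1(2) 2(2)] and ap = pair_act_ptens[OF M 1(2) 2(2)]
  note am = in_Lin[OF aL] mhom_compose[OF _ in_Lin[OF aL]] and ac = Lin_closed[OF aL]
  note c = Lin_closed[OF 1(2)] Lin_closed[OF 2(2)] and m = in_Lin[OF 1(2)] mhom_compose[OF _ in_Lin[OF 1(2)]] in_Lin[OF 2(2)] mhom_compose[OF _ in_Lin[OF 2(2)]]
  note I = linear_intros AD BD fdPQ M c m ac am
  note bc' = bc[unfolded braided_commute_iff[OF M BD(1) AD(1) 1(2) 2(2) sigma], rule_format]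
  have pure: "?\<alpha> (ptens M PQ (?\<alpha> (ptens M PQ x (ptens P Q a b))) (ptens P Q a' b')) =
      ?\<alpha> (ptens M PQ x (mu T (ptens PQ PQ (ptens P Q a b) (ptens P Q a' b'))))"
    if x: "x \<in> carrier M" and cc: "a \<in> carrier P" "b \<in> carrier Q" "a' \<in> carrier P" "b' \<in> carrier Q" for x a b a' b'
  proof (rule vec_eqI[OF M])
    have tc: "mu T (ptens PQ PQ (ptens P Q a b) (ptens P Q a' b')) \<in> carrier PQ"
      by (rule mu_T_closed) (simp add: cc)
    show "?\<alpha> (ptens M PQ (?\<alpha> (ptens M PQ x (ptens P Q a b))) (ptens P Q a' b')) \<in> carrier M" by (intro I x cc)
    show "?\<alpha> (ptens M PQ x (mu T (ptens PQ PQ (ptens P Q a b) (ptens P Q a' b')))) \<in> carrier M" by (intro I x tc)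
    fix f assume f: "f \<in> Lin M ground"
    note fm = mhom_compose[OF _ in_Lin[OF f]]
    let ?F = "\<lambda>a b. f (\<rho>1 (ptens M Q (\<rho>2 (ptens M P x a)) b))"
    have F: "bilin P Q ?F" by (intro I fm x)
    (* The commutation relation is applied to the vector ?y, underneath the action of b'. *)
    let ?g = "\<lambda>z\<in>carrier M. f (\<rho>1 (ptens M Q z b'))"
    have g: "?g \<in> Lin M ground" by (rule restrict_Lin[OF fdvs_module[OF M]]) (intro I fm cc)
    let ?y = "\<rho>2 (ptens M P x a)"
    have y: "?y \<in> carrier M" by (intro I x cc)
    have "f (?\<alpha> (ptens M PQ x (mu T (ptens PQ PQ (ptens P Q a b) (ptens P Q a' b'))))) =
       sw P Q (mu T (ptens PQ PQ (ptens P Q a b) (ptens P Q a' b'))) (\<lambda>a b. f (?\<alpha> (ptens M PQ x (ptens P Q a b))))"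
      by (rule functional_sw[OF AD(1) BD(1) _ tc]) (intro I fm x)
    also have "\<dots> = sw P Q (mu T (ptens PQ PQ (ptens P Q a b) (ptens P Q a' b'))) ?F"
      by (simp add: ap x)
    also have "\<dots> = sw P Q (\<sigma> (ptens Q P b a')) (\<lambda>a'' b''. ?F (mu A (ptens P P a a'')) (mu B (ptens Q Q b'' b')))"
      by (rule sw_mu_T_ptens[OF cc F])
    also have "\<dots> = sw P Q (\<sigma> (ptens Q P b a')) (\<lambda>a'' b''. ?g (\<rho>1 (ptens M Q (\<rho>2 (ptens M P ?y a'')) b'')))"
      by (simp add: 1(3)[symmetric] 2(3)[symmetric] x cc c M)
    also have "\<dots> = ?g (\<rho>2 (ptens M P (\<rho>1 (ptens M Q ?y b)) a'))"
      by (rule bc'[OF y g cc(2,3), symmetric])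
    also have "\<dots> = f (?\<alpha> (ptens M PQ (?\<alpha> (ptens M PQ x (ptens P Q a b))) (ptens P Q a' b')))"
      using y by (simp add: ap c x cc M)
    finally show "f (?\<alpha> (ptens M PQ (?\<alpha> (ptens M PQ x (ptens P Q a b))) (ptens P Q a' b'))) =
      f (?\<alpha> (ptens M PQ x (mu T (ptens PQ PQ (ptens P Q a b) (ptens P Q a' b')))))" ..
  qed
  show ?thesis unfolding right_module_def sp_T nu_T
  proof (intro conjI ballI M aL)
    fix x s t assume x: "x \<in> carrier M" and s: "s \<in> carrier PQ" and t: "t \<in> carrier PQ"
    have tm: "mu T (ptens PQ PQ s t) \<in> carrier PQ" if "s \<in> carrier PQ" "t \<in> carrier PQ" for s t
      by (rule mu_T_closed) (simp add: that)
    note Tm = mhom_compose[OF _ mu_T_mhom]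
    show "?\<alpha> (ptens M PQ (?\<alpha> (ptens M PQ x s)) t) = ?\<alpha> (ptens M PQ x (mu T (ptens PQ PQ s t)))"
    proof (rule Lin_tensor_eq[OF AD(1) BD(1) M _ _ _ s])
      show "(\<lambda>s. ?\<alpha> (ptens M PQ (?\<alpha> (ptens M PQ x s)) t)) \<in> mhom PQ M" by (intro I x t)
      show "(\<lambda>s. ?\<alpha> (ptens M PQ x (mu T (ptens PQ PQ s t)))) \<in> mhom PQ M" by (intro I x t Tm)
      fix a b assume ab: "a \<in> carrier P" "b \<in> carrier Q"
      show "?\<alpha> (ptens M PQ (?\<alpha> (ptens M PQ x (ptens P Q a b))) t) =
        ?\<alpha> (ptens M PQ x (mu T (ptens PQ PQ (ptens P Q a b) t)))"
      proof (rule Lin_tensor_eq[OF AD(1) BD(1) M _ _ _ t])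
        show "(\<lambda>t. ?\<alpha> (ptens M PQ (?\<alpha> (ptens M PQ x (ptens P Q a b))) t)) \<in> mhom PQ M" by (intro I x ab)
        show "(\<lambda>t. ?\<alpha> (ptens M PQ x (mu T (ptens PQ PQ (ptens P Q a b) t)))) \<in> mhom PQ M" by (intro I x ab Tm)
      qed (rule pure[OF x ab])
    qed
  next
    fix x assume x: "x \<in> carrier M"
    show "?\<alpha> (ptens M PQ x (ptens P Q (nu A 1) (nu B 1))) = x"
      by (simp add: ap x 1(4) 2(4))
  qed
qed

text \<open>
  Restricting a module along the maps from the two algebras. The relations \<open>mu_T_units\<close> say in
  turn that the restrictions are modules, that they commute up to \<open>\<sigma>\<close>, and that they recover the
  action.
\<close>

lemma module_split:
  assumes al: "right_module T M \<alpha>"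
  defines "\<rho>1 \<equiv> \<lambda>t\<in>carrier (M \<boxtimes> Q). \<alpha> (tmap M Q M PQ (\<lambda>x. x) (ptens P Q (nu A 1)) t)"
    and "\<rho>2 \<equiv> \<lambda>t\<in>carrier (M \<boxtimes> P). \<alpha> (tmap M P M PQ (\<lambda>x. x) (\<lambda>a. ptens P Q a (nu B 1)) t)"
  shows "right_module B M \<rho>1" "right_module A M \<rho>2" "braided_commute M Q P \<rho>1 \<rho>2 \<sigma>" "pair_act M \<rho>1 \<rho>2 = \<alpha>"
proof -
  note a = right_moduleD[OF al, unfolded sp_T nu_T]
  note M = a(1) and ac = Lin_closed[OF a(2)] and am = in_Lin[OF a(2)] mhom_compose[OF _ in_Lin[OF a(2)]]
  have m1: "ptens P Q (nu A 1) \<in> mhom Q PQ" and m2: "(\<lambda>a. ptens P Q a (nu B 1)) \<in> mhom P PQ"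
    by (intro linear_intros AD BD)+
  have r1: "\<rho>1 \<in> Lin (M \<boxtimes> Q) M" and r2: "\<rho>2 \<in> Lin (M \<boxtimes> P) M"
    unfolding \<rho>1_def \<rho>2_def
    by (intro restrict_Lin fdvs_module fdvs_tensor M AD BD am in_Lin[OF tmap_Lin] m1 m2 mhom_id)+
  have p1: "\<rho>1 (ptens M Q x b) = \<alpha> (ptens M PQ x (ptens P Q (nu A 1) b))" if "x \<in> carrier M" "b \<in> carrier Q" for x b
    using tmap_ptens[OF M BD(1) M fdPQ mhom_id m1 that] by (simp add: \<rho>1_def M that)
  have p2: "\<rho>2 (ptens M P x b) = \<alpha> (ptens M PQ x (ptens P Q b (nu B 1)))" if "x \<in> carrier M" "b \<in> carrier P" for x b
    using tmap_ptens[OF M AD(1) M fdPQ mhom_id m2 that] by (simp add: \<rho>2_def M that)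
  have p12: "\<rho>1 (ptens M Q (\<rho>2 (ptens M P x a)) b) = \<alpha> (ptens M PQ x (ptens P Q a b))"
    if "x \<in> carrier M" "a \<in> carrier P" "b \<in> carrier Q" for x a b
    using that by (simp add: p1 p2 ac M a(3) mu_T_units)
  show "right_module B M \<rho>1" unfolding right_module_def
    by (simp add: M r1 p1 ac a(3,4) mu_T_units(3)[OF AD(2)])
  show "right_module A M \<rho>2" unfolding right_module_def
    by (simp add: M r2 p2 ac a(3,4) mu_T_units(2)[OF _ BD(2)])
  show "braided_commute M Q P \<rho>1 \<rho>2 \<sigma>"
    unfolding braided_commute_iff[OF M BD(1) AD(1) r1 r2 sigma]
  proof (intro ballI)
    fix x f b a' assume x: "x \<in> carrier M" and f: "f \<in> Lin M ground" and b: "b \<in> carrier Q" and a': "a' \<in> carrier P"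
    have "f (\<rho>2 (ptens M P (\<rho>1 (ptens M Q x b)) a')) = f (\<alpha> (ptens M PQ x (\<sigma> (ptens Q P b a'))))"
      using x b a' by (simp add: p1 p2 ac M a(3) mu_T_units)
    also have "\<dots> = sw P Q (\<sigma> (ptens Q P b a')) (\<lambda>a b. f (\<alpha> (ptens M PQ x (ptens P Q a b))))"
      by (rule functional_sw[OF AD(1) BD(1)])
         (intro linear_intros AD BD fdPQ M mhom_compose[OF _ in_Lin[OF f]] am x Lin_closed[OF sigma] b a')+
    finally show "f (\<rho>2 (ptens M P (\<rho>1 (ptens M Q x b)) a')) =
        sw P Q (\<sigma> (ptens Q P b a')) (\<lambda>b' a'. f (\<rho>1 (ptens M Q (\<rho>2 (ptens M P x b')) a')))"
      using x by (simp add: p12)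
  qed
  show "pair_act M \<rho>1 \<rho>2 = \<alpha>"
  proof (rule Lin_eqI[OF pair_act_Lin[OF M r1 r2] a(2)])
    show "pair_act M \<rho>1 \<rho>2 t = \<alpha> t" if "t \<in> carrier (M \<boxtimes> PQ)" for t
      by (rule act_eqI[OF M M in_Lin[OF pair_act_Lin[OF M r1 r2]] am(1) _ that]) (simp add: pair_act_ptens[OF M r1 r2] p12)
  qed
qed

lemma pair_act_inj:
  assumes "right_module B M \<rho>1" "right_module A M \<rho>2" "right_module B M \<rho>1'" "right_module A M \<rho>2'"
    and e: "pair_act M \<rho>1 \<rho>2 = pair_act M \<rho>1' \<rho>2'"
  shows "\<rho>1 = \<rho>1'" "\<rho>2 = \<rho>2'"
proof -
  note R1 = right_moduleD[OF assms(1)] and R2 = right_moduleD[OF assms(2)]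
    and S1 = right_moduleD[OF assms(3)] and S2 = right_moduleD[OF assms(4)]
  note M = R1(1) and c = Lin_closed[OF R2(2)] Lin_closed[OF S2(2)]
  note p = pair_act_ptens[OF M R1(2) R2(2)] pair_act_ptens[OF M S1(2) S2(2)]
  show "\<rho>1 = \<rho>1'"
  proof (rule Lin_eqI[OF R1(2) S1(2)], rule Lin_tensor_eq[OF M BD(1) M in_Lin[OF R1(2)] in_Lin[OF S1(2)]])
    fix m b assume m: "m \<in> carrier M" and b: "b \<in> carrier Q"
    have "pair_act M \<rho>1 \<rho>2 (ptens M PQ m (ptens P Q (nu A 1) b)) = \<rho>1 (ptens M Q m b)"
      using m b by (simp add: p R2)
    moreover have "pair_act M \<rho>1' \<rho>2' (ptens M PQ m (ptens P Q (nu A 1) b)) = \<rho>1' (ptens M Q m b)"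
      using m b by (simp add: p S2)
    ultimately show "\<rho>1 (ptens M Q m b) = \<rho>1' (ptens M Q m b)" using e by simp
  qed
  show "\<rho>2 = \<rho>2'"
  proof (rule Lin_eqI[OF R2(2) S2(2)], rule Lin_tensor_eq[OF M AD(1) M in_Lin[OF R2(2)] in_Lin[OF S2(2)]])
    fix m a assume m: "m \<in> carrier M" and a: "a \<in> carrier P"
    have "pair_act M \<rho>1 \<rho>2 (ptens M PQ m (ptens P Q a (nu B 1))) = \<rho>2 (ptens M P m a)"
      using m a by (simp add: p R1 c M)
    moreover have "pair_act M \<rho>1' \<rho>2' (ptens M PQ m (ptens P Q a (nu B 1))) = \<rho>2' (ptens M P m a)"
      using m a by (simp add: p S1 c M)
    ultimately show "\<rho>2 (ptens M P m a) = \<rho>2' (ptens M P m a)" using e by simp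
  qed
qed

text \<open>
  Inserting the unit of either algebra recovers linearity for the action of the other.
\<close>

lemma pair_act_hom:
  assumes r: "right_module B M \<rho>1" "right_module A M \<rho>2" "right_module B N \<rho>1'" "right_module A N \<rho>2'"
    and f: "f \<in> Lin M N"
  shows "act_hom M N PQ (pair_act M \<rho>1 \<rho>2) (pair_act N \<rho>1' \<rho>2') f \<longleftrightarrow>
    act_hom M N Q \<rho>1 \<rho>1' f \<and> act_hom M N P \<rho>2 \<rho>2' f"
proof -
  note R1 = right_moduleD[OF r(1)] and R2 = right_moduleD[OF r(2)]
    and S1 = right_moduleD[OF r(3)] and S2 = right_moduleD[OF r(4)]
  note M = R1(1) and N = S1(1) and c = Lin_closed[OF R2(2)] Lin_closed[OF S2(2)] Lin_closed[OF f]
  note p = pair_act_ptens[OF M R1(2) R2(2)] pair_act_ptens[OF N S1(2) S2(2)]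
  note L = pair_act_Lin[OF M R1(2) R2(2)] pair_act_Lin[OF N S1(2) S2(2)]
  have "act_hom M N PQ (pair_act M \<rho>1 \<rho>2) (pair_act N \<rho>1' \<rho>2') f \<longleftrightarrow>
    (\<forall>m\<in>carrier M. \<forall>a\<in>carrier P. \<forall>b\<in>carrier Q. f (\<rho>1 (ptens M Q (\<rho>2 (ptens M P m a)) b)) = \<rho>1' (ptens N Q (\<rho>2' (ptens N P (f m) a)) b))"
    (is "?h \<longleftrightarrow> ?s")
  proof
    assume ?h
    then show ?s unfolding act_hom_iff[OF M N fdPQ L f] using p c by (metis AD(1) BD(1) tensor_ptens)
  next
    assume s: ?s
    show ?h unfolding act_hom_iff[OF M N fdPQ L f]
    proof (intro ballI)
      fix m t assume m: "m \<in> carrier M" and t: "t \<in> carrier PQ"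
      show "f (pair_act M \<rho>1 \<rho>2 (ptens M PQ m t)) = pair_act N \<rho>1' \<rho>2' (ptens N PQ (f m) t)"
        by (rule Lin_tensor_eq[OF AD(1) BD(1) N mhom_compose[OF mhom_compose[OF ptens_mhom2'[OF M fdPQ m] in_Lin[OF L(1)]] in_Lin[OF f]]
             mhom_compose[OF ptens_mhom2'[OF N fdPQ c(3)[OF m]] in_Lin[OF L(2)]] _ t]) (simp add: p m c s)
    qed
  qed
  moreover have "?s \<longleftrightarrow> act_hom M N Q \<rho>1 \<rho>1' f \<and> act_hom M N P \<rho>2 \<rho>2' f"
    unfolding act_hom_iff[OF M N BD(1) R1(2) S1(2) f] act_hom_iff[OF M N AD(1) R2(2) S2(2) f]
  proof (intro iffI conjI ballI)
    fix m b assume s: ?s and m: "m \<in> carrier M" and b: "b \<in> carrier Q"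
    show "f (\<rho>1 (ptens M Q m b)) = \<rho>1' (ptens N Q (f m) b)"
      using s[rule_format, OF m AD(2)[of 1] b] by (simp add: R2(4) S2(4) m c)
  next
    fix m a assume s: ?s and m: "m \<in> carrier M" and a: "a \<in> carrier P"
    show "f (\<rho>2 (ptens M P m a)) = \<rho>2' (ptens N P (f m) a)"
      using s[rule_format, OF m a BD(2)[of 1]] by (simp add: R1(4) S1(4) m a c M N)
  next
    fix m a b assume "(\<forall>m\<in>carrier M. \<forall>v\<in>carrier Q. f (\<rho>1 (ptens M Q m v)) = \<rho>1' (ptens N Q (f m) v)) \<and>
       (\<forall>m\<in>carrier M. \<forall>v\<in>carrier P. f (\<rho>2 (ptens M P m v)) = \<rho>2' (ptens N P (f m) v))"
      and "m \<in> carrier M" "a \<in> carrier P" "b \<in> carrier Q"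
    then show "f (\<rho>1 (ptens M Q (\<rho>2 (ptens M P m a)) b)) = \<rho>1' (ptens N Q (\<rho>2' (ptens N P (f m) a)) b)"
      by (simp add: c M)
  qed
  ultimately show ?thesis by blast
qed

end

lemma category_Mod_alg:
  assumes A: "fdvs (sp A)" shows "category (Mod_alg A)"
  unfolding Mod_alg_def
proof (rule category_of_linear_maps)
  fix M N L f g
  assume m: "M \<in> {M. right_module A (am_sp M) (am_act M)}" "N \<in> {M. right_module A (am_sp M) (am_act M)}"
    "L \<in> {M. right_module A (am_sp M) (am_act M)}" "f \<in> Lin (am_sp M) (am_sp N)" "g \<in> Lin (am_sp N) (am_sp L)"
    "act_hom (am_sp M) (am_sp N) (sp A) (am_act M) (am_act N) f" "act_hom (am_sp N) (am_sp L) (sp A) (am_act N) (am_act L) g"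
  then show "act_hom (am_sp M) (am_sp L) (sp A) (am_act M) (am_act L) (compose (carrier (am_sp M)) g f)"
    using act_hom_compose[of "am_sp M" "am_sp N" "am_sp L" "sp A" "am_act M" "am_act N" "am_act L" f g] A
    by (auto simp: right_moduleD(1,2))
qed (auto intro!: act_hom_id A simp: right_moduleD(1,2))

lemma category_Mod_br:
  assumes A: "fdvs (V1 S)" "fdvs (V2 S)" shows "category (Mod_br S)"
  unfolding Mod_br_def
proof (rule category_of_linear_maps)
  fix M N L f g
  assume m: "M \<in> {M. braided_module S M}" "N \<in> {M. braided_module S M}" "L \<in> {M. braided_module S M}"
    "f \<in> Lin (bm_sp M) (bm_sp N)" "g \<in> Lin (bm_sp N) (bm_sp L)"
    "act_hom (bm_sp M) (bm_sp N) (V1 S) (bm_act1 M) (bm_act1 N) f \<and> act_hom (bm_sp M) (bm_sp N) (V2 S) (bm_act2 M) (bm_act2 N) f"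
    "act_hom (bm_sp N) (bm_sp L) (V1 S) (bm_act1 N) (bm_act1 L) g \<and> act_hom (bm_sp N) (bm_sp L) (V2 S) (bm_act2 N) (bm_act2 L) g"
  then show "act_hom (bm_sp M) (bm_sp L) (V1 S) (bm_act1 M) (bm_act1 L) (compose (carrier (bm_sp M)) g f) \<and>
    act_hom (bm_sp M) (bm_sp L) (V2 S) (bm_act2 M) (bm_act2 L) (compose (carrier (bm_sp M)) g f)"
    using act_hom_compose[of "bm_sp M" "bm_sp N" "bm_sp L" "V1 S" "bm_act1 M" "bm_act1 N" "bm_act1 L" f g]
      act_hom_compose[of "bm_sp M" "bm_sp N" "bm_sp L" "V2 S" "bm_act2 M" "bm_act2 N" "bm_act2 L" f g] A
    by (auto simp: braided_module_def Let_def)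
qed (auto intro!: act_hom_id A simp: braided_module_def Let_def)

text \<open>
  Stated for a system whose diagonal braidings come from any two algebras, since it is needed both
  for the system of a bialgebra and for the one with the two components exchanged.
\<close>

lemma Mod_br_to_Mod_alg:
  fixes A1 :: "('k::field, 'v, 'y) alg_scheme" and A2 :: "('k, 'w, 'z) alg_scheme"
  assumes S: "V1 S = sp A1" "V2 S = sp A2" "sig11 S = sigma_ass A1 \<or> sig11 S = sigma_ass_r A1"
      "sig22 S = sigma_ass A2 \<or> sig22 S = sigma_ass_r A2" "nu1 S = nu A1" "nu2 S = nu A2"
    and tw: "twisting A2 A1 (sig12 S)"
  shows "equivalence_functor (Mod_br S :: (('k, 'm, 'v, 'w) br_mod, 'm \<Rightarrow> 'm) cat)
      (Mod_alg (twisted_product A2 A1 (sig12 S))) (br_to_alg S) (\<lambda>M N f. f)"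
    and "equivalent_cats (Mod_alg (twisted_product A2 A1 (sig12 S)) :: (('k, 'm, ('k, 'w, 'v) tensor) alg_mod, 'm \<Rightarrow> 'm) cat)
      (Mod_br S :: (('k, 'm, 'v, 'w) br_mod, 'm \<Rightarrow> 'm) cat)"
proof -
  interpret twisting A2 A1 "sig12 S" by (rule tw)
  let ?C = "Mod_br S :: (('k, 'm, 'v, 'w) br_mod, 'm \<Rightarrow> 'm) cat"
  let ?D = "Mod_alg (twisted_product A2 A1 (sig12 S)) :: (('k, 'm, ('k, 'w, 'v) tensor) alg_mod, 'm \<Rightarrow> 'm) cat"
  note bm = braided_module_iff[OF B A S]
  have F: "br_to_alg S X = \<lparr>am_sp = bm_sp X, am_act = pair_act (bm_sp X) (bm_act1 X) (bm_act2 X)\<rparr>" for X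
    by (simp add: br_to_alg_def Let_def pair_act_def S)
  have C: "category ?C" by (rule category_Mod_br) (simp_all add: S(1,2))
  have D: "category ?D" by (rule category_Mod_alg) simp
  have bij: "bij_betw (br_to_alg S) (Obj ?C) (Obj ?D)"
    unfolding bij_betw_def
  proof
    show "inj_on (br_to_alg S) (Obj ?C)"
    proof (rule inj_onI)
      fix X Y assume X: "X \<in> Obj ?C" and Y: "Y \<in> Obj ?C" and e: "br_to_alg S X = br_to_alg S Y"
      have s: "bm_sp Y = bm_sp X" using e by (simp add: F)
      have "bm_act1 X = bm_act1 Y \<and> bm_act2 X = bm_act2 Y"
        using X Y e pair_act_inj[of "bm_sp X" "bm_act1 X" "bm_act2 X" "bm_act1 Y" "bm_act2 Y"]
        by (simp add: Mod_br_def bm F s)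
      with s show "X = Y" by simp
    qed
    show "br_to_alg S ` Obj ?C = Obj ?D"
    proof (rule subset_antisym; rule subsetI)
      fix Y assume "Y \<in> br_to_alg S ` Obj ?C"
      then show "Y \<in> Obj ?D" by (auto simp: Mod_br_def Mod_alg_def bm F intro!: pair_act_module)
    next
      fix Y assume "Y \<in> Obj ?D"
      then have "right_module T (am_sp Y) (am_act Y)" by (simp add: Mod_alg_def)
      note sp = module_split[OF this]
      let ?X = "\<lparr>bm_sp = am_sp Y,
        bm_act1 = \<lambda>t\<in>carrier (am_sp Y \<boxtimes> Q). am_act Y (tmap (am_sp Y) Q (am_sp Y) PQ (\<lambda>x. x) (ptens P Q (nu A2 1)) t),
        bm_act2 = \<lambda>t\<in>carrier (am_sp Y \<boxtimes> P). am_act Y (tmap (am_sp Y) P (am_sp Y) PQ (\<lambda>x. x) (\<lambda>a. ptens P Q a (nu A1 1)) t)\<rparr>"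
      have "?X \<in> Obj ?C" using sp by (simp add: Mod_br_def bm)
      moreover have "br_to_alg S ?X = Y" using sp(4) by (simp add: F)
      ultimately show "Y \<in> br_to_alg S ` Obj ?C" by (rule image_eqI[OF sym, rotated])
    qed
  qed
  have hom: "Hom ?D (br_to_alg S X) (br_to_alg S Y) = Hom ?C X Y" if "X \<in> Obj ?C" "Y \<in> Obj ?C" for X Y
  proof -
    have r: "right_module A1 (bm_sp X) (bm_act1 X)" "right_module A2 (bm_sp X) (bm_act2 X)"
      "right_module A1 (bm_sp Y) (bm_act1 Y)" "right_module A2 (bm_sp Y) (bm_act2 Y)"
      using that by (simp_all add: Mod_br_def bm)
    show ?thesis
      using pair_act_hom[OF r] unfolding Mod_br_def Mod_alg_def F S cat.simps alg_mod.simps sp_T by blast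
  qed
  note E = equivalence_functorI[OF C D bij hom]
  show "equivalence_functor ?C ?D (br_to_alg S) (\<lambda>M N f. f)"
    by (rule E(1)) (simp_all add: Mod_br_def Mod_alg_def F)
  show "equivalent_cats ?D ?C"
    by (rule E(2)) (simp_all add: Mod_br_def Mod_alg_def F)
qed

section \<open>Hopf modules as braided modules\<close>

context bialg
begin

context
  fixes M :: "('k, 'm) module"
  assumes M: "fdvs M"
begin

lemma delta_co_inner_bilinear:
  "l \<in> carrier D \<Longrightarrow> bilinear_map M V M (\<lambda>a b. l b \<odot>\<^bsub>M\<^esub> a)"
  by (intro bilinear_mapI mhom_smult1 mhom_smult2 mhom_id M algD dual_mhom)

lemma delta_co_props:
  assumes d: "\<delta> \<in> Lin M (M \<boxtimes> V)"
  shows delta_co_Lin: "delta_co H M \<delta> \<in> Lin (M \<boxtimes> D) M"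
    and delta_co_ptens: "m \<in> carrier M \<Longrightarrow> l \<in> carrier D \<Longrightarrow>
      delta_co H M \<delta> (ptens M D m l) = tlift M V M (\<lambda>a b. l b \<odot>\<^bsub>M\<^esub> a) (\<delta> m)"
    and functional_delta_co: "m \<in> carrier M \<Longrightarrow> l \<in> carrier D \<Longrightarrow> f \<in> mhom M ground \<Longrightarrow>
      f (delta_co H M \<delta> (ptens M D m l)) = sw M V (\<delta> m) (\<lambda>a b. l b * f a)"
proof -
  note dc = Lin_closed[OF d]
  have b: "bilinear_map M D M (\<lambda>m l. tlift M V M (\<lambda>a b. l b \<odot>\<^bsub>M\<^esub> a) (\<delta> m))"
  proof (rule bilinear_mapI)
    show "(\<lambda>l. tlift M V M (\<lambda>a b. l b \<odot>\<^bsub>M\<^esub> a) (\<delta> m)) \<in> mhom D M" if m: "m \<in> carrier M" for m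
      by (rule mhom_tlift_right[OF M algD(1) M fdD dc[OF m] delta_co_inner_bilinear])
         (assumption, intro mhom_smult1 fdD M eval_mhom)
    show "(\<lambda>m. tlift M V M (\<lambda>a b. l b \<odot>\<^bsub>M\<^esub> a) (\<delta> m)) \<in> mhom M M" if l: "l \<in> carrier D" for l
      by (rule mhom_tlift_left[OF M algD(1) M delta_co_inner_bilinear[OF l] in_Lin[OF d]])
  qed
  show "delta_co H M \<delta> \<in> Lin (M \<boxtimes> D) M"
    unfolding delta_co_def by (rule tlift_Lin[OF M fdD M b])
  show e: "delta_co H M \<delta> (ptens M D m l) = tlift M V M (\<lambda>a b. l b \<odot>\<^bsub>M\<^esub> a) (\<delta> m)"
    if "m \<in> carrier M" "l \<in> carrier D" for m l
    unfolding delta_co_def by (rule tlift_ptens[OF M fdD M b that])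
  show "f (delta_co H M \<delta> (ptens M D m l)) = sw M V (\<delta> m) (\<lambda>a b. l b * f a)"
    if m: "m \<in> carrier M" and l: "l \<in> carrier D" and f: "f \<in> mhom M ground"
    unfolding e[OF m l] functional_tlift[OF M algD(1) M delta_co_inner_bilinear[OF l] f dc[OF m]]
    by (intro sw_cong refl) (simp add: mhomD(3)[OF f])
qed

text \<open>
  By \<open>functional_delta_co\<close> the induced action records the values of \<open>\<delta> m\<close> on all products of
  functionals.
\<close>

lemma delta_co_inj:
  assumes d: "\<delta> \<in> Lin M (M \<boxtimes> V)" and d': "\<delta>' \<in> Lin M (M \<boxtimes> V)" and e: "delta_co H M \<delta> = delta_co H M \<delta>'"
  shows "\<delta> = \<delta>'"
proof (rule Lin_eqI[OF d d'])
  fix m assume m: "m \<in> carrier M"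
  show "\<delta> m = \<delta>' m"
  proof (rule tensor_eqI_prod[OF M algD(1) Lin_closed[OF d m] Lin_closed[OF d' m]])
    fix f g assume f: "f \<in> Lin M ground" and g: "g \<in> Lin V ground"
    then show "sw M V (\<delta> m) (\<lambda>v w. f v * g w) = sw M V (\<delta>' m) (\<lambda>v w. f v * g w)"
      using functional_delta_co[OF d m, of g f] functional_delta_co[OF d' m, of g f]
      by (simp add: dual_carrier e mult.commute)
  qed
qed

text \<open>
  The coaction belonging to an action \<open>\<rho>\<close> of the dual is \<open>m \<mapsto> \<Sum> \<rho> (m \<otimes> \<phi>\<^sub>i) \<otimes> i\<close> over the chosen
  basis of \<open>H\<close> with coordinate functionals \<open>\<phi>\<close>; it is written here as a functional of bilinear
  forms.
\<close>

lemma delta_co_surj: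
  assumes r: "\<rho> \<in> Lin (M \<boxtimes> D) M"
  shows "\<exists>\<delta>\<in>Lin M (M \<boxtimes> V). delta_co H M \<delta> = \<rho>"
proof -
  note rc = Lin_closed[OF r] and rm = in_Lin[OF r] mhom_compose[OF _ in_Lin[OF r]]
  let ?F = "bilinear_forms M V"
  have ci: "coo V i \<in> carrier D" if "i \<in> bas V" for i using bas_props(3)[OF algD(1) that] by (simp add: dual_carrier)
  define t where "t m = (\<lambda>b\<in>carrier ?F. \<Sum>i\<in>bas V. b (\<rho> (ptens M D m (coo V i)), i))" for m
  have tc: "t m \<in> carrier (M \<boxtimes> V)" if m: "m \<in> carrier M" for m
    unfolding t_def tensor_space_def dual_carrier
  proof (rule restrict_Lin[OF module_bf[OF fdvs_module[OF M] fdvs_module[OF algD(1)]]])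
    show "(\<lambda>b. \<Sum>i\<in>bas V. b (\<rho> (ptens M D m (coo V i)), i)) \<in> mhom ?F ground"
      by (intro mhom_ground_sum mhomI) (use m ci in \<open>auto simp: rc M bas_carrier\<close>)
  qed
  have ts: "sw M V (t m) b = (\<Sum>i\<in>bas V. b (\<rho> (ptens M D m (coo V i))) i)" if m: "m \<in> carrier M" and b: "bilin M V b" for m b
    unfolding sw_eval[OF M algD(1) tc[OF m] b] using restrict_bilinear[OF M algD(1) b] m ci
    by (auto simp: t_def rc M bas_carrier simp del: bf_simps intro!: sum.cong)
  define \<delta> where "\<delta> = (\<lambda>m\<in>carrier M. t m)"
  have d: "\<delta> \<in> Lin M (M \<boxtimes> V)"
    unfolding \<delta>_def
  proof (rule restrict_Lin[OF fdvs_module[OF M]], rule mhom_weakI[OF fdvs_module[OF M] fdvs_tensor[OF M algD(1)] tc])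
    fix g assume g: "g \<in> Lin (M \<boxtimes> V) ground"
    note gm = mhom_compose[OF _ in_Lin[OF g]]
    have b: "bilin M V (\<lambda>a b. g (ptens M V a b))" by (intro linear_intros gm M algD)
    have "(\<lambda>m. \<Sum>i\<in>bas V. g (ptens M V (\<rho> (ptens M D m (coo V i))) i)) \<in> mhom M ground"
      by (intro mhom_ground_sum linear_intros gm rm M algD fdD ci bas_carrier)
    then show "(\<lambda>m. g (t m)) \<in> mhom M ground"
      by (rule mhom_cong[OF _ fdvs_module[OF M], rotated])
         (simp add: functional_sw[OF M algD(1) in_Lin[OF g] tc] ts[OF _ b])
  qed
  have "delta_co H M \<delta> = \<rho>"
  proof (rule Lin_eqI[OF delta_co_Lin[OF d] r], rule Lin_tensor_eq[OF M fdD M in_Lin[OF delta_co_Lin[OF d]] rm(1)])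
    fix m l assume m: "m \<in> carrier M" and l: "l \<in> carrier D"
    show "delta_co H M \<delta> (ptens M D m l) = \<rho> (ptens M D m l)"
    proof (rule vec_eqI[OF M Lin_closed[OF delta_co_Lin[OF d]] rc])
      fix f assume f: "f \<in> Lin M ground"
      have b: "bilin M V (\<lambda>a b. l b * f a)" by (intro linear_intros in_Lin[OF f] dual_mhom[OF l])
      have h: "(\<lambda>l. f (\<rho> (ptens M D m l))) \<in> mhom D ground"
        by (intro mhom_compose[OF _ in_Lin[OF f]] rm linear_intros M fdD m)
      have "f (delta_co H M \<delta> (ptens M D m l)) = (\<Sum>i\<in>bas V. l i * f (\<rho> (ptens M D m (coo V i))))"
        using functional_delta_co[OF d m l in_Lin[OF f]] ts[OF m b] m by (simp add: \<delta>_def)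
      also have "\<dots> = f (\<rho> (ptens M D m l))"
        using dual_functional_expand[OF algD(1) h, of l] l by (simp add: dual_carrier)
      finally show "f (delta_co H M \<delta> (ptens M D m l)) = f (\<rho> (ptens M D m l))" .
    qed (simp_all add: M m l)
  qed
  with d show ?thesis by blast
qed

text \<open>
  An action of the dual only sees products of functionals; expanding a trilinear form in
  coordinates shows that these suffice to test coassociativity.
\<close>

lemma coassoc_from_products:
  assumes d: "\<delta> \<in> Lin M (M \<boxtimes> V)" and m: "m \<in> carrier M" and T: "trilin M V V T"
    and *: "\<And>f l l'. f \<in> Lin M ground \<Longrightarrow> l \<in> carrier D \<Longrightarrow> l' \<in> carrier D \<Longrightarrow>
      sw M V (\<delta> m) (\<lambda>a c. sw M V (\<delta> a) (\<lambda>x y. f x * (l y * l' c))) =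
      sw M V (\<delta> m) (\<lambda>x c. SW c (\<lambda>y z. f x * (l y * l' z)))"
  shows "sw M V (\<delta> m) (\<lambda>a c. sw M V (\<delta> a) (\<lambda>x y. T x y c)) = sw M V (\<delta> m) (\<lambda>x c. SW c (\<lambda>y z. T x y z))"
proof -
  have e: "T x y z = (\<Sum>i\<in>bas M. \<Sum>j\<in>bas V. \<Sum>k\<in>bas V. coo M i x * (coo V j y * coo V k z) * T i j k)"
    if x: "x \<in> carrier M" and y: "y \<in> carrier V" and z: "z \<in> carrier V" for x y z
  proof -
    have "T x y z = (\<Sum>i\<in>bas M. coo M i x * T i y z)"
      by (rule functional_expand[OF M _ x]) (intro trilin_compose[OF T] mhom_id y z)
    also have "\<dots> = (\<Sum>i\<in>bas M. coo M i x * (\<Sum>j\<in>bas V. coo V j y * T i j z))"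
      by (intro sum.cong refl arg_cong[where f = "(*) _"] functional_expand[OF algD(1) _ y])
         (intro trilin_compose[OF T] mhom_id bas_carrier z)
    also have "\<dots> = (\<Sum>i\<in>bas M. coo M i x * (\<Sum>j\<in>bas V. coo V j y * (\<Sum>k\<in>bas V. coo V k z * T i j k)))"
      by (intro sum.cong refl arg_cong[where f = "(*) _"] functional_expand[OF algD(1) _ z])
         (intro trilin_compose[OF T] mhom_id bas_carrier)
    finally show ?thesis by (simp add: sum_distrib_left mult_ac)
  qed
  have "sw M V (\<delta> m) (\<lambda>a c. sw M V (\<delta> a) (\<lambda>x y. T x y c)) =
    sw M V (\<delta> m) (\<lambda>a c. sw M V (\<delta> a) (\<lambda>x y. \<Sum>i\<in>bas M. \<Sum>j\<in>bas V. \<Sum>k\<in>bas V. coo M i x * (coo V j y * coo V k c) * T i j k))"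
    by (intro sw_cong refl e)
  also have "\<dots> = (\<Sum>i\<in>bas M. \<Sum>j\<in>bas V. \<Sum>k\<in>bas V. sw M V (\<delta> m) (\<lambda>a c. sw M V (\<delta> a) (\<lambda>x y. coo M i x * (coo V j y * coo V k c))) * T i j k)"
    by (simp only: sw_sum sw_mult1)
  also have "\<dots> = (\<Sum>i\<in>bas M. \<Sum>j\<in>bas V. \<Sum>k\<in>bas V. sw M V (\<delta> m) (\<lambda>x c. SW c (\<lambda>y z. coo M i x * (coo V j y * coo V k z))) * T i j k)"
    by (intro sum.cong refl arg_cong2[where f = "(*)"] *) (simp_all add: bas_props(3) M dual_carrier)
  also have "\<dots> = sw M V (\<delta> m) (\<lambda>x c. SW c (\<lambda>y z. \<Sum>i\<in>bas M. \<Sum>j\<in>bas V. \<Sum>k\<in>bas V. coo M i x * (coo V j y * coo V k z) * T i j k))"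
    by (simp only: sw_sum sw_mult1)
  also have "\<dots> = sw M V (\<delta> m) (\<lambda>x c. SW c (\<lambda>y z. T x y z))"
    by (intro sw_cong refl e[symmetric])
  finally show ?thesis .
qed

text \<open>
  Under the pairing \<open>f(m l) = f(m\<^sub>0) l(m\<^sub>1)\<close>, acting by \<open>l'\<close> and then by \<open>l\<close> computes
  \<open>f(m\<^sub>0\<^sub>0) l(m\<^sub>0\<^sub>1) l'(m\<^sub>1)\<close>, and acting by \<open>l' \<star> l\<close> computes \<open>f(m\<^sub>0) l(m\<^sub>1\<^sub>1) l'(m\<^sub>1\<^sub>2)\<close>. The
  rainbow convention for the dual product is what makes the coaction a right action.
\<close>

lemma comodule_iff:
  assumes d: "\<delta> \<in> Lin M (M \<boxtimes> V)"
  shows "right_comodule H M \<delta> \<longleftrightarrow> right_module (dual_bialg H) M (delta_co H M \<delta>)"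
proof -
  let ?\<rho> = "delta_co H M \<delta>"
  note rL = delta_co_Lin[OF d] and fr = functional_delta_co[OF d] and dc = Lin_closed[OF d]
  note rc = Lin_closed[OF rL]
  have counit: "?\<rho> (ptens M D m (eps H)) = tlift M V M (\<lambda>m\<^sub>0 m\<^sub>1. eps H m\<^sub>1 \<odot>\<^bsub>M\<^esub> m\<^sub>0) (\<delta> m)" if "m \<in> carrier M" for m
    by (rule delta_co_ptens[OF d that eps_dual])
  have fm: "(\<lambda>x. sw M V (\<delta> x) b) \<in> mhom M ground" for b
    by (intro linear_intros M algD in_Lin[OF d])
  have 1: "f (?\<rho> (ptens M D (?\<rho> (ptens M D m l')) l)) = sw M V (\<delta> m) (\<lambda>a c. sw M V (\<delta> a) (\<lambda>x y. f x * (l y * l' c)))"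
    if m: "m \<in> carrier M" and l: "l \<in> carrier D" and l': "l' \<in> carrier D" and f: "f \<in> Lin M ground" for m l l' f
  proof -
    have "f (?\<rho> (ptens M D (?\<rho> (ptens M D m l')) l)) = sw M V (\<delta> (?\<rho> (ptens M D m l'))) (\<lambda>a b. l b * f a)"
      by (rule fr[OF rc l in_Lin[OF f]]) (simp add: M m l')
    also have "\<dots> = sw M V (\<delta> m) (\<lambda>a c. l' c * sw M V (\<delta> a) (\<lambda>a b. l b * f a))"
      by (rule fr[OF m l' fm])
    finally show ?thesis by (simp add: sw_mult2[symmetric] mult_ac)
  qed
  have 2: "f (?\<rho> (ptens M D m (l' \<star> l))) = sw M V (\<delta> m) (\<lambda>x c. SW c (\<lambda>y z. f x * (l y * l' z)))"
    if m: "m \<in> carrier M" and l: "l \<in> carrier D" and l': "l' \<in> carrier D" and f: "f \<in> Lin M ground" for m l l' f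
    using fr[OF m dprd_closed[OF l' l] in_Lin[OF f]] l l' by (simp add: sw_mult2 mult.commute)
  have 3: "?\<rho> (ptens M D (?\<rho> (ptens M D m l')) l) = ?\<rho> (ptens M D m (l' \<star> l)) \<longleftrightarrow>
      (\<forall>f\<in>Lin M ground. sw M V (\<delta> m) (\<lambda>a c. sw M V (\<delta> a) (\<lambda>x y. f x * (l y * l' c))) =
         sw M V (\<delta> m) (\<lambda>x c. SW c (\<lambda>y z. f x * (l y * l' z))))"
    if m: "m \<in> carrier M" and l: "l \<in> carrier D" and l': "l' \<in> carrier D" for m l l'
  proof -
    have c: "?\<rho> (ptens M D (?\<rho> (ptens M D m l')) l) \<in> carrier M" "?\<rho> (ptens M D m (l' \<star> l)) \<in> carrier M"
      by (intro rc tensor_ptens M fdD m l l' dprd_closed)+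
    show ?thesis using vec_eqI[OF M c] 1[OF that] 2[OF that] by auto
  qed
  have 4: "tassoc M V V (tmap M V (M \<boxtimes> V) V \<delta> (\<lambda>x. x) (\<delta> m)) = tmap M V M (V \<boxtimes> V) (\<lambda>x. x) (Delta H) (\<delta> m) \<longleftrightarrow>
    (\<forall>l'\<in>carrier D. \<forall>l\<in>carrier D. ?\<rho> (ptens M D (?\<rho> (ptens M D m l')) l) = ?\<rho> (ptens M D m (l' \<star> l)))"
    if m: "m \<in> carrier M" for m
    unfolding coassoc_iff[OF M d m]
  proof (intro iffI ballI allI impI)
    fix l l' assume *: "\<forall>T. trilin M V V T \<longrightarrow> sw M V (\<delta> m) (\<lambda>a c. sw M V (\<delta> a) (\<lambda>x y. T x y c)) =
          sw M V (\<delta> m) (\<lambda>x c. SW c (\<lambda>y z. T x y z))" and l': "l' \<in> carrier D" and l: "l \<in> carrier D"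
    show "?\<rho> (ptens M D (?\<rho> (ptens M D m l')) l) = ?\<rho> (ptens M D m (l' \<star> l))"
      unfolding 3[OF m l l']
    proof (intro ballI *[rule_format])
      fix f assume "f \<in> Lin M ground"
      then show "trilin M V V (\<lambda>x y z. f x * (l y * l' z))" by (intro trilinI linear_intros in_Lin dual_mhom l l')
    qed
  next
    fix T assume *: "\<forall>l'\<in>carrier D. \<forall>l\<in>carrier D. ?\<rho> (ptens M D (?\<rho> (ptens M D m l')) l) = ?\<rho> (ptens M D m (l' \<star> l))"
      and T: "trilin M V V T"
    show "sw M V (\<delta> m) (\<lambda>a c. sw M V (\<delta> a) (\<lambda>x y. T x y c)) = sw M V (\<delta> m) (\<lambda>x c. SW c (\<lambda>y z. T x y z))"
      by (rule coassoc_from_products[OF d m T]) (use * 3[OF m] in blast)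
  qed
  show ?thesis
    unfolding right_comodule_def right_module_def Let_def dual_bialg_simps(1)
    using M d rL 4 counit by auto
qed

text \<open>
  Tested on \<open>f \<otimes> l\<close>, the coaction of \<open>m h\<close> is \<open>f ((m h) l)\<close>. The other side of the Hopf condition
  is \<open>f (m\<^sub>0 h\<^sub>1) l (m\<^sub>1 h\<^sub>2)\<close>, in which \<open>l(- h\<^sub>2)\<close> is applied to \<open>m\<^sub>1\<close>: this is the action of the
  value of \<open>\<sigma>\<^sub>b\<^sub>i\<close> at \<open>h \<otimes> l\<close>.
\<close>

lemma hopf_compatibility_iff:
  assumes d: "\<delta> \<in> Lin M (M \<boxtimes> V)" and r: "\<rho> \<in> Lin (M \<boxtimes> V) M"
  shows "(\<forall>t\<in>carrier (M \<boxtimes> V). \<delta> (\<rho> t) = codiagonal M \<delta> \<rho> t) \<longleftrightarrow>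
    braided_commute M V D \<rho> (delta_co H M \<delta>) (sigma_bi H)"
proof -
  note rr = in_Lin[OF r] and dc = Lin_closed[OF d] and rc = Lin_closed[OF r]
  let ?R = "codiagonal M \<delta> \<rho>"
  note R = codiagonal_mhom[OF M d r] and e = sw_codiagonal[OF M d r]
  have L: "(\<lambda>t. \<delta> (\<rho> t)) \<in> mhom (M \<boxtimes> V) (M \<boxtimes> V)" by (rule mhom_compose[OF rr in_Lin[OF d]])
  have c: "ptens M V m h \<in> carrier (M \<boxtimes> V)" if "m \<in> carrier M" "h \<in> carrier V" for m h by (simp add: M that)
  let ?\<kappa> = "delta_co H M \<delta>"
  note kL = delta_co_Lin[OF d] and fk = functional_delta_co[OF d]
  have s: "sw D V (sigma_bi H (ptens V D h l)) (\<lambda>l' h'. f (\<rho> (ptens M V (?\<kappa> (ptens M D m l')) h'))) =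
      sw M V (?R (ptens M V m h)) (\<lambda>a b. f a * l b)"
    if m: "m \<in> carrier M" and h: "h \<in> carrier V" and l: "l \<in> carrier D" and f: "f \<in> Lin M ground" for m h l f
  proof -
    note fm = mhom_compose[OF _ in_Lin[OF f]]
    note I = intros2 M mhom_compose[OF _ rr] mhom_compose[OF _ in_Lin[OF kL]] fm m Lin_closed[OF kL]
    have b: "bilin D V (\<lambda>l' h'. f (\<rho> (ptens M V (?\<kappa> (ptens M D m l')) h')))" by (intro I)
    have B: "bilin M V (\<lambda>a b. f a * l b)" by (intro linear_intros in_Lin[OF f] dual_mhom l)
    have "sw D V (sigma_bi H (ptens V D h l)) (\<lambda>l' h'. f (\<rho> (ptens M V (?\<kappa> (ptens M D m l')) h'))) =
        SW h (\<lambda>x y. f (\<rho> (ptens M V (?\<kappa> (ptens M D m (rtrans y l))) x)))"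
      by (rule sw_sigma_bi[OF h l b])
    also have "\<dots> = SW h (\<lambda>x y. sw M V (\<delta> m) (\<lambda>a b. f (\<rho> (ptens M V a x)) * l (b \<cdot> y)))"
    proof (intro sw_cong refl)
      fix x y assume x: "x \<in> carrier V" and y: "y \<in> carrier V"
      have g: "(\<lambda>a. f (\<rho> (ptens M V a x))) \<in> mhom M ground" by (intro I x)
      show "f (\<rho> (ptens M V (?\<kappa> (ptens M D m (rtrans y l))) x)) = sw M V (\<delta> m) (\<lambda>a b. f (\<rho> (ptens M V a x)) * l (b \<cdot> y))"
        using fk[OF m rtrans_closed[OF y l] g] by (simp add: mult.commute)
    qed
    also have "\<dots> = sw M V (\<delta> m) (\<lambda>a b. SW h (\<lambda>x y. f (\<rho> (ptens M V a x)) * l (b \<cdot> y)))"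
      by (rule sw_swap)
    finally show ?thesis unfolding e[OF m h B] .
  qed
  have k: "f (?\<kappa> (ptens M D (\<rho> (ptens M V m h)) l)) = sw M V (\<delta> (\<rho> (ptens M V m h))) (\<lambda>a b. f a * l b)"
    if "m \<in> carrier M" "h \<in> carrier V" "l \<in> carrier D" "f \<in> Lin M ground" for m h l f
    using fk[OF rc[OF c[OF that(1,2)]] that(3) in_Lin[OF that(4)]] by (simp add: mult.commute)
  show ?thesis
    unfolding braided_commute_iff[OF M algD(1) fdD r kL sigma_bi_Lin]
  proof (intro iffI ballI)
    fix m f h l assume "\<forall>t\<in>carrier (M \<boxtimes> V). \<delta> (\<rho> t) = ?R t" and *: "m \<in> carrier M" "f \<in> Lin M ground" "h \<in> carrier V" "l \<in> carrier D"
    then have "\<delta> (\<rho> (ptens M V m h)) = ?R (ptens M V m h)" using c[of m h] by blast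
    then show "f (?\<kappa> (ptens M D (\<rho> (ptens M V m h)) l)) =
        sw D V (sigma_bi H (ptens V D h l)) (\<lambda>b' a'. f (\<rho> (ptens M V (?\<kappa> (ptens M D m b')) a')))"
      unfolding k[OF *(1,3,4,2)] s[OF *(1,3,4,2)] by simp
  next
    fix t assume *: "\<forall>m\<in>carrier M. \<forall>f\<in>Lin M ground. \<forall>h\<in>carrier V. \<forall>l\<in>carrier D.
       f (?\<kappa> (ptens M D (\<rho> (ptens M V m h)) l)) =
        sw D V (sigma_bi H (ptens V D h l)) (\<lambda>b' a'. f (\<rho> (ptens M V (?\<kappa> (ptens M D m b')) a')))"
      and t: "t \<in> carrier (M \<boxtimes> V)"
    show "\<delta> (\<rho> t) = ?R t"
    proof (rule Lin_tensor_eq[OF M algD(1) fdvs_tensor[OF M algD(1)] L R _ t])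
      fix m h assume m: "m \<in> carrier M" and h: "h \<in> carrier V"
      show "\<delta> (\<rho> (ptens M V m h)) = ?R (ptens M V m h)"
      proof (rule tensor_eqI_prod[OF M algD(1) dc[OF rc[OF c[OF m h]]] mhomD(1)[OF R c[OF m h]]])
        fix f l assume f: "f \<in> Lin M ground" and "l \<in> Lin V ground"
        then have l: "l \<in> carrier D" by (simp add: dual_carrier)
        show "sw M V (\<delta> (\<rho> (ptens M V m h))) (\<lambda>v w. f v * l w) = sw M V (?R (ptens M V m h)) (\<lambda>v w. f v * l w)"
          unfolding k[OF m h l f, symmetric] s[OF m h l f, symmetric] using * m h l f by blast
      qed
    qed
  qed
qed

end

text \<open>
  Again both conditions compare the values on all products \<open>p \<otimes> l\<close> of functionals.
\<close>

lemma colinear_iff: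
  fixes M N :: "('k, 'm) module"
  assumes M: "fdvs M" and N: "fdvs N" and d: "\<delta> \<in> Lin M (M \<boxtimes> V)" and d': "\<delta>' \<in> Lin N (N \<boxtimes> V)" and f: "f \<in> Lin M N"
  shows "act_hom M N D (delta_co H M \<delta>) (delta_co H N \<delta>') f \<longleftrightarrow>
    (\<forall>m\<in>carrier M. \<delta>' (f m) = tmap M V N V f (\<lambda>x. x) (\<delta> m))"
  unfolding act_hom_iff[OF M N fdD delta_co_Lin[OF M d] delta_co_Lin[OF N d'] f]
proof (intro ball_cong refl)
  fix m assume m: "m \<in> carrier M"
  note fm = in_Lin[OF f] and fc = Lin_closed[OF f]
  have t: "tmap M V N V f (\<lambda>x. x) (\<delta> m) \<in> carrier (N \<boxtimes> V)"
    by (intro tmap_closed M N algD fm mhom_id Lin_closed[OF d m])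
  have 1: "p (f (delta_co H M \<delta> (ptens M D m l))) = sw N V (tmap M V N V f (\<lambda>x. x) (\<delta> m)) (\<lambda>a b. p a * l b)"
    if l: "l \<in> carrier D" and p: "p \<in> Lin N ground" for l p
  proof -
    have "sw N V (tmap M V N V f (\<lambda>x. x) (\<delta> m)) (\<lambda>a b. p a * l b) = sw M V (\<delta> m) (\<lambda>a b. p (f a) * l b)"
      by (rule sw_tmap) (intro M N algD fm mhom_id Lin_closed[OF d m] linear_intros in_Lin[OF p] dual_mhom[OF l])+
    then show ?thesis
      using functional_delta_co[OF M d m l mhom_compose[OF fm in_Lin[OF p]]] by (simp add: mult.commute)
  qed
  have 2: "p (delta_co H N \<delta>' (ptens N D (f m) l)) = sw N V (\<delta>' (f m)) (\<lambda>a b. p a * l b)"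
    if l: "l \<in> carrier D" and p: "p \<in> Lin N ground" for l p
    using functional_delta_co[OF N d' fc[OF m] l in_Lin[OF p]] by (simp add: mult.commute)
  have c: "f (delta_co H M \<delta> (ptens M D m l)) \<in> carrier N" "delta_co H N \<delta>' (ptens N D (f m) l) \<in> carrier N"
    if "l \<in> carrier D" for l
    by (intro fc Lin_closed[OF delta_co_Lin[OF M d]] Lin_closed[OF delta_co_Lin[OF N d']] tensor_ptens M N fdD m that)+
  show "(\<forall>l\<in>carrier D. f (delta_co H M \<delta> (ptens M D m l)) = delta_co H N \<delta>' (ptens N D (f m) l)) \<longleftrightarrow>
    \<delta>' (f m) = tmap M V N V f (\<lambda>x. x) (\<delta> m)"
  proof (intro iffI ballI)
    assume *: "\<forall>l\<in>carrier D. f (delta_co H M \<delta> (ptens M D m l)) = delta_co H N \<delta>' (ptens N D (f m) l)"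
    show "\<delta>' (f m) = tmap M V N V f (\<lambda>x. x) (\<delta> m)"
    proof (rule tensor_eqI_prod[OF N algD(1) Lin_closed[OF d' fc[OF m]] t])
      fix p l assume p: "p \<in> Lin N ground" and "l \<in> Lin V ground"
      then have l: "l \<in> carrier D" by (simp add: dual_carrier)
      show "sw N V (\<delta>' (f m)) (\<lambda>v w. p v * l w) = sw N V (tmap M V N V f (\<lambda>x. x) (\<delta> m)) (\<lambda>v w. p v * l w)"
        using 1[OF l p] 2[OF l p] * l by simp
    qed
  next
    fix l assume *: "\<delta>' (f m) = tmap M V N V f (\<lambda>x. x) (\<delta> m)" and l: "l \<in> carrier D"
    show "f (delta_co H M \<delta> (ptens M D m l)) = delta_co H N \<delta>' (ptens N D (f m) l)"
      by (rule vec_eqI[OF N c[OF l]]) (simp add: 1[OF l] 2[OF l] *)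
  qed
qed

lemma hopf_module_iff:
  fixes X :: "('k, 'm, 'h) hopf_mod"
  assumes M: "fdvs (hm_sp X)" and d: "hm_coact X \<in> Lin (hm_sp X) (hm_sp X \<boxtimes> V)"
  shows "hopf_module H X \<longleftrightarrow> braided_module (B_sys H) (hopf_to_br H X)"
proof -
  have "braided_module (B_sys H) (hopf_to_br H X) \<longleftrightarrow> right_module H (hm_sp X) (hm_act X) \<and>
      right_module (dual_bialg H) (hm_sp X) (delta_co H (hm_sp X) (hm_coact X)) \<and>
      braided_commute (hm_sp X) V D (hm_act X) (delta_co H (hm_sp X) (hm_coact X)) (sigma_bi H)"
    using braided_module_iff[OF alg unital_algebra_dual, of "B_sys H" "hopf_to_br H X"]
    by (simp add: hopf_to_br_def)
  also have "\<dots> \<longleftrightarrow> hopf_module H X"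
    using comodule_iff[OF M d] hopf_compatibility_iff[OF M d right_moduleD(2)]
    unfolding hopf_module_def Let_def codiagonal_def by blast
  finally show ?thesis ..
qed

lemma hopf_moduleD:
  fixes X :: "('k, 'm, 'h) hopf_mod"
  assumes "hopf_module H X"
  shows "fdvs (hm_sp X)" "hm_coact X \<in> Lin (hm_sp X) (hm_sp X \<boxtimes> V)" "hm_act X \<in> Lin (hm_sp X \<boxtimes> V) (hm_sp X)"
  using assms by (auto simp: hopf_module_def right_module_def right_comodule_def Let_def)

lemma category_Mod_hopf: "category (Mod_hopf H :: (('k, 'm, 'h) hopf_mod, 'm \<Rightarrow> 'm) cat)"
  unfolding Mod_hopf_def
proof (rule category_of_linear_maps)
  fix X :: "('k, 'm, 'h) hopf_mod" assume "X \<in> {M. hopf_module H M}"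
  then have X: "hopf_module H X" by simp
  note x = hopf_moduleD[OF X]
  show "fdvs (hm_sp X)" by (rule x)
  show "act_hom (hm_sp X) (hm_sp X) V (hm_act X) (hm_act X) (\<lambda>m\<in>carrier (hm_sp X). m) \<and>
    (\<forall>m\<in>carrier (hm_sp X). hm_coact X ((\<lambda>m\<in>carrier (hm_sp X). m) m) =
       tmap (hm_sp X) V (hm_sp X) V (\<lambda>m\<in>carrier (hm_sp X). m) (\<lambda>x. x) (hm_coact X m))"
    using act_hom_id[OF x(1) algD(1) x(3)] by (simp add: tmap_id x Lin_closed[OF x(2)])
next
  fix X Y Z :: "('k, 'm, 'h) hopf_mod" and f g
  assume "X \<in> {M. hopf_module H M}" "Y \<in> {M. hopf_module H M}" "Z \<in> {M. hopf_module H M}"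
    and f: "f \<in> Lin (hm_sp X) (hm_sp Y)" and g: "g \<in> Lin (hm_sp Y) (hm_sp Z)"
    and fh: "act_hom (hm_sp X) (hm_sp Y) V (hm_act X) (hm_act Y) f \<and>
      (\<forall>m\<in>carrier (hm_sp X). hm_coact Y (f m) = tmap (hm_sp X) V (hm_sp Y) V f (\<lambda>x. x) (hm_coact X m))"
    and gh: "act_hom (hm_sp Y) (hm_sp Z) V (hm_act Y) (hm_act Z) g \<and>
      (\<forall>m\<in>carrier (hm_sp Y). hm_coact Z (g m) = tmap (hm_sp Y) V (hm_sp Z) V g (\<lambda>x. x) (hm_coact Y m))"
  then have X: "hopf_module H X" "hopf_module H Y" "hopf_module H Z" by simp_all
  note x = hopf_moduleD[OF X(1)] and y = hopf_moduleD[OF X(2)] and z = hopf_moduleD[OF X(3)]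
  have gf: "compose (carrier (hm_sp X)) g f \<in> Lin (hm_sp X) (hm_sp Z)" by (rule Lin_compose[OF fdvs_module[OF x(1)] f g])
  show "act_hom (hm_sp X) (hm_sp Z) V (hm_act X) (hm_act Z) (compose (carrier (hm_sp X)) g f) \<and>
    (\<forall>m\<in>carrier (hm_sp X). hm_coact Z (compose (carrier (hm_sp X)) g f m) =
       tmap (hm_sp X) V (hm_sp Z) V (compose (carrier (hm_sp X)) g f) (\<lambda>x. x) (hm_coact X m))"
  proof (intro conjI ballI)
    show "act_hom (hm_sp X) (hm_sp Z) V (hm_act X) (hm_act Z) (compose (carrier (hm_sp X)) g f)"
      using fh gh by (intro act_hom_compose[OF x(1) y(1) z(1) algD(1) x(3) y(3) z(3) f g]) auto
    fix m assume m: "m \<in> carrier (hm_sp X)"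
    have "hm_coact Z (g (f m)) = tmap (hm_sp Y) V (hm_sp Z) V g (\<lambda>x. x) (tmap (hm_sp X) V (hm_sp Y) V f (\<lambda>x. x) (hm_coact X m))"
      using fh gh m Lin_closed[OF f m] by simp
    also have "\<dots> = tmap (hm_sp X) V (hm_sp Z) V (\<lambda>x. g (f x)) (\<lambda>x. x) (hm_coact X m)"
      by (rule tmap_tmap) (intro x y z algD in_Lin[OF f] in_Lin[OF g] mhom_id Lin_closed[OF x(2) m])+
    also have "\<dots> = tmap (hm_sp X) V (hm_sp Z) V (compose (carrier (hm_sp X)) g f) (\<lambda>x. x) (hm_coact X m)"
      by (rule fun_cong[OF tmap_cong]) (simp_all add: compose_eq)
    finally show "hm_coact Z (compose (carrier (hm_sp X)) g f m) =
       tmap (hm_sp X) V (hm_sp Z) V (compose (carrier (hm_sp X)) g f) (\<lambda>x. x) (hm_coact X m)"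
      using m by (simp add: compose_eq)
  qed
qed

lemma hopf_to_br_bij:
  "bij_betw (hopf_to_br H) {X :: ('k, 'm, 'h) hopf_mod. hopf_module H X} {X. braided_module (B_sys H) X}"
  unfolding bij_betw_def
proof
  show "inj_on (hopf_to_br H) {X :: ('k, 'm, 'h) hopf_mod. hopf_module H X}"
  proof (rule inj_onI)
    fix X Y :: "('k, 'm, 'h) hopf_mod"
    assume "X \<in> {X. hopf_module H X}" "Y \<in> {X. hopf_module H X}" and e: "hopf_to_br H X = hopf_to_br H Y"
    then have X: "hopf_module H X" and Y: "hopf_module H Y" by simp_all
    note x = hopf_moduleD[OF X] and y = hopf_moduleD[OF Y]
    have s: "hm_sp Y = hm_sp X" and a: "hm_act Y = hm_act X" and
      d: "delta_co H (hm_sp X) (hm_coact X) = delta_co H (hm_sp X) (hm_coact Y)"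
      using e by (auto simp: hopf_to_br_def)
    have "hm_coact X = hm_coact Y"
      by (rule delta_co_inj[OF x(1) x(2) _ d]) (use y(2) s in simp)
    with s a show "X = Y" by simp
  qed
  show "hopf_to_br H ` {X :: ('k, 'm, 'h) hopf_mod. hopf_module H X} = {X. braided_module (B_sys H) X}"
  proof (rule subset_antisym; rule subsetI)
    fix Y assume "Y \<in> hopf_to_br H ` {X :: ('k, 'm, 'h) hopf_mod. hopf_module H X}"
    then obtain X :: "('k, 'm, 'h) hopf_mod" where X: "hopf_module H X" and Y: "Y = hopf_to_br H X" by blast
    then show "Y \<in> {X. braided_module (B_sys H) X}"
      using hopf_module_iff[OF hopf_moduleD(1)[OF X] hopf_moduleD(2)[OF X]] by simp
  next
    fix Y :: "('k, 'm, 'h, 'h \<Rightarrow> 'k) br_mod" assume "Y \<in> {X. braided_module (B_sys H) X}"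
    then have Y: "braided_module (B_sys H) Y" by simp
    then have M: "fdvs (bm_sp Y)" and r: "bm_act2 Y \<in> Lin (bm_sp Y \<boxtimes> D) (bm_sp Y)"
      by (auto simp: braided_module_def Let_def)
    obtain \<delta> where d: "\<delta> \<in> Lin (bm_sp Y) (bm_sp Y \<boxtimes> V)" and e: "delta_co H (bm_sp Y) \<delta> = bm_act2 Y"
      using delta_co_surj[OF M r] by blast
    define X where "X = \<lparr>hm_sp = bm_sp Y, hm_act = bm_act1 Y, hm_coact = \<delta>\<rparr>"
    have XY: "hopf_to_br H X = Y" using e by (simp add: X_def hopf_to_br_def)
    have "hopf_module H X"
      using hopf_module_iff[of X] M d Y XY by (simp add: X_def)
    then show "Y \<in> hopf_to_br H ` {X :: ('k, 'm, 'h) hopf_mod. hopf_module H X}"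
      using XY by (intro image_eqI[OF sym]) simp_all
  qed
qed

lemma hopf_to_br_hom:
  fixes X Y :: "('k, 'm, 'h) hopf_mod"
  assumes X: "hopf_module H X" and Y: "hopf_module H Y" and f: "f \<in> Lin (hm_sp X) (hm_sp Y)"
  shows "act_hom (hm_sp X) (hm_sp Y) D (bm_act2 (hopf_to_br H X)) (bm_act2 (hopf_to_br H Y)) f \<longleftrightarrow>
    (\<forall>m\<in>carrier (hm_sp X). hm_coact Y (f m) = tmap (hm_sp X) V (hm_sp Y) V f (\<lambda>x. x) (hm_coact X m))"
  using colinear_iff[OF hopf_moduleD(1)[OF X] hopf_moduleD(1)[OF Y] hopf_moduleD(2)[OF X] hopf_moduleD(2)[OF Y] f]
  by (simp add: hopf_to_br_def)

lemma hopf_to_br_equivalence: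
  "equivalence_functor (Mod_hopf H :: (('k, 'm, 'h) hopf_mod, 'm \<Rightarrow> 'm) cat) (Mod_br (B_sys H)) (hopf_to_br H) (\<lambda>M N f. f)"
proof (rule equivalence_functorI(1)[OF category_Mod_hopf])
  show "category (Mod_br (B_sys H))" by (rule category_Mod_br) simp_all
  show "bij_betw (hopf_to_br H) (Obj (Mod_hopf H :: (('k, 'm, 'h) hopf_mod, 'm \<Rightarrow> 'm) cat)) (Obj (Mod_br (B_sys H)))"
    using hopf_to_br_bij by (simp add: Mod_hopf_def Mod_br_def)
  fix X Y :: "('k, 'm, 'h) hopf_mod"
  assume "X \<in> Obj (Mod_hopf H :: (('k, 'm, 'h) hopf_mod, 'm \<Rightarrow> 'm) cat)" "Y \<in> Obj (Mod_hopf H :: (('k, 'm, 'h) hopf_mod, 'm \<Rightarrow> 'm) cat)"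
  then have "hopf_module H X" "hopf_module H Y" by (simp_all add: Mod_hopf_def)
  from hopf_to_br_hom[OF this]
  show "Hom (Mod_br (B_sys H)) (hopf_to_br H X) (hopf_to_br H Y) = Hom (Mod_hopf H) X Y"
    by (auto simp: Mod_hopf_def Mod_br_def hopf_to_br_def)
qed (simp_all add: Mod_hopf_def Mod_br_def hopf_to_br_def)

lemma twisting_sigma: "twisting (dual_bialg H) H (sigma_bi H)"
  using natural by unfold_locales (simp_all add: alg unital_algebra_dual sigma_bi_Lin natural_units_def)

text \<open>
  Naturality in the units passes to the inverse of the braiding.
\<close>

lemma twisting_theta:
  assumes i: "invertible_map (V \<boxtimes> D) (D \<boxtimes> V) (sigma_bi H)"
  shows "twisting H (dual_bialg H) (inverse_map (V \<boxtimes> D) (D \<boxtimes> V) (sigma_bi H))"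
proof
  note S = inverse_map_props[OF i]
  show "unital_algebra H" "unital_algebra (dual_bialg H)" by (rule alg unital_algebra_dual)+
  show "inverse_map (V \<boxtimes> D) (D \<boxtimes> V) (sigma_bi H) \<in> Lin (sp (dual_bialg H) \<boxtimes> sp H) (sp H \<boxtimes> sp (dual_bialg H))"
    using S(1) by simp
  show "inverse_map (V \<boxtimes> D) (D \<boxtimes> V) (sigma_bi H) (ptens (sp (dual_bialg H)) V (nu (dual_bialg H) 1) a) =
      ptens V (sp (dual_bialg H)) a (nu (dual_bialg H) 1)" if "a \<in> carrier V" for a
    using S(2)[of "ptens V D a (eps H)"] natural that by (simp add: natural_units_def)
  show "inverse_map (V \<boxtimes> D) (D \<boxtimes> V) (sigma_bi H) (ptens (sp (dual_bialg H)) V b one) =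
      ptens V (sp (dual_bialg H)) one b" if "b \<in> carrier (sp (dual_bialg H))" for b
    using S(2)[of "ptens V D one b"] natural that by (simp add: natural_units_def)
qed

lemma s1_sys_simps:
  "V1 (s1_sys (B_sys H)) = D" "V2 (s1_sys (B_sys H)) = V"
  "sig11 (s1_sys (B_sys H)) = sigma_ass (dual_bialg H)" "sig22 (s1_sys (B_sys H)) = sigma_ass_r H"
  "sig12 (s1_sys (B_sys H)) = inverse_map (V \<boxtimes> D) (D \<boxtimes> V) (sigma_bi H)"
  "nu1 (s1_sys (B_sys H)) = nu (dual_bialg H)" "nu2 (s1_sys (B_sys H)) = nu H"
  by (simp_all add: s1_sys_def)

definition hopf_to_s1 :: "('k, 'm, 'h) hopf_mod \<Rightarrow> ('k, 'm, 'h \<Rightarrow> 'k, 'h) br_mod" where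
  "hopf_to_s1 X = \<lparr>bm_sp = hm_sp X, bm_act1 = delta_co H (hm_sp X) (hm_coact X), bm_act2 = hm_act X\<rparr>"

text \<open>
  The functor from Hopf modules is the earlier one followed by exchanging the two actions, which
  is a bijection from braided modules for \<open>\<sigma>\<^sub>b\<^sub>i\<close> to those for its inverse by
  \<open>braided_commute_inverse\<close>.
\<close>

lemma s1_equivalence:
  assumes i: "invertible_map (V \<boxtimes> D) (D \<boxtimes> V) (sigma_bi H)"
  shows "equivalent_cats (Mod_br (s1_sys (B_sys H)) :: (('k, 'm, 'h \<Rightarrow> 'k, 'h) br_mod, 'm \<Rightarrow> 'm) cat)
    (Mod_hopf H :: (('k, 'm, 'h) hopf_mod, 'm \<Rightarrow> 'm) cat)"
proof (rule equivalence_functorI(2)[OF category_Mod_hopf])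
  show "category (Mod_br (s1_sys (B_sys H)) :: (('k, 'm, 'h \<Rightarrow> 'k, 'h) br_mod, 'm \<Rightarrow> 'm) cat)"
    by (rule category_Mod_br) (simp_all add: s1_sys_simps)
  define flip_acts where "flip_acts Y = \<lparr>bm_sp = bm_sp Y, bm_act1 = bm_act2 Y, bm_act2 = bm_act1 Y\<rparr>" for Y :: "('k, 'm, 'h, 'h \<Rightarrow> 'k) br_mod"
  have s: "hopf_to_s1 = flip_acts \<circ> hopf_to_br H" by (auto simp: fun_eq_iff hopf_to_s1_def flip_acts_def hopf_to_br_def)
  have b: "braided_module (s1_sys (B_sys H)) (flip_acts Y) \<longleftrightarrow> braided_module (B_sys H) Y" for Y
  proof -
    have "braided_module (B_sys H) Y \<longleftrightarrow> right_module H (bm_sp Y) (bm_act1 Y) \<and>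
      right_module (dual_bialg H) (bm_sp Y) (bm_act2 Y) \<and>
      braided_commute (bm_sp Y) V D (bm_act1 Y) (bm_act2 Y) (sigma_bi H)"
      using braided_module_iff[OF alg unital_algebra_dual, of "B_sys H" Y] by simp
    moreover have "braided_module (s1_sys (B_sys H)) (flip_acts Y) \<longleftrightarrow> right_module (dual_bialg H) (bm_sp Y) (bm_act2 Y) \<and>
      right_module H (bm_sp Y) (bm_act1 Y) \<and>
      braided_commute (bm_sp Y) D V (bm_act2 Y) (bm_act1 Y) (inverse_map (V \<boxtimes> D) (D \<boxtimes> V) (sigma_bi H))"
      using braided_module_iff[OF unital_algebra_dual alg, of "s1_sys (B_sys H)" "flip_acts Y"] by (simp add: s1_sys_simps flip_acts_def)
    moreover have "braided_commute (bm_sp Y) D V (bm_act2 Y) (bm_act1 Y) (inverse_map (V \<boxtimes> D) (D \<boxtimes> V) (sigma_bi H)) \<longleftrightarrow>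
        braided_commute (bm_sp Y) V D (bm_act1 Y) (bm_act2 Y) (sigma_bi H)"
      if r: "right_module H (bm_sp Y) (bm_act1 Y)" "right_module (dual_bialg H) (bm_sp Y) (bm_act2 Y)"
      by (rule braided_commute_inverse[OF right_moduleD(1)[OF r(1)] algD(1) fdD right_moduleD(2)[OF r(1)] _ i])
         (use right_moduleD(2)[OF r(2)] in simp)
    ultimately show ?thesis by blast
  qed
  have "bij_betw flip_acts {Y. braided_module (B_sys H) Y} {Y. braided_module (s1_sys (B_sys H)) Y}"
  proof (rule bij_betwI[where g = "\<lambda>Y. \<lparr>bm_sp = bm_sp Y, bm_act1 = bm_act2 Y, bm_act2 = bm_act1 Y\<rparr>"])
    show "flip_acts \<in> {Y. braided_module (B_sys H) Y} \<rightarrow> {Y. braided_module (s1_sys (B_sys H)) Y}" using b by auto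
    have r: "flip_acts \<lparr>bm_sp = bm_sp Y, bm_act1 = bm_act2 Y, bm_act2 = bm_act1 Y\<rparr> = Y" for Y by (simp add: flip_acts_def)
    show "flip_acts \<lparr>bm_sp = bm_sp Y, bm_act1 = bm_act2 Y, bm_act2 = bm_act1 Y\<rparr> = Y" for Y by (rule r)
    show "(\<lambda>Y :: ('k, 'm, 'h \<Rightarrow> 'k, 'h) br_mod. \<lparr>bm_sp = bm_sp Y, bm_act1 = bm_act2 Y, bm_act2 = bm_act1 Y\<rparr>) \<in>
       {Y. braided_module (s1_sys (B_sys H)) Y} \<rightarrow> {Y. braided_module (B_sys H) Y}"
    proof (rule Pi_I)
      fix Y :: "('k, 'm, 'h \<Rightarrow> 'k, 'h) br_mod" assume "Y \<in> {Y. braided_module (s1_sys (B_sys H)) Y}"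
      then show "\<lparr>bm_sp = bm_sp Y, bm_act1 = bm_act2 Y, bm_act2 = bm_act1 Y\<rparr> \<in> {Y. braided_module (B_sys H) Y}"
        using b[of "\<lparr>bm_sp = bm_sp Y, bm_act1 = bm_act2 Y, bm_act2 = bm_act1 Y\<rparr>"] r[of Y] by simp
    qed
    show "\<lparr>bm_sp = bm_sp (flip_acts Y), bm_act1 = bm_act2 (flip_acts Y), bm_act2 = bm_act1 (flip_acts Y)\<rparr> = Y" for Y by (simp add: flip_acts_def)
  qed
  from bij_betw_trans[OF hopf_to_br_bij this]
  show "bij_betw hopf_to_s1 (Obj (Mod_hopf H :: (('k, 'm, 'h) hopf_mod, 'm \<Rightarrow> 'm) cat)) (Obj (Mod_br (s1_sys (B_sys H))))"
    by (simp add: s Mod_hopf_def Mod_br_def)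
  fix X Y :: "('k, 'm, 'h) hopf_mod"
  assume "X \<in> Obj (Mod_hopf H :: (('k, 'm, 'h) hopf_mod, 'm \<Rightarrow> 'm) cat)" "Y \<in> Obj (Mod_hopf H :: (('k, 'm, 'h) hopf_mod, 'm \<Rightarrow> 'm) cat)"
  then have "hopf_module H X" "hopf_module H Y" by (simp_all add: Mod_hopf_def)
  from hopf_to_br_hom[OF this]
  show "Hom (Mod_br (s1_sys (B_sys H))) (hopf_to_s1 X) (hopf_to_s1 Y) = Hom (Mod_hopf H) X Y"
    by (auto simp: Mod_hopf_def Mod_br_def hopf_to_s1_def hopf_to_br_def s1_sys_simps)
qed (simp_all add: Mod_hopf_def Mod_br_def hopf_to_s1_def)

end


section \<open>Bialgebras as braided systems\<close>

theorem theorem6p8: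
  shows
    "(groupoid (Bialg_gpd :: (('k::field, 'h) bialg, 'h \<Rightarrow> 'h) cat) \<and>
      groupoid (BrSyst_gpd :: (('k, 'h, 'h \<Rightarrow> 'k) brsys, ('h \<Rightarrow> 'h) \<times> (('h \<Rightarrow> 'k) \<Rightarrow> ('h \<Rightarrow> 'k))) cat) \<and>
      is_functor (Bialg_gpd :: (('k, 'h) bialg, 'h \<Rightarrow> 'h) cat) BrSyst_gpd B_sys B_arr \<and>
      fully_faithful (Bialg_gpd :: (('k, 'h) bialg, 'h \<Rightarrow> 'h) cat) BrSyst_gpd B_sys B_arr)
     \<and>
     (\<forall>H :: ('k, 'h) bialg. bialgebra H \<longrightarrow>
        (invertible_map (sp H \<boxtimes> dual (sp H)) (dual (sp H) \<boxtimes> sp H) (sigma_bi H) \<longleftrightarrow> has_antipode H))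
     \<and>
     (\<forall>H :: ('k, 'h) bialg.
        unital_algebra H \<and> counital_coalgebra H \<and> normalized_pair H \<longrightarrow>
        (let V = sp H; D = dual V; B = B_sys H;
             natural_units =
               ((\<forall>l\<in>carrier D. sigma_bi H (ptens V D (nu H 1) l) = ptens D V l (nu H 1)) \<and>
                (\<forall>h\<in>carrier V. sigma_bi H (ptens V D h (nu (dual_bialg H) 1)) =
                               ptens D V (nu (dual_bialg H) 1) h))
         in
          (yang_baxter V V D (sig11 B) (sig12 B) (sig12 B) \<and> natural_units
             \<longleftrightarrow> bialgebra_compatibility H) \<and>
          (yang_baxter V D D (sig12 B) (sig12 B) (sig22 B) \<and> natural_units
             \<longleftrightarrow> bialgebra_compatibility H)))
     \<and>
     (\<forall>H :: ('k, 'h) bialg. bialgebra H \<longrightarrow>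
        equivalence_functor
          (Mod_hopf H :: (('k, 'm, 'h) hopf_mod, 'm \<Rightarrow> 'm) cat)
          (Mod_br (B_sys H))
          (hopf_to_br H) (\<lambda>M N f. f) \<and>
        equivalence_functor
          (Mod_br (B_sys H) :: (('k, 'm, 'h, 'h \<Rightarrow> 'k) br_mod, 'm \<Rightarrow> 'm) cat)
          (Mod_alg (twisted_product (dual_bialg H) H (sigma_bi H)))
          (br_to_alg (B_sys H)) (\<lambda>M N f. f) \<and>
        (has_antipode H \<longrightarrow>
           (let \<theta> = inverse_map (sp H \<boxtimes> dual (sp H)) (dual (sp H) \<boxtimes> sp H) (sigma_bi H) in
             equivalent_cats
               (Mod_alg (twisted_product H (dual_bialg H) \<theta>)
                  :: (('k, 'm, ('k, 'h, 'h \<Rightarrow> 'k) tensor) alg_mod, 'm \<Rightarrow> 'm) cat)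
               (Mod_br (s1_sys (B_sys H))
                  :: (('k, 'm, 'h \<Rightarrow> 'k, 'h) br_mod, 'm \<Rightarrow> 'm) cat) \<and>
             equivalent_cats
               (Mod_br (s1_sys (B_sys H))
                  :: (('k, 'm, 'h \<Rightarrow> 'k, 'h) br_mod, 'm \<Rightarrow> 'm) cat)
               (Mod_hopf H :: (('k, 'm, 'h) hopf_mod, 'm \<Rightarrow> 'm) cat))))"
proof (intro conjI allI impI)
  fix H :: "('k, 'h) bialg" assume H: "bialgebra H"
  interpret bialg H by (rule bialgebra_bialg[OF H])
  show "invertible_map (sp H \<boxtimes> dual (sp H)) (dual (sp H) \<boxtimes> sp H) (sigma_bi H) \<longleftrightarrow> has_antipode H"
    by (rule invertible_iff_antipode)
next
  fix H :: "('k, 'h) bialg" assume H: "unital_algebra H \<and> counital_coalgebra H \<and> normalized_pair H"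
  interpret algebra_coalgebra H by unfold_locales (use H in auto)
  show "let V = sp H; D = dual V; B = B_sys H;
             natural_units =
               ((\<forall>l\<in>carrier D. sigma_bi H (ptens V D (nu H 1) l) = ptens D V l (nu H 1)) \<and>
                (\<forall>h\<in>carrier V. sigma_bi H (ptens V D h (nu (dual_bialg H) 1)) =
                               ptens D V (nu (dual_bialg H) 1) h))
         in
          (yang_baxter V V D (sig11 B) (sig12 B) (sig12 B) \<and> natural_units
             \<longleftrightarrow> bialgebra_compatibility H) \<and>
          (yang_baxter V D D (sig12 B) (sig12 B) (sig22 B) \<and> natural_units
             \<longleftrightarrow> bialgebra_compatibility H)"
    using compatibility_iff_yang_baxter H unfolding natural_units_def Let_def by simp
next
  fix H :: "('k, 'h) bialg" assume H: "bialgebra H"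
  interpret bialg H by (rule bialgebra_bialg[OF H])
  show "equivalence_functor (Mod_hopf H :: (('k, 'm, 'h) hopf_mod, 'm \<Rightarrow> 'm) cat) (Mod_br (B_sys H))
     (hopf_to_br H) (\<lambda>M N f. f)" by (rule hopf_to_br_equivalence)
  show "equivalence_functor (Mod_br (B_sys H) :: (('k, 'm, 'h, 'h \<Rightarrow> 'k) br_mod, 'm \<Rightarrow> 'm) cat)
     (Mod_alg (twisted_product (dual_bialg H) H (sigma_bi H))) (br_to_alg (B_sys H)) (\<lambda>M N f. f)"
    using Mod_br_to_Mod_alg(1)[of "B_sys H" H "dual_bialg H"] twisting_sigma by simp
  assume "has_antipode H"
  then have i: "invertible_map (V \<boxtimes> D) (D \<boxtimes> V) (sigma_bi H)" by (simp add: invertible_iff_antipode)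
  show "let \<theta> = inverse_map (sp H \<boxtimes> dual (sp H)) (dual (sp H) \<boxtimes> sp H) (sigma_bi H) in
             equivalent_cats
               (Mod_alg (twisted_product H (dual_bialg H) \<theta>)
                  :: (('k, 'm, ('k, 'h, 'h \<Rightarrow> 'k) tensor) alg_mod, 'm \<Rightarrow> 'm) cat)
               (Mod_br (s1_sys (B_sys H))
                  :: (('k, 'm, 'h \<Rightarrow> 'k, 'h) br_mod, 'm \<Rightarrow> 'm) cat) \<and>
             equivalent_cats
               (Mod_br (s1_sys (B_sys H))
                  :: (('k, 'm, 'h \<Rightarrow> 'k, 'h) br_mod, 'm \<Rightarrow> 'm) cat)
               (Mod_hopf H :: (('k, 'm, 'h) hopf_mod, 'm \<Rightarrow> 'm) cat)"
    using Mod_br_to_Mod_alg(2)[of "s1_sys (B_sys H)" "dual_bialg H" H] twisting_theta[OF i] s1_equivalence[OF i]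
    by (simp add: s1_sys_simps)
qed (rule groupoid_Bialg groupoid_BrSyst B_functor B_fully_faithful)+

end
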